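(* Let $P\subset\mathbb{R}^2$ be a convex $n$-gon with angles $\alpha_1/2,\dots,\alpha_n/2$, and let $\alpha=(\alpha_1,\dots,\alpha_n)$. Then $H_1(P)$, the space of convex polygons with edges parallel to those of $P$ up to translations and homotheties, is a convex polyhedron in the hyperbolic space $\mathbb{H}^{n-3}$, and it isometrically embeds into $\mathcal{M}(\mathbb{S}^2,\alpha)$.
   Context: Polygons. Let $n_1,\dots,n_n$ be the outward unit normals of the sides of $P$. $\tilde H(P)$ is the set of convex $n$-gons $Q$ with edges parallel to those of $P$ (same outward unit normals). $Q$ is identified with the vector $h\in\mathbb{R}^n$ of its support numbers $h_i=\max_{x\in Q}\langle x,n_i\rangle$ (signed distance from the origin to the line containing the $i$-th side). Then $\tilde H(P)$ is an open convex polyhedral cone in $\mathbb{R}^n$. $H(P)$ is the quotient of $\tilde H(P)$ by translations; it is an open convex polyhedral cone in $W_P=\mathbb{R}^n/\{(\langle x,n_i\rangle)_i: x\in\mathbb{R}^2\}\cong\mathbb{R}^{n-2}$. $H_1(P)$ is the quotient of $H(P)$ by positive homotheties. The area of $Q$ is the restriction to $\tilde H(P)$ of a unique quadratic form $\mathrm{area}_P$ on $\mathbb{R}^n$, which descends to $W_P$. That $H_1(P)$ is a convex polyhedron in $\mathbb{H}^{n-3}$ means: $\mathrm{area}_P$ has signature $(1,n-3)$ on $W_P$ (one positive direction, non-degenerate), and $H_1(P)$, identified with the set of $h\in H(P)$ with $\mathrm{area}_P(h)=1$, is the intersection of the hyperbolic space (one sheet of $\{\mathrm{area}_P=1\}$)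 with a convex polyhedral cone. Flat metrics on the sphere. For $\alpha\in(0,2\pi)^n$ and marked points $p_1,\dots,p_n\in\mathbb{S}^2$, $\mathcal{M}(\mathbb{S}^2,\alpha)$ is the set of flat metrics on $\mathbb{S}^2$ with cone singularities exactly at the $p_i$, with cone angle $\alpha_i$ at $p_i$, modulo orientation-preserving similarities isotopic to the identity (fixing each $p_i$). The double of a convex polygon with angles $\alpha_i/2$ (two copies, with opposite orientations, glued along the boundary) is such a metric; the doubles of all $Q\in\tilde H(P)$ are identified with the marked sphere through the combinatorial correspondence with the double of $P$. Unfolding charts and the area form. Cut a metric in $\mathcal{M}(\mathbb{S}^2,\alpha)$ along a tree with vertex set $\{p_1,\dots,p_n\}$ and $n-1$ geodesic edges, and develop the resulting flat disk into $\mathbb{C}$ as a (possibly self-overlapping) polygon with $2(n-1)$ sides, regarded as complex numbers. For a fixed isotopy class of the tree these side vectors lie in a complex vector space $V\cong\mathbb{C}^{n-2}$, cut out by the linear relations that the two sides coming from one edge differ by a fixed rotation determined by $\alpha$, and that the sum of all side vectors is $0$. This gives local charts of $\mathcal{M}(\mathbb{S}^2,\alpha)$ into the projective space $\mathbb{CP}^{n-3}$ of $V$; the set of side vectors in $V$ is called an unfolding chart. The area of the metric is the restriction of a Hermitian form on $V$ (the area form), which by Thurston has signature $(1,n-3)$ and gives $\mathcal{M}(\mathbb{S}^2,\alpha)$ its complex hyperbolic structure. That $H_1(P)$ isometrically embeds into $\mathcal{M}(\mathbb{S}^2,\alpha)$ means: the map sending $Q$ to the class of its double is an injection $H_1(P)\to\mathcal{M}(\mathbb{S}^2,\alpha)$,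 and it is induced by an injective $\mathbb{R}$-linear map $W_P\to V$ that sends $H(P)$ into an unfolding chart and pulls back the area form of $V$ to a positive constant multiple of $\mathrm{area}_P$ (the area of the double being twice that of $Q$). *)

theory Defs
  imports "HOL-Complex_Analysis.Complex_Analysis"
begin

section \<open>Convex polygons with prescribed side directions\<close>

text \<open>
  The Euclidean plane is the type of complex numbers. A convex \<open>n\<close>-gon is given by its family of
  vertices, labelled by a finite type of cardinality \<open>n\<close>; \<open>nxt\<close> sends a vertex to the next one in
  counterclockwise order. The side with label \<open>i\<close> runs from vertex \<open>i\<close> to vertex \<open>nxt i\<close>. All
  vertices other than its two endpoints lie strictly to its left; for at least three vertices this
  forces \<open>nxt\<close> to be a cyclic permutation and the vertices to be in convex position.
\<close>

definition convex_ngon :: "('n::finite \<Rightarrow> 'n) \<Rightarrow> ('n \<Rightarrow> complex) \<Rightarrow> bool" where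
  "convex_ngon nxt w \<longleftrightarrow>
     3 \<le> CARD('n) \<and> (\<forall>i. nxt i \<noteq> i) \<and>
     (\<forall>i j. j \<noteq> i \<and> j \<noteq> nxt i \<longrightarrow> 0 < Im (cnj (w (nxt i) - w i) * (w j - w i)))"

definition region :: "('n::finite \<Rightarrow> complex) \<Rightarrow> complex set" where
  "region w = convex hull (range w)"

definition side :: "('n::finite \<Rightarrow> 'n) \<Rightarrow> ('n \<Rightarrow> complex) \<Rightarrow> 'n \<Rightarrow> complex set" where
  "side nxt w i = closed_segment (w i) (w (nxt i))"

definition outer_normal :: "('n::finite \<Rightarrow> 'n) \<Rightarrow> ('n \<Rightarrow> complex) \<Rightarrow> 'n \<Rightarrow> complex" where
  "outer_normal nxt w i = sgn (- \<i> * (w (nxt i) - w i))"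

text \<open>Angle at \<open>b\<close>, measured counterclockwise from \<open>c - b\<close> to \<open>a - b\<close>: the interior angle at \<open>b\<close> if
  \<open>a, b, c\<close> are consecutive vertices in counterclockwise order.\<close>

definition interior_angle :: "complex \<Rightarrow> complex \<Rightarrow> complex \<Rightarrow> real" where
  "interior_angle a b c = Arg ((a - b) / (c - b))"

text \<open>The space \<open>H~(P)\<close> for the polygon \<open>P\<close> with vertex family \<open>v\<close>.\<close>

definition parallel_ngons :: "('n::finite \<Rightarrow> 'n) \<Rightarrow> ('n \<Rightarrow> complex) \<Rightarrow> ('n \<Rightarrow> complex) set" where
  "parallel_ngons nxt v =
     {w. convex_ngon nxt w \<and> (\<forall>i. outer_normal nxt w i = outer_normal nxt v i)}"

definition support_vector ::
    "('n::finite \<Rightarrow> 'n) \<Rightarrow> ('n \<Rightarrow> complex) \<Rightarrow> ('n \<Rightarrow> complex) \<Rightarrow> real^'n" where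
  "support_vector nxt v w = (\<chi> i. SUP x\<in>region w. x \<bullet> outer_normal nxt v i)"

definition support_cone :: "('n::finite \<Rightarrow> 'n) \<Rightarrow> ('n \<Rightarrow> complex) \<Rightarrow> (real^'n) set" where
  "support_cone nxt v = support_vector nxt v ` parallel_ngons nxt v"

text \<open>The subspace by which \<open>W\<^sub>P\<close> is the quotient of the space of all support vectors. Functions,
  cones and linear maps on \<open>W\<^sub>P\<close> are expressed below by their invariant lifts.\<close>

definition translation_vectors :: "('n::finite \<Rightarrow> 'n) \<Rightarrow> ('n \<Rightarrow> complex) \<Rightarrow> (real^'n) set" where
  "translation_vectors nxt v = range (\<lambda>x. \<chi> i. x \<bullet> outer_normal nxt v i)"

definition homothety_rel ::
    "('n::finite \<Rightarrow> 'n) \<Rightarrow> ('n \<Rightarrow> complex) \<Rightarrow> (('n \<Rightarrow> complex) \<times> ('n \<Rightarrow> complex)) set" where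
  "homothety_rel nxt v =
     {(w, w'). w \<in> parallel_ngons nxt v \<and> w' \<in> parallel_ngons nxt v \<and>
        (\<exists>c t. 0 < c \<and> (\<forall>i. w' i = c *\<^sub>R w i + t))}"

definition H1 :: "('n::finite \<Rightarrow> 'n) \<Rightarrow> ('n \<Rightarrow> complex) \<Rightarrow> ('n \<Rightarrow> complex) set set" where
  "H1 nxt v = parallel_ngons nxt v // homothety_rel nxt v"


section \<open>Quadratic forms, signature, polyhedra in hyperbolic space\<close>

definition quadratic_form :: "('a::real_vector \<Rightarrow> real) \<Rightarrow> bool" where
  "quadratic_form q \<longleftrightarrow>
     (\<exists>B. bilinear B \<and> (\<forall>x y. B x y = B y x) \<and> (\<forall>x. q x = B x x))"

definition polar_form :: "('a::real_vector \<Rightarrow> real) \<Rightarrow> 'a \<Rightarrow> 'a \<Rightarrow> real" where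
  "polar_form q x y = (q (x + y) - q x - q y) / 2"

text \<open>The quadratic form \<open>q\<close> descends to the quotient by the subspace \<open>T\<close> and has signature \<open>(a, b)\<close>
  there, with no kernel: the classes of \<open>E \<union> F\<close> form an orthogonal basis of the quotient.\<close>

definition has_signature_mod ::
    "('a::real_vector \<Rightarrow> real) \<Rightarrow> 'a set \<Rightarrow> nat \<Rightarrow> nat \<Rightarrow> bool" where
  "has_signature_mod q T a b \<longleftrightarrow>
     quadratic_form q \<and> (\<forall>x. \<forall>t\<in>T. q (x + t) = q x) \<and>
     (\<exists>E F. finite E \<and> finite F \<and> card E = a \<and> card F = b \<and> E \<inter> F = {} \<and>
        independent (E \<union> F) \<and> span (E \<union> F) \<inter> T = {0} \<and> span (E \<union> F \<union> T) = UNIV \<and>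
        pairwise (\<lambda>x y. polar_form q x y = 0) (E \<union> F) \<and>
        (\<forall>x\<in>E. 0 < q x) \<and> (\<forall>x\<in>F. q x < 0))"

definition area_P :: "('n::finite \<Rightarrow> 'n) \<Rightarrow> ('n \<Rightarrow> complex) \<Rightarrow> real^'n \<Rightarrow> real" where
  "area_P nxt v =
     (THE q. quadratic_form q \<and>
        (\<forall>w\<in>parallel_ngons nxt v. q (support_vector nxt v w) = measure lebesgue (region w)))"

definition open_polyhedral_cone :: "('a::real_inner) set \<Rightarrow> bool" where
  "open_polyhedral_cone C \<longleftrightarrow> (\<exists>A. finite A \<and> C = {x. \<forall>a\<in>A. 0 < a \<bullet> x})"

text \<open>With \<open>q\<close> of signature \<open>(1, N)\<close> on the quotient by \<open>T\<close>, the sheets of \<open>{q = 1}\<close> in the quotient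
  are the connected components, and their preimages are the components upstairs, \<open>T\<close> being
  connected. The set \<open>X\<close> is the preimage of a convex polyhedron in hyperbolic \<open>N\<close>-space.\<close>

definition hyperbolic_polyhedron_mod ::
    "('a::real_inner \<Rightarrow> real) \<Rightarrow> 'a set \<Rightarrow> nat \<Rightarrow> 'a set \<Rightarrow> bool" where
  "hyperbolic_polyhedron_mod q T N X \<longleftrightarrow>
     has_signature_mod q T 1 N \<and>
     (\<exists>S C. S \<in> components {x. q x = 1} \<and> open_polyhedral_cone C \<and>
        (\<forall>x\<in>C. \<forall>t\<in>T. x + t \<in> C) \<and> X = S \<inter> C)"


section \<open>Flat metrics with cone singularities on the sphere\<close>

type_synonym point = "complex \<times> real"

abbreviation S2 :: "point set" where
  "S2 \<equiv> sphere 0 1"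

text \<open>Distance in the Euclidean cone of total angle \<open>\<theta>\<close> between the points with polar coordinates
  \<open>(r, \<phi>)\<close> and \<open>(s, \<psi>)\<close>, angles being taken modulo \<open>\<theta>\<close>. For \<open>\<theta> = 2 * pi\<close> this is the Euclidean
  distance in the plane.\<close>

definition cone_dist :: "real \<Rightarrow> real \<times> real \<Rightarrow> real \<times> real \<Rightarrow> real" where
  "cone_dist \<theta> = (\<lambda>(r, \<phi>) (s, \<psi>).
     sqrt (r\<^sup>2 + s\<^sup>2 - 2 * r * s * cos (min pi (INF k::int. \<bar>\<phi> - \<psi> - of_int k * \<theta>\<bar>))))"

definition cone_angle_at :: "(point \<Rightarrow> point \<Rightarrow> real) \<Rightarrow> point \<Rightarrow> real \<Rightarrow> bool" where
  "cone_angle_at d x \<theta> \<longleftrightarrow>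
     (\<exists>\<epsilon> f. 0 < \<epsilon> \<and> f ` ({0..<\<epsilon>} \<times> UNIV) = {y \<in> S2. d x y < \<epsilon>} \<and> (\<forall>\<phi>. f (0, \<phi>) = x) \<and>
        (\<forall>a\<in>{0..<\<epsilon>} \<times> UNIV. \<forall>b\<in>{0..<\<epsilon>} \<times> UNIV. d (f a) (f b) = cone_dist \<theta> a b))"

definition geodesic_metric :: "(point \<Rightarrow> point \<Rightarrow> real) \<Rightarrow> bool" where
  "geodesic_metric d \<longleftrightarrow>
     (\<forall>x\<in>S2. \<forall>y\<in>S2. \<exists>\<gamma>. \<gamma> ` {0..d x y} \<subseteq> S2 \<and> \<gamma> 0 = x \<and> \<gamma> (d x y) = y \<and>
        (\<forall>s\<in>{0..d x y}. \<forall>t\<in>{0..d x y}. d (\<gamma> s) (\<gamma> t) = \<bar>s - t\<bar>))"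

text \<open>A flat metric is given by its distance function, which is intrinsic; by compactness,
  intrinsic means that any two points are joined by a shortest path.\<close>

definition cone_metrics ::
    "('n::finite \<Rightarrow> point) \<Rightarrow> ('n \<Rightarrow> real) \<Rightarrow> (point \<Rightarrow> point \<Rightarrow> real) set" where
  "cone_metrics p \<alpha> =
     {d. Metric_space S2 d \<and> Metric_space.mtopology S2 d = top_of_set S2 \<and> geodesic_metric d \<and>
         (\<forall>i. cone_angle_at d (p i) (\<alpha> i)) \<and>
         (\<forall>x\<in>S2 - range p. cone_angle_at d x (2 * pi))}"

text \<open>Isotopy relative to the marked points; such maps automatically preserve the orientation.\<close>

definition isotopic_to_id :: "('n::finite \<Rightarrow> point) \<Rightarrow> (point \<Rightarrow> point) \<Rightarrow> bool" where
  "isotopic_to_id p f \<longleftrightarrow>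
     homotopic_with
       (\<lambda>g. homeomorphic_map (top_of_set S2) (top_of_set S2) g \<and> (\<forall>i. g (p i) = p i))
       (top_of_set S2) (top_of_set S2) id f"

definition similarity_rel ::
    "('n::finite \<Rightarrow> point) \<Rightarrow> ('n \<Rightarrow> real) \<Rightarrow>
     ((point \<Rightarrow> point \<Rightarrow> real) \<times> (point \<Rightarrow> point \<Rightarrow> real)) set" where
  "similarity_rel p \<alpha> =
     {(d, d'). d \<in> cone_metrics p \<alpha> \<and> d' \<in> cone_metrics p \<alpha> \<and>
        (\<exists>f c. isotopic_to_id p f \<and> 0 < c \<and> (\<forall>x\<in>S2. \<forall>y\<in>S2. d' (f x) (f y) = c * d x y))}"

definition moduli_space ::
    "('n::finite \<Rightarrow> point) \<Rightarrow> ('n \<Rightarrow> real) \<Rightarrow> (point \<Rightarrow> point \<Rightarrow> real) set set" where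
  "moduli_space p \<alpha> = cone_metrics p \<alpha> // similarity_rel p \<alpha>"


section \<open>Orientation\<close>

definition orientation_preserving_at :: "(complex \<Rightarrow> complex) \<Rightarrow> complex \<Rightarrow> bool" where
  "orientation_preserving_at f z \<longleftrightarrow>
     (\<exists>\<epsilon>>0. \<forall>r. 0 < r \<and> r < \<epsilon> \<longrightarrow>
        f z \<notin> path_image (f \<circ> circlepath z r) \<and> winding_number (f \<circ> circlepath z r) (f z) = 1)"

text \<open>Stereographic projection from the south pole is orientation preserving for the orientation
  of the sphere given by the outward normal.\<close>

definition stereographic :: "point \<Rightarrow> complex" where
  "stereographic = (\<lambda>(z, t). z / of_real (1 + t))"

definition sphere_oriented_on :: "complex set \<Rightarrow> (complex \<Rightarrow> point) \<Rightarrow> bool" where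
  "sphere_oriented_on U g \<longleftrightarrow>
     (\<forall>z\<in>U. g z \<noteq> (0, -1) \<longrightarrow> orientation_preserving_at (stereographic \<circ> g) z)"


section \<open>Doubles of polygons\<close>

text \<open>The double of \<open>Q\<close> consists of the two sheets \<open>Q \<times> {s}\<close>, \<open>s :: bool\<close>, glued along the frontier
  of \<open>Q\<close>; the sheet \<open>True\<close> carries the orientation of the plane. For convex \<open>Q\<close> the glued path
  metric is as follows.\<close>

definition double_dist :: "complex set \<Rightarrow> bool \<Rightarrow> complex \<Rightarrow> bool \<Rightarrow> complex \<Rightarrow> real" where
  "double_dist Q s x t y =
     (if s = t then dist x y else (INF z\<in>frontier Q. dist x z + dist z y))"

text \<open>A homeomorphism from the double of the compact set \<open>Q\<close> onto the sphere, given by its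
  restrictions to the two sheets.\<close>

definition double_homeo :: "complex set \<Rightarrow> (bool \<Rightarrow> complex \<Rightarrow> point) \<Rightarrow> bool" where
  "double_homeo Q \<phi> \<longleftrightarrow>
     (\<forall>s. continuous_on Q (\<phi> s) \<and> inj_on (\<phi> s) Q) \<and>
     (\<forall>x\<in>Q. \<forall>y\<in>Q. \<phi> True x = \<phi> False y \<longleftrightarrow> x = y \<and> x \<in> frontier Q) \<and>
     (\<Union>s. \<phi> s ` Q) = S2"

definition double_marking ::
    "('n::finite \<Rightarrow> complex) \<Rightarrow> ('n \<Rightarrow> point) \<Rightarrow> (bool \<Rightarrow> complex \<Rightarrow> point) \<Rightarrow> bool" where
  "double_marking v p \<Phi> \<longleftrightarrow>
     double_homeo (region v) \<Phi> \<and> sphere_oriented_on (interior (region v)) (\<Phi> True) \<and>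
     (\<forall>s i. \<Phi> s (v i) = p i)"

text \<open>The metrics on the sphere obtained by transporting the metric of the double of \<open>w\<close> along a
  homeomorphism which sends every sheet, side and vertex to the image under \<open>\<Phi>\<close> of the
  corresponding sheet, side and vertex of the double of \<open>v\<close>.\<close>

definition double_metrics ::
    "('n::finite \<Rightarrow> 'n) \<Rightarrow> ('n \<Rightarrow> complex) \<Rightarrow> ('n \<Rightarrow> point) \<Rightarrow> ('n \<Rightarrow> real) \<Rightarrow>
     (bool \<Rightarrow> complex \<Rightarrow> point) \<Rightarrow> ('n \<Rightarrow> complex) \<Rightarrow> (point \<Rightarrow> point \<Rightarrow> real) set" where
  "double_metrics nxt v p \<alpha> \<Phi> w =
     {d \<in> cone_metrics p \<alpha>. \<exists>\<phi>. double_homeo (region w) \<phi> \<and>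
        (\<forall>s. \<phi> s ` region w = \<Phi> s ` region v) \<and>
        (\<forall>s i. \<phi> s ` side nxt w i = \<Phi> s ` side nxt v i) \<and>
        (\<forall>s i. \<phi> s (w i) = \<Phi> s (v i)) \<and>
        (\<forall>s t. \<forall>x\<in>region w. \<forall>y\<in>region w. d (\<phi> s x) (\<phi> t y) = double_dist (region w) s x t y)}"

definition double_class ::
    "('n::finite \<Rightarrow> 'n) \<Rightarrow> ('n \<Rightarrow> complex) \<Rightarrow> ('n \<Rightarrow> point) \<Rightarrow> ('n \<Rightarrow> real) \<Rightarrow>
     (bool \<Rightarrow> complex \<Rightarrow> point) \<Rightarrow> ('n \<Rightarrow> complex) \<Rightarrow> (point \<Rightarrow> point \<Rightarrow> real) set" where
  "double_class nxt v p \<alpha> \<Phi> w = similarity_rel p \<alpha> `` double_metrics nxt v p \<alpha> \<Phi> w"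


section \<open>Unfolding charts\<close>

text \<open>The sphere cut along a tree is parametrized by the closed unit disk, whose boundary is
  divided into \<open>m\<close> sides; side \<open>k\<close> consists of the points \<open>circle_point m x\<close> with \<open>k \<le> x \<le> k + 1\<close>.\<close>

definition circle_point :: "nat \<Rightarrow> real \<Rightarrow> complex" where
  "circle_point m x = cis (2 * pi * x / real m)"

text \<open>Let \<open>m = 2 * (n - 1)\<close>. The map \<open>g\<close> parametrizes the sphere cut along an embedded graph with
  the marked points as vertices. Corner \<open>k\<close> of the disk goes to the marked point labelled \<open>lab k\<close>,
  and every edge is the image of exactly two sides, \<open>k\<close> and \<open>opp k\<close>, traversed in opposite
  directions. The graph has \<open>n\<close> vertices, \<open>n - 1\<close> edges and connected complement, so it is a tree.\<close>

definition tree_cut ::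
    "('n::finite \<Rightarrow> point) \<Rightarrow> (nat \<Rightarrow> 'n) \<Rightarrow> (nat \<Rightarrow> nat) \<Rightarrow> (complex \<Rightarrow> point) \<Rightarrow> bool" where
  "tree_cut p lab opp g \<longleftrightarrow>
     (let m = 2 * (CARD('n) - 1) in
       continuous_on (cball 0 1) g \<and> g ` cball 0 1 = S2 \<and>
       inj_on g (ball 0 1) \<and> g ` ball 0 1 \<inter> g ` sphere 0 1 = {} \<and>
       sphere_oriented_on (ball 0 1) g \<and>
       lab ` {..<m} = UNIV \<and> (\<forall>k<m. g (circle_point m (real k)) = p (lab k)) \<and>
       (\<forall>k<m. opp k < m \<and> opp k \<noteq> k \<and> opp (opp k) = k) \<and>
       (\<forall>k<m. \<forall>x\<in>{0<..<1}. g (circle_point m (real k + x)) \<notin> range p) \<and>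
       (\<forall>k<m. \<forall>l<m. \<forall>x\<in>{0<..<1}. \<forall>y\<in>{0<..<1}.
          g (circle_point m (real k + x)) = g (circle_point m (real l + y)) \<longleftrightarrow>
          (l = k \<and> y = x) \<or> (l = opp k \<and> y = 1 - x)))"

text \<open>The map \<open>\<delta>\<close> develops the cut sphere into the plane. Straightness of the developed sides
  expresses that the edges of the tree are geodesics of \<open>d\<close>.\<close>

definition developing_map ::
    "nat \<Rightarrow> (point \<Rightarrow> point \<Rightarrow> real) \<Rightarrow> (complex \<Rightarrow> point) \<Rightarrow> (complex \<Rightarrow> complex) \<Rightarrow> bool" where
  "developing_map m d g \<delta> \<longleftrightarrow>
     continuous_on (cball 0 1) \<delta> \<and>
     (\<forall>z\<in>ball 0 1. orientation_preserving_at \<delta> z \<and>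
        (\<exists>\<epsilon>>0. ball z \<epsilon> \<subseteq> ball 0 1 \<and>
           (\<forall>x\<in>ball z \<epsilon>. \<forall>y\<in>ball z \<epsilon>. dist (\<delta> x) (\<delta> y) = d (g x) (g y)))) \<and>
     (\<forall>k<m. inj_on (\<lambda>x. \<delta> (circle_point m (real k + x))) {0..1} \<and>
        (\<lambda>x. \<delta> (circle_point m (real k + x))) ` {0..1} =
          closed_segment (\<delta> (circle_point m (real k))) (\<delta> (circle_point m (real (k + 1)))))"

text \<open>\<open>s\<close> consists of the side vectors of an unfolding of \<open>d\<close> along a geodesic tree in the isotopy
  class of the tree cut by \<open>g\<close>; vectors in complex \<open>m\<close>-space are functions on the natural numbers
  vanishing from \<open>m\<close> on.\<close>

definition unfolds_to ::
    "('n::finite \<Rightarrow> point) \<Rightarrow> (complex \<Rightarrow> point) \<Rightarrow> (point \<Rightarrow> point \<Rightarrow> real) \<Rightarrow>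
     (nat \<Rightarrow> complex) \<Rightarrow> bool" where
  "unfolds_to p g d s \<longleftrightarrow>
     (let m = 2 * (CARD('n) - 1) in
       \<exists>f \<delta>. isotopic_to_id p f \<and> developing_map m d (f \<circ> g) \<delta> \<and>
         (\<forall>k. s k = (if k < m
            then \<delta> (circle_point m (real (k + 1))) - \<delta> (circle_point m (real k)) else 0)))"

text \<open>The space \<open>V\<close>. Between the sides \<open>k\<close> and \<open>opp k\<close>, with \<open>k < opp k\<close>, the boundary of the
  unfolded polygon runs once around the subtree beyond the edge, turning at a corner of interior
  angle \<open>\<beta>\<close> by \<open>pi - \<beta>\<close>. The interior angles at these \<open>opp k - k\<close> corners, an odd number, add up to
  the cone angles at the vertices of the subtree.\<close>

definition side_space ::
    "('n::finite \<Rightarrow> real) \<Rightarrow> (nat \<Rightarrow> 'n) \<Rightarrow> (nat \<Rightarrow> nat) \<Rightarrow> (nat \<Rightarrow> complex) set" where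
  "side_space \<alpha> lab opp =
     (let m = 2 * (CARD('n) - 1) in
       {s. (\<forall>k\<ge>m. s k = 0) \<and> (\<Sum>k<m. s k) = 0 \<and>
           (\<forall>k<m. k < opp k \<longrightarrow>
              s (opp k) = - cis (- (\<Sum>i\<in>lab ` {k+1..opp k}. \<alpha> i)) * s k)})"

definition unfolding_chart ::
    "('n::finite \<Rightarrow> point) \<Rightarrow> ('n \<Rightarrow> real) \<Rightarrow> (nat \<Rightarrow> 'n) \<Rightarrow> (nat \<Rightarrow> nat) \<Rightarrow> (complex \<Rightarrow> point) \<Rightarrow>
     (nat \<Rightarrow> complex) set" where
  "unfolding_chart p \<alpha> lab opp g =
     {s \<in> side_space \<alpha> lab opp. \<exists>d\<in>cone_metrics p \<alpha>. unfolds_to p g d s}"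

text \<open>The Hermitian form, antilinear in the first argument, whose value at \<open>(s, s)\<close> is the area
  enclosed by the closed polygon with side vectors \<open>s\<close>, that is, by the shoelace formula, half the
  sum of \<open>Im (cnj (s j) * s k)\<close> over \<open>j < k < m\<close>.\<close>

definition area_form :: "nat \<Rightarrow> (nat \<Rightarrow> complex) \<Rightarrow> (nat \<Rightarrow> complex) \<Rightarrow> complex" where
  "area_form m s t =
     (\<Sum>k<m. \<Sum>j<k. cnj (s j) * t k - cnj (s k) * t j) / (4 * \<i>)"


section \<open>Isometric embedding\<close>

text \<open>The linear map \<open>L\<close> is the lift of an injective real linear map from \<open>W\<^sub>P\<close> to \<open>V\<close>. It induces
  the map \<open>Q \<mapsto> double of Q\<close>: the point \<open>L h\<close> of the chart consists of side vectors of an unfolding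
  of the double of the polygon with support vector \<open>h\<close>. The pulled back area form is real, and
  twice \<open>area_P\<close>.\<close>

definition H1_isometrically_embeds ::
    "('n::finite \<Rightarrow> 'n) \<Rightarrow> ('n \<Rightarrow> complex) \<Rightarrow> ('n \<Rightarrow> point) \<Rightarrow> ('n \<Rightarrow> real) \<Rightarrow>
     (bool \<Rightarrow> complex \<Rightarrow> point) \<Rightarrow> bool" where
  "H1_isometrically_embeds nxt v p \<alpha> \<Phi> \<longleftrightarrow>
     (\<forall>w\<in>parallel_ngons nxt v. double_class nxt v p \<alpha> \<Phi> w \<in> moduli_space p \<alpha>) \<and>
     (\<lambda>X. \<Union>w\<in>X. double_class nxt v p \<alpha> \<Phi> w) ` H1 nxt v \<subseteq> moduli_space p \<alpha> \<and>
     inj_on (\<lambda>X. \<Union>w\<in>X. double_class nxt v p \<alpha> \<Phi> w) (H1 nxt v) \<and>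
     (\<exists>lab opp g. \<exists>L :: real^'n \<Rightarrow> nat \<Rightarrow> complex.
        tree_cut p lab opp g \<and>
        (\<forall>k. linear (\<lambda>h. L h k)) \<and>
        range L \<subseteq> side_space \<alpha> lab opp \<and>
        {h. L h = (\<lambda>_. 0)} = translation_vectors nxt v \<and>
        L ` support_cone nxt v \<subseteq> unfolding_chart p \<alpha> lab opp g \<and>
        (\<forall>w\<in>parallel_ngons nxt v. \<exists>d\<in>double_metrics nxt v p \<alpha> \<Phi> w.
           unfolds_to p g d (L (support_vector nxt v w))) \<and>
        (\<forall>h h'. area_form (2 * (CARD('n) - 1)) (L h) (L h') =
           of_real (2 * polar_form (area_P nxt v) h h')))"

end

theory Submission
  imports Defs
begin

text \<open>
  A polygon parallel to \<open>P\<close> is determined by the signed lengths of its sides, which are linear in the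
  support numbers and must only be positive; this makes the space of parallel polygons a polyhedral
  cone. For the signature, fix a direction that no side is parallel to. The width of the polygon in
  this direction is a linear form on the support vectors, and on its kernel Abel summation turns the
  area into minus a sum of squares, so that the area form has exactly one positive direction.

  The double of a convex polygon \<open>Q\<close> is a flat cone metric because near a boundary point \<open>Q\<close> is a
  sector of angle \<open>\<beta> \<le> pi\<close>, and two sectors glued along both sides form a cone of angle \<open>2 * \<beta>\<close>. The
  distances of the marked points recover the side lengths, hence \<open>Q\<close> up to homothety. Two choices of
  the identification with the sphere differ by a homeomorphism preserving sheets, sides and vertices,
  which is isotopic to the identity by a linear isotopy on the sides and the Alexander trick on the
  sheets.

  Cutting the double open along all sides but one, a path through all vertices, and developing yields
  the union of \<open>Q\<close> with its mirror image in the remaining side. Its side vectors are linear in the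
  support numbers, and its area is twice the area of \<open>Q\<close>.
\<close>

section \<open>Convex polygons\<close>

text \<open>One point organises the second half of the proof: \<open>mid\<close>, the midpoint of
  the side that is not cut. It is the apex of a fan of triangles, the centre of the radial map
  \<open>kap\<close> from the upper half disk onto the polygon, and a fixed point of the mirror.
  Since the diameter goes onto the uncut side, conjugation of the disk becomes reflection of the
  plane, and both the cut map into the sphere and the developing map are assembled from
  \<open>kap\<close>. The two ends of that side are opposite as seen from \<open>mid\<close>; this
  degenerate pair accounts for the exceptional cases below. Orientation is prescribed through
  winding numbers, and the marking is only a homeomorphism, with no derivative at hand. So
  orientation is verified at one point and spread by local constancy of the degree of an injective
  map; stereographic projection excludes at most one point, which does not disconnect the disk. The
  marking is given for \<open>P\<close> alone. Radial maps carry the double of each parallel polygon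
  to that of \<open>P\<close>, so that one cut map unfolds all of them and the isotopy in
  \<open>unfolds_to\<close> is the identity.\<close>

definition wedge :: "complex \<Rightarrow> complex \<Rightarrow> real" where
  "wedge a b = Im (cnj a * b)"

lemma wedge_eq: "wedge a b = Re a * Im b - Im a * Re b"
  by (simp add: wedge_def)

lemma bounded_bilinear_wedge: "bounded_bilinear wedge"
proof
  show "\<exists>K. \<forall>a b. norm (wedge a b) \<le> norm a * norm b * K"
    by (rule exI[of _ 1]) (metis abs_Im_le_cmod complex_mod_cnj mult.right_neutral norm_mult real_norm_def wedge_def)
qed (simp_all add: wedge_eq algebra_simps)

interpretation wedge: bounded_bilinear wedge
  by (rule bounded_bilinear_wedge)

declare wedge.zero_left [simp] wedge.zero_right [simp]

lemma wedge_self [simp]: "wedge a a = 0"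
  by (simp add: wedge_eq)

lemma wedge_commute: "wedge a b = - wedge b a"
  by (simp add: wedge_eq)

text \<open>Twice the signed area of the triangle \<open>a\<close>, \<open>b\<close>,
  \<open>c\<close>, positive when it is traversed counterclockwise; \<open>convex_ngon\<close> is a
  list of inequalities for this quantity.\<close>

abbreviation orient :: "complex \<Rightarrow> complex \<Rightarrow> complex \<Rightarrow> real" where
  "orient a b c \<equiv> wedge (b - a) (c - a)"

lemma orient_rotate: "orient a b c = orient b c a"
  by (simp add: wedge_eq algebra_simps)

lemma wedge_polar: "wedge a b = norm a * norm b * sin (Arg b - Arg a)"
proof -
  have "a = rcis (norm a) (Arg a)" "b = rcis (norm b) (Arg b)"
    by (simp_all add: rcis_cmod_Arg)
  then have "Re a = norm a * cos (Arg a)" "Im a = norm a * sin (Arg a)"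
     "Re b = norm b * cos (Arg b)" "Im b = norm b * sin (Arg b)"
    by (metis Re_rcis Im_rcis)+
  then show ?thesis
    by (simp add: wedge_eq sin_diff algebra_simps)
qed

text \<open>Arguments in the closed right half-plane lie within \<open>pi / 2\<close> of 0 and so
  differ by at most \<open>pi\<close>; on that range the sine in \<open>wedge_polar\<close> has the
  sign of the difference.\<close>

lemma Arg_less_of_wedge_pos:
  assumes "0 \<le> Re a" "0 \<le> Re b" "0 < wedge a b"
  shows "Arg a < Arg b"
proof (rule ccontr)
  assume "\<not> Arg a < Arg b"
  moreover have "\<bar>Arg a\<bar> \<le> pi/2" "\<bar>Arg b\<bar> \<le> pi/2"
    using assms Arg_Re_nonneg[of a] Arg_Re_nonneg[of b] by auto
  ultimately have "0 \<le> sin (Arg a - Arg b)"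
    by (intro sin_ge_zero) auto
  then have "sin (Arg b - Arg a) \<le> 0"
    by (metis minus_diff_eq neg_le_0_iff_le sin_minus)
  then have "wedge a b \<le> 0"
    unfolding wedge_polar by (simp add: mult_nonneg_nonpos)
  with assms show False by simp
qed

section \<open>The cyclic order of the vertices\<close>

locale ngon =
  fixes nxt :: "'n::finite \<Rightarrow> 'n" and w :: "'n \<Rightarrow> complex" and i0 :: 'n
  assumes ngon: "convex_ngon nxt w"
begin

lemma card_ge_3: "3 \<le> CARD('n)"
  using ngon by (simp add: convex_ngon_def)

lemma nxt_neq: "nxt i \<noteq> i"
  using ngon by (simp add: convex_ngon_def)

lemma left: "j \<noteq> i \<Longrightarrow> j \<noteq> nxt i \<Longrightarrow> 0 < orient (w i) (w (nxt i)) (w j)"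
  using ngon by (simp add: convex_ngon_def wedge_def)

lemma left_ge: "0 \<le> orient (w i) (w (nxt i)) (w j)"
  using left[of j i] by (cases "j = i"; cases "j = nxt i") auto

lemma third: fixes i j :: 'n shows "\<exists>k. k \<noteq> i \<and> k \<noteq> j"
proof (rule ccontr)
  assume "\<not> ?thesis"
  then have "(UNIV :: 'n set) \<subseteq> {i, j}" by auto
  then have "CARD('n) \<le> card {i, j}" by (intro card_mono) auto
  also have "\<dots> \<le> 2" by (simp add: card_insert_if)
  finally show False using card_ge_3 by simp
qed

text \<open>Otherwise a third vertex would lie strictly to the left of a segment and of its
  reverse.\<close>

lemma nxt_nxt_neq: "nxt (nxt i) \<noteq> i"
proof
  assume *: "nxt (nxt i) = i"
  obtain k where "k \<noteq> i" "k \<noteq> nxt i" using third by blast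
  then have "0 < orient (w i) (w (nxt i)) (w k)" "0 < orient (w (nxt i)) (w i) (w k)"
    using left[of k i] left[of k "nxt i"] * by auto
  then show False by (simp add: wedge_eq algebra_simps)
qed

text \<open>Of two sides with a common end, each would have the start of the other strictly on its
  left, which is contradictory.\<close>

lemma inj_nxt: "inj nxt"
proof (rule injI, rule ccontr)
  fix i j assume *: "nxt i = nxt j" "i \<noteq> j"
  then have "0 < orient (w i) (w (nxt i)) (w j)" "0 < orient (w j) (w (nxt j)) (w i)"
    using left nxt_neq by metis+
  then show False using * by (simp add: wedge_eq algebra_simps)
qed

lemma bij_nxt: "bij nxt"
  using inj_nxt by (simp add: bij_def finite_UNIV_inj_surj)

lemma inj_w: "inj w"
proof (rule injI, rule ccontr)
  fix i j assume *: "w i = w j" "i \<noteq> j"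
  obtain k where "k \<noteq> i" "k \<noteq> nxt i" using third by blast
  then show False using left[of k i] left[of j i] * by (cases "j = nxt i") auto
qed

text \<open>Seen from a leftmost vertex \<open>j\<close>, the argument increases along \<open>nxt\<close>, so every orbit
  of \<open>nxt\<close> meets \<open>j\<close>.\<close>

lemma orbit_reaches_leftmost:
  assumes j: "\<And>i. Re (w j) \<le> Re (w i)"
  shows "\<exists>k. (nxt ^^ k) a = j"
proof (rule ccontr)
  assume *: "\<not> ?thesis"
  define K where "K = (\<lambda>b. Arg (w b - w j))"
  let ?O = "range (\<lambda>k. (nxt ^^ k) a)"
  have "finite (K ` ?O)" "K ` ?O \<noteq> {}" by auto
  then have "Max (K ` ?O) \<in> K ` ?O" by (rule Max_in)
  then obtain k where k: "K ((nxt ^^ k) a) = Max (K ` ?O)" by (metis (no_types, lifting) imageE)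
  let ?b = "(nxt ^^ k) a"
  have "?b \<noteq> j" "nxt ?b \<noteq> j" using * by (metis funpow.simps(2) comp_apply)+
  then have "0 < orient (w ?b) (w (nxt ?b)) (w j)"
    using left by metis
  then have "0 < wedge (w ?b - w j) (w (nxt ?b) - w j)"
    by (simp add: wedge_eq algebra_simps)
  then have "K ?b < K (nxt ?b)"
    unfolding K_def by (intro Arg_less_of_wedge_pos) (use j in auto)
  moreover have "K (nxt ?b) \<le> Max (K ` ?O)"
  proof (rule Max_ge)
    have "nxt ?b = (nxt ^^ Suc k) a" by simp
    then show "K (nxt ?b) \<in> K ` ?O" by blast
  qed auto
  ultimately show False using k by (metis leD)
qed

lemma funpow_period: "\<exists>P>0. (nxt ^^ P) a = a"
  by (metis finite inj_nxt funpow_inj_finite)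

text \<open>Both orbits pass through a leftmost vertex \<open>j\<close>. Since \<open>b\<close> is
  periodic, the way from \<open>b\<close> to \<open>j\<close> can be completed to a way from
  \<open>j\<close> back to \<open>b\<close>.\<close>

lemma orbit_UNIV: "\<exists>k. (nxt ^^ k) a = b"
proof -
  obtain j where j: "\<And>i. Re (w j) \<le> Re (w i)"
    using ex_is_arg_min_if_finite[of "UNIV :: 'n set" "\<lambda>i. Re (w i)"]
    by (auto simp: is_arg_min_def not_less)
  obtain k l where k: "(nxt ^^ k) a = j" and l: "(nxt ^^ l) b = j"
    using orbit_reaches_leftmost[OF j] by metis
  obtain P where P: "P > 0" "(nxt ^^ P) b = b" using funpow_period by blast
  \<comment> \<open>A multiple of the period that is at least \<open>l\<close> is wanted, so that
    \<open>l\<close> can be subtracted from it.\<close>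
  have "((nxt ^^ P) ^^ l) b = b" by (induction l) (use P in auto)
  then have *: "(nxt ^^ (P * l)) b = b" by (simp add: funpow_mult mult.commute)
  have "l \<le> P * l" using P by simp
  then have "(nxt ^^ (P * l - l)) ((nxt ^^ l) b) = b"
    using * by (metis comp_apply funpow_add le_add_diff_inverse2)
  then have "(nxt ^^ (P * l - l + k)) a = b"
    using k l by (simp add: funpow_add)
  then show ?thesis by blast
qed

text \<open>Numbering of the labels along \<open>nxt\<close>, starting from the base label
  \<open>i0\<close>. The base is a parameter of the locale so that a proof can restart the numbering
  at a side or vertex of its choice.\<close>

definition lbl :: "nat \<Rightarrow> 'n" where "lbl k = (nxt ^^ k) i0"

lemma lbl_0 [simp]: "lbl 0 = i0" and lbl_Suc: "lbl (Suc k) = nxt (lbl k)"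
  by (simp_all add: lbl_def)

lemma nxt_lbl: "nxt (lbl k) = lbl (Suc k)"
  by (simp add: lbl_def)

text \<open>\<open>P\<close> is the least period of the base label. Below it the labels are
  distinct, since cancelling \<open>nxt ^^ a\<close> would give a shorter period, and they exhaust
  the type because there is only one orbit; counting identifies \<open>P\<close>.\<close>

lemma lbl_bij_and_period: "bij_betw lbl {..<CARD('n)} UNIV \<and> lbl CARD('n) = i0"
proof -
  define P where "P = (LEAST P. P > 0 \<and> (nxt ^^ P) i0 = i0)"
  have P: "P > 0 \<and> (nxt ^^ P) i0 = i0"
    unfolding P_def by (rule LeastI_ex) (use funpow_period in blast)
  have least: "k \<ge> P" if "k > 0" "lbl k = i0" for k
    unfolding P_def by (rule Least_le) (use that in \<open>auto simp: lbl_def\<close>)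
  have mod: "lbl k = lbl (k mod P)" for k
    unfolding lbl_def using P by (simp add: funpow_mod_eq)
  have "b \<in> lbl ` {..<P}" for b
  proof -
    obtain k where "lbl k = b" using orbit_UNIV unfolding lbl_def by blast
    then show ?thesis using mod[of k] P by (metis imageI lessThan_iff mod_less_divisor)
  qed
  then have surj: "lbl ` {..<P} = UNIV" by blast
  have False if "a < b" "b < P" "lbl a = lbl b" for a b
  proof -
    have "(nxt ^^ a) i0 = (nxt ^^ a) (lbl (b - a))"
      using that by (simp add: lbl_def flip: funpow_add comp_apply[of "nxt ^^ a"])
    moreover have "inj (nxt ^^ a)" using inj_nxt inj_fn by blast
    ultimately have "lbl (b - a) = i0" by (metis injD)
    then show False using least[of "b - a"] that by simp
  qed
  then have "inj_on lbl {..<P}"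
    by (metis inj_onI lessThan_iff linorder_neqE_nat)
  then have bij: "bij_betw lbl {..<P} UNIV" using surj by (simp add: bij_betw_def)
  then have "P = CARD('n)" using bij_betw_same_card by fastforce
  then show ?thesis using bij P by (simp add: lbl_def)
qed

lemma bij_lbl: "bij_betw lbl {..<CARD('n)} UNIV"
  using lbl_bij_and_period by blast

lemma lbl_card [simp]: "lbl CARD('n) = i0"
  using lbl_bij_and_period by blast

lemma lbl_eq_iff: "a < CARD('n) \<Longrightarrow> b < CARD('n) \<Longrightarrow> lbl a = lbl b \<longleftrightarrow> a = b"
  using bij_lbl by (auto simp: bij_betw_def inj_on_def)

lemma lbl_exhaust: obtains k where "k < CARD('n)" "i = lbl k"
  using bij_lbl by (metis UNIV_I bij_betw_imp_surj_on imageE lessThan_iff)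

lemma nxt_lbl_last: "nxt (lbl (CARD('n) - 1)) = i0"
  using card_ge_3 by (simp add: nxt_lbl)

definition W :: "nat \<Rightarrow> complex" where "W k = w (lbl k)"

lemma orient_W_side:
  assumes "k < CARD('n)" "j < CARD('n)" "j \<noteq> k" "j \<noteq> Suc k" "Suc k < CARD('n)"
  shows "0 < orient (W k) (W (Suc k)) (W j)"
  using left[of "lbl j" "lbl k"] assms by (simp add: W_def nxt_lbl lbl_eq_iff)

text \<open>Induction on \<open>k\<close>. Convexity only speaks about triples that contain a side,
  so the step compares four vectors issuing from \<open>W i\<close>, the side to
  \<open>W (Suc i)\<close> among them.\<close>

lemma orient_W_triple:
  assumes "i < j" "j < k" "k < CARD('n)"
  shows "0 < orient (W i) (W j) (W k)"
  using assms(2,3)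
proof (induction k)
  case (Suc k)
  show ?case
  proof (cases "j = k")
    case True
    then have "0 < orient (W j) (W (Suc j)) (W i)"
      using orient_W_side[of j i] Suc assms(1) by auto
    then show ?thesis using True by (simp add: wedge_eq algebra_simps)
  next
    case False
    then have 1: "0 < orient (W i) (W j) (W k)" using Suc by auto
    have "0 < orient (W k) (W (Suc k)) (W i)"
      using orient_W_side[of k i] Suc assms(1) by auto
    then have 2: "0 < orient (W i) (W k) (W (Suc k))" by (simp add: wedge_eq algebra_simps)
    have 3: "0 < orient (W i) (W (Suc i)) (W k)" "0 < orient (W i) (W (Suc i)) (W (Suc k))"
      using orient_W_side[of i] Suc assms(1) False by auto
    have 4: "0 \<le> orient (W i) (W (Suc i)) (W j)"
      using orient_W_side[of i j] Suc assms(1) by (cases "j = Suc i") auto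
    \<comment> \<open>Three-term Pluecker relation for the vectors from \<open>W i\<close> to
      \<open>W (Suc i)\<close>, \<open>W j\<close>, \<open>W k\<close>, \<open>W (Suc k)\<close>;
      the second factor on the left is positive by 3 and can be cancelled.\<close>
    have "orient (W i) (W j) (W (Suc k)) * orient (W i) (W (Suc i)) (W k) =
       orient (W i) (W j) (W k) * orient (W i) (W (Suc i)) (W (Suc k))
       + orient (W i) (W (Suc i)) (W j) * orient (W i) (W k) (W (Suc k))"
      unfolding wedge_eq by (simp add: algebra_simps)
    also have "\<dots> > 0" using 1 2 3 4 by (intro add_pos_nonneg) auto
    finally show ?thesis using 3 by (simp add: zero_less_mult_iff)
  qed
qed simp

lemma range_w: "range w = W ` {..<CARD('n)}"
proof -
  have "range w = w ` lbl ` {..<CARD('n)}"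
    using bij_lbl by (simp add: bij_betw_def)
  then show ?thesis unfolding W_def by auto
qed

lemma sum_lbl: "(\<Sum>i\<in>UNIV. f i) = (\<Sum>k<CARD('n). f (lbl k))"
  using sum.reindex_bij_betw[OF bij_lbl, of f] by simp

end

section \<open>The region as an intersection of half-planes\<close>

lemma affine_wedge_halfplane: "convex {x. 0 \<le> orient a b x}"
proof -
  have "{x. 0 \<le> orient a b x} = {x. inner (- \<i> * (b - a)) x \<le> inner (- \<i> * (b - a)) a}"
    by (auto simp: wedge_eq inner_complex_def algebra_simps)
  then show ?thesis by (simp only: convex_halfspace_le)
qed

text \<open>The areas that \<open>x\<close> spans with the three sides, divided by the whole area
  \<open>D\<close>, are its barycentric coordinates.\<close>

lemma mem_triangle_iff:
  assumes pos: "0 < orient a b c"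
  shows "x \<in> convex hull {a, b, c} \<longleftrightarrow>
    0 \<le> orient a b x \<and> 0 \<le> orient b c x \<and> 0 \<le> orient c a x"
proof
  assume "x \<in> convex hull {a, b, c}"
  moreover have "convex hull {a, b, c} \<subseteq>
      {x. 0 \<le> orient a b x} \<inter> {x. 0 \<le> orient b c x} \<inter> {x. 0 \<le> orient c a x}"
    by (intro hull_minimal convex_Int affine_wedge_halfplane)
      (use pos in \<open>auto simp: wedge_eq algebra_simps\<close>)
  ultimately show "0 \<le> orient a b x \<and> 0 \<le> orient b c x \<and> 0 \<le> orient c a x"
    by auto
next
  assume *: "0 \<le> orient a b x \<and> 0 \<le> orient b c x \<and> 0 \<le> orient c a x"
  define D where "D = orient a b c"
  have D: "D > 0" using pos D_def by simp
  have sum: "orient a b x + orient b c x + orient c a x = D"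
    unfolding D_def wedge_eq by (simp add: algebra_simps)
  have x: "x = (orient b c x / D) *\<^sub>R a + (orient c a x / D) *\<^sub>R b + (orient a b x / D) *\<^sub>R c"
  proof -
    have "D *\<^sub>R x = orient b c x *\<^sub>R a + orient c a x *\<^sub>R b + orient a b x *\<^sub>R c"
      unfolding D_def by (rule complex_eqI) (simp_all add: wedge_eq algebra_simps)
    then have "x = (1 / D) *\<^sub>R (orient b c x *\<^sub>R a + orient c a x *\<^sub>R b + orient a b x *\<^sub>R c)"
      using D by (metis (no_types, lifting) divide_self_if order_less_irrefl scaleR_one scaleR_scaleR times_divide_eq_left mult_1)
    then show ?thesis by (simp add: scaleR_add_right)
  qed
  have "orient b c x / D + orient c a x / D + orient a b x / D = 1"
    using sum D by (simp add: field_simps)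
  then show "x \<in> convex hull {a, b, c}"
    unfolding convex_hull_3 mem_Collect_eq
    by (intro exI[of _ "orient b c x / D"] exI[of _ "orient c a x / D"] exI[of _ "orient a b x / D"] conjI x)
      (use * D in simp_all)
qed

context ngon
begin

text \<open>Midpoint of the closing side from the last vertex back to \<open>W 0\<close>. Placing
  the apex of the fan on the boundary makes the triangle over the closing side degenerate, so that
  only the sides \<open>0\<close> to \<open>n - 2\<close> count.\<close>

definition mid :: complex where "mid = (W 0 + W (CARD('n) - 1)) / 2"

lemma orient_mid: "orient mid a b = (orient (W 0) a b + orient (W (CARD('n) - 1)) a b) / 2"
  unfolding mid_def by (simp add: wedge_eq field_simps)

text \<open>The area with apex \<open>mid\<close> is the mean of those with apex \<open>W 0\<close>
  and with the last vertex as apex. One of them is positive unless \<open>j\<close> and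
  \<open>k\<close> are the two end vertices, which are collinear with \<open>mid\<close>.\<close>

lemma orient_mid_pos:
  assumes "j < k" "k < CARD('n)" "0 < j \<or> k < CARD('n) - 1"
  shows "0 < orient mid (W j) (W k)"
proof -
  have "0 < orient (W 0) (W j) (W k)" if "j > 0" using orient_W_triple[of 0 j k] that assms by simp
  moreover have "0 < orient (W (CARD('n) - 1)) (W j) (W k)" if "k < CARD('n) - 1"
  proof -
    have "0 < orient (W j) (W k) (W (CARD('n) - 1))"
      by (intro orient_W_triple) (use that assms in auto)
    then show ?thesis by (metis orient_rotate)
  qed
  moreover have "0 = orient (W 0) (W j) (W k)" if "j = 0" using that by simp
  moreover have "0 = orient (W (CARD('n) - 1)) (W j) (W k)" if "k = CARD('n) - 1"
    using that by simp
  moreover have "k < CARD('n) - 1 \<or> k = CARD('n) - 1" using assms by auto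
  ultimately show ?thesis
    unfolding orient_mid using assms
    by (cases "j = 0"; cases "k < CARD('n) - 1") (auto simp del: One_nat_def)
qed

lemma orient_mid_Suc: "Suc k < CARD('n) \<Longrightarrow> 0 < orient mid (W k) (W (Suc k))"
  using orient_mid_pos[of k "Suc k"] card_ge_3 by (cases "k = 0") auto

definition halfplanes :: "complex set" where
  "halfplanes = {x. \<forall>i. 0 \<le> orient (w i) (w (nxt i)) x}"

lemma convex_halfplanes: "convex halfplanes"
proof -
  have "halfplanes = (\<Inter>i. {x. 0 \<le> orient (w i) (w (nxt i)) x})"
    by (auto simp: halfplanes_def)
  then show ?thesis by (simp add: convex_INT affine_wedge_halfplane)
qed

lemma region_subset_halfplanes: "region w \<subseteq> halfplanes"
  unfolding region_def
  by (intro hull_minimal convex_halfplanes) (auto simp: halfplanes_def left_ge)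

lemma side_last: "nxt (lbl (CARD('n) - 1)) = i0" "w (lbl (CARD('n) - 1)) = W (CARD('n) - 1)" "w i0 = W 0"
  using nxt_lbl_last by (auto simp: W_def)

lemma w_in_region: "w i \<in> region w"
  unfolding region_def by (simp add: hull_inc)

lemma W_in_region: "W k \<in> region w"
  by (simp add: W_def w_in_region)

lemma convex_region: "convex (region w)"
  by (simp add: region_def)

lemma compact_region: "compact (region w)"
  unfolding region_def by (intro compact_convex_hull finite_imp_compact) simp

lemma mid_in_region: "mid \<in> region w"
proof -
  have "(1/2) *\<^sub>R W 0 + (1/2) *\<^sub>R W (CARD('n) - 1) \<in> region w"
    by (intro convexD[OF convex_region] W_in_region) auto
  then show ?thesis by (simp add: mid_def scaleR_conv_of_real field_simps)
qed

text \<open>Discrete intermediate value argument: because \<open>x\<close> is to the left of the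
  closing side, \<open>orient mid (W k) x\<close> is nonnegative at the first vertex and nonpositive
  at the last. Where the sign changes, \<open>x\<close> lies in the angle between two consecutive
  vertices, and the side between them closes the triangle.\<close>

lemma fan:
  assumes x: "x \<in> halfplanes"
  shows "\<exists>k. Suc k < CARD('n) \<and> x \<in> convex hull {mid, W k, W (Suc k)}"
proof -
  let ?N = "CARD('n) - 1"
  have last: "0 \<le> orient (W ?N) (W 0) x"
    using x side_last unfolding halfplanes_def by (metis (mono_tags, lifting) mem_Collect_eq)
  have 0: "0 \<le> orient mid (W 0) x" "orient mid (W ?N) x \<le> 0"
    using last unfolding mid_def by (simp_all add: wedge_eq field_simps)
  define k where "k = (GREATEST k. k \<le> ?N \<and> 0 \<le> orient mid (W k) x)"
  show ?thesis
  proof (cases "0 \<le> orient mid (W ?N) x \<and> x \<noteq> mid \<and> orient mid (W 0) x = 0 \<and> False")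
    case False
    have "\<exists>k<?N. 0 \<le> orient mid (W k) x \<and> orient mid (W (Suc k)) x \<le> 0"
    proof (rule ccontr)
      assume *: "\<not> ?thesis"
      have "0 \<le> orient mid (W k) x \<and> (0 < k \<longrightarrow> 0 < orient mid (W k) x)" if "k \<le> ?N" for k
        using that
      proof (induction k)
        case (Suc k)
        then show ?case using * by (metis Suc_leD Suc_le_lessD not_less order_less_imp_le)
      qed (use 0 in auto)
      from this[of ?N] 0 card_ge_3 show False by simp
    qed
    then obtain k where k: "k < ?N" "0 \<le> orient mid (W k) x" "orient mid (W (Suc k)) x \<le> 0"
      by blast
    have "0 \<le> orient (W k) (W (Suc k)) x"
      using x unfolding halfplanes_def W_def lbl_Suc by auto
    moreover have "orient (W (Suc k)) mid x = - orient mid (W (Suc k)) x"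
      by (simp add: wedge_eq algebra_simps)
    ultimately have "x \<in> convex hull {mid, W k, W (Suc k)}"
      by (subst mem_triangle_iff) (use k orient_mid_Suc[of k] in auto)
    then show ?thesis using k by (intro exI[of _ k]) auto
  qed auto
qed

lemma triangle_subset_region: "convex hull {mid, W j, W k} \<subseteq> region w"
  by (intro hull_minimal convex_region) (auto simp: mid_in_region W_in_region)

lemma region_eq: "region w = {x. \<forall>i. 0 \<le> orient (w i) (w (nxt i)) x}"
  using region_subset_halfplanes fan triangle_subset_region unfolding halfplanes_def by blast

lemma region_fan: "region w = (\<Union>k<CARD('n) - 1. convex hull {mid, W k, W (Suc k)})"
proof
  show "region w \<subseteq> (\<Union>k<CARD('n) - 1. convex hull {mid, W k, W (Suc k)})"
    using region_subset_halfplanes fan by fastforce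
qed (use triangle_subset_region in blast)

lemma continuous_orient: "continuous_on UNIV (\<lambda>x. orient a b x)"
  by (intro wedge.continuous_on continuous_intros)

lemma open_strict: "open {x. \<forall>i. 0 < orient (w i) (w (nxt i)) x}"
proof -
  have "{x. \<forall>i. 0 < orient (w i) (w (nxt i)) x} = (\<Inter>i. {x. 0 < orient (w i) (w (nxt i)) x})"
    by auto
  then show ?thesis
    by (simp only:) (intro open_INT finite ballI open_Collect_less continuous_orient continuous_on_const)
qed

lemma side_subset_region: "side nxt w i \<subseteq> region w"
  unfolding side_def by (intro closed_segment_subset convex_region w_in_region)

lemma w_nxt_neq: "w (nxt i) \<noteq> w i"
  using inj_w nxt_neq by (metis injD)

lemma interior_region: "interior (region w) = {x. \<forall>i. 0 < orient (w i) (w (nxt i)) x}"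
proof
  show "{x. \<forall>i. 0 < orient (w i) (w (nxt i)) x} \<subseteq> interior (region w)"
    by (rule interior_maximal) (auto simp: region_eq open_strict less_imp_le)
  show "interior (region w) \<subseteq> {x. \<forall>i. 0 < orient (w i) (w (nxt i)) x}"
  proof (safe, rule ccontr)
    fix x i assume x: "x \<in> interior (region w)" and *: "\<not> 0 < orient (w i) (w (nxt i)) x"
    obtain e where e: "e > 0" "cball x e \<subseteq> region w" using x mem_interior_cball by blast
    define d where "d = w (nxt i) - w i"
    have d: "d \<noteq> 0" using w_nxt_neq by (simp add: d_def)
    \<comment> \<open>The point at distance \<open>e\<close> from \<open>x\<close> along the outer
      normal of side \<open>i\<close>; it stays in the ball but violates the inequality of that
      side.\<close>
    let ?y = "x - of_real (e / norm d) * (\<i> * d)"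
    have "?y \<in> cball x e"
      using e d by (simp add: dist_norm norm_mult norm_divide)
    then have "0 \<le> orient (w i) (w (nxt i)) ?y" using e region_eq by blast
    moreover have "orient (w i) (w (nxt i)) ?y =
        orient (w i) (w (nxt i)) x - (e / norm d) * (Re d * Re d + Im d * Im d)"
      unfolding d_def[symmetric] by (simp add: wedge_eq algebra_simps)
    moreover have "(e / norm d) * (Re d * Re d + Im d * Im d) > 0"
      using e d by (intro mult_pos_pos) (auto simp: complex_eq_iff sum_squares_gt_zero_iff)
    ultimately show False using * by simp
  qed
qed

text \<open>For \<open>x\<close> on the line of side \<open>i\<close>, the constraints of the two neighbouring sides place \<open>x\<close>
  between the endpoints.\<close>

lemma on_line_in_side:
  assumes "x \<in> region w" "orient (w i) (w (nxt i)) x = 0"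
  shows "x \<in> side nxt w i"
proof -
  define d where "d = w (nxt i) - w i"
  have d: "d \<noteq> 0" using w_nxt_neq by (simp add: d_def)
  obtain h where h: "nxt h = i" using bij_nxt by (metis bij_pointE)
  define t where "t = (Re d * Re (x - w i) + Im d * Im (x - w i)) / (Re d * Re d + Im d * Im d)"
  have dd: "Re d * Re d + Im d * Im d > 0"
    using d by (auto simp: complex_eq_iff sum_squares_gt_zero_iff)
  have w0: "Re d * Im (x - w i) = Im d * Re (x - w i)"
    using assms(2) by (simp add: wedge_eq d_def)
  have "x - w i = of_real t * d"
  proof (rule complex_eqI)
    have "Re (x - w i) * (Re d * Re d + Im d * Im d) = (Re d * Re (x - w i) + Im d * Im (x - w i)) * Re d"
      using w0 by algebra
    then have "Re (x - w i) = t * Re d" unfolding t_def times_divide_eq_left using dd by (metis nonzero_eq_divide_eq order_less_irrefl)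
    then show "Re (x - w i) = Re (of_real t * d)" by simp
    have "Im (x - w i) * (Re d * Re d + Im d * Im d) = (Re d * Re (x - w i) + Im d * Im (x - w i)) * Im d"
      using w0 by algebra
    then have "Im (x - w i) = t * Im d" unfolding t_def times_divide_eq_left using dd by (metis nonzero_eq_divide_eq order_less_irrefl)
    then show "Im (x - w i) = Im (of_real t * d)" by simp
  qed
  then have x: "x = w i + of_real t * d" by (simp add: algebra_simps)
  have "0 \<le> orient (w h) (w i) x" using assms(1) h by (auto simp: region_eq)
  moreover have "0 < orient (w h) (w i) (w (nxt i))"
    using left[of "nxt i" h] h nxt_nxt_neq nxt_neq by metis
  moreover have "orient (w h) (w i) x = t * orient (w h) (w i) (w (nxt i))"
    unfolding x d_def by (simp add: wedge_eq algebra_simps)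
  ultimately have t0: "0 \<le> t" by (simp add: zero_le_mult_iff)
  have "0 \<le> orient (w (nxt i)) (w (nxt (nxt i))) x" using assms(1) by (auto simp: region_eq)
  moreover have "0 < orient (w (nxt i)) (w (nxt (nxt i))) (w i)"
    using left[of i "nxt i"] nxt_nxt_neq nxt_neq by metis
  moreover have "orient (w (nxt i)) (w (nxt (nxt i))) x = (1 - t) * orient (w (nxt i)) (w (nxt (nxt i))) (w i)"
    unfolding x d_def by (simp add: wedge_eq algebra_simps)
  ultimately have t1: "t \<le> 1" by (simp add: zero_le_mult_iff)
  have "x = (1 - t) *\<^sub>R w i + t *\<^sub>R w (nxt i)"
    using x by (simp add: d_def scaleR_conv_of_real algebra_simps)
  then show ?thesis unfolding side_def in_segment using t0 t1 by blast
qed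

lemma side_on_line: "x \<in> side nxt w i \<Longrightarrow> orient (w i) (w (nxt i)) x = 0"
  unfolding side_def in_segment by (auto simp: wedge_eq) (simp add: algebra_simps)

lemma frontier_region: "frontier (region w) = (\<Union>i. side nxt w i)"
proof -
  have "frontier (region w) = region w - interior (region w)"
    using compact_region by (simp add: frontier_def compact_imp_closed)
  also have "\<dots> = (\<Union>i. side nxt w i)"
  proof safe
    fix x assume x: "x \<in> region w" "x \<notin> interior (region w)"
    then obtain i where "\<not> 0 < orient (w i) (w (nxt i)) x" by (auto simp: interior_region)
    moreover have "0 \<le> orient (w i) (w (nxt i)) x" using x by (simp add: region_eq)
    ultimately show "x \<in> (\<Union>i. side nxt w i)" using on_line_in_side[of x i] x by auto
  next
    fix x i assume "x \<in> side nxt w i"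
    then show "x \<in> region w" using side_subset_region by blast
  next
    fix x i assume "x \<in> side nxt w i" "x \<in> interior (region w)"
    then show False using side_on_line[of x i] by (auto simp: interior_region dest!: spec[of _ i])
  qed
  finally show ?thesis .
qed

text \<open>The affine function that vanishes on the line of side \<open>j\<close> is nonnegative at
  both ends of side \<open>i\<close> and positive at one of them, so on side \<open>i\<close> it can
  vanish only at an end.\<close>

lemma side_Int:
  assumes "i \<noteq> j" "x \<in> side nxt w i" "x \<in> side nxt w j"
  shows "x \<in> range w"
proof -
  obtain t where t: "0 \<le> t" "t \<le> 1" "x = (1 - t) *\<^sub>R w i + t *\<^sub>R w (nxt i)"
    using assms unfolding side_def in_segment by blast
  let ?f = "\<lambda>y. orient (w j) (w (nxt j)) y"
  have "?f x = (1 - t) * ?f (w i) + t * ?f (w (nxt i))"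
    unfolding t(3) by (simp add: wedge_eq algebra_simps)
  then have z: "(1 - t) * ?f (w i) + t * ?f (w (nxt i)) = 0"
    using side_on_line assms by metis
  moreover have "0 \<le> (1 - t) * ?f (w i)" "0 \<le> t * ?f (w (nxt i))"
    using t left_ge by auto
  ultimately have "(1 - t) * ?f (w i) = 0" "t * ?f (w (nxt i)) = 0" by linarith+
  moreover have "0 < ?f (w i) \<or> 0 < ?f (w (nxt i))"
    using left[of i j] left[of "nxt i" j] assms(1) inj_nxt nxt_nxt_neq by (metis injD)
  ultimately have "t = 0 \<or> t = 1" by auto
  then show ?thesis using t(3) by auto
qed

text \<open>The centroid of three vertices works, since every side contains at most two of
  them.\<close>

lemma interior_nonempty: "interior (region w) \<noteq> {}"
proof -
  let ?c = "(W 0 + W 1 + W 2) / 3"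
  have "0 < orient (w i) (w (nxt i)) ?c" for i
  proof -
    have c: "orient (w i) (w (nxt i)) ?c = (orient (w i) (w (nxt i)) (W 0) +
       orient (w i) (w (nxt i)) (W 1) + orient (w i) (w (nxt i)) (W 2)) / 3"
      by (simp add: wedge_eq field_simps)
    have "lbl 0 \<noteq> lbl 1" "lbl 1 \<noteq> lbl 2" "lbl 0 \<noteq> lbl 2"
      using card_ge_3 by (auto simp: lbl_eq_iff simp del: lbl_0)
    then obtain k where "k < 3" "lbl k \<noteq> i" "lbl k \<noteq> nxt i"
      by (metis One_nat_def Suc_1 eval_nat_numeral(3) lessI less_Suc_eq zero_less_numeral)
    then have "0 < orient (w i) (w (nxt i)) (W k)" "k = 0 \<or> k = 1 \<or> k = 2" using left by (auto simp: W_def)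
    moreover have "0 \<le> orient (w i) (w (nxt i)) (W k)" for k using left_ge by (simp add: W_def)
    note this[of 0] this[of 1] this[of 2]
    ultimately show ?thesis unfolding c by auto
  qed
  then show ?thesis unfolding interior_region by blast
qed

end

section \<open>Area of triangles and the shoelace formula\<close>

lemma measure_lebesgue_complex_of_vec:
  fixes S :: "(real^2) set"
  assumes "S \<in> sets borel" "(\<lambda>x. Complex (x $ 1) (x $ 2)) ` S \<in> sets borel"
  shows "measure lebesgue ((\<lambda>x. Complex (x $ 1) (x $ 2)) ` S) = measure lebesgue S"
proof -
  define f where "f = (\<lambda>x :: real^2. Complex (x $ 1) (x $ 2))"
  have f: "f \<in> borel_measurable borel"
    unfolding f_def by (intro borel_measurable_continuous_onI) (auto intro!: continuous_intros simp: Complex_eq)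
  have inj: "inj f" by (auto simp: f_def inj_def vec_eq_iff forall_2)
  have "distr lborel borel f = lborel"
  proof (rule sym, rule lborel_eqI)
    fix l u :: complex assume lu: "\<And>b. b \<in> Basis \<Longrightarrow> l \<bullet> b \<le> u \<bullet> b"
    define l' where "l' = (vector [Re l, Im l] :: real^2)"
    define u' where "u' = (vector [Re u, Im u] :: real^2)"
    have le: "Re l \<le> Re u" "Im l \<le> Im u" using lu[of 1] lu[of \<i>] by (auto simp: Basis_complex_def inner_complex_def)
    have "f -` box l u = box l' u'"
      by (auto simp: set_eq_iff f_def l'_def u'_def mem_box_cart forall_2 in_box_complex_iff)
    then have "emeasure (distr lborel borel f) (box l u) = emeasure lborel (box l' u')"
      using f by (subst emeasure_distr) auto
    also have "\<dots> = ennreal (\<Prod>b\<in>Basis. (u' - l') \<bullet> b)"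
    proof (rule emeasure_lborel_box)
      have "l' $ i \<le> u' $ i" for i
        using le exhaust_2[of i] by (auto simp: l'_def u'_def)
      then show "l' \<bullet> b \<le> u' \<bullet> b" if "b \<in> Basis" for b
        using that by (auto simp: Basis_vec_def inner_axis)
    qed
    also have "(\<Prod>b\<in>Basis. (u' - l') \<bullet> b) = (\<Prod>b\<in>Basis. (u - l) \<bullet> b)"
    proof -
      have B: "(Basis :: (real^2) set) = {axis 1 1, axis 2 1}"
        unfolding Basis_vec_def UNIV_2 by auto
      have "axis 1 1 \<noteq> (axis 2 1 :: real^2)" by (simp add: axis_eq_axis)
      then show ?thesis
        unfolding B by (simp add: Basis_complex_def inner_axis inner_complex_def l'_def u'_def)
    qed
    finally show "emeasure (distr lborel borel f) (box l u) = ennreal (\<Prod>b\<in>Basis. (u - l) \<bullet> b)" .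
  qed simp
  then have "measure lborel (f ` S) = measure (distr lborel borel f) (f ` S)" by simp
  also have "\<dots> = measure lborel (f -` f ` S)"
    using assms(2) f by (subst measure_distr) (auto simp: f_def)
  also have "f -` f ` S = S" using inj by (simp add: inj_vimage_image_eq)
  finally show ?thesis using assms by (simp add: f_def)
qed

text \<open>The formula \<open>content_triangle\<close> lives in \<open>real^2\<close>; taking
  coordinates preserves Lebesgue measure, because the transported measure agrees on boxes.\<close>

lemma measure_lebesgue_triangle:
  fixes a b c :: complex
  shows "measure lebesgue (convex hull {a, b, c}) = \<bar>orient a b c\<bar> / 2"
proof -
  define f where "f = (\<lambda>x :: real^2. Complex (x $ 1) (x $ 2))"
  define g where "g = (\<lambda>z. vector [Re z, Im z] :: real^2)"
  have lin: "linear f" by (auto simp: f_def linear_iff complex_eq_iff)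
  have fg: "f (g z) = z" for z by (simp add: f_def g_def)
  let ?T = "convex hull {g a, g b, g c}"
  have im: "f ` ?T = convex hull {a, b, c}"
    using convex_hull_linear_image[OF lin, of "{g a, g b, g c}"] by (simp add: fg)
  have c: "compact ?T" "compact (convex hull {a, b, c})"
    by (intro compact_convex_hull finite_imp_compact; simp)+
  have "measure lebesgue (f ` ?T) = measure lebesgue ?T"
    unfolding f_def by (rule measure_lebesgue_complex_of_vec) (use c im in \<open>auto simp: f_def intro: borel_compact\<close>)
  also have "\<dots> = \<bar>orient a b c\<bar> / 2"
    using content_triangle[of "g a" "g b" "g c"] c(1)
    by (simp add: g_def wedge_eq borel_compact abs_minus_commute algebra_simps)
  finally show ?thesis using im by simp
qed

lemma negligible_line: "a \<noteq> b \<Longrightarrow> negligible {x. orient a b x = 0}"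
proof -
  assume "a \<noteq> b"
  have "{x. orient a b x = 0} = {x. (\<i> * (b - a)) \<bullet> x = (\<i> * (b - a)) \<bullet> a}"
    by (auto simp: wedge_eq inner_complex_def algebra_simps)
  moreover have "negligible {x. (\<i> * (b - a)) \<bullet> x = (\<i> * (b - a)) \<bullet> a}"
    by (rule negligible_hyperplane) (use \<open>a \<noteq> b\<close> in auto)
  ultimately show ?thesis by simp
qed

text \<open>The terms containing \<open>a\<close> telescope around a closed polygon.\<close>

lemma shoelace_translate:
  assumes "X n = X 0"
  shows "(\<Sum>k<n. wedge (X k - a) (X (Suc k) - a)) = (\<Sum>k<n. wedge (X k) (X (Suc k)))"
proof -
  have "wedge (X k - a) (X (Suc k) - a) = wedge (X k) (X (Suc k)) + (wedge (X (Suc k)) a - wedge (X k) a)" for k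
    by (simp add: wedge_eq algebra_simps)
  then have "(\<Sum>k<n. wedge (X k - a) (X (Suc k) - a)) =
     (\<Sum>k<n. wedge (X k) (X (Suc k))) + (\<Sum>k<n. wedge (X (Suc k)) a - wedge (X k) a)"
    by (simp add: sum.distrib)
  moreover have "(\<Sum>k<n. wedge (X (Suc k)) a - wedge (X k) a) = 0"
    using sum_lessThan_telescope[of "\<lambda>k. wedge (X k) a" n] assms by simp
  ultimately show ?thesis by simp
qed

context ngon
begin

lemma W_neq_mid: "k < CARD('n) \<Longrightarrow> W k \<noteq> mid"
  using orient_mid_Suc[of k] orient_mid_Suc[of "k - 1"] card_ge_3 by (cases "k = 0") auto

lemma W_last_eq: "W (CARD('n) - 1) - mid = - (W 0 - mid)"
  by (simp add: mid_def field_simps)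

lemma measure_region_fan:
  "measure lebesgue (region w) = (\<Sum>k<CARD('n) - 1. orient mid (W k) (W (Suc k))) / 2"
proof -
  let ?T = "\<lambda>k. convex hull {mid, W k, W (Suc k)}"
  \<comment> \<open>The line through \<open>mid\<close> and \<open>W k\<close> separates the two
    triangles, so they overlap in a null set.\<close>
  have negl: "negligible (?T j \<inter> ?T k)" if "j < k" "k < CARD('n) - 1" for j k
  proof (rule negligible_subset)
    show "negligible {x. orient mid (W k) x = 0}"
      by (rule negligible_line) (use W_neq_mid[of k] that in force)
    show "?T j \<inter> ?T k \<subseteq> {x. orient mid (W k) x = 0}"
    proof
      fix x assume x: "x \<in> ?T j \<inter> ?T k"
      then have "0 \<le> orient mid (W k) x"
        using orient_mid_Suc[of k] that by (auto simp: mem_triangle_iff)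
      moreover have "?T j \<subseteq> {x. 0 \<le> orient (W k) mid x}"
      proof (rule hull_minimal)
        have "0 \<le> orient mid (W i) (W k)" if "i \<le> k" "i < k \<longrightarrow> 0 < i \<or> k < CARD('n) - 1" for i
          using orient_mid_pos[of i k] that \<open>k < CARD('n) - 1\<close> by (cases "i = k") (auto simp: less_imp_le)
        from this[of j] this[of "Suc j"]
        have "0 \<le> orient mid (W j) (W k)" "0 \<le> orient mid (W (Suc j)) (W k)"
          using that by auto
        then have "0 \<le> orient (W k) mid (W j)" "0 \<le> orient (W k) mid (W (Suc j))"
          by (metis orient_rotate)+
        then show "{mid, W j, W (Suc j)} \<subseteq> {x. 0 \<le> orient (W k) mid x}" by simp
      qed (rule affine_wedge_halfplane)
      then have "0 \<le> orient (W k) mid x" using x by blast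
      then have "orient mid (W k) x \<le> 0" by (simp add: wedge_eq algebra_simps)
      ultimately show "x \<in> {x. orient mid (W k) x = 0}" by simp
    qed
  qed
  have "measure lebesgue (region w) = (\<Sum>k<CARD('n) - 1. measure lebesgue (?T k))"
    unfolding region_fan
  proof (rule measure_negligible_finite_Union_image)
    show "pairwise (\<lambda>j k. negligible (?T j \<inter> ?T k)) {..<CARD('n) - 1}"
      unfolding pairwise_def by (metis negl Int_commute lessThan_iff linorder_neqE_nat)
    show "?T k \<in> lmeasurable" for k
      by (intro lmeasurable_compact compact_convex_hull finite_imp_compact) simp
  qed simp
  also have "\<dots> = (\<Sum>k<CARD('n) - 1. orient mid (W k) (W (Suc k)) / 2)"
  proof (rule sum.cong)
    fix k assume "k \<in> {..<CARD('n) - 1}"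
    then show "measure lebesgue (?T k) = orient mid (W k) (W (Suc k)) / 2"
      using orient_mid_Suc[of k] by (simp add: measure_lebesgue_triangle less_diff_conv)
  qed simp
  finally show ?thesis by (simp add: sum_divide_distrib)
qed

lemma W_card [simp]: "W CARD('n) = W 0"
  by (simp add: W_def)

text \<open>The triangle over the closing side with apex \<open>mid\<close> is degenerate, so the
  fan sum is already the full cyclic sum; moving the apex to the origin gives the shoelace
  formula.\<close>

lemma measure_region:
  "measure lebesgue (region w) = (\<Sum>i\<in>UNIV. wedge (w i) (w (nxt i))) / 2"
proof -
  have N: "CARD('n) = Suc (CARD('n) - 1)" using card_ge_3 by simp
  have "(\<Sum>i\<in>UNIV. wedge (w i) (w (nxt i))) = (\<Sum>k<CARD('n). wedge (W k) (W (Suc k)))"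
    by (simp add: sum_lbl W_def nxt_lbl)
  also have "\<dots> = (\<Sum>k<CARD('n). orient mid (W k) (W (Suc k)))"
    using shoelace_translate[of W "CARD('n)" mid] by simp
  also have "\<dots> = (\<Sum>k<CARD('n) - 1. orient mid (W k) (W (Suc k))) + orient mid (W (CARD('n) - 1)) (W CARD('n))"
    using sum.lessThan_Suc[of "\<lambda>k. orient mid (W k) (W (Suc k))" "CARD('n) - 1"] N by simp
  also have "orient mid (W (CARD('n) - 1)) (W CARD('n)) = 0"
    unfolding W_last_eq W_card by (simp add: wedge_eq algebra_simps)
  finally show ?thesis by (simp add: measure_region_fan)
qed

end

section \<open>Side directions and minima of height functions\<close>

context ngon
begin

definition prv :: "'n \<Rightarrow> 'n" where "prv = inv nxt"

lemma nxt_prv [simp]: "nxt (prv i) = i" and prv_nxt [simp]: "prv (nxt i) = i"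
  using bij_nxt inj_nxt by (simp_all add: prv_def bij_is_surj surj_f_inv_f)

text \<open>Equal to \<open>\<i>\<close> times the outer normal, hence common to all parallel
  polygons.\<close>

definition D :: "'n \<Rightarrow> complex" where "D i = sgn (w (nxt i) - w i)"

lemma side_len_pos: "0 < norm (w (nxt i) - w i)"
  using w_nxt_neq by simp

lemma side_vec: "w (nxt i) - w i = norm (w (nxt i) - w i) *\<^sub>R D i"
  using side_len_pos[of i] by (simp add: D_def sgn_div_norm)

lemma norm_D [simp]: "norm (D i) = 1"
  using w_nxt_neq by (simp add: D_def norm_sgn)

lemma D_neq_0 [simp]: "D i \<noteq> 0"
  using norm_D by (metis norm_zero zero_neq_one)

lemma wedge_D_pos: "0 < wedge (D i) y \<longleftrightarrow> 0 < wedge (w (nxt i) - w i) y"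
  by (subst side_vec) (use side_len_pos[of i] in \<open>simp add: wedge.scaleR_left zero_less_mult_iff\<close>)

lemma wedge_D_nonneg: "0 \<le> wedge (D i) y \<longleftrightarrow> 0 \<le> wedge (w (nxt i) - w i) y"
  by (subst side_vec) (use side_len_pos[of i] in \<open>simp add: wedge.scaleR_left zero_le_mult_iff\<close>)

lemma wedge_consecutive: "0 < wedge (D i) (D (nxt i))"
proof -
  have "0 < orient (w i) (w (nxt i)) (w (nxt (nxt i)))"
    by (rule left) (use nxt_neq nxt_nxt_neq in auto)
  then have "0 < wedge (w (nxt i) - w i) (w (nxt (nxt i)) - w (nxt i))"
    by (simp add: wedge_eq algebra_simps)
  then have "0 < wedge (D i) (norm (w (nxt (nxt i)) - w (nxt i)) *\<^sub>R D (nxt i))"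
    using side_vec wedge_D_pos by metis
  then show ?thesis using side_len_pos[of "nxt i"] by (simp add: wedge.scaleR_right zero_less_mult_iff)
qed

lemma wedge_prv: "0 < wedge (D (prv i)) (D i)"
  using wedge_consecutive[of "prv i"] by simp

lemma outer_normal_eq: "outer_normal nxt w i = - \<i> * D i"
  by (simp add: outer_normal_def D_def sgn_eq norm_mult)

lemma inner_outer_normal: "x \<bullet> outer_normal nxt w i = - wedge (D i) x"
  by (simp add: outer_normal_eq inner_complex_def wedge_eq)

text \<open>At a strict local minimum of a height function all other vertices lie in the wedge spanned by
  the two adjacent sides.\<close>

lemma local_min:
  assumes "wedge c (D (prv i)) \<le> 0" "0 \<le> wedge c (D i)"
  shows "0 \<le> wedge c (w j - w i)"
    and "wedge c (D (prv i)) < 0 \<Longrightarrow> 0 < wedge c (D i) \<Longrightarrow> j \<noteq> i \<Longrightarrow> 0 < wedge c (w j - w i)"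
proof -
  define a b y where "a = D (prv i)" "b = D i" "y = w j - w i"
  have ab: "0 < wedge a b" using wedge_prv by (simp add: a_b_y_def)
  have ay: "0 \<le> wedge a y"
  proof -
    have "orient (w (prv i)) (w i) (w j) = wedge (w i - w (prv i)) y"
      by (simp add: a_b_y_def wedge_eq algebra_simps)
    then show ?thesis using left_ge[of "prv i" j] wedge_D_nonneg[of "prv i" y] by (simp add: a_b_y_def)
  qed
  have "by": "0 \<le> wedge b y"
    using left_ge[of i j] wedge_D_nonneg[of i y] by (simp add: a_b_y_def)
  \<comment> \<open>Cramer's rule: \<open>wedge a b\<close> times \<open>y\<close> is
    \<open>wedge a y\<close> times \<open>b\<close> minus \<open>wedge b y\<close> times
    \<open>a\<close>. With nonnegative coefficients this places \<open>y\<close> in the cone of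
    \<open>b\<close> and \<open>- a\<close>.\<close>
  have eq: "wedge a b * wedge c y = wedge a y * wedge c b + wedge b y * (- wedge c a)"
    by (simp add: wedge_eq algebra_simps)
  have "0 \<le> wedge a y * wedge c b + wedge b y * (- wedge c a)"
    using ay "by" assms by (intro add_nonneg_nonneg mult_nonneg_nonneg) (auto simp: a_b_y_def)
  then have "0 \<le> wedge a b * wedge c y" by (simp only: eq)
  then show "0 \<le> wedge c (w j - w i)"
    using ab by (simp add: a_b_y_def(3) zero_le_mult_iff)
  assume *: "wedge c (D (prv i)) < 0" "0 < wedge c (D i)" "j \<noteq> i"
  have "0 < wedge a y \<or> 0 < wedge b y"
  proof (cases "j = nxt i")
    case False
    then have "0 < orient (w i) (w (nxt i)) (w j)" using left * by auto
    then show ?thesis using wedge_D_pos[of i y] by (simp add: a_b_y_def)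
  next
    case True
    then have "y = norm (w (nxt i) - w i) *\<^sub>R b" using side_vec[of i] by (simp add: a_b_y_def)
    then show ?thesis using ab side_len_pos[of i] by (metis mult_pos_pos real_scaleR_def wedge.scaleR_right)
  qed
  then have "0 < wedge a y * wedge c b + wedge b y * (- wedge c a)"
  proof
    assume "0 < wedge a y"
    moreover have "0 \<le> wedge b y * (- wedge c a)"
      using * "by" by (intro mult_nonneg_nonneg) (auto simp: a_b_y_def(1))
    ultimately show ?thesis using * by (intro add_pos_nonneg mult_pos_pos) (auto simp: a_b_y_def(2))
  next
    assume "0 < wedge b y"
    moreover have "0 \<le> wedge a y * wedge c b"
      using * ay by (intro mult_nonneg_nonneg) (auto simp: a_b_y_def(2))
    ultimately show ?thesis using * by (intro add_nonneg_pos mult_pos_pos) (auto simp: a_b_y_def(1))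
  qed
  then have "0 < wedge a b * wedge c y" by (simp only: eq)
  then show "0 < wedge c (w j - w i)"
    using ab by (simp add: a_b_y_def(3) zero_less_mult_iff)
qed

section \<open>Vertices and side lengths as functions of the support numbers\<close>

text \<open>Intersection of the supporting lines of the sides \<open>prv i\<close> and
  \<open>i\<close>, by Cramer's rule; the line of side \<open>i\<close> is
  \<open>wedge (D i) x = - h $ i\<close>. It makes sense for every \<open>h\<close>, also for those
  that come from no polygon.\<close>

definition vert :: "real^'n \<Rightarrow> 'n \<Rightarrow> complex" where
  "vert h i = (1 / wedge (D (prv i)) (D i)) *\<^sub>R (h $ i *\<^sub>R D (prv i) - h $ prv i *\<^sub>R D i)"

definition slen :: "real^'n \<Rightarrow> 'n \<Rightarrow> real" where
  "slen h i = D i \<bullet> (vert h (nxt i) - vert h i)"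

lemma linear_vert: "linear (\<lambda>h. vert h i)"
  unfolding vert_def by (intro linearI) (simp_all add: algebra_simps scaleR_add_left)

lemma linear_slen: "linear (\<lambda>h. slen h i)"
  unfolding slen_def
  by (intro linearI)
    (simp_all add: linear_add[OF linear_vert] linear_cmul[OF linear_vert] inner_diff_right inner_add_right algebra_simps)

lemma wedge_vert: "wedge (D i) (vert h i) = - h $ i" "wedge (D (prv i)) (vert h i) = - h $ prv i"
proof -
  have *: "wedge (D (prv i)) (D i) \<noteq> 0" using wedge_prv[of i] by simp
  then show "wedge (D i) (vert h i) = - h $ i"
    by (simp add: vert_def wedge.scaleR_right wedge.diff_right wedge_commute[of "D i" "D (prv i)"] field_simps)
  show "wedge (D (prv i)) (vert h i) = - h $ prv i" using *
    by (simp add: vert_def wedge.scaleR_right wedge.diff_right field_simps)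
qed

lemma wedge_vert_nxt: "wedge (D i) (vert h (nxt i)) = - h $ i"
  using wedge_vert(2)[of "nxt i" h] by simp

lemma unit_decomp: "norm d = 1 \<Longrightarrow> wedge d y = 0 \<Longrightarrow> y = (d \<bullet> y) *\<^sub>R d"
proof -
  assume "norm d = 1" "wedge d y = 0"
  then have 1: "Re d * Re d + Im d * Im d = 1" and 2: "Re d * Im y = Im d * Re y"
    by (auto simp: wedge_eq cmod_def power2_eq_square)
  show ?thesis
    by (rule complex_eqI; simp add: inner_complex_def) (use 1 2 in algebra)+
qed

lemma vert_side: "vert h (nxt i) - vert h i = slen h i *\<^sub>R D i"
  unfolding slen_def by (rule unit_decomp) (simp_all add: wedge.diff_right wedge_vert wedge_vert_nxt)

lemma vert_unique:
  assumes "\<And>i. wedge (D i) (x i) = - h $ i" "\<And>i. wedge (D i) (x (nxt i)) = - h $ i"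
  shows "x i = vert h i"
proof -
  have a: "wedge (D i) (x i - vert h i) = 0"
    by (simp add: wedge.diff_right assms wedge_vert)
  have b: "wedge (D (prv i)) (x i - vert h i) = 0"
    using assms(2)[of "prv i"] by (simp add: wedge.diff_right wedge_vert)
  have "x i - vert h i = (D i \<bullet> (x i - vert h i)) *\<^sub>R D i"
    by (rule unit_decomp[OF norm_D a])
  then have "(D i \<bullet> (x i - vert h i)) * wedge (D (prv i)) (D i) = 0"
    using b by (metis real_scaleR_def wedge.scaleR_right)
  then have "D i \<bullet> (x i - vert h i) = 0" using wedge_prv[of i] by simp
  then show ?thesis using \<open>x i - vert h i = _\<close> by simp
qed

text \<open>When all sides have length 0 the vertices collapse to one point \<open>x\<close>, and
  the support numbers are then those of \<open>x\<close>. So the side lengths are coordinates on the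
  quotient by translations.\<close>

lemma slen_eq_0_iff: "(\<forall>i. slen h i = 0) \<longleftrightarrow> h \<in> translation_vectors nxt w"
proof
  assume *: "\<forall>i. slen h i = 0"
  have "vert h (nxt i) = vert h i" for i using vert_side[of h i] * by simp
  then have "vert h (lbl k) = vert h i0" for k by (induction k) (auto simp: lbl_Suc)
  then have "vert h i = vert h i0" for i by (metis lbl_exhaust)
  then have "h $ i = - wedge (D i) (vert h i0)" for i
    using wedge_vert(1)[of i h] by (metis minus_minus)
  then have "h = (\<chi> i. vert h i0 \<bullet> outer_normal nxt w i)"
    by (simp add: vec_eq_iff inner_outer_normal)
  then show "h \<in> translation_vectors nxt w" unfolding translation_vectors_def by blast
next
  assume "h \<in> translation_vectors nxt w"
  then obtain x where h: "h = (\<chi> i. x \<bullet> outer_normal nxt w i)" unfolding translation_vectors_def by blast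
  have "vert h i = x" for i
    by (rule vert_unique[symmetric]) (simp_all add: h inner_outer_normal)
  then show "\<forall>i. slen h i = 0" by (simp add: slen_def)
qed

lemma vert_translate: "t \<in> translation_vectors nxt w \<Longrightarrow> \<exists>x. \<forall>i. vert t i = x"
proof -
  assume "t \<in> translation_vectors nxt w"
  then have "vert t (nxt i) = vert t i" for i using vert_side[of t i] slen_eq_0_iff[of t] by simp
  then have "vert t (lbl k) = vert t i0" for k by (induction k) (auto simp: lbl_Suc)
  then have "vert t i = vert t i0" for i by (metis lbl_exhaust)
  then show ?thesis by blast
qed

end

text \<open>\<open>v\<close> fixes the directions and thereby \<open>vert\<close> and
  \<open>slen\<close>; the sublocale provides the notions of a single polygon for \<open>w\<close>,
  and \<open>same_D\<close> identifies the directions.\<close>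

locale parallel_pair = ngon nxt v i0 for nxt :: "'n::finite \<Rightarrow> 'n" and v i0 +
  fixes w
  assumes par: "w \<in> parallel_ngons nxt v"
begin

sublocale w: ngon nxt w i0
  using par by unfold_locales (simp add: parallel_ngons_def)

lemma same_D [simp]: "w.D = D"
proof
  fix i
  have "- \<i> * w.D i = - \<i> * D i"
    using par by (simp add: parallel_ngons_def w.outer_normal_eq outer_normal_eq)
  then show "w.D i = D i" by simp
qed

text \<open>The region lies to the left of side \<open>i\<close>, so the supremum is attained along
  that side, in particular at its first vertex.\<close>

lemma support_vector_nth: "support_vector nxt v w $ i = - wedge (D i) (w i)"
proof -
  have "(SUP x\<in>region w. x \<bullet> outer_normal nxt v i) = w i \<bullet> outer_normal nxt v i"
  proof (rule cSup_eq_maximum)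
    show "w i \<bullet> outer_normal nxt v i \<in> (\<lambda>x. x \<bullet> outer_normal nxt v i) ` region w"
      using w.w_in_region by blast
    fix y assume "y \<in> (\<lambda>x. x \<bullet> outer_normal nxt v i) ` region w"
    then obtain x where "x \<in> region w" and y: "y = x \<bullet> outer_normal nxt v i" by blast
    then have "0 \<le> orient (w i) (w (nxt i)) x" by (simp add: w.region_eq)
    then have "0 \<le> wedge (D i) (x - w i)" using w.wedge_D_nonneg by simp
    then show "y \<le> w i \<bullet> outer_normal nxt v i"
      by (simp add: y inner_outer_normal wedge.diff_right)
  qed
  then show ?thesis by (simp add: support_vector_def inner_outer_normal)
qed

lemma vert_support_vector: "vert (support_vector nxt v w) i = w i"
proof (rule vert_unique[symmetric])
  fix i
  show "wedge (D i) (w i) = - support_vector nxt v w $ i" by (simp add: support_vector_nth)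
  have "wedge (D i) (w (nxt i) - w i) = 0" using w.side_vec[of i] by (metis same_D wedge.scaleR_right scaleR_zero_right wedge_self real_scaleR_def mult_zero_right)
  then show "wedge (D i) (w (nxt i)) = - support_vector nxt v w $ i"
    by (simp add: support_vector_nth wedge.diff_right)
qed

lemma slen_support_vector: "slen (support_vector nxt v w) i = norm (w (nxt i) - w i)"
proof -
  have "slen (support_vector nxt v w) i *\<^sub>R D i = norm (w (nxt i) - w i) *\<^sub>R D i"
    using vert_side[of "support_vector nxt v w" i] w.side_vec[of i] by (simp add: vert_support_vector)
  then show ?thesis by simp
qed

end

context ngon
begin

text \<open>The height of the vertices above side \<open>i\<close> rises and then falls around the polygon, because a
  local minimum above side \<open>i\<close> would contradict the convexity of \<open>w\<close>.\<close>

lemma convex_ngon_of_slen_pos: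
  assumes pos: "\<And>i. 0 < slen h i"
  shows "convex_ngon nxt (vert h)"
proof -
  have "0 < wedge (slen h i0' *\<^sub>R D i0') (vert h j - vert h i0')" if j: "j \<noteq> i0'" "j \<noteq> nxt i0'" for i0' j
  proof -
    \<comment> \<open>The numbering restarts at the side under test; \<open>f\<close> records the
      slopes of the other sides relative to it and \<open>H\<close> the heights above it.\<close>
    interpret s: ngon nxt w i0' by unfold_locales (rule ngon)
    define f where "f = (\<lambda>k. wedge (D i0') (D (s.lbl k)))"
    define H where "H = (\<lambda>k. wedge (D i0') (vert h (s.lbl k) - vert h i0'))"
    let ?n = "CARD('n)"
    have step: "H (Suc k) = H k + slen h (s.lbl k) * f k" for k
    proof -
      have "vert h (s.lbl (Suc k)) - vert h i0' = vert h (s.lbl k) - vert h i0' + slen h (s.lbl k) *\<^sub>R D (s.lbl k)"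
        using vert_side[of h "s.lbl k"] by (simp add: s.lbl_Suc algebra_simps)
      then show ?thesis unfolding H_def f_def by (simp only: wedge.add_right wedge.scaleR_right real_scaleR_def)
    qed
    have f1: "0 < f 1" using wedge_consecutive[of i0'] by (simp add: f_def s.lbl_Suc)
    have fall: "f (Suc k) < 0" if "1 \<le> k" "Suc k < ?n" "f k \<le> 0" for k
    proof (rule ccontr)
      assume "\<not> f (Suc k) < 0"
      then have "0 \<le> wedge (D i0') (D (s.lbl (Suc k)))" "wedge (D i0') (D (prv (s.lbl (Suc k)))) \<le> 0"
        using that by (auto simp: f_def s.lbl_Suc)
      then have "0 \<le> wedge (D i0') (w i0' - w (s.lbl (Suc k)))" by (intro local_min(1))
      then have "wedge (D i0') (w (s.lbl (Suc k)) - w i0') \<le> 0" by (simp add: wedge.diff_right)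
      moreover have "0 < wedge (D i0') (w (s.lbl (Suc k)) - w i0')"
      proof -
        have "s.lbl (Suc k) \<noteq> s.lbl 0" "s.lbl (Suc k) \<noteq> s.lbl (Suc 0)"
          by (subst s.lbl_eq_iff; use that in simp)+
        then have "0 < orient (w i0') (w (nxt i0')) (w (s.lbl (Suc k)))"
          by (intro left) (auto simp: s.lbl_Suc)
        then show ?thesis by (simp add: wedge_D_pos)
      qed
      ultimately show False by simp
    qed
    have fall': "f l < 0" if "1 \<le> k" "f k \<le> 0" "k < l" "l < ?n" for k l
      using that(3,4)
    proof (induction l)
      case (Suc l)
      then show ?case using fall[of l] that by (cases "k = l") auto
    qed simp
    obtain k where k: "k < ?n" "j = s.lbl k" by (rule s.lbl_exhaust)
    have k2: "2 \<le> k"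
    proof (rule ccontr)
      assume "\<not> 2 \<le> k"
      then have "k = 0 \<or> k = 1" by auto
      then show False using k j by (auto simp: s.lbl_Suc)
    qed
    have H1: "H 1 = 0" and H0: "H ?n = 0"
      using vert_side[of h i0'] by (simp_all add: H_def s.lbl_Suc wedge.scaleR_right)
    have "0 < H k"
    \<comment> \<open>Either all slopes before \<open>k\<close> are positive and \<open>H k\<close>
      is a sum of positive steps from height 0, or the slopes are negative from \<open>k\<close> on
      and \<open>H\<close> has to descend from \<open>H k\<close> to the final height 0.\<close>
    proof (cases "\<forall>l. 1 \<le> l \<and> l < k \<longrightarrow> 0 < f l")
      case True
      have "0 < H l" if "2 \<le> l" "l \<le> k" for l
        using that
      proof (induction l rule: nat_induct_at_least)
        case base
        have "H 2 = H 1 + slen h (s.lbl 1) * f 1" using step[of 1] by (simp add: numeral_2_eq_2)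
        then show ?case using H1 f1 pos by simp
      next
        case (Suc l)
        then show ?case using step[of l] True pos[of "s.lbl l"] by (auto intro!: add_pos_pos mult_pos_pos)
      qed
      then show ?thesis using k2 by auto
    next
      case False
      then obtain l where l: "1 \<le> l" "l < k" "f l \<le> 0" by auto
      have neg: "f i < 0" if "k \<le> i" "i < ?n" for i using fall'[of l i] l that by auto
      have "H (k + i) + 0 \<le> H k \<and> (0 < i \<longrightarrow> H (k + i) < H k)" if "k + i \<le> ?n" for i
        using that
      proof (induction i)
        case (Suc i)
        have "slen h (s.lbl (k + i)) * f (k + i) < 0"
          using neg[of "k + i"] pos Suc by (intro mult_pos_neg) auto
        then show ?case using Suc step[of "k + i"] by auto
      qed simp
      from this[of "?n - k"] k H0 show ?thesis by auto
    qed
    then show ?thesis using pos[of i0'] by (simp add: H_def k wedge.scaleR_left)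
  qed
  then show ?thesis
    unfolding convex_ngon_def vert_side wedge_def[symmetric] using card_ge_3 nxt_neq by blast
qed

lemma parallel_of_slen_pos:
  assumes pos: "\<And>i. 0 < slen h i"
  shows "vert h \<in> parallel_ngons nxt w" "support_vector nxt w (vert h) = h"
proof -
  have "outer_normal nxt (vert h) i = outer_normal nxt w i" for i
  proof -
    have "outer_normal nxt (vert h) i = sgn (- \<i> * (slen h i *\<^sub>R D i))"
      by (simp add: outer_normal_def vert_side)
    also have "\<dots> = - \<i> * D i"
      using pos[of i] by (simp add: sgn_eq norm_mult scaleR_conv_of_real)
    finally show ?thesis by (simp add: outer_normal_eq)
  qed
  then show *: "vert h \<in> parallel_ngons nxt w"
    using convex_ngon_of_slen_pos[OF pos] by (simp add: parallel_ngons_def)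
  interpret parallel_pair nxt w i0 "vert h" by unfold_locales (rule *)
  show "support_vector nxt w (vert h) = h"
    by (simp add: vec_eq_iff support_vector_nth wedge_vert)
qed

lemma support_cone_eq: "support_cone nxt w = {h. \<forall>i. 0 < slen h i}"
proof
  show "support_cone nxt w \<subseteq> {h. \<forall>i. 0 < slen h i}"
  proof (clarsimp simp: support_cone_def)
    fix w' i assume "w' \<in> parallel_ngons nxt w"
    then interpret parallel_pair nxt w i0 w' by unfold_locales
    show "0 < slen (support_vector nxt w w') i" using w.side_len_pos by (simp add: slen_support_vector)
  qed
  show "{h. \<forall>i. 0 < slen h i} \<subseteq> support_cone nxt w"
    unfolding support_cone_def using parallel_of_slen_pos by (metis (mono_tags, lifting) imageI mem_Collect_eq subsetI)
qed

lemma self_parallel: "w \<in> parallel_ngons nxt w"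
  using ngon by (simp add: parallel_ngons_def)

end

section \<open>Signature of quadratic forms\<close>

text \<open>By the parallelogram law the second difference of \<open>q\<close> at \<open>x\<close>
  in direction \<open>y\<close> is a multiple of \<open>q y\<close>, so the values near one point
  determine the form everywhere.\<close>

lemma quadratic_form_eq_on_open:
  fixes q q' :: "'a::real_normed_vector \<Rightarrow> real"
  assumes "quadratic_form q" "quadratic_form q'" "open S" "x \<in> S" and eq: "\<And>x. x \<in> S \<Longrightarrow> q x = q' x"
  shows "q = q'"
proof
  fix y :: 'a
  obtain B where B: "bilinear B" "\<And>x y. B x y = B y x" "\<And>x. q x = B x x"
    using assms(1) unfolding quadratic_form_def by blast
  obtain B' where B': "bilinear B'" "\<And>x y. B' x y = B' y x" "\<And>x. q' x = B' x x"
    using assms(2) unfolding quadratic_form_def by blast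
  obtain e where e: "e > 0" "ball x e \<subseteq> S" using assms by (meson openE)
  \<comment> \<open>Small enough to keep both translates of \<open>x\<close> in the ball; the added
    1 covers \<open>y = 0\<close>.\<close>
  define t where "t = e / (2 * (norm y + 1))"
  have t: "t > 0" using e by (simp add: t_def add_nonneg_pos)
  have "t * norm y < e"
  proof -
    have "t * norm y \<le> t * (norm y + 1)" using t by simp
    also have "norm y + 1 \<noteq> 0" using norm_ge_zero[of y] by linarith
    then have "t * (norm y + 1) = e / 2" unfolding t_def by (metis (no_types) divide_divide_eq_left nonzero_eq_divide_eq)
    finally show ?thesis using e by simp
  qed
  then have "x + t *\<^sub>R y \<in> S" "x - t *\<^sub>R y \<in> S"
    using e t by (auto simp: dist_norm subset_iff)
  then have *: "q (x + t *\<^sub>R y) = q' (x + t *\<^sub>R y)" "q (x - t *\<^sub>R y) = q' (x - t *\<^sub>R y)" "q x = q' x"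
    using eq assms by auto
  have exp: "b (x + t *\<^sub>R y) (x + t *\<^sub>R y) + b (x - t *\<^sub>R y) (x - t *\<^sub>R y) = 2 * b x x + 2 * t\<^sup>2 * b y y"
    if "bilinear b" for b :: "'a \<Rightarrow> 'a \<Rightarrow> real"
    using that by (simp add: bilinear_ladd bilinear_radd bilinear_lsub bilinear_rsub bilinear_lmul bilinear_rmul
       power2_eq_square algebra_simps)
  have "2 * t\<^sup>2 * B y y = 2 * t\<^sup>2 * B' y y"
    using exp[OF B(1)] exp[OF B'(1)] *[unfolded B(3) B'(3)] by linarith
  then have "B y y = B' y y" using t by auto
  then show "q y = q' y" by (simp add: B(3) B'(3))
qed

lemma polar_form_bilinear:
  assumes "bilinear B" "\<And>x y. B x y = B y x"
  shows "polar_form (\<lambda>x. B x x) x y = B x y"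
  using assms by (simp add: polar_form_def bilinear_ladd bilinear_radd)

lemma bilinear_sum_scale_left:
  fixes B :: "'a::real_vector \<Rightarrow> 'a \<Rightarrow> real"
  assumes "bilinear B"
  shows "B (\<Sum>x\<in>F. a x *\<^sub>R x) y = (\<Sum>x\<in>F. a x * B x y)"
proof -
  have "linear (\<lambda>x. B x y)" using assms by (simp add: bilinear_def)
  from linear_sum[OF this, of "\<lambda>x. a x *\<^sub>R x" F] show ?thesis
    by (simp add: bilinear_lmul[OF assms])
qed

text \<open>Pairing a combination of members of \<open>F\<close> with one of them isolates its
  coefficient, whereas elements of \<open>T\<close> pair to 0 with everything.\<close>

lemma anisotropic_orthogonal_independent:
  fixes B :: "'a::real_vector \<Rightarrow> 'a \<Rightarrow> real"
  assumes B: "bilinear B" and F: "finite F" "pairwise (\<lambda>x y. B x y = 0) F" "\<And>x. x \<in> F \<Longrightarrow> B x x \<noteq> 0"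
    and T: "\<And>t x. t \<in> T \<Longrightarrow> B t x = 0" "0 \<in> T"
  shows "independent F" "span F \<inter> T = {0}"
proof -
  have coeff: "a y * B y y = B (\<Sum>x\<in>F. a x *\<^sub>R x) y" if "y \<in> F" for a y
  proof -
    have "(\<Sum>x\<in>F. a x * B x y) = (\<Sum>x\<in>{y}. a x * B x y)"
      using F that by (intro sum.mono_neutral_right) (auto simp: pairwise_def)
    then show ?thesis by (simp add: bilinear_sum_scale_left[OF B])
  qed
  have zero: "a y = 0" if "(\<Sum>x\<in>F. a x *\<^sub>R x) \<in> T" "y \<in> F" for a y
    using coeff[OF that(2), of a] T(1)[OF that(1)] F(3)[OF that(2)] by simp
  show "independent F"
  proof
    assume "dependent F"
    then obtain a v where "v \<in> F" "a v \<noteq> 0" "(\<Sum>x\<in>F. a x *\<^sub>R x) = 0"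
      using dependent_finite[OF F(1)] by auto
    then show False using zero T by metis
  qed
  show "span F \<inter> T = {0}"
  proof
    show "span F \<inter> T \<subseteq> {0}"
    proof
      fix s assume "s \<in> span F \<inter> T"
      then obtain a where a: "s = (\<Sum>x\<in>F. a x *\<^sub>R x)" "s \<in> T"
        unfolding span_finite[OF F(1)] by auto
      then show "s \<in> {0}" using zero[of a] by simp
    qed
    show "{0} \<subseteq> span F \<inter> T" using T(2) span_zero[of F] by simp
  qed
qed

lemma orthogonal_projection:
  fixes B :: "'a::real_vector \<Rightarrow> 'a \<Rightarrow> real"
  assumes B: "bilinear B" and F: "finite F" "pairwise (\<lambda>x y. B x y = 0) F" "\<And>x. x \<in> F \<Longrightarrow> B x x \<noteq> 0"
    and y: "y \<in> F"
  shows "B (x - (\<Sum>f\<in>F. (B x f / B f f) *\<^sub>R f)) y = 0"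
proof -
  have "(\<Sum>f\<in>F. B x f / B f f * B f y) = (\<Sum>f\<in>{y}. B x f / B f f * B f y)"
    using F y by (intro sum.mono_neutral_right) (auto simp: pairwise_def)
  then show ?thesis using F(3)[OF y]
    by (simp add: bilinear_lsub[OF B] bilinear_sum_scale_left[OF B])
qed

text \<open>The form is negative modulo \<open>T\<close> on the kernel of \<phi> and positive
  somewhere. A largest orthogonal family \<open>F\<close> of negative vectors in that kernel spans
  it modulo \<open>T\<close>, and the component of \<open>x0\<close> orthogonal to \<open>F\<close>
  supplies the positive direction.\<close>

lemma has_signature_mod_lorentzian:
  fixes B :: "'a::euclidean_space \<Rightarrow> 'a \<Rightarrow> real"
  assumes B: "bilinear B" and sym: "\<And>x y. B x y = B y x"
    and T: "subspace T" "\<And>t x. t \<in> T \<Longrightarrow> B t x = 0"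
    and \<phi>: "linear (\<phi> :: 'a \<Rightarrow> real)" "\<And>t. t \<in> T \<Longrightarrow> \<phi> t = 0"
    and neg: "\<And>x. \<phi> x = 0 \<Longrightarrow> x \<notin> T \<Longrightarrow> B x x < 0"
    and x0: "0 < B x0 x0"
  shows "has_signature_mod (\<lambda>x. B x x) T 1 (DIM('a) - dim T - 1)"
proof -
  have T0: "0 \<in> T" using T subspace_0 by blast
  define H where "H = {x. \<phi> x = 0}"
  have H: "subspace H" unfolding H_def using linear_subspace_kernel[OF \<phi>(1)] by simp
  have TH: "T \<subseteq> H" using \<phi>(2) by (auto simp: H_def)
  define good where "good = (\<lambda>F. finite F \<and> F \<subseteq> H \<and> pairwise (\<lambda>x y. B x y = 0) F \<and> (\<forall>x\<in>F. B x x < 0))"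
  have ind: "independent F" "span F \<inter> T = {0}" if "good F" for F
  proof -
    have "finite F" "pairwise (\<lambda>x y. B x y = 0) F" "\<And>x. x \<in> F \<Longrightarrow> B x x \<noteq> 0"
      using that by (auto simp: good_def)
    from anisotropic_orthogonal_independent[OF B this T(2) T0]
    show "independent F" "span F \<inter> T = {0}" by auto
  qed
  have "good {}" by (simp add: good_def)
  \<comment> \<open>Such families are independent, so their size is bounded by the dimension and a
    largest one exists.\<close>
  moreover have "\<forall>F. good F \<longrightarrow> card F < DIM('a) + 1"
    using ind independent_bound by (auto simp: less_Suc_eq_le)
  ultimately obtain F where F: "good F" and max: "\<And>F'. good F' \<Longrightarrow> card F' \<le> card F"
    using ex_has_greatest_nat[of good "{}" card "DIM('a) + 1"] by (auto simp: less_imp_le)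
  have F': "finite F" "F \<subseteq> H" "pairwise (\<lambda>x y. B x y = 0) F" "\<And>x. x \<in> F \<Longrightarrow> B x x < 0"
    using F by (auto simp: good_def)
  have Fne: "\<And>x. x \<in> F \<Longrightarrow> B x x \<noteq> 0" using F'(4) by force
  define pr where "pr = (\<lambda>x. x - (\<Sum>f\<in>F. (B x f / B f f) *\<^sub>R f))"
  have pr: "B (pr x) y = 0" if "y \<in> F" for x y
    unfolding pr_def by (rule orthogonal_projection[OF B F'(1,3) Fne that])
  have x_pr: "x - pr x \<in> span F" for x
    unfolding pr_def by (simp add: span_sum span_scale span_base)
  have spanH: "span (F \<union> T) = H"
  proof
    show "span (F \<union> T) \<subseteq> H" using F' TH H by (simp add: span_minimal)
    show "H \<subseteq> span (F \<union> T)"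
    proof (rule subsetI, rule ccontr)
      \<comment> \<open>The component of \<open>x\<close> orthogonal to \<open>F\<close> would be a
        further negative vector, against maximality.\<close>
      fix x assume x: "x \<in> H" "x \<notin> span (F \<union> T)"
      have 1: "x - pr x \<in> span (F \<union> T)" using x_pr span_mono[of F "F \<union> T"] by blast
      have "pr x \<notin> T"
      proof
        assume "pr x \<in> T"
        then have "(x - pr x) + pr x \<in> span (F \<union> T)" using 1 \<open>pr x \<in> T\<close> by (intro span_add[OF 1] span_base) simp
        then show False using x by simp
      qed
      moreover have "span F \<subseteq> H" using F' H by (simp add: span_minimal)
      then have "x - (x - pr x) \<in> H" using x_pr[of x] subspace_diff[OF H x(1)] by blast
      then have prH: "pr x \<in> H" by simp
      ultimately have n: "B (pr x) (pr x) < 0" using neg by (simp add: H_def)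
      then have nF: "pr x \<notin> F" using pr by force
      have "good (insert (pr x) F)"
        unfolding good_def using F' prH n pr sym by (auto simp: pairwise_insert)
      then show False using max[of "insert (pr x) F"] nF F' by simp
    qed
  qed
  define e where "e = pr x0"
  have e_F: "B e f = 0" if "f \<in> F" for f using pr that by (simp add: e_def)
  have e_span: "B e s = 0" if "s \<in> span F" for s
  proof -
    obtain a where a: "s = (\<Sum>x\<in>F. a x *\<^sub>R x)" using \<open>s \<in> span F\<close> unfolding span_finite[OF F'(1)] by auto
    have "B s e = (\<Sum>x\<in>F. a x * B x e)" unfolding a by (rule bilinear_sum_scale_left[OF B])
    also have "\<dots> = 0" using e_F by (intro sum.neutral) (auto simp: sym[of _ e])
    finally show ?thesis by (simp add: sym)
  qed
  \<comment> \<open>\<open>x0\<close> splits orthogonally into \<open>e\<close> and a vector of the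
    hyperplane, where the form is nonpositive.\<close>
  have e_pos: "0 < B e e"
  proof -
    let ?d = "x0 - e"
    have d: "?d \<in> span F" using x_pr by (simp add: e_def)
    then have "?d \<in> H" using F' H span_minimal by blast
    then have "B ?d ?d \<le> 0" using neg[of ?d] T(2)[of ?d ?d] by (cases "?d \<in> T") (auto simp: H_def)
    moreover have "B x0 x0 = B e e + B ?d ?d"
    proof -
      have "B e ?d = 0" "B ?d e = 0" using e_span[OF d] sym by auto
      then have "B (e + ?d) (e + ?d) = B e e + B ?d ?d"
        by (simp only: bilinear_ladd[OF B] bilinear_radd[OF B])
      then show ?thesis by simp
    qed
    ultimately show ?thesis using x0 by simp
  qed
  have eF: "e \<notin> F" using F'(4) e_pos by force
  have eH: "\<phi> e \<noteq> 0"
    using neg[of e] e_pos T(2)[of e e] by (cases "e \<in> T") auto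
  let ?G = "{e} \<union> F"
  have G: "finite ?G" "pairwise (\<lambda>x y. B x y = 0) ?G" "\<And>x. x \<in> ?G \<Longrightarrow> B x x \<noteq> 0"
    using F' e_F e_pos Fne sym by (auto simp: pairwise_insert)
  have Gi: "independent ?G" "span ?G \<inter> T = {0}"
    using anisotropic_orthogonal_independent[OF B G T(2) T0] by auto
  have Gs: "span (?G \<union> T) = UNIV"
  proof (rule UNIV_eq_I[symmetric])
    fix y
    let ?z = "y - (\<phi> y / \<phi> e) *\<^sub>R e"
    have "\<phi> ?z = 0" using eH by (simp add: linear_diff[OF \<phi>(1)] linear_cmul[OF \<phi>(1)])
    then have "?z \<in> span (F \<union> T)" using spanH by (simp add: H_def)
    then have "?z \<in> span (?G \<union> T)" using span_mono[of "F \<union> T" "?G \<union> T"] by blast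
    then have "?z + (\<phi> y / \<phi> e) *\<^sub>R e \<in> span (?G \<union> T)"
      by (intro span_add span_scale) (auto intro: span_base)
    then show "y \<in> span (?G \<union> T)" by simp
  qed
  have "dim {x + y |x y. x \<in> span ?G \<and> y \<in> T} + dim (span ?G \<inter> T) = dim (span ?G) + dim T"
    by (rule dim_sums_Int) (use T in auto)
  moreover have "{x + y |x y. x \<in> span ?G \<and> y \<in> T} = UNIV"
  proof -
    have "span T = T" using T(1) by simp
    then show ?thesis using Gs span_Un[of ?G T] by (simp only:)
  qed
  ultimately have "DIM('a) = card ?G + dim T" using Gi by (simp add: dim_eq_card_independent)
  then have cF: "card F = DIM('a) - dim T - 1" using eF F' by simp
  have "quadratic_form (\<lambda>x. B x x)" unfolding quadratic_form_def using B sym by blast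
  moreover have "B (x + t) (x + t) = B x x" if "t \<in> T" for x t
    using T(2)[OF that] sym[of x t] by (simp add: bilinear_ladd[OF B] bilinear_radd[OF B])
  moreover have "pairwise (\<lambda>x y. polar_form (\<lambda>x. B x x) x y = 0) ?G"
    using G(2) by (simp add: polar_form_bilinear[OF B sym])
  ultimately show ?thesis
    unfolding has_signature_mod_def
    using F' G Gi Gs cF eF e_pos by (intro conjI exI[of _ "{e}"] exI[of _ F]) auto
qed

section \<open>The area form\<close>

text \<open>\<open>Complex 1 t\<close> is never vertical, so it suffices that its slope
  \<open>t\<close> avoids the finitely many values \<open>Im a / Re a\<close>; a vertical
  \<open>a\<close> contributes the harmless value 0.\<close>

lemma ex_generic_direction:
  assumes "finite A" "0 \<notin> A"
  shows "\<exists>c. \<forall>a\<in>A. wedge c a \<noteq> 0"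
proof -
  have "finite ((\<lambda>a. Im a / Re a) ` A)" using assms by simp
  then obtain t where t: "t \<notin> (\<lambda>a. Im a / Re a) ` A"
    using ex_new_if_finite[OF infinite_UNIV_char_0] by blast
  have "wedge (Complex 1 t) a \<noteq> 0" if "a \<in> A" for a
  proof
    assume *: "wedge (Complex 1 t) a = 0"
    then have 1: "Im a = t * Re a" by (simp add: wedge_eq)
    have "a \<noteq> 0" using that assms by auto
    then have "Re a \<noteq> 0" using 1 by (auto simp: complex_eq_iff)
    then have "t = Im a / Re a" using 1 by simp
    then show False using t that by blast
  qed
  then show ?thesis by blast
qed

text \<open>Abel summation of the signed area of a chain of sides which starts and ends at height \<open>0\<close>.\<close>

lemma chain_area:
  fixes y z M :: "nat \<Rightarrow> real"
  assumes y: "y a = 0" "y b = 0" and ab: "a < b"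
    and z: "\<And>k. a \<le> k \<Longrightarrow> k < b \<Longrightarrow> z (Suc k) - z k = M k * (y (Suc k) - y k)"
    and M: "\<And>k. a \<le> k \<Longrightarrow> Suc k < b \<Longrightarrow> M (Suc k) < M k"
  shows "(\<Sum>k=a..<b. z k * y (Suc k) - y k * z (Suc k)) \<le> 0"
    and "(\<Sum>k=a..<b. z k * y (Suc k) - y k * z (Suc k)) = 0 \<Longrightarrow> k \<in> {a..b} \<Longrightarrow> y k = 0"
proof -
  let ?S = "\<Sum>k=a..<b. z k * y (Suc k) - y k * z (Suc k)"
  let ?R = "\<lambda>m. \<Sum>k=Suc a..<m. (M k - M (k - 1)) * (y k)\<^sup>2"
  \<comment> \<open>Think of \<open>y\<close> as height, \<open>z\<close> as horizontal coordinate
    and \<open>M\<close> as inverse slope. Each area term is a telescoping difference plus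
    \<open>M k\<close> times a difference of squares, and summation by parts moves the difference
    onto the decreasing \<open>M\<close>.\<close>
  have "z k * y (Suc k) - y k * z (Suc k) = (y (Suc k) * z (Suc k) - y k * z k) + M k * ((y k)\<^sup>2 - (y (Suc k))\<^sup>2)"
    if "k \<in> {a..<b}" for k
  proof -
    have zk: "z (Suc k) = z k + M k * (y (Suc k) - y k)" using z[of k] that by simp
    show ?thesis unfolding zk power2_eq_square by (simp add: algebra_simps)
  qed
  then have "?S = (\<Sum>k=a..<b. y (Suc k) * z (Suc k) - y k * z k) + (\<Sum>k=a..<b. M k * ((y k)\<^sup>2 - (y (Suc k))\<^sup>2))"
    by (simp add: sum.distrib)
  also have "(\<Sum>k=a..<b. y (Suc k) * z (Suc k) - y k * z k) = 0"
    using sum_Suc_diff'[of a b "\<lambda>k. y k * z k"] ab y by simp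
  also have "(\<Sum>k=a..<m. M k * ((y k)\<^sup>2 - (y (Suc k))\<^sup>2)) = ?R m - M (m - 1) * (y m)\<^sup>2" if "Suc a \<le> m" for m
    using that
  proof (induction m rule: nat_induct_at_least)
    case (Suc m)
    then show ?case by (simp add: algebra_simps)
  qed (use y in simp)
  from this[of b] have "(\<Sum>k=a..<b. M k * ((y k)\<^sup>2 - (y (Suc k))\<^sup>2)) = ?R b"
    using ab y by simp
  finally have S: "?S = ?R b" by simp
  have nonpos: "(M k - M (k - 1)) * (y k)\<^sup>2 \<le> 0" if "k \<in> {Suc a..<b}" for k
    using M[of "k - 1"] that by (intro mult_nonpos_nonneg) (auto simp: less_imp_le)
  show "?S \<le> 0" unfolding S by (rule sum_nonpos) (rule nonpos)
  assume "?S = 0" and k: "k \<in> {a..b}"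
  then have R0: "?R b = 0" using S by simp
  show "y k = 0"
  proof (cases "k = a \<or> k = b")
    case False
    then have k': "k \<in> {Suc a..<b}" using k by auto
    have "(\<Sum>k=Suc a..<b. - ((M k - M (k - 1)) * (y k)\<^sup>2)) = 0"
      using R0 by (simp add: sum_negf)
    then have "- ((M k - M (k - 1)) * (y k)\<^sup>2) = 0"
      using sum_nonneg_0[of "{Suc a..<b}" "\<lambda>k. - ((M k - M (k - 1)) * (y k)\<^sup>2)" k] nonpos k' by (simp only:) force
    moreover have "M k - M (k - 1) < 0" using M[of "k - 1"] k' by auto
    ultimately show ?thesis by simp
  qed (use y in auto)
qed

context ngon
begin

text \<open>Polarised shoelace formula: the denominator collects a half from the area and a half
  from symmetrising.\<close>

definition area_bil :: "real^'n \<Rightarrow> real^'n \<Rightarrow> real" where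
  "area_bil h h' = (\<Sum>i\<in>UNIV. wedge (vert h i) (vert h' (nxt i)) + wedge (vert h' i) (vert h (nxt i))) / 4"

lemma area_bil_commute: "area_bil h h' = area_bil h' h"
  by (simp add: area_bil_def add.commute)

lemma bilinear_area_bil: "bilinear area_bil"
proof -
  have "linear (area_bil h)" for h
    unfolding area_bil_def
    by (intro linearI)
      (simp_all add: linear_add[OF linear_vert] linear_cmul[OF linear_vert] wedge.add_left wedge.add_right
        wedge.scaleR_left wedge.scaleR_right sum.distrib sum_distrib_left add_divide_distrib algebra_simps)
  then show ?thesis
    unfolding bilinear_def using area_bil_commute by (simp add: area_bil_commute[of _ h' for h'])
qed

lemma area_bil_self: "area_bil h h = (\<Sum>i\<in>UNIV. wedge (vert h i) (vert h (nxt i))) / 2"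
  by (simp add: area_bil_def sum.distrib flip: sum_distrib_left)

lemma area_bil_translation:
  assumes "t \<in> translation_vectors nxt w"
  shows "area_bil t h = 0"
proof -
  obtain x where x: "\<And>i. vert t i = x" using vert_translate[OF assms] by blast
  have "(\<Sum>i\<in>UNIV. wedge x (vert h (nxt i))) = (\<Sum>i\<in>UNIV. wedge x (vert h i))"
    using sum.reindex_bij_betw[of nxt UNIV UNIV "\<lambda>i. wedge x (vert h i)"] bij_nxt by simp
  then show ?thesis by (simp add: area_bil_def x sum_subtractf wedge_commute[of _ x])
qed

lemma quadratic_form_area: "quadratic_form (\<lambda>h. area_bil h h)"
  unfolding quadratic_form_def using bilinear_area_bil area_bil_commute by blast

lemma area_bil_support_vector:
  assumes "w' \<in> parallel_ngons nxt w"
  shows "area_bil (support_vector nxt w w') (support_vector nxt w w') = measure lebesgue (region w')"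
proof -
  interpret parallel_pair nxt w i0 w' by unfold_locales (rule assms)
  show ?thesis unfolding area_bil_self w.measure_region by (simp add: vert_support_vector)
qed

lemma open_support_cone: "open (support_cone nxt w)"
proof -
  have "support_cone nxt w = (\<Inter>i. {h. 0 < slen h i})" by (auto simp: support_cone_eq)
  moreover have "open {h. 0 < slen h i}" for i
    by (intro open_Collect_less continuous_on_const linear_continuous_on linear_conv_bounded_linear[THEN iffD1] linear_slen)
  ultimately show ?thesis by (simp add: open_INT)
qed

text \<open>The description in \<open>area_P\<close> has only this solution, since quadratic forms
  that agree on the nonempty open support cone coincide.\<close>

lemma area_P_eq: "area_P nxt w = (\<lambda>h. area_bil h h)"
  unfolding area_P_def
proof (rule the_equality, intro conjI ballI)
  fix q assume q: "quadratic_form q \<and> (\<forall>w'\<in>parallel_ngons nxt w. q (support_vector nxt w w') = measure lebesgue (region w'))"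
  show "q = (\<lambda>h. area_bil h h)"
  proof (rule quadratic_form_eq_on_open)
    show "open (support_cone nxt w)" by (rule open_support_cone)
    show "support_vector nxt w w \<in> support_cone nxt w" by (simp add: support_cone_def self_parallel)
    show "q h = area_bil h h" if "h \<in> support_cone nxt w" for h
      using that q area_bil_support_vector by (auto simp: support_cone_def)
  qed (use q quadratic_form_area in auto)
qed (use quadratic_form_area area_bil_support_vector in auto)

text \<open>From a lowest vertex the sides first rise. After a fall no side rises again: the vertex
  in between would be a strict local minimum and hence, by \<open>local_min\<close>, strictly lower
  than \<open>i0\<close>.\<close>

lemma unimodal_from_min:
  assumes gen: "\<And>i. wedge c (D i) \<noteq> 0" and min: "\<And>j. 0 \<le> wedge c (w j - w i0)"
  obtains K where "0 < K" "K < CARD('n)" "\<And>k. k < K \<Longrightarrow> 0 < wedge c (D (lbl k))"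
    "\<And>k. K \<le> k \<Longrightarrow> k < CARD('n) \<Longrightarrow> wedge c (D (lbl k)) < 0"
proof -
  let ?n = "CARD('n)"
  let ?f = "\<lambda>k. wedge c (D (lbl k))"
  have up: "0 < ?f 0"
  proof -
    have "0 \<le> norm (w (nxt i0) - w i0) * wedge c (D i0)"
      using min[of "nxt i0"] side_vec[of i0] by (metis real_scaleR_def wedge.scaleR_right)
    then show ?thesis using gen[of i0] side_len_pos[of i0] by (simp add: zero_le_mult_iff less_le)
  qed
  have down: "?f (?n - 1) < 0"
  proof -
    let ?p = "lbl (?n - 1)"
    have *: "nxt ?p = i0" by (rule nxt_lbl_last)
    have "norm (w (nxt ?p) - w ?p) * wedge c (D ?p) = wedge c (w i0 - w ?p)"
      using side_vec[of ?p] * by (metis real_scaleR_def wedge.scaleR_right)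
    moreover have "wedge c (w i0 - w ?p) \<le> 0" using min[of ?p] by (simp add: wedge.diff_right)
    ultimately show ?thesis using gen[of ?p] side_len_pos[of ?p]
      by (metis linorder_neqE_linordered_idom mult_pos_pos not_less)
  qed
  define K where "K = (LEAST k. ?f k < 0)"
  have K: "?f K < 0" "K \<le> ?n - 1" unfolding K_def
    using down by (auto intro: LeastI Least_le)
  have before: "0 < ?f k" if "k < K" for k
    using not_less_Least[of k "\<lambda>k. ?f k < 0"] that gen[of "lbl k"] unfolding K_def by force
  have K0: "0 < K" using up K by (cases K) auto
  have step: "?f (Suc k) < 0" if "?f k < 0" "Suc k < ?n" for k
  proof (rule ccontr)
    assume "\<not> ?f (Suc k) < 0"
    then have *: "0 < ?f (Suc k)" using gen[of "lbl (Suc k)"] by linarith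
    have "lbl (Suc k) \<noteq> lbl 0" by (subst lbl_eq_iff; use that in simp)
    then have "0 < wedge c (w i0 - w (lbl (Suc k)))"
      using that * by (intro local_min(2)) (auto simp: lbl_Suc intro: less_imp_le)
    moreover have "0 \<le> wedge c (w (lbl (Suc k)) - w i0)" by (rule min)
    ultimately show False by (simp add: wedge.diff_right)
  qed
  have "?f k < 0" if "K \<le> k" "k < ?n" for k
    using that by (induction k rule: dec_induct) (use K step in auto)
  then show ?thesis using that[of K] K0 K before card_ge_3 by fastforce
qed

text \<open>The vertices \<open>0\<close> and \<open>K\<close> cut the boundary into a chain of
  rising and a chain of falling directions. Zero width puts both ends of each chain at height 0, so
  \<open>chain_area\<close> applies to either. \<open>h\<close> is an arbitrary vector; only the
  order of the directions enters.\<close>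

lemma area_neg_of_width_0:
  assumes gen: "\<And>i. wedge c (D i) \<noteq> 0"
    and K: "0 < K" "K < CARD('n)" "\<And>k. k < K \<Longrightarrow> 0 < wedge c (D (lbl k))"
    "\<And>k. K \<le> k \<Longrightarrow> k < CARD('n) \<Longrightarrow> wedge c (D (lbl k)) < 0"
    and width: "wedge c (vert h (lbl K) - vert h i0) = 0"
  shows "area_bil h h \<le> 0" "area_bil h h = 0 \<Longrightarrow> h \<in> translation_vectors nxt w"
proof -
  let ?n = "CARD('n)"
  define Y where "Y = (\<lambda>k. vert h (lbl k) - vert h i0)"
  define y z where "y = (\<lambda>k. wedge c (Y k))" "z = (\<lambda>k. c \<bullet> Y k)"
  \<comment> \<open>Inverse slope of side \<open>k\<close> relative to \<open>c\<close>; it depends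
    on the direction alone and not on \<open>h\<close>.\<close>
  define M where "M = (\<lambda>k. (c \<bullet> D (lbl k)) / wedge c (D (lbl k)))"
  have Ystep: "Y (Suc k) - Y k = slen h (lbl k) *\<^sub>R D (lbl k)" for k
    using vert_side[of h "lbl k"] by (simp add: Y_def lbl_Suc)
  have ystep: "y (Suc k) - y k = slen h (lbl k) * wedge c (D (lbl k))" for k
    using Ystep[of k] by (metis y_z_def(1) real_scaleR_def wedge.diff_right wedge.scaleR_right)
  have "z (Suc k) - z k = slen h (lbl k) * (c \<bullet> D (lbl k))" for k
    using Ystep[of k] by (metis y_z_def(2) inner_diff_right inner_scaleR_right)
  then have zstep: "z (Suc k) - z k = M k * (y (Suc k) - y k)" for k
    using gen[of "lbl k"] by (simp add: ystep M_def)
  have c0: "0 < (norm c)\<^sup>2" using gen[of i0] by auto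
  \<comment> \<open>Lagrange's identity: it rewrites areas in the two coordinates given by
    \<open>c\<close>.\<close>
  have lag: "(norm c)\<^sup>2 * wedge a b = (c \<bullet> a) * wedge c b - wedge c a * (c \<bullet> b)" for a b
    unfolding cmod_power2 by (simp add: wedge_eq inner_complex_def power2_eq_square algebra_simps)
  \<comment> \<open>As long as the slopes keep their sign, a left turn lowers the inverse
    slope.\<close>
  have Mstep: "M (Suc k) < M k" if "0 < wedge c (D (lbl k)) * wedge c (D (lbl (Suc k)))" for k
  proof -
    have "0 < (norm c)\<^sup>2 * wedge (D (lbl k)) (D (lbl (Suc k)))"
      using c0 wedge_consecutive by (simp add: lbl_Suc)
    then have "0 < ((c \<bullet> D (lbl k)) * wedge c (D (lbl (Suc k))) - wedge c (D (lbl k)) * (c \<bullet> D (lbl (Suc k)))) /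
        (wedge c (D (lbl k)) * wedge c (D (lbl (Suc k))))"
      using that lag by (simp add: divide_pos_pos)
    also have "\<dots> = M k - M (Suc k)"
      using gen by (simp add: M_def field_simps)
    finally show ?thesis by simp
  qed
  have y0: "y 0 = 0" "y K = 0" "y ?n = 0"
    using width by (simp_all add: y_z_def Y_def)
  let ?t = "\<lambda>k. z k * y (Suc k) - y k * z (Suc k)"
  have M1: "M (Suc k) < M k" if "0 \<le> k" "Suc k < K" for k
    using that K(3) by (intro Mstep mult_pos_pos) auto
  have M2: "M (Suc k) < M k" if "K \<le> k" "Suc k < ?n" for k
    using that K(4) by (intro Mstep mult_neg_neg) auto
  note c1 = chain_area[OF y0(1,2) K(1) zstep M1]
  note c2 = chain_area[OF y0(2,3) K(2) zstep M2]
  have "(\<Sum>i\<in>UNIV. wedge (vert h i) (vert h (nxt i))) = (\<Sum>k<?n. wedge (Y k) (Y (Suc k)))"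
    unfolding Y_def
    by (subst shoelace_translate[of "\<lambda>k. vert h (lbl k)"]) (simp_all add: sum_lbl nxt_lbl)
  then have "(norm c)\<^sup>2 * (2 * area_bil h h) = (\<Sum>k<?n. ?t k)"
    by (simp only: area_bil_self lag[symmetric] y_z_def) (simp flip: sum_distrib_left)
  also have "\<dots> = (\<Sum>k=0..<K. ?t k) + (\<Sum>k=K..<?n. ?t k)"
    using K by (simp add: sum.atLeastLessThan_concat lessThan_atLeast0)
  finally have A: "(norm c)\<^sup>2 * (2 * area_bil h h) = (\<Sum>k=0..<K. ?t k) + (\<Sum>k=K..<?n. ?t k)" .
  then have "(norm c)\<^sup>2 * (2 * area_bil h h) \<le> 0" using c1(1) c2(1) by linarith
  then show "area_bil h h \<le> 0" using c0 by (simp add: mult_le_0_iff)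
  assume "area_bil h h = 0"
  then have "(\<Sum>k=0..<K. ?t k) = 0" "(\<Sum>k=K..<?n. ?t k) = 0" using A c1(1) c2(1) by auto
  then have yz: "y k = 0" if "k \<le> ?n" for k
    using c1(2)[of k] c2(2)[of k] that K by (cases "k \<le> K") auto
  have "slen h i = 0" for i
  proof -
    obtain k where k: "k < ?n" "i = lbl k" by (rule lbl_exhaust)
    then have "slen h i * wedge c (D i) = 0" using ystep[of k] yz[of k] yz[of "Suc k"] by simp
    then show ?thesis using gen by simp
  qed
  then show "h \<in> translation_vectors nxt w" using slen_eq_0_iff by blast
qed

lemma dim_translation_vectors: "subspace (translation_vectors nxt w)" "dim (translation_vectors nxt w) = 2"
proof -
  let ?f = "\<lambda>x. (\<chi> i. x \<bullet> outer_normal nxt w i) :: real^'n"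
  have lin: "linear ?f" by (intro linearI) (simp_all add: vec_eq_iff inner_add_left)
  have "x = y" if "?f x = ?f y" for x y
  proof -
    have *: "wedge (D i) (x - y) = 0" for i
      using that by (auto simp: vec_eq_iff inner_outer_normal wedge.diff_right)
    have "x - y = (D (nxt i0) \<bullet> (x - y)) *\<^sub>R D (nxt i0)" by (rule unit_decomp) (use * in auto)
    then have "wedge (D i0) ((D (nxt i0) \<bullet> (x - y)) *\<^sub>R D (nxt i0)) = 0" using *[of i0] by simp
    then have "D (nxt i0) \<bullet> (x - y) = 0" using wedge_consecutive[of i0] by (simp add: wedge.scaleR_right)
    then show ?thesis using \<open>x - y = _\<close> by simp
  qed
  then have inj: "inj ?f" by (rule injI)
  show "subspace (translation_vectors nxt w)"
    unfolding translation_vectors_def by (rule linear_subspace_image[OF lin subspace_UNIV])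
  show "dim (translation_vectors nxt w) = 2"
    unfolding translation_vectors_def using dim_image_eq[OF lin, of UNIV] inj by simp
qed

lemma measure_region_pos: "0 < measure lebesgue (region w)"
proof -
  have "0 \<in> {..<CARD('n) - 1}" using card_ge_3 by simp
  then show ?thesis
    unfolding measure_region_fan using orient_mid_Suc
    by (intro divide_pos_pos sum_pos) (auto simp: less_diff_conv)
qed

lemma area_self_pos: "0 < area_bil (support_vector nxt w w) (support_vector nxt w w)"
proof -
  show ?thesis using measure_region_pos area_bil_support_vector[OF self_parallel] by simp
qed

lemma has_signature_area:
  "has_signature_mod (area_P nxt w) (translation_vectors nxt w) 1 (CARD('n) - 3)"
proof -
  have "0 \<notin> range D" by (metis D_neq_0 imageE)
  then obtain c where gen: "\<And>i. wedge c (D i) \<noteq> 0"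
    using ex_generic_direction[of "range D"] by auto
  obtain j0 where j0: "\<And>j. 0 \<le> wedge c (w j - w j0)"
    using ex_is_arg_min_if_finite[of "UNIV :: 'n set" "\<lambda>i. wedge c (w i)"]
    by (auto simp: is_arg_min_def not_less wedge.diff_right)
  \<comment> \<open>With the numbering started at a lowest vertex, \<open>K\<close> is a highest
    one, and the linear form \<phi> is the difference of their heights.\<close>
  interpret s: ngon nxt w j0 by unfold_locales (rule ngon)
  obtain K where K: "0 < K" "K < CARD('n)" "\<And>k. k < K \<Longrightarrow> 0 < wedge c (D (s.lbl k))"
    "\<And>k. K \<le> k \<Longrightarrow> k < CARD('n) \<Longrightarrow> wedge c (D (s.lbl k)) < 0"
    using s.unimodal_from_min[OF gen j0] by blast
  define \<phi> where "\<phi> = (\<lambda>h. wedge c (vert h (s.lbl K) - vert h j0))"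
  have "has_signature_mod (\<lambda>h. area_bil h h) (translation_vectors nxt w) 1
     (DIM(real^'n) - dim (translation_vectors nxt w) - 1)"
  proof (rule has_signature_mod_lorentzian[where B = area_bil])
    show "linear \<phi>" unfolding \<phi>_def
      by (intro linearI) (simp_all add: linear_add[OF linear_vert] linear_cmul[OF linear_vert]
         wedge.diff_right wedge.add_right wedge.scaleR_right algebra_simps)
    show "\<phi> t = 0" if "t \<in> translation_vectors nxt w" for t
      using vert_translate[OF that] by (auto simp: \<phi>_def)
    show "area_bil h h < 0" if "\<phi> h = 0" "h \<notin> translation_vectors nxt w" for h
      using s.area_neg_of_width_0[OF gen K, of h] that unfolding \<phi>_def by force
    show "0 < area_bil (support_vector nxt w w) (support_vector nxt w w)" by (rule area_self_pos)
  qed (use bilinear_area_bil area_bil_commute dim_translation_vectors area_bil_translation in auto)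
  then show ?thesis by (simp add: area_P_eq dim_translation_vectors)
qed

text \<open>Radial projection of the convex support cone onto the level set 1 is continuous, so its
  image is connected and lies in a single sheet.\<close>

lemma hyperbolic_polyhedron:
  "hyperbolic_polyhedron_mod (area_P nxt w) (translation_vectors nxt w) (CARD('n) - 3)
     {h \<in> support_cone nxt w. area_P nxt w h = 1}"
proof -
  let ?C = "support_cone nxt w" and ?q = "area_P nxt w"
  let ?X = "{h \<in> ?C. ?q h = 1}"
  have pos: "0 < ?q h" if h: "h \<in> ?C" for h
  proof -
    obtain w' where w': "w' \<in> parallel_ngons nxt w" "h = support_vector nxt w w'"
      using h by (auto simp: support_cone_def)
    interpret parallel_pair nxt w i0 w' by unfold_locales (rule w')
    show ?thesis using w.measure_region_pos area_bil_support_vector[OF w'(1)] w'(2) by (simp add: area_P_eq)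
  qed
  have scale: "?q (c *\<^sub>R h) = c\<^sup>2 * ?q h" for c h
    by (simp add: area_P_eq bilinear_lmul[OF bilinear_area_bil] bilinear_rmul[OF bilinear_area_bil] power2_eq_square)
  have cone: "c *\<^sub>R h \<in> ?C" if "h \<in> ?C" "c > 0" for c h
    using that by (simp add: support_cone_eq linear_cmul[OF linear_slen])
  have Xim: "?X = (\<lambda>h. (1 / sqrt (?q h)) *\<^sub>R h) ` ?C"
  proof
    show "?X \<subseteq> (\<lambda>h. (1 / sqrt (?q h)) *\<^sub>R h) ` ?C"
    proof
      fix h assume "h \<in> ?X"
      then show "h \<in> (\<lambda>h. (1 / sqrt (?q h)) *\<^sub>R h) ` ?C" by (intro image_eqI[of _ _ h]) auto
    qed
    show "(\<lambda>h. (1 / sqrt (?q h)) *\<^sub>R h) ` ?C \<subseteq> ?X"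
    proof clarify
      fix h assume h: "h \<in> ?C"
      then show "(1 / sqrt (?q h)) *\<^sub>R h \<in> ?C \<and> ?q ((1 / sqrt (?q h)) *\<^sub>R h) = 1"
        using pos[OF h] cone[OF h] by (simp add: scale power_divide)
    qed
  qed
  have "convex ?C"
  proof -
    have "?C = (\<Inter>i. {h. 0 < slen h i})" by (auto simp: support_cone_eq)
    moreover have "convex {h. 0 < slen h i}" for i
    proof -
      have "{h. 0 < slen h i} = (\<lambda>h. slen h i) -` {0<..}" by auto
      then show ?thesis using convex_linear_vimage[OF linear_slen convex_real_interval(3)] by simp
    qed
    ultimately show ?thesis by (simp add: convex_INT)
  qed
  then have "connected ?C" by (rule convex_connected)
  moreover have contq: "continuous_on ?C ?q"
  proof -
    have "bounded_bilinear area_bil" using bilinear_area_bil bilinear_conv_bounded_bilinear by blast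
    from bounded_bilinear.continuous_on[OF this continuous_on_id continuous_on_id]
    show ?thesis unfolding area_P_eq .
  qed
  then have "continuous_on ?C (\<lambda>h. (1 / sqrt (?q h)) *\<^sub>R h)"
  proof (intro continuous_intros ballI)
    show "sqrt (?q h) \<noteq> 0" if "h \<in> ?C" for h using pos[OF that] by simp
  qed
  ultimately have conn: "connected ?X" unfolding Xim by (rule connected_continuous_image[rotated])
  have "support_vector nxt w w \<in> ?C" by (simp add: support_cone_def self_parallel)
  then have "?X \<noteq> {}" unfolding Xim by blast
  then obtain S where S: "S \<in> components {h. ?q h = 1}" "?X \<subseteq> S"
    using exists_component_superset[of ?X "{h. ?q h = 1}"] conn by blast
  have "open_polyhedral_cone ?C"
    unfolding open_polyhedral_cone_def
  proof (intro exI conjI)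
    \<comment> \<open>Facet normals: the adjoint evaluated at 1 is the vector representing the
      linear form \<open>slen\<close>.\<close>
    let ?A = "range (\<lambda>i. adjoint (\<lambda>h. slen h i) 1)"
    show "finite ?A" by simp
    have "adjoint (\<lambda>h. slen h i) 1 \<bullet> h = slen h i" for i h
      using adjoint_works[OF linear_slen, of h i 1] by (simp add: inner_commute)
    then show "?C = {h. \<forall>a\<in>?A. 0 < a \<bullet> h}" by (simp add: support_cone_eq)
  qed
  moreover have "h + t \<in> ?C" if "h \<in> ?C" "t \<in> translation_vectors nxt w" for h t
    using that slen_eq_0_iff[of t] by (simp add: support_cone_eq linear_add[OF linear_slen])
  moreover have "?X = S \<inter> ?C" using S in_components_subset[OF S(1)] by auto
  ultimately show ?thesis
    unfolding hyperbolic_polyhedron_mod_def using has_signature_area S by blast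
qed

end

section \<open>The metric of the double\<close>

locale doubled =
  fixes Q :: "complex set" and \<phi> :: "bool \<Rightarrow> complex \<Rightarrow> point"
  assumes compact_Q: "compact Q" and convex_Q: "convex Q" and Q_ne: "Q \<noteq> {}"
    and homeo: "double_homeo Q \<phi>"
begin

abbreviation dd where "dd \<equiv> double_dist Q"

lemma frontier_subset: "frontier Q \<subseteq> Q"
  using compact_Q by (simp add: compact_imp_closed frontier_subset_closed)

lemma frontier_ne: "frontier Q \<noteq> {}"
  using compact_Q Q_ne by (metis compact_imp_bounded frontier_eq_empty not_bounded_UNIV)

lemma compact_frontier_Q: "compact (frontier Q)"
  using compact_Q by (simp add: compact_frontier)

lemma dd_le: "z \<in> frontier Q \<Longrightarrow> dd s x t y \<le> dist x z + dist z y"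
proof -
  assume z: "z \<in> frontier Q"
  have "(INF z\<in>frontier Q. dist x z + dist z y) \<le> dist x z + dist z y"
    by (rule cINF_lower[OF _ z]) (auto intro!: bdd_belowI2[where m = 0])
  moreover have "dist x y \<le> dist x z + dist z y" by (rule dist_triangle)
  ultimately show ?thesis by (simp add: double_dist_def)
qed

lemma dd_attained:
  assumes "s \<noteq> t"
  obtains z where "z \<in> frontier Q" "dd s x t y = dist x z + dist z y"
proof -
  have "continuous_on (frontier Q) (\<lambda>z. dist x z + dist z y)" by (intro continuous_intros)
  then obtain z where z: "z \<in> frontier Q" "\<And>z'. z' \<in> frontier Q \<Longrightarrow> dist x z + dist z y \<le> dist x z' + dist z' y"
    using continuous_attains_inf[OF compact_frontier_Q frontier_ne, of "\<lambda>z. dist x z + dist z y"]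
    by blast
  have "dist x z + dist z y \<le> (INF z\<in>frontier Q. dist x z + dist z y)"
    by (rule cINF_greatest[OF frontier_ne z(2)])
  then have "dd s x t y = dist x z + dist z y"
    using dd_le[OF z(1), of s x t y] assms by (simp add: double_dist_def)
  then show ?thesis using that z by blast
qed

lemma dd_same [simp]: "dd s x s y = dist x y"
  by (simp add: double_dist_def)

lemma dd_ge: "dist x y \<le> dd s x t y"
proof (cases "s = t")
  case False
  then show ?thesis by (metis dd_attained dist_triangle)
qed auto

lemma dd_frontier: "x \<in> frontier Q \<Longrightarrow> dd s x t y = dist x y" "y \<in> frontier Q \<Longrightarrow> dd s x t y = dist x y"
  using dd_le[of x s x t y] dd_le[of y s x t y] dd_ge[of x y s t] by auto

lemma dd_commute: "dd s x t y = dd t y s x"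
  by (simp add: double_dist_def dist_commute add.commute)

text \<open>If two consecutive points share a sheet, the best crossing point of one path serves for
  the other. Otherwise \<open>s = u\<close>, as there are only two sheets, and the claim is the
  planar inequality with \<open>dd_ge\<close>.\<close>

lemma dd_triangle: "dd s x u z \<le> dd s x t y + dd t y u z"
proof -
  have *: "dd s x u z \<le> dd s x t y + dd t y u z" if "s = t \<or> t = u" for s x t y u z
  proof (cases "s = u")
    case True
    then show ?thesis using dist_triangle[of x z y] dd_ge[of x y s t] dd_ge[of y z t u] by auto
  next
    case False
    show ?thesis
    proof (cases "s = t")
      case True
      with False obtain z' where "z' \<in> frontier Q" "dd t y u z = dist y z' + dist z' z"
        using dd_attained[of t u] by metis
      then show ?thesis using True dd_le[of z' s x u z] dist_triangle[of x z' y] by auto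
    next
      case False
      then have "t = u" "s \<noteq> t" using that by auto
      then obtain z' where "z' \<in> frontier Q" "dd s x t y = dist x z' + dist z' y"
        using dd_attained[of s t] by metis
      then show ?thesis using \<open>t = u\<close> dd_le[of z' s x u z] dist_triangle[of z' z y] by auto
    qed
  qed
  show ?thesis
  proof (cases "s = t \<or> t = u")
    case False
    then have "s = u" by auto
    then show ?thesis using dist_triangle[of x z y] dd_ge[of x y s t] dd_ge[of y z t u] by auto
  qed (rule *)
qed

lemma dd_nonneg: "0 \<le> dd s x t y"
  using dd_ge[of x y s t] zero_le_dist[of x y] by linarith

lemma inj_\<phi>: "x \<in> Q \<Longrightarrow> y \<in> Q \<Longrightarrow> \<phi> s x = \<phi> s y \<longleftrightarrow> x = y"
  using homeo by (auto simp: double_homeo_def inj_on_def)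

lemma \<phi>_eq_iff: "s \<noteq> t \<Longrightarrow> x \<in> Q \<Longrightarrow> y \<in> Q \<Longrightarrow> \<phi> s x = \<phi> t y \<longleftrightarrow> x = y \<and> x \<in> frontier Q"
  using homeo unfolding double_homeo_def by (cases s; cases t) (metis (full_types))+

lemma dd_eq_0_iff:
  assumes "x \<in> Q" "y \<in> Q"
  shows "dd s x t y = 0 \<longleftrightarrow> \<phi> s x = \<phi> t y"
proof (cases "s = t")
  case False
  show ?thesis
  proof
    assume *: "dd s x t y = 0"
    obtain z where z: "z \<in> frontier Q" "dd s x t y = dist x z + dist z y" using dd_attained[OF False] .
    then have "dist x z + dist z y = 0" using * by simp
    then have "x = z \<and> y = z" by (metis add_nonneg_eq_0_iff dist_eq_0_iff zero_le_dist)
    then show "\<phi> s x = \<phi> t y" using \<phi>_eq_iff[OF False] assms z by auto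
  next
    assume "\<phi> s x = \<phi> t y"
    then show "dd s x t y = 0" using \<phi>_eq_iff[OF False] assms dd_frontier by auto
  qed
qed (use assms inj_\<phi> in auto)

text \<open>Glued points are at distance 0, so by the triangle inequality \<open>dd\<close> does not
  distinguish them and descends to the sphere.\<close>

lemma dd_cong:
  assumes "x \<in> Q" "x' \<in> Q" "\<phi> s x = \<phi> s' x'"
  shows "dd s x t y = dd s' x' t y"
proof -
  have "dd s x s' x' = 0" "dd s' x' s x = 0" using dd_eq_0_iff assms by metis+
  then show ?thesis using dd_triangle[of s x t y s' x'] dd_triangle[of s' x' t y s x] by auto
qed

lemma S2_cases:
  assumes "a \<in> S2" obtains s x where "x \<in> Q" "a = \<phi> s x"
  using homeo assms unfolding double_homeo_def by blast

lemma \<phi>_in_S2: "x \<in> Q \<Longrightarrow> \<phi> s x \<in> S2"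
  using homeo unfolding double_homeo_def by blast

text \<open>\<open>Metric_space\<close> asks for nonnegativity and symmetry on the whole type, so
  \<open>d\<close> is built from preimages chosen for every point; on the sphere
  \<open>dd_cong\<close> makes the choice irrelevant.\<close>

lemma ex_metric:
  "\<exists>d. (\<forall>a b. 0 \<le> d a b) \<and> (\<forall>a b. d a b = d b a) \<and>
     (\<forall>s t. \<forall>x\<in>Q. \<forall>y\<in>Q. d (\<phi> s x) (\<phi> t y) = dd s x t y)"
proof -
  define pt where "pt = (\<lambda>a. SOME u. snd u \<in> Q \<and> \<phi> (fst u) (snd u) = a)"
  have pt: "snd (pt (\<phi> s x)) \<in> Q \<and> \<phi> (fst (pt (\<phi> s x))) (snd (pt (\<phi> s x))) = \<phi> s x" if "x \<in> Q" for s x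
    unfolding pt_def by (rule someI[of _ "(s, x)"]) (use that in auto)
  define d where "d = (\<lambda>a b. dd (fst (pt a)) (snd (pt a)) (fst (pt b)) (snd (pt b)))"
  have "d (\<phi> s x) (\<phi> t y) = dd s x t y" if "x \<in> Q" "y \<in> Q" for s t x y
    unfolding d_def using pt[OF that(1), of s] pt[OF that(2), of t] dd_cong dd_commute that
    by (metis (no_types, lifting))
  then show ?thesis by (intro exI[of _ d]) (auto simp: d_def dd_nonneg intro: dd_commute)
qed

end

locale double_metric = doubled +
  fixes d :: "point \<Rightarrow> point \<Rightarrow> real"
  assumes d_nonneg: "\<And>a b. 0 \<le> d a b" and d_commute: "\<And>a b. d a b = d b a"
    and d_eq: "\<And>s t x y. x \<in> Q \<Longrightarrow> y \<in> Q \<Longrightarrow> d (\<phi> s x) (\<phi> t y) = dd s x t y"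
begin

sublocale Metric_space S2 d
proof
  show "0 \<le> d x y" "d x y = d y x" for x y by (rule d_nonneg, rule d_commute)
  show "d x y = 0 \<longleftrightarrow> x = y" if xy: "x \<in> S2" "y \<in> S2" for x y
  proof -
    obtain s a where 1: "a \<in> Q" "x = \<phi> s a" using S2_cases[OF xy(1)] .
    obtain t b where 2: "b \<in> Q" "y = \<phi> t b" using S2_cases[OF xy(2)] .
    then show ?thesis using 1 by (simp add: d_eq dd_eq_0_iff)
  qed
  show "d x z \<le> d x y + d y z" if xy: "x \<in> S2" "y \<in> S2" "z \<in> S2" for x y z
  proof -
    obtain s a where 1: "a \<in> Q" "x = \<phi> s a" using S2_cases[OF xy(1)] .
    obtain t b where 2: "b \<in> Q" "y = \<phi> t b" using S2_cases[OF xy(2)] .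
    obtain u c where 3: "c \<in> Q" "z = \<phi> u c" using S2_cases[OF xy(3)] .
    show ?thesis using 1 2 3 dd_triangle by (simp add: d_eq)
  qed
qed

text \<open>The complement of the ball is the union of the images of two compact sets, one for each
  sheet, because the distance to a fixed point is 1-Lipschitz on a sheet.\<close>

lemma openin_mball_S2: "openin (top_of_set S2) (mball a r)"
proof (cases "a \<in> S2")
  case True
  obtain t b where b: "b \<in> Q" "a = \<phi> t b" using S2_cases[OF True] .
  have closed: "closed (\<phi> s ` {y \<in> Q. r \<le> d a (\<phi> s y)})" for s
  proof (rule compact_imp_closed, rule compact_continuous_image)
    have "\<bar>d a (\<phi> s y) - d a (\<phi> s y')\<bar> \<le> dist y y'" if "y \<in> Q" "y' \<in> Q" for y y'
      using dd_triangle[of t b s y s y'] dd_triangle[of t b s y' s y] that b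
      by (simp add: d_eq dist_commute abs_le_iff)
    then have "continuous_on Q (\<lambda>y. d a (\<phi> s y))"
      unfolding continuous_on_iff dist_real_def by (meson abs_minus_commute le_less_trans)
    then have "closed {y \<in> Q. r \<le> d a (\<phi> s y)}"
      using compact_imp_closed[OF compact_Q] by (intro continuous_on_closed_Collect_le continuous_on_const)
    then have "compact (Q \<inter> {y \<in> Q. r \<le> d a (\<phi> s y)})" by (intro compact_Int_closed compact_Q)
    moreover have "Q \<inter> {y \<in> Q. r \<le> d a (\<phi> s y)} = {y \<in> Q. r \<le> d a (\<phi> s y)}" by blast
    ultimately show "compact {y \<in> Q. r \<le> d a (\<phi> s y)}" by simp
    show "continuous_on {y \<in> Q. r \<le> d a (\<phi> s y)} (\<phi> s)"
      using homeo unfolding double_homeo_def by (metis (no_types, lifting) continuous_on_subset mem_Collect_eq subsetI)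
  qed
  have "mball a r = S2 \<inter> - (\<Union>s. \<phi> s ` {y \<in> Q. r \<le> d a (\<phi> s y)})"
  proof (intro equalityI subsetI)
    fix y assume y: "y \<in> S2 \<inter> - (\<Union>s. \<phi> s ` {y \<in> Q. r \<le> d a (\<phi> s y)})"
    then have yS: "y \<in> S2" by (rule IntD1)
    obtain s x where x: "x \<in> Q" "y = \<phi> s x" using S2_cases[OF yS] .
    have "\<phi> s x \<notin> \<phi> s ` {y \<in> Q. r \<le> d a (\<phi> s y)}" using y x by blast
    then have "\<not> r \<le> d a (\<phi> s x)" using x(1) by blast
    then show "y \<in> mball a r" unfolding in_mball using True yS x by (metis not_le)
  next
    fix y assume "y \<in> mball a r"
    then have yS: "y \<in> S2" and lt: "d a y < r" by (metis in_mball)+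
    have "y \<notin> (\<Union>s. \<phi> s ` {y \<in> Q. r \<le> d a (\<phi> s y)})"
    proof
      assume "y \<in> (\<Union>s. \<phi> s ` {y \<in> Q. r \<le> d a (\<phi> s y)})"
      then obtain s x where "y = \<phi> s x" "r \<le> d a (\<phi> s x)" by blast
      then show False using lt by (metis not_le)
    qed
    with yS show "y \<in> S2 \<inter> - (\<Union>s. \<phi> s ` {y \<in> Q. r \<le> d a (\<phi> s y)})"
      unfolding Int_iff Compl_iff by (rule conjI)
  qed
  moreover have "open (- (\<Union>s. \<phi> s ` {y \<in> Q. r \<le> d a (\<phi> s y)}))"
    using closed by (intro open_Compl closed_UN) auto
  ultimately show ?thesis by (simp only: openin_open_Int)
next
  case False
  then have "mball a r = {}" by (auto simp: in_mball)
  then show ?thesis by simp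
qed

text \<open>The identity is continuous from the compact sphere to a Hausdorff topology, hence a
  homeomorphism.\<close>

lemma mtopology_eq: "mtopology = top_of_set S2"
proof -
  have "continuous_map (top_of_set S2) mtopology id"
    unfolding continuous_map_def
  proof (intro conjI allI impI)
    fix U assume U: "openin mtopology U"
    then have "U = \<Union>{mball a r | a r. mball a r \<subseteq> U}"
    proof -
      have "x \<in> \<Union>{mball a r | a r. mball a r \<subseteq> U}" if xU: "x \<in> U" for x
      proof -
        obtain r where "r > 0" "mball x r \<subseteq> U" "x \<in> S2" using U xU unfolding openin_mtopology by blast
        then show ?thesis using centre_in_mball_iff by blast
      qed
      then show ?thesis by blast
    qed
    moreover have "openin (top_of_set S2) (\<Union>{mball a r | a r. mball a r \<subseteq> U})"
      by (intro openin_Union) (auto simp: openin_mball_S2)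
    moreover have "{x \<in> topspace (top_of_set S2). id x \<in> U} = U"
      using U by (auto simp: openin_mtopology)
    ultimately show "openin (top_of_set S2) {x \<in> topspace (top_of_set S2). id x \<in> U}" by simp
  qed simp
  moreover have "compact_space (top_of_set S2)"
    by (simp add: compact_space_subtopology compact_sphere)
  ultimately have "homeomorphic_map (top_of_set S2) mtopology id"
    by (rule continuous_imp_homeomorphic_map) (auto simp: Hausdorff_space_mtopology)
  then show ?thesis by simp
qed

text \<open>Between different sheets two segments are joined at a frontier point that attains the
  infimum in \<open>double_dist\<close>.\<close>

lemma geodesic: "geodesic_metric d"
  unfolding geodesic_metric_def
proof (intro ballI)
  fix a b assume a: "a \<in> S2" and b: "b \<in> S2"
  obtain s x where x: "x \<in> Q" "a = \<phi> s x" using S2_cases[OF a] .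
  obtain t y where y: "y \<in> Q" "b = \<phi> t y" using S2_cases[OF b] .
  have seg: "\<exists>\<gamma>. \<gamma> ` {0..dist x z} \<subseteq> Q \<and> \<gamma> 0 = x \<and> \<gamma> (dist x z) = z \<and>
      (\<forall>u\<in>{0..dist x z}. \<forall>v\<in>{0..dist x z}. dist (\<gamma> u) (\<gamma> v) = \<bar>u - v\<bar>)" if "x \<in> Q" "z \<in> Q" for x z
  proof (intro exI[of _ "\<lambda>u. x + u *\<^sub>R sgn (z - x)"] conjI ballI)
    show "x + dist x z *\<^sub>R sgn (z - x) = z"
      by (cases "x = z") (auto simp: sgn_div_norm dist_norm norm_minus_commute)
    show "dist (x + u *\<^sub>R sgn (z - x)) (x + v *\<^sub>R sgn (z - x)) = \<bar>u - v\<bar>"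
      if "u \<in> {0..dist x z}" "v \<in> {0..dist x z}" for u v
    proof (cases "x = z")
      case False
      then have "norm (sgn (z - x)) = 1" by (simp add: norm_sgn)
      then have "norm (u *\<^sub>R sgn (z - x) - v *\<^sub>R sgn (z - x)) = \<bar>u - v\<bar>"
        by (metis mult.right_neutral norm_scaleR scaleR_left_diff_distrib)
      then show ?thesis by (simp add: dist_norm)
    qed (use that in auto)
    show "(\<lambda>u. x + u *\<^sub>R sgn (z - x)) ` {0..dist x z} \<subseteq> Q"
    proof clarify
      fix u assume u: "u \<in> {0..dist x z}"
      show "x + u *\<^sub>R sgn (z - x) \<in> Q"
      proof (cases "x = z")
        case False
        then have n: "dist x z > 0" by simp
        have "x + u *\<^sub>R sgn (z - x) = (1 - u / dist x z) *\<^sub>R x + (u / dist x z) *\<^sub>R z"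
          by (simp add: sgn_div_norm dist_norm norm_minus_commute algebra_simps divide_inverse)
        moreover have "\<dots> \<in> Q" using u n by (intro convexD_alt[OF convex_Q that]) (auto simp: field_simps)
        ultimately show ?thesis by simp
      qed (use u that in auto)
    qed
  qed simp
  show "\<exists>\<gamma>. \<gamma> ` {0..d a b} \<subseteq> S2 \<and> \<gamma> 0 = a \<and> \<gamma> (d a b) = b \<and>
        (\<forall>s\<in>{0..d a b}. \<forall>t\<in>{0..d a b}. d (\<gamma> s) (\<gamma> t) = \<bar>s - t\<bar>)"
  proof (cases "s = t")
    case True
    obtain \<gamma> where \<gamma>: "\<gamma> ` {0..dist x y} \<subseteq> Q" "\<gamma> 0 = x" "\<gamma> (dist x y) = y"
      "\<And>u v. u \<in> {0..dist x y} \<Longrightarrow> v \<in> {0..dist x y} \<Longrightarrow> dist (\<gamma> u) (\<gamma> v) = \<bar>u - v\<bar>"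
      using seg[OF x(1) y(1)] by metis
    have dab: "d a b = dist x y" using x y True by (simp add: d_eq)
    show ?thesis unfolding dab
    proof (intro exI[of _ "\<phi> s \<circ> \<gamma>"] conjI ballI)
      show "(\<phi> s \<circ> \<gamma>) ` {0..dist x y} \<subseteq> S2" using \<gamma>(1) \<phi>_in_S2 by fastforce
      show "d ((\<phi> s \<circ> \<gamma>) u) ((\<phi> s \<circ> \<gamma>) v) = \<bar>u - v\<bar>" if "u \<in> {0..dist x y}" "v \<in> {0..dist x y}" for u v
        using \<gamma>(1) \<gamma>(4)[OF that] that by (simp add: d_eq image_subset_iff)
    qed (use \<gamma> x y True in auto)
  next
    case False
    obtain z where z: "z \<in> frontier Q" "dd s x t y = dist x z + dist z y" using dd_attained[OF False] .
    then have zQ: "z \<in> Q" using frontier_subset by blast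
    define l where "l = dist x z"
    define l' where "l' = dist z y"
    have dab: "d a b = l + l'" using x y z by (simp add: d_eq l_def l'_def)
    have l: "0 \<le> l" "0 \<le> l'" by (simp_all add: l_def l'_def)
    obtain \<gamma> where \<gamma>: "\<gamma> ` {0..l} \<subseteq> Q" "\<gamma> 0 = x" "\<gamma> l = z"
      "\<And>u v. u \<in> {0..l} \<Longrightarrow> v \<in> {0..l} \<Longrightarrow> dist (\<gamma> u) (\<gamma> v) = \<bar>u - v\<bar>"
      using seg[OF x(1) zQ] unfolding l_def by metis
    obtain \<gamma>' where \<gamma>': "\<gamma>' ` {0..l'} \<subseteq> Q" "\<gamma>' 0 = z" "\<gamma>' l' = y"
      "\<And>u v. u \<in> {0..l'} \<Longrightarrow> v \<in> {0..l'} \<Longrightarrow> dist (\<gamma>' u) (\<gamma>' v) = \<bar>u - v\<bar>"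
      using seg[OF zQ y(1)] unfolding l'_def by metis
    have zst: "\<phi> s z = \<phi> t z" using \<phi>_eq_iff[OF False zQ zQ] z by simp
    define g where "g = (\<lambda>u. if u \<le> l then \<phi> s (\<gamma> u) else \<phi> t (\<gamma>' (u - l)))"
    have gS: "g u \<in> S2" if "u \<in> {0..l + l'}" for u
      using that \<gamma>(1) \<gamma>'(1) \<phi>_in_S2 by (auto simp: g_def image_subset_iff)
    \<comment> \<open>The upper bound goes through the joint \<open>\<phi> s z\<close>. For the
      lower bound, a shortcut between \<open>g u\<close> and \<open>g v\<close> would make the whole
      path shorter than \<open>d a b\<close>.\<close>
    have cross: "d (g u) (g v) = v - u" if "0 \<le> u" "u \<le> l" "l < v" "v \<le> l + l'" for u v
    proof -
      have in_Q: "\<gamma> u \<in> Q" "\<gamma>' (v - l) \<in> Q" using that \<gamma>(1) \<gamma>'(1) by auto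
      have gu: "d a (g u) = u" "d (g u) (\<phi> s z) = l - u"
        using in_Q x that l \<gamma>(2,3) \<gamma>(4)[of 0 u] \<gamma>(4)[of u l] zQ by (simp_all add: g_def d_eq)
      have gv: "d (g v) b = l + l' - v" "d (\<phi> s z) (g v) = v - l"
        using in_Q y that l \<gamma>'(2,3) \<gamma>'(4)[of "v - l" l'] \<gamma>'(4)[of 0 "v - l"] zQ by (simp_all add: g_def d_eq zst)
      have S: "g u \<in> S2" "g v \<in> S2" using gS that l by auto
      have "d (g u) (g v) \<le> v - u"
        using triangle[OF S(1) \<phi>_in_S2[OF zQ, of s] S(2)] gu gv by simp
      moreover have "l + l' \<le> u + d (g u) (g v) + (l + l' - v)"
        using triangle[OF a S(1) b] triangle[OF S b] gu gv dab by simp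
      ultimately show ?thesis by simp
    qed
    show ?thesis unfolding dab
    proof (intro exI[of _ g] conjI ballI)
      show "g ` {0..l + l'} \<subseteq> S2" using gS by blast
      show "g 0 = a" using l \<gamma> x by (simp add: g_def)
      show "g (l + l') = b" using l \<gamma>(3) \<gamma>'(2,3) y zst by (cases "l' = 0") (auto simp: g_def)
      fix u v assume uv: "u \<in> {0..l + l'}" "v \<in> {0..l + l'}"
      show "d (g u) (g v) = \<bar>u - v\<bar>"
      proof (cases "u \<le> l"; cases "v \<le> l")
        assume "u \<le> l" "v \<le> l"
        then show ?thesis using uv \<gamma>(1) \<gamma>(4)[of u v] by (simp add: g_def d_eq image_subset_iff)
      next
        assume "\<not> u \<le> l" "\<not> v \<le> l"
        then show ?thesis using uv \<gamma>'(1) \<gamma>'(4)[of "u - l" "v - l"] by (simp add: g_def d_eq image_subset_iff)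
      next
        assume "u \<le> l" "\<not> v \<le> l"
        then show ?thesis using cross[of u v] uv by auto
      next
        assume "\<not> u \<le> l" "v \<le> l"
        then show ?thesis using cross[of v u] uv d_commute[of "g u"] by auto
      qed
    qed
  qed
qed

end

section \<open>Cone angles of the double\<close>

lemma INF_dist_mod:
  fixes \<theta> \<phi> \<psi> :: real and a b :: int
  assumes \<theta>: "0 < \<theta>" and le: "\<bar>\<phi> - \<psi>\<bar> \<le> \<theta>"
  shows "(INF k::int. \<bar>(\<phi> + a * \<theta>) - (\<psi> + b * \<theta>) - of_int k * \<theta>\<bar>) = min \<bar>\<phi> - \<psi>\<bar> (\<theta> - \<bar>\<phi> - \<psi>\<bar>)"
proof (rule cInf_eq_minimum)
  let ?m = "min \<bar>\<phi> - \<psi>\<bar> (\<theta> - \<bar>\<phi> - \<psi>\<bar>)" and ?f = "\<lambda>k::int. \<bar>(\<phi> + a * \<theta>) - (\<psi> + b * \<theta>) - of_int k * \<theta>\<bar>"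
  have f: "?f k = \<bar>(\<phi> - \<psi>) + of_int (a - b - k) * \<theta>\<bar>" for k by (simp add: algebra_simps)
  show "?m \<in> range ?f"
  \<comment> \<open>Taking \<open>k = a - b\<close> undoes the shifts; one turn more or less gives
    the way round the other side.\<close>
  proof (cases "\<bar>\<phi> - \<psi>\<bar> \<le> \<theta> - \<bar>\<phi> - \<psi>\<bar>")
    case True
    then show ?thesis by (intro range_eqI[of _ _ "a - b"]) (subst f, simp)
  next
    case False
    show ?thesis
    proof (cases "\<phi> - \<psi> \<ge> 0")
      case True
      then show ?thesis using False le by (intro range_eqI[of _ _ "a - b + 1"]) (subst f, simp)
    next
      case F: False
      then show ?thesis using False le by (intro range_eqI[of _ _ "a - b - 1"]) (subst f, simp)
    qed
  qed
  fix u assume "u \<in> range ?f"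
  then obtain k where u: "u = ?f k" by blast
  show "?m \<le> u"
  proof (cases "a - b - k = 0")
    case True
    then show ?thesis unfolding u f by simp
  next
    case False
    then have "1 \<le> \<bar>real_of_int (a - b - k)\<bar>" by linarith
    then have "\<theta> \<le> \<bar>real_of_int (a - b - k) * \<theta>\<bar>" using \<theta> by (simp add: abs_mult)
    then show ?thesis unfolding u f by linarith
  qed
qed

text \<open>Polar angles on a cone of angle \<open>2 * \<beta>\<close> made of two sectors: sheet
  \<open>True\<close> carries the angles \<gamma> and sheet \<open>False\<close> the angles
  \<open>- \<gamma>\<close>, with \<gamma> measured inside the sector.\<close>

lemma mod_representative:
  fixes \<phi> \<beta> :: real
  assumes "0 < \<beta>"
  obtains t :: bool and \<gamma> :: real and a :: int
  where "0 \<le> \<gamma>" "\<gamma> \<le> \<beta>" "\<phi> = (if t then \<gamma> else - \<gamma>) + a * (2 * \<beta>)"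
proof -
  define a where "a = \<lfloor>(\<phi> + \<beta>) / (2 * \<beta>)\<rfloor>"
  define \<phi>' where "\<phi>' = \<phi> - a * (2 * \<beta>)"
  have 1: "of_int a \<le> (\<phi> + \<beta>) / (2 * \<beta>)" "(\<phi> + \<beta>) / (2 * \<beta>) < of_int a + 1"
    unfolding a_def by linarith+
  have "of_int a * (2 * \<beta>) \<le> \<phi> + \<beta>" using 1(1) assms by (simp add: pos_le_divide_eq)
  moreover have "\<phi> + \<beta> < (of_int a + 1) * (2 * \<beta>)" using 1(2) assms by (simp add: pos_divide_less_eq)
  ultimately have "- \<beta> \<le> \<phi>'" "\<phi>' \<le> \<beta>" unfolding \<phi>'_def by (simp_all add: algebra_simps)
  then have "\<bar>\<phi>'\<bar> \<le> \<beta>" by linarith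
  moreover have "(if 0 \<le> \<phi>' then \<bar>\<phi>'\<bar> else - \<bar>\<phi>'\<bar>) = \<phi>'" by simp
  then have "\<phi> = (if 0 \<le> \<phi>' then \<bar>\<phi>'\<bar> else - \<bar>\<phi>'\<bar>) + a * (2 * \<beta>)"
    unfolding \<phi>'_def by linarith
  ultimately show ?thesis by (rule that[OF abs_ge_zero])
qed

lemma dist_polar:
  assumes "norm e = 1"
  shows "dist (x + of_real r * (e * cis a)) (x + of_real s * (e * cis b)) = sqrt (r\<^sup>2 + s\<^sup>2 - 2 * r * s * cos (a - b))"
proof -
  have "dist (x + of_real r * (e * cis a)) (x + of_real s * (e * cis b)) = norm (e * (of_real r * cis a - of_real s * cis b))"
    by (simp add: dist_norm algebra_simps)
  also have "\<dots> = norm (of_real r * cis a - of_real s * cis b)" using assms by (simp add: norm_mult)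
  also have "\<dots> = sqrt ((r * cos a - s * cos b)\<^sup>2 + (r * sin a - s * sin b)\<^sup>2)"
    by (simp add: cmod_def)
  also have "(r * cos a - s * cos b)\<^sup>2 + (r * sin a - s * sin b)\<^sup>2 =
      r\<^sup>2 * ((cos a)\<^sup>2 + (sin a)\<^sup>2) + s\<^sup>2 * ((cos b)\<^sup>2 + (sin b)\<^sup>2) - 2 * r * s * (cos a * cos b + sin a * sin b)"
    by algebra
  finally show ?thesis by (simp add: cos_diff)
qed

lemma cos_le_cos_symmetric:
  assumes "0 \<le> \<mu>" "\<mu> \<le> pi" "\<mu> \<le> t" "t \<le> 2 * pi - \<mu>"
  shows "cos t \<le> cos \<mu>"
proof (cases "t \<le> pi")
  case True
  then show ?thesis using assms by (intro cos_monotone_0_pi_le) auto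
next
  case False
  have "cos (2 * pi - t) \<le> cos \<mu>" using False assms by (intro cos_monotone_0_pi_le) auto
  then show ?thesis by (simp add: cos_diff)
qed

text \<open>Reflection in a ray with direction \<open>e\<close>; \<open>\<kappa>\<close> is the side on which the points lie.\<close>

lemma reflected_path_ge:
  assumes e: "norm e = 1" and \<kappa>: "\<kappa> = 1 \<or> \<kappa> = -1"
    and X: "X = x + of_real r * (e * cis (\<kappa> * \<gamma>))" and Y: "Y = x + of_real s * (e * cis (\<kappa> * \<eta>))"
    and z: "z = x + of_real \<rho> * e"
  shows "sqrt (r\<^sup>2 + s\<^sup>2 - 2 * r * s * cos (\<gamma> + \<eta>)) \<le> dist X z + dist z Y"
proof -
  define Y' where "Y' = x + of_real s * (e * cis (- (\<kappa> * \<eta>)))"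
  have z': "z = x + of_real \<rho> * (e * cis 0)" using z by simp
  have "dist z Y = dist z Y'" unfolding z' Y Y'_def dist_polar[OF e] by simp
  moreover have "dist X Y' = sqrt (r\<^sup>2 + s\<^sup>2 - 2 * r * s * cos (\<gamma> + \<eta>))"
    unfolding X Y'_def dist_polar[OF e] using \<kappa>
    by (auto simp: add.commute) (metis cos_minus minus_add_distrib add.commute uminus_add_conv_diff)
  ultimately show ?thesis using dist_triangle[of X Y' z] by simp
qed

text \<open>With \<open>Y\<close> replaced by its mirror image, a total angle of at most
  \<open>pi\<close> makes the segment from \<open>X\<close> cross the ray, and the crossing point is
  the optimal one. The bound by \<open>max r s\<close> keeps it where the sector describes the
  frontier.\<close>

lemma reflected_path_attained:
  assumes e: "norm e = 1" and \<kappa>: "\<kappa> = 1 \<or> \<kappa> = -1"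
    and X: "X = x + of_real r * (e * cis (\<kappa> * \<gamma>))" and Y: "Y = x + of_real s * (e * cis (\<kappa> * \<eta>))"
    and nn: "0 \<le> r" "0 \<le> s" "0 \<le> \<gamma>" "0 \<le> \<eta>" and pi: "\<gamma> + \<eta> \<le> pi"
  shows "\<exists>\<rho>\<ge>0. \<rho> \<le> max r s \<and> dist X (x + of_real \<rho> * e) + dist (x + of_real \<rho> * e) Y
     = sqrt (r\<^sup>2 + s\<^sup>2 - 2 * r * s * cos (\<gamma> + \<eta>))"
proof -
  define Y' where "Y' = x + of_real s * (e * cis (- (\<kappa> * \<eta>)))"
  have zY: "dist (x + of_real \<rho> * e) Y = dist (x + of_real \<rho> * e) Y'" for \<rho>
  proof -
    have z': "x + of_real \<rho> * e = x + of_real \<rho> * (e * cis 0)" by simp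
    show ?thesis unfolding z' Y Y'_def dist_polar[OF e] by simp
  qed
  have XY': "dist X Y' = sqrt (r\<^sup>2 + s\<^sup>2 - 2 * r * s * cos (\<gamma> + \<eta>))"
    unfolding X Y'_def dist_polar[OF e] using \<kappa>
    by (auto simp: add.commute) (metis cos_minus minus_add_distrib add.commute uminus_add_conv_diff)
  consider "r = 0 \<or> s = 0" | "\<gamma> = 0" | "\<eta> = 0" | "0 < r" "0 < s" "0 < \<gamma>" "0 < \<eta>"
    using nn by linarith
  then show ?thesis
  proof cases
    case 1
    then have "dist X (x + of_real 0 * e) + dist (x + of_real 0 * e) Y' = dist X Y'"
      by (auto simp: X Y'_def dist_norm)
    then show ?thesis using nn by (intro exI[of _ 0]) (simp only: zY XY', simp add: max_def)
  next
    case 2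
    then have "x + of_real r * e = X" by (simp add: X)
    then have "dist X (x + of_real r * e) + dist (x + of_real r * e) Y' = dist X Y'" by simp
    then show ?thesis using nn by (intro exI[of _ r]) (simp only: zY XY', simp add: max_def)
  next
    case 3
    then have "x + of_real s * e = Y'" by (simp add: Y'_def)
    then have "dist X (x + of_real s * e) + dist (x + of_real s * e) Y' = dist X Y'" by simp
    then show ?thesis using nn by (intro exI[of _ s]) (simp only: zY XY', simp add: max_def)
  next
    case 4
    then have s: "0 < sin \<gamma>" "0 < sin \<eta>" using pi by (auto intro!: sin_gt_zero)
    \<comment> \<open>The distances \<open>r * sin \<gamma>\<close> and
      \<open>s * sin \<eta>\<close> of the two ends from the ray, on opposite sides, give the ratio
      \<open>l\<close> in which the ray divides the segment; \<rho> is the position on the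
      ray.\<close>
    define den where "den = r * sin \<gamma> + s * sin \<eta>"
    have den: "0 < den" unfolding den_def using s 4 by (intro add_pos_pos mult_pos_pos)
    define l where "l = r * sin \<gamma> / den"
    have l: "0 \<le> l" "l \<le> 1" using s 4 den by (auto simp: l_def den_def)
    define \<rho> where "\<rho> = r * s * sin (\<gamma> + \<eta>) / den"
    have \<rho>0: "0 \<le> \<rho>" unfolding \<rho>_def using den nn pi by (intro divide_nonneg_pos mult_nonneg_nonneg sin_ge_zero) auto
    have lin: "(1 - l) * (r * cos \<gamma>) + l * (s * cos \<eta>) = \<rho>" "(1 - l) * (r * sin \<gamma>) - l * (s * sin \<eta>) = 0"
    proof -
      have 1: "1 - l = s * sin \<eta> / den" using den by (simp add: l_def den_def field_simps)
      show "(1 - l) * (r * cos \<gamma>) + l * (s * cos \<eta>) = \<rho>"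
        by (simp only: 1) (simp add: l_def \<rho>_def sin_add distrib_left add_divide_distrib ac_simps)
      show "(1 - l) * (r * sin \<gamma>) - l * (s * sin \<eta>) = 0"
        by (simp only: 1) (simp add: l_def ac_simps)
    qed
    have c: "cos (\<kappa> * \<gamma>) = cos \<gamma>" "cos (\<kappa> * \<eta>) = cos \<eta>" "sin (\<kappa> * \<gamma>) = \<kappa> * sin \<gamma>" "sin (\<kappa> * \<eta>) = \<kappa> * sin \<eta>"
      using \<kappa> by auto
    have comb: "of_real (1 - l) * (of_real r * cis (\<kappa> * \<gamma>)) + of_real l * (of_real s * cis (- (\<kappa> * \<eta>))) = of_real \<rho>"
    proof (rule complex_eqI)
      show "Re (of_real (1 - l) * (of_real r * cis (\<kappa> * \<gamma>)) + of_real l * (of_real s * cis (- (\<kappa> * \<eta>)))) = Re (of_real \<rho>)"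
        using lin(1) by (simp add: c)
      show "Im (of_real (1 - l) * (of_real r * cis (\<kappa> * \<gamma>)) + of_real l * (of_real s * cis (- (\<kappa> * \<eta>)))) = Im (of_real \<rho>)"
      proof -
        have "Im (of_real (1 - l) * (of_real r * cis (\<kappa> * \<gamma>)) + of_real l * (of_real s * cis (- (\<kappa> * \<eta>)))) =
          \<kappa> * ((1 - l) * (r * sin \<gamma>) - l * (s * sin \<eta>))"
          by (simp add: c) (simp add: algebra_simps)
        then show ?thesis by (simp only: lin(2)) simp
      qed
    qed
    have z: "x + of_real \<rho> * e = (1 - l) *\<^sub>R X + l *\<^sub>R Y'"
    proof -
      have "(1 - l) *\<^sub>R X + l *\<^sub>R Y' = x + (of_real (1 - l) * (of_real r * cis (\<kappa> * \<gamma>)) + of_real l * (of_real s * cis (- (\<kappa> * \<eta>)))) * e"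
        unfolding X Y'_def scaleR_conv_of_real of_real_diff of_real_1 by algebra
      then show ?thesis by (simp only: comb)
    qed
    then have seg: "x + of_real \<rho> * e \<in> closed_segment X Y'" using l in_segment by blast
    then have "dist X (x + of_real \<rho> * e) + dist (x + of_real \<rho> * e) Y' = dist X Y'"
      unfolding between_mem_segment[symmetric] between by simp
    moreover have "\<rho> \<le> max r s"
    proof -
      have "closed_segment X Y' \<subseteq> cball x (max r s)"
      proof (rule closed_segment_subset)
        show "X \<in> cball x (max r s)" "Y' \<in> cball x (max r s)"
          using e nn by (simp_all add: X Y'_def dist_norm norm_mult)
      qed simp
      then have "dist x (x + of_real \<rho> * e) \<le> max r s" using seg by auto
      then show ?thesis using e \<rho>0 by (simp add: dist_norm norm_mult)
    qed
    ultimately show ?thesis using \<rho>0 XY' zY[of \<rho>] by (intro exI[of _ \<rho>] conjI) simp_all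
  qed
qed

text \<open>The sector is swept counterclockwise from the ray along \<open>e\<close>;
  \<open>\<beta> = pi\<close>, a half disk, covers the inner points of a side. The frontier is
  recorded as well, since the distances in the double are infima over it.\<close>

definition sector_at :: "complex set \<Rightarrow> complex \<Rightarrow> real \<Rightarrow> complex \<Rightarrow> real \<Rightarrow> bool" where
  "sector_at Q x \<epsilon> e \<beta> \<longleftrightarrow> norm e = 1 \<and> 0 < \<beta> \<and> \<beta> \<le> pi \<and> 0 < \<epsilon> \<and>
     (\<forall>y\<in>ball x \<epsilon>. y \<in> Q \<longleftrightarrow> (\<exists>r\<ge>0. \<exists>\<phi>\<in>{0..\<beta>}. y = x + of_real r * (e * cis \<phi>))) \<and>
     (\<forall>y\<in>ball x \<epsilon>. y \<in> frontier Q \<longleftrightarrow> (\<exists>r\<ge>0. y = x + of_real r * e \<or> y = x + of_real r * (e * cis \<beta>)))"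

context doubled
begin

text \<open>A shortest crossing meets one of the two rays, at total angle
  \<open>\<gamma> + \<eta>\<close> or \<open>2 * \<beta> - (\<gamma> + \<eta>)\<close>, and
  reflection in that ray straightens it. The sector has twice the radius allowed for the points, so
  that a crossing outside it is at least as long as the detour through \<open>x\<close>.\<close>

lemma dd_sector:
  assumes sec: "sector_at Q x (2 * \<epsilon>) e \<beta>" and st: "s \<noteq> t"
    and X: "X = x + of_real r * (e * cis \<gamma>)" and Y: "Y = x + of_real r' * (e * cis \<eta>)"
    and r: "0 \<le> r" "r < \<epsilon>" "0 \<le> r'" "r' < \<epsilon>" and ang: "\<gamma> \<in> {0..\<beta>}" "\<eta> \<in> {0..\<beta>}"
  shows "dd s X t Y = sqrt (r\<^sup>2 + r'\<^sup>2 - 2 * r * r' * cos (min (\<gamma> + \<eta>) (2 * \<beta> - (\<gamma> + \<eta>))))"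
proof -
  define \<mu> where "\<mu> = min (\<gamma> + \<eta>) (2 * \<beta> - (\<gamma> + \<eta>))"
  define V where "V = (\<lambda>a. sqrt (r\<^sup>2 + r'\<^sup>2 - 2 * r * r' * cos a))"
  have e: "norm e = 1" "norm (e * cis \<beta>) = 1" and \<beta>: "0 < \<beta>" "\<beta> \<le> pi"
    using sec by (auto simp: sector_at_def norm_mult)
  have \<mu>: "0 \<le> \<mu>" "\<mu> \<le> pi" "\<mu> \<le> \<gamma> + \<eta>" "\<gamma> + \<eta> \<le> 2 * pi - \<mu>"
      "\<mu> \<le> 2 * \<beta> - (\<gamma> + \<eta>)" "2 * \<beta> - (\<gamma> + \<eta>) \<le> 2 * pi - \<mu>"
    using ang \<beta> by (auto simp: \<mu>_def)
  have Vmono: "V \<mu> \<le> V a" if "\<mu> \<le> a" "a \<le> 2 * pi - \<mu>" for a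
  proof -
    have "2 * r * r' * cos a \<le> 2 * r * r' * cos \<mu>"
      using cos_le_cos_symmetric[OF \<mu>(1,2) that] r by (intro mult_left_mono) auto
    then show ?thesis by (simp add: V_def)
  qed
  have X2: "X = x + of_real r * ((e * cis \<beta>) * cis (-1 * (\<beta> - \<gamma>)))"
    and Y2: "Y = x + of_real r' * ((e * cis \<beta>) * cis (-1 * (\<beta> - \<eta>)))"
    by (simp_all add: X Y mult.assoc cis_mult)
  have X1: "X = x + of_real r * (e * cis (1 * \<gamma>))" and Y1: "Y = x + of_real r' * (e * cis (1 * \<eta>))"
    by (simp_all add: X Y)
  have sum2: "(\<beta> - \<gamma>) + (\<beta> - \<eta>) = 2 * \<beta> - (\<gamma> + \<eta>)" by simp
  have dX: "dist x X = r" "dist x Y = r'" using r e by (simp_all add: X Y dist_norm norm_mult)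
  have lower: "V \<mu> \<le> dist X z + dist z Y" if z: "z \<in> frontier Q" for z
  proof (cases "z \<in> ball x (2 * \<epsilon>)")
    case True
    then obtain \<rho> where "z = x + of_real \<rho> * e \<or> z = x + of_real \<rho> * (e * cis \<beta>)"
      using sec z unfolding sector_at_def by blast
    then show ?thesis
    proof
      assume "z = x + of_real \<rho> * e"
      from reflected_path_ge[OF e(1) _ X1 Y1 this] have "V (\<gamma> + \<eta>) \<le> dist X z + dist z Y"
        unfolding V_def by simp
      then show ?thesis using Vmono[OF \<mu>(3,4)] by linarith
    next
      assume "z = x + of_real \<rho> * (e * cis \<beta>)"
      from reflected_path_ge[OF e(2) _ X2 Y2 this] have "V (2 * \<beta> - (\<gamma> + \<eta>)) \<le> dist X z + dist z Y"
        unfolding sum2 V_def by simp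
      then show ?thesis using Vmono[OF \<mu>(5,6)] by linarith
    qed
  next
    case False
    then have "2 * \<epsilon> \<le> dist x z" by simp
    then have "r + r' \<le> dist X z + dist z Y"
      using dX r dist_triangle[of x z X] dist_triangle[of x z Y] by (simp add: dist_commute)
    moreover have "V \<mu> \<le> r + r'"
    proof -
      have "(r\<^sup>2 + r'\<^sup>2 - 2 * r * r' * cos \<mu>) \<le> (r + r')\<^sup>2"
      proof -
        have "2 * r * r' * (-1) \<le> 2 * r * r' * cos \<mu>" using r by (intro mult_left_mono) auto
        then show ?thesis by (simp add: power2_eq_square algebra_simps)
      qed
      then show ?thesis unfolding V_def using r by (intro real_le_lsqrt) auto
    qed
    ultimately show ?thesis by simp
  qed
  have attained: "\<exists>z\<in>frontier Q. dist X z + dist z Y = V \<mu>"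
  proof (cases "\<gamma> + \<eta> \<le> 2 * \<beta> - (\<gamma> + \<eta>)")
    case True
    then have m: "\<mu> = \<gamma> + \<eta>" by (simp add: \<mu>_def)
    obtain \<rho> where \<rho>: "0 \<le> \<rho>" "\<rho> \<le> max r r'" "dist X (x + of_real \<rho> * e) + dist (x + of_real \<rho> * e) Y = V \<mu>"
      using reflected_path_attained[OF e(1) _ X1 Y1] r ang \<mu> unfolding V_def m by auto
    have "x + of_real \<rho> * e \<in> ball x (2 * \<epsilon>)" using \<rho> r e by (auto simp: dist_norm norm_mult)
    then have "x + of_real \<rho> * e \<in> frontier Q" using sec \<rho> unfolding sector_at_def by blast
    then show ?thesis using \<rho> by blast
  next
    case False
    then have m: "\<mu> = (\<beta> - \<gamma>) + (\<beta> - \<eta>)" by (simp add: \<mu>_def)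
    obtain \<rho> where \<rho>: "0 \<le> \<rho>" "\<rho> \<le> max r r'"
      "dist X (x + of_real \<rho> * (e * cis \<beta>)) + dist (x + of_real \<rho> * (e * cis \<beta>)) Y = V \<mu>"
      using reflected_path_attained[OF e(2) _ X2 Y2] r ang \<mu> unfolding V_def m by auto
    have "x + of_real \<rho> * (e * cis \<beta>) \<in> ball x (2 * \<epsilon>)" using \<rho> r e by (auto simp: dist_norm norm_mult)
    then have "x + of_real \<rho> * (e * cis \<beta>) \<in> frontier Q" using sec \<rho> unfolding sector_at_def by blast
    then show ?thesis using \<rho> by blast
  qed
  obtain z where "z \<in> frontier Q" "dd s X t Y = dist X z + dist z Y" using dd_attained[OF st] .
  then have "V \<mu> \<le> dd s X t Y" using lower by simp
  moreover have "dd s X t Y \<le> V \<mu>" using attained dd_le by metis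
  ultimately show ?thesis by (simp add: V_def \<mu>_def)
qed

end

context double_metric
begin

lemma cone_angle_frontier:
  assumes sec: "sector_at Q x (2 * \<epsilon>) e \<beta>" and x: "x \<in> frontier Q"
  shows "cone_angle_at d (\<phi> s x) (2 * \<beta>)"
proof -
  have e: "norm e = 1" and \<beta>: "0 < \<beta>" "\<beta> \<le> pi" and \<epsilon>: "0 < \<epsilon>"
    using sec by (auto simp: sector_at_def)
  have xQ: "x \<in> Q" using x frontier_subset by blast
  define pnt where "pnt = (\<lambda>r \<gamma>. x + of_real r * (e * cis \<gamma>))"
  have pQ: "pnt r \<gamma> \<in> Q" if "0 \<le> r" "r < \<epsilon>" "0 \<le> \<gamma>" "\<gamma> \<le> \<beta>" for r \<gamma>
  proof -
    have "pnt r \<gamma> \<in> ball x (2 * \<epsilon>)" using that e by (simp add: pnt_def dist_norm norm_mult)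
    moreover have "\<exists>r'\<ge>0. \<exists>\<phi>\<in>{0..\<beta>}. pnt r \<gamma> = x + of_real r' * (e * cis \<phi>)"
      using that unfolding pnt_def by (intro exI[of _ r] conjI bexI[of _ \<gamma>]) auto
    ultimately show ?thesis using sec unfolding sector_at_def by blast
  qed
  \<comment> \<open>Sheet \<open>t\<close> with angle \<gamma> represents the cone angle \<phi>.
    Representatives are not unique on the two rays; \<open>key\<close> holds for every choice, which
    is why an arbitrary one may be taken for \<open>f\<close>.\<close>
  define rp where "rp = (\<lambda>\<phi> t \<gamma>. 0 \<le> \<gamma> \<and> \<gamma> \<le> \<beta> \<and> (\<exists>a::int. \<phi> = (if t then \<gamma> else - \<gamma>) + a * (2 * \<beta>)))"
  have key: "d (\<phi> t (pnt r \<gamma>)) (\<phi> u (pnt r' \<eta>)) = cone_dist (2 * \<beta>) (r, a) (r', b)"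
    if "rp a t \<gamma>" "rp b u \<eta>" "0 \<le> r" "r < \<epsilon>" "0 \<le> r'" "r' < \<epsilon>" for t u \<gamma> \<eta> r r' a b
  proof -
    obtain m :: int where m: "a = (if t then \<gamma> else - \<gamma>) + m * (2 * \<beta>)" and \<gamma>: "0 \<le> \<gamma>" "\<gamma> \<le> \<beta>"
      using \<open>rp a t \<gamma>\<close> unfolding rp_def by blast
    obtain n :: int where n: "b = (if u then \<eta> else - \<eta>) + n * (2 * \<beta>)" and \<eta>: "0 \<le> \<eta>" "\<eta> \<le> \<beta>"
      using \<open>rp b u \<eta>\<close> unfolding rp_def by blast
    define \<delta> where "\<delta> = \<bar>(if t then \<gamma> else - \<gamma>) - (if u then \<eta> else - \<eta>)\<bar>"
    have le: "\<delta> \<le> 2 * \<beta>" using \<gamma> \<eta> by (auto simp: \<delta>_def)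
    have inf: "(INF k::int. \<bar>a - b - of_int k * (2 * \<beta>)\<bar>) = min \<delta> (2 * \<beta> - \<delta>)"
      using INF_dist_mod[of "2 * \<beta>" "if t then \<gamma> else - \<gamma>" "if u then \<eta> else - \<eta>" m n] \<beta> le
      unfolding m n \<delta>_def by simp
    have "min pi (min \<delta> (2 * \<beta> - \<delta>)) = min \<delta> (2 * \<beta> - \<delta>)" using \<beta> le by (auto simp: min_def)
    then have cd: "cone_dist (2 * \<beta>) (r, a) (r', b) = sqrt (r\<^sup>2 + r'\<^sup>2 - 2 * r * r' * cos (min \<delta> (2 * \<beta> - \<delta>)))"
      unfolding cone_dist_def by (simp add: inf)
    have dq: "d (\<phi> t (pnt r \<gamma>)) (\<phi> u (pnt r' \<eta>)) = dd t (pnt r \<gamma>) u (pnt r' \<eta>)"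
      using pQ that \<gamma> \<eta> by (intro d_eq) auto
    show ?thesis
    proof (cases "t = u")
      case True
      then have \<delta>: "\<delta> = \<bar>\<gamma> - \<eta>\<bar>" by (auto simp: \<delta>_def)
      then have "\<delta> \<le> \<beta>" using \<gamma> \<eta> by auto
      then have "min \<delta> (2 * \<beta> - \<delta>) = \<bar>\<gamma> - \<eta>\<bar>" using \<delta> by auto
      then show ?thesis unfolding cd dq using True dist_polar[OF e, of x r \<gamma> r' \<eta>] by (simp add: pnt_def)
    next
      case False
      then have \<delta>: "\<delta> = \<gamma> + \<eta>" using \<gamma> \<eta> by (auto simp: \<delta>_def)
      show ?thesis unfolding cd dq \<delta>
        by (rule dd_sector[OF sec False pnt_def[THEN fun_cong, THEN fun_cong] pnt_def[THEN fun_cong, THEN fun_cong]])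
          (use that \<gamma> \<eta> in auto)
    qed
  qed
  have ex: "\<exists>t \<gamma>. rp a t \<gamma>" for a
    using mod_representative[OF \<beta>(1), of a] unfolding rp_def by metis
  define f where "f = (\<lambda>(r, a). \<phi> (fst (SOME u. rp a (fst u) (snd u))) (pnt r (snd (SOME u. rp a (fst u) (snd u)))))"
  have f: "\<exists>t \<gamma>. rp a t \<gamma> \<and> (\<forall>r. f (r, a) = \<phi> t (pnt r \<gamma>))" for a
  proof -
    have "rp a (fst (SOME u. rp a (fst u) (snd u))) (snd (SOME u. rp a (fst u) (snd u)))"
      using someI_ex[of "\<lambda>u. rp a (fst u) (snd u)"] ex[of a] by simp
    then show ?thesis unfolding f_def by auto
  qed
  have x_s: "\<phi> t x = \<phi> s x" for t using \<phi>_eq_iff[of t s x x] xQ x by (cases "t = s") auto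
  have dx: "d (\<phi> s x) (\<phi> t y) = dist x y" if "y \<in> Q" for t y
    using d_eq[OF xQ that] dd_frontier(1)[OF x] by simp
  show ?thesis
    unfolding cone_angle_at_def
  proof (intro exI conjI ballI allI)
    show "0 < \<epsilon>" by (rule \<epsilon>)
    show "f (0, a) = \<phi> s x" for a using f[of a] x_s by (auto simp: pnt_def)
    show "d (f a) (f b) = cone_dist (2 * \<beta>) a b" if "a \<in> {0..<\<epsilon>} \<times> UNIV" "b \<in> {0..<\<epsilon>} \<times> UNIV" for a b
      using f[of "snd a"] f[of "snd b"] key[of "snd a" _ _ "snd b" _ _ "fst a" "fst b"] that by auto
    show "f ` ({0..<\<epsilon>} \<times> UNIV) = {y \<in> S2. d (\<phi> s x) y < \<epsilon>}"
    proof (intro equalityI subsetI)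
      fix y assume "y \<in> f ` ({0..<\<epsilon>} \<times> UNIV)"
      then obtain r a where ra: "0 \<le> r" "r < \<epsilon>" "y = f (r, a)" by auto
      obtain t \<gamma> where "rp a t \<gamma>" and y: "y = \<phi> t (pnt r \<gamma>)" using f[of a] ra by auto
      then have Q: "pnt r \<gamma> \<in> Q" using pQ ra by (auto simp: rp_def)
      have "dist x (pnt r \<gamma>) = r" using ra e by (simp add: pnt_def dist_norm norm_mult)
      then have "d (\<phi> s x) y < \<epsilon>" unfolding y dx[OF Q] using ra by simp
      then show "y \<in> {y \<in> S2. d (\<phi> s x) y < \<epsilon>}" using \<phi>_in_S2[OF Q] y by blast
    next
      fix y assume "y \<in> {y \<in> S2. d (\<phi> s x) y < \<epsilon>}"
      then have y: "y \<in> S2" "d (\<phi> s x) y < \<epsilon>" by auto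
      obtain t z where z: "z \<in> Q" "y = \<phi> t z" using S2_cases[OF y(1)] .
      then have "dist x z < \<epsilon>" using y dx by simp
      then have "z \<in> ball x (2 * \<epsilon>)" using \<epsilon> by simp
      then obtain r \<gamma> where r: "0 \<le> r" "\<gamma> \<in> {0..\<beta>}" "z = pnt r \<gamma>"
        using sec z unfolding sector_at_def pnt_def by blast
      have r\<epsilon>: "r < \<epsilon>" using \<open>dist x z < \<epsilon>\<close> r e by (simp add: pnt_def dist_norm norm_mult)
      define a where "a = (if t then \<gamma> else - \<gamma>)"
      have "rp a t \<gamma>" unfolding rp_def a_def using r by (auto intro!: exI[of _ 0])
      obtain t' \<gamma>' where t': "rp a t' \<gamma>'" "f (r, a) = \<phi> t' (pnt r \<gamma>')" using f[of a] by blast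
      \<comment> \<open>The representative used by \<open>f\<close> may differ from the given one,
        but \<open>key\<close> computes the same distance for both, so they are the same
        point.\<close>
      have "d y (f (r, a)) = cone_dist (2 * \<beta>) (r, a) (r, a)"
        unfolding z(2) r(3) t'(2) using key[OF \<open>rp a t \<gamma>\<close> t'(1)] r r\<epsilon> by simp
      also have "\<dots> = d y y"
        unfolding z(2) r(3) using key[OF \<open>rp a t \<gamma>\<close> \<open>rp a t \<gamma>\<close>] r r\<epsilon> by simp
      also have "\<dots> = 0" using y zero by blast
      finally have "d y (f (r, a)) = 0" .
      moreover have "f (r, a) \<in> S2" using t' pQ r r\<epsilon> \<phi>_in_S2 by (auto simp: rp_def)
      ultimately have "y = f (r, a)" using zero y by blast
      then show "y \<in> f ` ({0..<\<epsilon>} \<times> UNIV)" using r r\<epsilon> by auto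
    qed
  qed
qed

lemma cone_angle_interior:
  assumes x: "x \<in> interior Q"
  shows "cone_angle_at d (\<phi> s x) (2 * pi)"
proof -
  obtain \<epsilon> where \<epsilon>: "0 < \<epsilon>" "ball x \<epsilon> \<subseteq> interior Q" using x open_interior openE by blast
  have xQ: "x \<in> Q" using x interior_subset by blast
  have bQ: "y \<in> Q" if "dist x y < \<epsilon>" for y using that \<epsilon> interior_subset by fastforce
  define f where "f = (\<lambda>(r::real, a). \<phi> s (x + of_real r * (1 * cis a)))"
  have dx: "dist x (x + of_real r * (1 * cis a)) = r" if "0 \<le> r" for r a
    using that by (simp add: dist_norm norm_mult)
  show ?thesis
    unfolding cone_angle_at_def
  proof (intro exI conjI ballI allI)
    show "0 < \<epsilon>" by (rule \<epsilon>)
    show "f (0, a) = \<phi> s x" for a by (simp add: f_def)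
    show "d (f p) (f q) = cone_dist (2 * pi) p q" if pq: "p \<in> {0..<\<epsilon>} \<times> UNIV" "q \<in> {0..<\<epsilon>} \<times> UNIV" for p q
    proof -
      obtain r a where p: "p = (r, a)" "0 \<le> r" "r < \<epsilon>" using pq by auto
      obtain r' b where q: "q = (r', b)" "0 \<le> r'" "r' < \<epsilon>" using pq by auto
      obtain t \<gamma> m where m: "0 \<le> \<gamma>" "\<gamma> \<le> pi" "a = (if t then \<gamma> else - \<gamma>) + of_int m * (2 * pi)"
        using mod_representative[OF pi_gt_zero, of a] by metis
      obtain u \<eta> n where n: "0 \<le> \<eta>" "\<eta> \<le> pi" "b = (if u then \<eta> else - \<eta>) + of_int n * (2 * pi)"
        using mod_representative[OF pi_gt_zero, of b] by metis
      define \<delta> where "\<delta> = (if t then \<gamma> else - \<gamma>) - (if u then \<eta> else - \<eta>)"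
      have le: "\<bar>\<delta>\<bar> \<le> 2 * pi" using m n by (auto simp: \<delta>_def)
      have inf: "(INF k::int. \<bar>a - b - of_int k * (2 * pi)\<bar>) = min \<bar>\<delta>\<bar> (2 * pi - \<bar>\<delta>\<bar>)"
        using INF_dist_mod[of "2 * pi" "if t then \<gamma> else - \<gamma>" "if u then \<eta> else - \<eta>" m n] le
        unfolding m(3) n(3) \<delta>_def by simp
      \<comment> \<open>Angles modulo \<open>2 * pi\<close> are at most \<open>pi\<close> apart, so
        \<open>cone_dist\<close> reduces to the planar law of cosines.\<close>
      have "cos (min pi (min \<bar>\<delta>\<bar> (2 * pi - \<bar>\<delta>\<bar>))) = cos \<delta>"
      proof (cases "\<bar>\<delta>\<bar> \<le> pi")
        case True
        then have "min pi (min \<bar>\<delta>\<bar> (2 * pi - \<bar>\<delta>\<bar>)) = \<bar>\<delta>\<bar>" by auto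
        then show ?thesis by simp
      next
        case False
        then have "min pi (min \<bar>\<delta>\<bar> (2 * pi - \<bar>\<delta>\<bar>)) = 2 * pi - \<bar>\<delta>\<bar>" by auto
        then show ?thesis by (simp add: cos_diff)
      qed
      also have "cos \<delta> = cos (a - b)"
      proof -
        have "a - b = \<delta> + of_int (m - n) * (2 * pi)" by (simp add: m n \<delta>_def algebra_simps)
        then show ?thesis by (metis cos_int_2pin mult.commute cos_add sin_int_2pin mult_zero_right diff_zero mult.right_neutral)
      qed
      finally have "cone_dist (2 * pi) p q = sqrt (r\<^sup>2 + r'\<^sup>2 - 2 * r * r' * cos (a - b))"
        unfolding cone_dist_def p q by (simp add: inf)
      moreover have "d (f p) (f q) = dist (x + of_real r * (1 * cis a)) (x + of_real r' * (1 * cis b))"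
        unfolding f_def p q using bQ dx p q by (simp add: d_eq)
      ultimately show ?thesis using dist_polar[of 1] by simp
    qed
    show "f ` ({0..<\<epsilon>} \<times> UNIV) = {y \<in> S2. d (\<phi> s x) y < \<epsilon>}"
    proof (intro equalityI subsetI)
      fix y assume "y \<in> f ` ({0..<\<epsilon>} \<times> UNIV)"
      then obtain r a where ra: "0 \<le> r" "r < \<epsilon>" "y = f (r, a)" by auto
      then have Q: "x + of_real r * (1 * cis a) \<in> Q" using bQ dx by simp
      then have "d (\<phi> s x) y = r" using ra dx xQ by (simp add: f_def d_eq)
      then show "y \<in> {y \<in> S2. d (\<phi> s x) y < \<epsilon>}" using \<phi>_in_S2[OF Q, of s] ra by (simp add: f_def)
    next
      fix y assume "y \<in> {y \<in> S2. d (\<phi> s x) y < \<epsilon>}"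
      then have y: "y \<in> S2" "d (\<phi> s x) y < \<epsilon>" by auto
      obtain t z where z: "z \<in> Q" "y = \<phi> t z" using S2_cases[OF y(1)] .
      have dd: "dd s x t z < \<epsilon>" using y z xQ by (simp add: d_eq)
      \<comment> \<open>The other sheet is reached only through the frontier, whose distance from
        \<open>x\<close> is at least \<epsilon>.\<close>
      have "s = t"
      proof (rule ccontr)
        assume "s \<noteq> t"
        then obtain u where u: "u \<in> frontier Q" "dd s x t z = dist x u + dist u z" using dd_attained by metis
        have "\<epsilon> \<le> dist x u" using \<epsilon> u(1) unfolding frontier_def by force
        then show False using dd u(2) zero_le_dist[of u z] by linarith
      qed
      then have "dist x z < \<epsilon>" using dd by simp
      moreover have "z = x + of_real (norm (z - x)) * (1 * cis (Arg (z - x)))"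
        using rcis_cmod_Arg[of "z - x"] by (simp add: rcis_def)
      ultimately show "y \<in> f ` ({0..<\<epsilon>} \<times> UNIV)"
        using z \<open>s = t\<close> by (intro image_eqI[of _ _ "(norm (z - x), Arg (z - x))"]) (auto simp: f_def dist_norm norm_minus_commute)
    qed
  qed
qed

end

lemma wedge_cis:
  assumes "norm e = 1"
  shows "wedge (of_real r * (e * cis a)) (of_real s * (e * cis b)) = r * s * sin (b - a)"
proof -
  have e: "cnj e * e = 1" using assms by (metis complex_norm_square mult.commute of_real_1 power_one)
  have "cnj (of_real r * (e * cis a)) * (of_real s * (e * cis b)) = of_real (r * s) * ((cnj e * e) * (cnj (cis a) * cis b))"
    by (simp only: complex_cnj_mult complex_cnj_complex_of_real of_real_mult mult_ac)
  also have "\<dots> = of_real (r * s) * cis (b - a)" unfolding e by (simp add: cis_cnj cis_mult)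
  finally have "cnj (of_real r * (e * cis a)) * (of_real s * (e * cis b)) = of_real (r * s) * cis (b - a)" .
  then have "Im (cnj (of_real r * (e * cis a)) * (of_real s * (e * cis b))) = Im (of_real (r * s) * cis (b - a))" by (rule arg_cong)
  then show ?thesis unfolding wedge_def by (simp only: times_complex.simps complex.sel Re_complex_of_real Im_complex_of_real cis.sel)
qed

text \<open>A sector of angle at most \<open>pi\<close> is the intersection of two half-planes: the
  signs of \<open>sin \<phi>\<close> and \<open>sin (\<beta> - \<phi>)\<close> confine the argument
  \<phi> to the interval from 0 to \<beta>.\<close>

lemma sector_iff:
  assumes e: "norm e = 1" and \<beta>: "0 < \<beta>" "\<beta> \<le> pi"
  shows "0 \<le> wedge e z \<and> 0 \<le> wedge z (e * cis \<beta>) \<longleftrightarrow> (\<exists>r\<ge>0. \<exists>\<phi>\<in>{0..\<beta>}. z = of_real r * (e * cis \<phi>))"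
    and "0 \<le> wedge e z \<Longrightarrow> 0 \<le> wedge z (e * cis \<beta>) \<Longrightarrow>
      wedge e z = 0 \<or> wedge z (e * cis \<beta>) = 0 \<longleftrightarrow> (\<exists>r\<ge>0. z = of_real r * e \<or> z = of_real r * (e * cis \<beta>))"
proof -
  have w1: "wedge e (of_real r * (e * cis \<phi>)) = r * sin \<phi>" for r \<phi>
    using wedge_cis[OF e, of 1 0 r \<phi>] by simp
  have w2: "wedge (of_real r * (e * cis \<phi>)) (e * cis \<beta>) = r * sin (\<beta> - \<phi>)" for r \<phi>
    using wedge_cis[OF e, of r \<phi> 1 \<beta>] by simp
  have fwd: "\<exists>r\<ge>0. \<exists>\<phi>\<in>{0..\<beta>}. z = of_real r * (e * cis \<phi>)" if "0 \<le> wedge e z" "0 \<le> wedge z (e * cis \<beta>)"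
  proof (cases "z = 0")
    case True
    then show ?thesis using \<beta> by (intro exI[of _ 0]) auto
  next
    case False
    define r where "r = norm z"
    define \<phi> where "\<phi> = Arg (z / e)"
    have r: "r > 0" using False by (simp add: r_def)
    have "z / e = of_real (norm (z / e)) * cis \<phi>" using rcis_cmod_Arg[of "z / e"] by (simp add: rcis_def \<phi>_def)
    moreover have "e \<noteq> 0" using e by auto
    ultimately have z: "z = of_real r * (e * cis \<phi>)"
      using e by (simp add: norm_divide r_def nonzero_divide_eq_eq mult_ac)
    have \<phi>: "- pi < \<phi>" "\<phi> \<le> pi" using Arg_bounded[of "z / e"] by (auto simp: \<phi>_def)
    have "0 \<le> sin \<phi>" using that(1) r unfolding z w1 by (simp add: zero_le_mult_iff)
    then have \<phi>0: "0 \<le> \<phi>" using sin_lt_zero[of "\<phi> + 2 * pi"] \<phi> by force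
    have "0 \<le> sin (\<beta> - \<phi>)" using that(2) r unfolding z w2 by (simp add: zero_le_mult_iff)
    moreover have "sin (\<beta> - \<phi>) < 0" if "\<beta> < \<phi>"
    proof -
      have "0 < sin (\<phi> - \<beta>)" using that \<beta> \<phi> by (intro sin_gt_zero) auto
      then show ?thesis by (metis minus_diff_eq neg_less_0_iff_less sin_minus)
    qed
    ultimately have "\<phi> \<le> \<beta>" by fastforce
    then show ?thesis using \<phi>0 z r by (intro exI[of _ r] conjI bexI[of _ \<phi>]) auto
  qed
  show "0 \<le> wedge e z \<and> 0 \<le> wedge z (e * cis \<beta>) \<longleftrightarrow> (\<exists>r\<ge>0. \<exists>\<phi>\<in>{0..\<beta>}. z = of_real r * (e * cis \<phi>))"
  proof
    assume "\<exists>r\<ge>0. \<exists>\<phi>\<in>{0..\<beta>}. z = of_real r * (e * cis \<phi>)"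
    then obtain r \<phi> where "0 \<le> r" "0 \<le> \<phi>" "\<phi> \<le> \<beta>" and z: "z = of_real r * (e * cis \<phi>)" by auto
    then show "0 \<le> wedge e z \<and> 0 \<le> wedge z (e * cis \<beta>)" unfolding z w1 w2
      using \<beta> by (intro conjI mult_nonneg_nonneg sin_ge_zero) auto
  qed (use fwd in blast)
  assume *: "0 \<le> wedge e z" "0 \<le> wedge z (e * cis \<beta>)"
  obtain r \<phi> where r: "0 \<le> r" "0 \<le> \<phi>" "\<phi> \<le> \<beta>" and z: "z = of_real r * (e * cis \<phi>)"
    using fwd[OF *] by auto
  show "wedge e z = 0 \<or> wedge z (e * cis \<beta>) = 0 \<longleftrightarrow> (\<exists>r\<ge>0. z = of_real r * e \<or> z = of_real r * (e * cis \<beta>))"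
  proof
    assume 0: "wedge e z = 0 \<or> wedge z (e * cis \<beta>) = 0"
    have "r = 0 \<or> \<phi> = 0 \<or> \<phi> = \<beta>"
    proof (rule ccontr)
      assume n: "\<not> ?thesis"
      then have "0 < sin \<phi>" "0 < sin (\<beta> - \<phi>)" using r \<beta> by (auto intro!: sin_gt_zero)
      then show False using 0 n unfolding z w1 w2 by auto
    qed
    then show "\<exists>r\<ge>0. z = of_real r * e \<or> z = of_real r * (e * cis \<beta>)"
      using r z by auto
  next
    assume "\<exists>r\<ge>0. z = of_real r * e \<or> z = of_real r * (e * cis \<beta>)"
    then obtain r where "z = of_real r * (e * cis 0) \<or> z = of_real r * (e * cis \<beta>)" by auto
    then show "wedge e z = 0 \<or> wedge z (e * cis \<beta>) = 0" using w1[of r 0] w2[of r \<beta>] by auto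
  qed
qed

context ngon
begin

text \<open>\<open>A\<close> is meant to be the set of sides through \<open>x\<close>. The strict
  inequalities of all other sides persist in a small ball, so there the polygon is cut out by the
  sides in \<open>A\<close> alone.\<close>

lemma sector_general:
  fixes A :: "'n set"
  assumes e: "norm e = 1" and \<beta>: "0 < \<beta>" "\<beta> \<le> pi"
    and far: "\<And>j. j \<notin> A \<Longrightarrow> 0 < orient (w j) (w (nxt j)) x"
    and nn: "\<And>z. (\<forall>j\<in>A. 0 \<le> orient (w j) (w (nxt j)) (x + z)) \<longleftrightarrow> 0 \<le> wedge e z \<and> 0 \<le> wedge z (e * cis \<beta>)"
    and zero: "\<And>z. (\<exists>j\<in>A. orient (w j) (w (nxt j)) (x + z) = 0) \<longleftrightarrow> wedge e z = 0 \<or> wedge z (e * cis \<beta>) = 0"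
  shows "\<exists>\<epsilon>. sector_at (region w) x \<epsilon> e \<beta>"
proof -
  have "open (\<Inter>j\<in>-A. {y. 0 < orient (w j) (w (nxt j)) y})"
    by (intro open_INT finite ballI open_Collect_less continuous_orient continuous_on_const)
  moreover have "x \<in> (\<Inter>j\<in>-A. {y. 0 < orient (w j) (w (nxt j)) y})" using far by simp
  ultimately obtain \<epsilon> where \<epsilon>: "0 < \<epsilon>" "ball x \<epsilon> \<subseteq> (\<Inter>j\<in>-A. {y. 0 < orient (w j) (w (nxt j)) y})"
    by (meson openE)
  have pos: "0 < orient (w j) (w (nxt j)) y" if "y \<in> ball x \<epsilon>" "j \<notin> A" for y j
    using \<epsilon>(2) that by blast
  have reg: "y \<in> region w \<longleftrightarrow> 0 \<le> wedge e (y - x) \<and> 0 \<le> wedge (y - x) (e * cis \<beta>)" if "y \<in> ball x \<epsilon>" for y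
  proof -
    have "y \<in> region w \<longleftrightarrow> (\<forall>j\<in>A. 0 \<le> orient (w j) (w (nxt j)) y)"
      using pos[OF that] unfolding region_eq by (auto intro: less_imp_le)
    then show ?thesis using nn[of "y - x"] by simp
  qed
  have fro: "y \<in> frontier (region w) \<longleftrightarrow> y \<in> region w \<and> (wedge e (y - x) = 0 \<or> wedge (y - x) (e * cis \<beta>) = 0)"
    if y: "y \<in> ball x \<epsilon>" for y
  proof -
    have "y \<in> frontier (region w) \<longleftrightarrow> y \<in> region w \<and> \<not> (\<forall>j. 0 < orient (w j) (w (nxt j)) y)"
      using compact_region by (simp add: frontier_def compact_imp_closed interior_region)
    also have "\<dots> \<longleftrightarrow> y \<in> region w \<and> (\<exists>j\<in>A. orient (w j) (w (nxt j)) y = 0)"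
      using pos[OF y] unfolding region_eq by (auto simp: less_le)
    finally show ?thesis using zero[of "y - x"] by simp
  qed
  have "y \<in> region w \<longleftrightarrow> (\<exists>r\<ge>0. \<exists>\<phi>\<in>{0..\<beta>}. y = x + of_real r * (e * cis \<phi>))" if "y \<in> ball x \<epsilon>" for y
    unfolding reg[OF that] sector_iff(1)[OF e \<beta>] by (simp add: algebra_simps)
  moreover have "y \<in> frontier (region w) \<longleftrightarrow> (\<exists>r\<ge>0. y = x + of_real r * e \<or> y = x + of_real r * (e * cis \<beta>))"
    if "y \<in> ball x \<epsilon>" for y
  proof -
    have *: "(\<exists>r\<ge>0. y = x + of_real r * e \<or> y = x + of_real r * (e * cis \<beta>)) \<longleftrightarrow>
        (\<exists>r\<ge>0. y - x = of_real r * e \<or> y - x = of_real r * (e * cis \<beta>))" by (simp add: algebra_simps)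
    show ?thesis
    proof (cases "y \<in> region w")
      case True
      then show ?thesis unfolding fro[OF that] * using sector_iff(2)[OF e \<beta>, of "y - x"] reg[OF that] by blast
    next
      case False
      have "(\<exists>r\<ge>0. y - x = of_real r * e \<or> y - x = of_real r * (e * cis \<beta>)) \<Longrightarrow>
         \<exists>r\<ge>0. \<exists>\<phi>\<in>{0..\<beta>}. y - x = of_real r * (e * cis \<phi>)"
      proof -
        assume "\<exists>r\<ge>0. y - x = of_real r * e \<or> y - x = of_real r * (e * cis \<beta>)"
        then obtain r where "r \<ge> 0" "y - x = of_real r * (e * cis 0) \<or> y - x = of_real r * (e * cis \<beta>)" by auto
        moreover have "0 \<in> {0..\<beta>}" "\<beta> \<in> {0..\<beta>}" using \<beta> by auto
        ultimately show ?thesis by blast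
      qed
      then show ?thesis unfolding fro[OF that] * using False reg[OF that] sector_iff(1)[OF e \<beta>, of "y - x"] by blast
    qed
  qed
  ultimately show ?thesis using e \<beta> \<epsilon> unfolding sector_at_def by blast
qed

lemma orient_from_side_point:
  assumes "orient (w i) (w (nxt i)) x = 0"
  shows "orient (w i) (w (nxt i)) (x + z) = norm (w (nxt i) - w i) * wedge (D i) z"
proof -
  have "orient (w i) (w (nxt i)) (x + z) = orient (w i) (w (nxt i)) x + wedge (w (nxt i) - w i) z"
    by (simp add: wedge.add_right wedge.diff_right)
  then show ?thesis using assms side_vec[of i] by (metis add_0 real_scaleR_def wedge.scaleR_left)
qed

text \<open>Only one side passes through \<open>x\<close>; for the angle \<open>pi\<close> the two
  half-planes of \<open>sector_iff\<close> coincide with the one of that side.\<close>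

lemma sector_edge:
  assumes "x \<in> side nxt w i" "x \<notin> range w"
  shows "\<exists>\<epsilon>. sector_at (region w) x \<epsilon> (D i) pi"
proof (rule sector_general[where A = "{i}"])
  show "0 < orient (w j) (w (nxt j)) x" if "j \<notin> {i}" for j
  proof -
    have x: "x \<in> region w" using assms side_subset_region by blast
    then have "0 \<le> orient (w j) (w (nxt j)) x" by (simp add: region_eq)
    moreover have "orient (w j) (w (nxt j)) x \<noteq> 0"
      using on_line_in_side[OF x] side_Int[of i j x] assms that by auto
    ultimately show ?thesis by simp
  qed
  have o: "orient (w i) (w (nxt i)) (x + z) = norm (w (nxt i) - w i) * wedge (D i) z" for z
    using side_on_line[OF assms(1)] by (rule orient_from_side_point)
  have m: "wedge z (D i * cis pi) = wedge (D i) z" for z by (simp add: wedge_eq)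
  show "(\<forall>j\<in>{i}. 0 \<le> orient (w j) (w (nxt j)) (x + z)) \<longleftrightarrow> 0 \<le> wedge (D i) z \<and> 0 \<le> wedge z (D i * cis pi)" for z
    using side_len_pos[of i] unfolding m by (simp add: o zero_le_mult_iff)
  show "(\<exists>j\<in>{i}. orient (w j) (w (nxt j)) (x + z) = 0) \<longleftrightarrow> wedge (D i) z = 0 \<or> wedge z (D i * cis pi) = 0" for z
    using side_len_pos[of i] unfolding m by (simp add: o)
qed auto

lemma interior_angle_eq: "interior_angle (w i) (w (nxt i)) (w (nxt (nxt i))) = Arg (- D i / D (nxt i))"
proof -
  have "w i - w (nxt i) = - (norm (w (nxt i) - w i) *\<^sub>R D i)" using side_vec[of i] by (simp add: algebra_simps)
  then have "(w i - w (nxt i)) / (w (nxt (nxt i)) - w (nxt i)) =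
     of_real (norm (w (nxt i) - w i) / norm (w (nxt (nxt i)) - w (nxt i))) * (- D i / D (nxt i))"
    using side_vec[of "nxt i"] by (simp add: scaleR_conv_of_real)
  moreover have "0 < norm (w (nxt i) - w i) / norm (w (nxt (nxt i)) - w (nxt i))"
    using side_len_pos by (intro divide_pos_pos) auto
  ultimately show ?thesis unfolding interior_angle_def by (simp only: Arg_times_of_real)
qed

lemma interior_angle_bounds:
  "0 < interior_angle (w i) (w (nxt i)) (w (nxt (nxt i)))" "interior_angle (w i) (w (nxt i)) (w (nxt (nxt i))) < pi"
    and cis_interior_angle: "D (nxt i) * cis (interior_angle (w i) (w (nxt i)) (w (nxt (nxt i)))) = - D i"
proof -
  have n: "cnj (D (nxt i)) * D (nxt i) = 1" by (metis complex_norm_square mult.commute norm_D of_real_1 power_one)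
  have inv: "- D i / D (nxt i) = - (D i * cnj (D (nxt i)))"
    using n by (simp add: field_simps)
  have "Im (- D i / D (nxt i)) = wedge (D i) (D (nxt i))" unfolding inv by (simp add: wedge_eq)
  then have "0 < Im (- D i / D (nxt i))" using wedge_consecutive by simp
  then show "0 < interior_angle (w i) (w (nxt i)) (w (nxt (nxt i)))" "interior_angle (w i) (w (nxt i)) (w (nxt (nxt i))) < pi"
    unfolding interior_angle_eq using Arg_lt_pi[of "- D i / D (nxt i)"] by blast+
  have "norm (- D i / D (nxt i)) = 1" by (simp add: norm_divide)
  then have "cis (Arg (- D i / D (nxt i))) = - D i / D (nxt i)"
    using rcis_cmod_Arg[of "- D i / D (nxt i)"] by (simp add: rcis_def)
  then show "D (nxt i) * cis (interior_angle (w i) (w (nxt i)) (w (nxt (nxt i)))) = - D i"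
    unfolding interior_angle_eq by simp
qed

text \<open>By \<open>cis_interior_angle\<close> the second ray points back along side
  \<open>i\<close>, so its half-plane is the one to the left of that side.\<close>

lemma sector_vertex:
  "\<exists>\<epsilon>. sector_at (region w) (w (nxt i)) \<epsilon> (D (nxt i)) (interior_angle (w i) (w (nxt i)) (w (nxt (nxt i))))"
proof (rule sector_general[where A = "{i, nxt i}"])
  let ?x = "w (nxt i)" and ?\<beta> = "interior_angle (w i) (w (nxt i)) (w (nxt (nxt i)))"
  show "0 < orient (w j) (w (nxt j)) ?x" if "j \<notin> {i, nxt i}" for j
    using that inj_nxt by (intro left) (auto dest: injD)
  have o1: "orient (w i) (w (nxt i)) (?x + z) = norm (w (nxt i) - w i) * wedge (D i) z" for z
    by (rule orient_from_side_point) simp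
  have o2: "orient (w (nxt i)) (w (nxt (nxt i))) (?x + z) = norm (w (nxt (nxt i)) - w (nxt i)) * wedge (D (nxt i)) z" for z
    by (rule orient_from_side_point) simp
  have m: "wedge z (D (nxt i) * cis ?\<beta>) = wedge (D i) z" for z unfolding cis_interior_angle by (simp add: wedge_eq)
  show "(\<forall>j\<in>{i, nxt i}. 0 \<le> orient (w j) (w (nxt j)) (?x + z)) \<longleftrightarrow> 0 \<le> wedge (D (nxt i)) z \<and> 0 \<le> wedge z (D (nxt i) * cis ?\<beta>)" for z
  proof -
    have "(\<forall>j\<in>{i, nxt i}. 0 \<le> orient (w j) (w (nxt j)) (?x + z)) \<longleftrightarrow>
        0 \<le> orient (w i) (w (nxt i)) (?x + z) \<and> 0 \<le> orient (w (nxt i)) (w (nxt (nxt i))) (?x + z)" by blast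
    then show ?thesis unfolding o1 o2 m using side_len_pos[of i] side_len_pos[of "nxt i"]
      by (auto simp: zero_le_mult_iff)
  qed
  show "(\<exists>j\<in>{i, nxt i}. orient (w j) (w (nxt j)) (?x + z) = 0) \<longleftrightarrow> wedge (D (nxt i)) z = 0 \<or> wedge z (D (nxt i) * cis ?\<beta>) = 0" for z
  proof -
    have "(\<exists>j\<in>{i, nxt i}. orient (w j) (w (nxt j)) (?x + z) = 0) \<longleftrightarrow>
        orient (w i) (w (nxt i)) (?x + z) = 0 \<or> orient (w (nxt i)) (w (nxt (nxt i))) (?x + z) = 0" by blast
    then show ?thesis unfolding o1 o2 m using side_len_pos[of i] side_len_pos[of "nxt i"]
      by auto
  qed
qed (use interior_angle_bounds in \<open>auto intro: less_imp_le\<close>)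

text \<open>Doubling turns the angle \<open>\<alpha> / 2\<close> at a vertex into \<alpha> and the
  straight angle along a side into \<open>2 * pi\<close>; a point in the interior has a flat
  neighbourhood within its sheet.\<close>

lemma double_in_cone_metrics:
  assumes dm: "double_metric (region w) \<phi> d" and p: "\<And>s i. \<phi> s (w i) = p i"
    and \<alpha>: "\<And>i. interior_angle (w i) (w (nxt i)) (w (nxt (nxt i))) = \<alpha> (nxt i) / 2"
  shows "d \<in> cone_metrics p \<alpha>"
proof -
  interpret double_metric "region w" \<phi> d by (rule dm)
  have fr: "x \<in> frontier (region w) \<longleftrightarrow> (\<exists>i. x \<in> side nxt w i)" for x by (simp add: frontier_region)
  have "cone_angle_at d (p i) (\<alpha> i)" for i
  proof -
    obtain h where h: "i = nxt h" using bij_nxt by (metis bij_pointE)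
    obtain \<epsilon> where "sector_at (region w) (w (nxt h)) \<epsilon> (D (nxt h)) (interior_angle (w h) (w (nxt h)) (w (nxt (nxt h))))"
      using sector_vertex by blast
    then have "sector_at (region w) (w (nxt h)) (2 * (\<epsilon> / 2)) (D (nxt h)) (\<alpha> (nxt h) / 2)"
      by (simp add: \<alpha>)
    moreover have "w (nxt h) \<in> frontier (region w)" unfolding fr side_def by auto
    ultimately have "cone_angle_at d (\<phi> True (w (nxt h))) (2 * (\<alpha> (nxt h) / 2))"
      by (rule cone_angle_frontier)
    then show ?thesis using p h by simp
  qed
  moreover have "cone_angle_at d a (2 * pi)" if a: "a \<in> S2 - range p" for a
  proof -
    obtain s x where x: "x \<in> region w" "a = \<phi> s x" using a S2_cases by blast
    have nw: "x \<notin> range w" using a p x by auto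
    show ?thesis
    proof (cases "x \<in> interior (region w)")
      case True
      then show ?thesis unfolding x(2) by (rule cone_angle_interior)
    next
      case False
      then have f: "x \<in> frontier (region w)" using x compact_region by (simp add: frontier_def compact_imp_closed)
      then obtain i where "x \<in> side nxt w i" using fr by blast
      then obtain \<epsilon> where "sector_at (region w) x \<epsilon> (D i) pi" using sector_edge nw by blast
      then have "sector_at (region w) x (2 * (\<epsilon> / 2)) (D i) pi" by simp
      then show ?thesis unfolding x(2) using f by (rule cone_angle_frontier)
    qed
  qed
  ultimately show ?thesis
    unfolding cone_metrics_def using Metric_space_axioms mtopology_eq geodesic by blast
qed

end

section \<open>Parametrization by the upper half disk\<close>

text \<open>Made for formulas in polar coordinates: at the centre the angular factor
  \<open>g\<close> has no limit, but it is bounded and multiplied by a radius tending to 0.\<close>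

lemma continuous_on_scaleR_bounded:
  fixes g :: "'a::topological_space \<Rightarrow> 'b::real_normed_vector"
  assumes \<rho>: "continuous_on S \<rho>" and g: "continuous_on {x \<in> S. \<rho> x \<noteq> 0} g"
    and C: "\<And>x. x \<in> S \<Longrightarrow> \<rho> x \<noteq> 0 \<Longrightarrow> norm (g x) \<le> C"
  shows "continuous_on S (\<lambda>x. \<rho> x *\<^sub>R g x)"
  unfolding continuous_on_def
proof
  fix x assume x: "x \<in> S"
  show "((\<lambda>x. \<rho> x *\<^sub>R g x) \<longlongrightarrow> \<rho> x *\<^sub>R g x) (at x within S)"
  proof (cases "\<rho> x = 0")
    case True
    have "((\<lambda>x. \<rho> x *\<^sub>R g x) \<longlongrightarrow> 0) (at x within S)"
    proof (rule Lim_null_comparison)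
      have "norm (\<rho> y *\<^sub>R g y) \<le> \<bar>\<rho> y\<bar> * C" if "y \<in> S" for y
        using C[OF that] by (cases "\<rho> y = 0") (auto intro!: mult_left_mono)
      then show "\<forall>\<^sub>F y in at x within S. norm (\<rho> y *\<^sub>R g y) \<le> \<bar>\<rho> y\<bar> * C"
        unfolding eventually_at_filter by (intro always_eventually) auto
      have "(\<rho> \<longlongrightarrow> 0) (at x within S)" using \<rho> x True unfolding continuous_on_def by force
      then have "((\<lambda>y. \<bar>\<rho> y\<bar> * C) \<longlongrightarrow> \<bar>0\<bar> * C) (at x within S)" by (intro tendsto_intros)
      then show "((\<lambda>y. \<bar>\<rho> y\<bar> * C) \<longlongrightarrow> 0) (at x within S)" by simp
    qed
    then show ?thesis using True by simp
  next
    case False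
    have "openin (top_of_set S) (S \<inter> \<rho> -` (- {0}))"
      using \<rho> by (intro continuous_openin_preimage_gen) auto
    then obtain V where V: "open V" "S \<inter> \<rho> -` (- {0}) = S \<inter> V" unfolding openin_open by blast
    have "at x within S = at x within {x \<in> S. \<rho> x \<noteq> 0}"
      using V x False by (intro at_within_nhd[of x V]) auto
    moreover have "(g \<longlongrightarrow> g x) (at x within {x \<in> S. \<rho> x \<noteq> 0})"
      using g x False unfolding continuous_on_def by blast
    moreover have "(\<rho> \<longlongrightarrow> \<rho> x) (at x within S)" using \<rho> x unfolding continuous_on_def by blast
    ultimately show ?thesis by (simp add: tendsto_scaleR)
  qed
qed

abbreviation upper_disk :: "complex set" where "upper_disk \<equiv> {z. norm z \<le> 1 \<and> 0 \<le> Im z}"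

lemma upper_disk_polar:
  assumes "z \<in> upper_disk"
  obtains r \<theta> where "0 \<le> r" "r \<le> 1" "0 \<le> \<theta>" "\<theta> \<le> pi" "z = of_real r * cis \<theta>" "r = norm z"
proof (rule that[of "norm z" "Arg2pi z"])
  show "0 \<le> norm z" "norm z \<le> 1" "norm z = norm z" using assms by auto
  show "0 \<le> Arg2pi z" "Arg2pi z \<le> pi"
    using assms Arg2pi_ge_0[of z] Arg2pi_le_pi[of z] by auto
  show "z = of_real (norm z) * cis (Arg2pi z)"
    using Arg2pi_eq[of z] unfolding cis_conv_exp .
qed

lemma Arg2pi_polar: "0 < r \<Longrightarrow> 0 \<le> \<theta> \<Longrightarrow> \<theta> \<le> pi \<Longrightarrow> Arg2pi (of_real r * cis \<theta>) = \<theta>"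
  by (rule Arg2pi_unique[of r]) (auto simp: cis_conv_exp intro: le_less_trans[of _ pi])

context ngon
begin

text \<open>Index of the closing side. Written in terms of \<open>nxt\<close>, it is literally the
  same for all parallel polygons.\<close>

definition N :: nat where "N = card (range nxt) - 1"

lemma N_eq: "N = CARD('n) - 1"
  using bij_nxt by (simp add: N_def bij_is_surj)

lemma N_ge_2: "2 \<le> N" and Suc_N: "Suc N = CARD('n)"
  using card_ge_3 by (simp_all add: N_eq)

lemmas W_N = W_last_eq[folded N_eq]
  and region_fan_N = region_fan[folded N_eq]
  and side_N = side_last[folded N_eq]
  and nxt_lbl_N = nxt_lbl_last[folded N_eq]

lemma mid_N: "mid = (W 0 + W N) / 2"
  by (simp add: mid_def N_eq)

text \<open>Polygonal path with \<open>W k\<close> at the integer \<open>k\<close>; up to the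
  parameter \<open>N\<close> it runs through all sides except the closing one.\<close>

definition ppath :: "real \<Rightarrow> complex" where
  "ppath t = W (nat \<lfloor>t\<rfloor>) + (t - of_int \<lfloor>t\<rfloor>) *\<^sub>R (W (Suc (nat \<lfloor>t\<rfloor>)) - W (nat \<lfloor>t\<rfloor>))"

lemma ppath_eq: "0 \<le> s \<Longrightarrow> s \<le> 1 \<Longrightarrow> ppath (real k + s) = W k + s *\<^sub>R (W (Suc k) - W k)"
proof (cases "s = 1")
  case True
  then have "\<lfloor>real k + s\<rfloor> = int (Suc k)" by (simp add: floor_eq_iff)
  then show ?thesis using True by (simp add: ppath_def nat_add_distrib)
next
  case False
  assume "0 \<le> s" "s \<le> 1"
  with False have "\<lfloor>real k + s\<rfloor> = int k" by (simp add: floor_eq_iff)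
  then show ?thesis by (simp add: ppath_def)
qed

lemma ppath_nat: "ppath (real k) = W k"
  using ppath_eq[of 0 k] by simp

lemma continuous_on_ppath: "continuous_on {0..real M} ppath"
proof (induction M)
  case (Suc M)
  have "continuous_on {real M..real (Suc M)} ppath"
  proof -
    have eq: "ppath t = W M + (t - real M) *\<^sub>R (W (Suc M) - W M)" if "t \<in> {real M..real (Suc M)}" for t
      using ppath_eq[of "t - real M" M] that by simp
    have "continuous_on {real M..real (Suc M)} (\<lambda>t. W M + (t - real M) *\<^sub>R (W (Suc M) - W M))"
      by (intro continuous_intros)
    then show ?thesis by (subst continuous_on_cong[OF refl eq])
  qed
  moreover have "{0..real (Suc M)} = {0..real M} \<union> {real M..real (Suc M)}" by auto
  ultimately show ?case using Suc by (simp add: continuous_on_closed_Un)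
qed auto

text \<open>In \<open>orient_ppath\<close> the first point needs a remainder below 1 and the second
  a positive remainder, so that the weight of the outer pair of vertices is positive; hence the two
  decompositions.\<close>

lemma ppath_rep_floor:
  assumes "0 \<le> t" "t < real M"
  obtains k s where "k < M" "0 \<le> s" "s < 1" "t = real k + s"
proof (rule that[of "nat \<lfloor>t\<rfloor>" "t - real (nat \<lfloor>t\<rfloor>)"])
  show "nat \<lfloor>t\<rfloor> < M" using assms by linarith
  show "0 \<le> t - real (nat \<lfloor>t\<rfloor>)" "t - real (nat \<lfloor>t\<rfloor>) < 1" using assms by linarith+
qed simp

lemma ppath_rep_ceil:
  assumes "0 < t" "t \<le> real M"
  obtains k s where "k < M" "0 < s" "s \<le> 1" "t = real k + s"
proof (rule that[of "nat (\<lceil>t\<rceil> - 1)" "t - real (nat (\<lceil>t\<rceil> - 1))"])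
  show "nat (\<lceil>t\<rceil> - 1) < M" using assms by linarith
  show "0 < t - real (nat (\<lceil>t\<rceil> - 1))" "t - real (nat (\<lceil>t\<rceil> - 1)) \<le> 1" using assms by linarith+
qed simp

lemma orient_mid_nonneg: "a \<le> b \<Longrightarrow> b \<le> N \<Longrightarrow> 0 \<le> orient mid (W a) (W b)"
proof -
  assume ab: "a \<le> b" "b \<le> N"
  show ?thesis
  proof (cases "a = b \<or> (a = 0 \<and> b = N)")
    case True
    moreover have "orient mid (W 0) (W N) = 0" unfolding W_N by (simp only: wedge.minus_right wedge_self minus_zero)
    ultimately show ?thesis by auto
  next
    case False
    then have "a < b" "b < CARD('n)" "0 < a \<or> b < CARD('n) - 1" using ab Suc_N by auto
    then show ?thesis by (intro less_imp_le orient_mid_pos)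
  qed
qed

text \<open>For points on different sides the orientation expands into four vertex terms with
  nonnegative weights. At least one is positive unless the points are the two ends of the closing
  side, which are opposite as seen from \<open>mid\<close>.\<close>

lemma orient_ppath:
  assumes t: "0 \<le> t" "t < t'" "t' \<le> real N" and ne: "0 < t \<or> t' < real N"
  shows "0 < orient mid (ppath t) (ppath t')"
proof -
  obtain j s where j: "j < N" "0 \<le> s" "s < 1" "t = real j + s"
    using ppath_rep_floor[of t N] t by auto
  obtain k s' where k: "k < N" "0 < s'" "s' \<le> 1" "t' = real k + s'"
    using ppath_rep_ceil[of t' N] t by auto
  have jk: "j \<le> k" using t j k by linarith
  let ?O = "\<lambda>a b. orient mid (W a) (W b)"
  have P: "ppath t = W j + s *\<^sub>R (W (Suc j) - W j)" "ppath t' = W k + s' *\<^sub>R (W (Suc k) - W k)"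
    unfolding j(4) k(4) by (rule ppath_eq; use j k in simp)+
  have exp: "orient mid (ppath t) (ppath t') =
     (1 - s) * (1 - s') * ?O j k + (1 - s) * s' * ?O j (Suc k) + s * (1 - s') * ?O (Suc j) k + s * s' * ?O (Suc j) (Suc k)"
    unfolding P by (simp add: wedge_eq algebra_simps)
  show ?thesis
  proof (cases "j = k")
    case True
    have "orient mid (ppath t) (ppath t') = (s' - s) * ?O j (Suc j)"
      unfolding P True by (simp add: wedge_eq algebra_simps)
    moreover have "s < s'" using t j k True by simp
    moreover have "0 < ?O j (Suc j)" using j Suc_N by (intro orient_mid_Suc) simp
    ultimately show ?thesis by (simp add: zero_less_mult_iff)
  next
    case False
    then have jk': "Suc j \<le> k" using jk by simp
    have nn: "0 \<le> (1 - s) * (1 - s') * ?O j k" "0 \<le> (1 - s) * s' * ?O j (Suc k)"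
      "0 \<le> s * (1 - s') * ?O (Suc j) k" "0 \<le> s * s' * ?O (Suc j) (Suc k)"
      using j k jk' by (intro mult_nonneg_nonneg orient_mid_nonneg; simp)+
    show ?thesis
    proof (cases "j = 0 \<and> Suc k = N")
      case False
      have "0 < ?O j (Suc k)" using False jk' k Suc_N by (intro orient_mid_pos) auto
      then have "0 < (1 - s) * s' * ?O j (Suc k)" using j k by simp
      then show ?thesis unfolding exp using nn by linarith
    next
      \<comment> \<open>Here the outer pair consists of the two ends of the closing side and
        contributes 0; a point that is not such an end supplies another positive term.\<close>
      case True
      then have "0 < s \<or> s' < 1" using ne j k by (auto simp: of_nat_Suc[symmetric] simp del: of_nat_Suc)
      then show ?thesis
      proof
        assume "0 < s"
        moreover have "0 < ?O (Suc j) (Suc k)" using True jk' k Suc_N by (intro orient_mid_pos) auto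
        ultimately have "0 < s * s' * ?O (Suc j) (Suc k)" using k by simp
        then show ?thesis unfolding exp using nn by linarith
      next
        assume "s' < 1"
        moreover have "0 < ?O j k" using True jk' k Suc_N by (intro orient_mid_pos) auto
        ultimately have "0 < (1 - s) * (1 - s') * ?O j k" using j by simp
        then show ?thesis unfolding exp using nn by linarith
      qed
    qed
  qed
qed

lemma ppath_in_side: "k < N \<Longrightarrow> 0 \<le> s \<Longrightarrow> s \<le> 1 \<Longrightarrow> ppath (real k + s) \<in> side nxt w (lbl k)"
  unfolding ppath_eq side_def in_segment nxt_lbl W_def by (intro exI[of _ s]) (simp add: algebra_simps)

lemma ppath_side: "0 \<le> t \<Longrightarrow> t \<le> real N \<Longrightarrow> \<exists>i. ppath t \<in> side nxt w i"
proof -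
  assume t: "0 \<le> t" "t \<le> real N"
  show ?thesis
  proof (cases "t = 0")
    case True
    then show ?thesis using ppath_in_side[of 0 0] N_ge_2 by auto
  next
    case False
    then obtain k s where "k < N" "0 < s" "s \<le> 1" "t = real k + s" using ppath_rep_ceil[of t N] t by auto
    then show ?thesis using ppath_in_side[of k s] by auto
  qed
qed

lemma ppath_in_region: "0 \<le> t \<Longrightarrow> t \<le> real N \<Longrightarrow> ppath t \<in> region w"
  using ppath_side side_subset_region by blast

lemma ppath_neq_mid: "0 \<le> t \<Longrightarrow> t \<le> real N \<Longrightarrow> ppath t \<noteq> mid"
proof
  assume t: "0 \<le> t" "t \<le> real N" "ppath t = mid"
  show False
  proof (cases "t < real N")
    case True
    then show False using orient_ppath[of t "(t + real N) / 2"] t by (auto simp: field_simps)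
  next
    case False
    then have "t = real N" using t by simp
    then show False using orient_ppath[of 1 t] t N_ge_2 by (auto simp: )
  qed
qed

text \<open>Radial map from \<open>mid\<close>: the polar angle from 0 to \<open>pi\<close> runs
  linearly along \<open>ppath\<close>, each side receiving an arc of \<open>pi / N\<close>, as the
  points \<open>circle_point (2 * N)\<close> require. The diameter goes to the closing side, because
  its two halves point to \<open>W 0\<close> and \<open>W N\<close>.\<close>

definition kap :: "complex \<Rightarrow> complex" where
  "kap z = mid + norm z *\<^sub>R (ppath (real N * Arg2pi z / pi) - mid)"

lemma kap_polar:
  assumes "0 \<le> r" "0 \<le> \<theta>" "\<theta> \<le> pi"
  shows "kap (of_real r * cis \<theta>) = mid + r *\<^sub>R (ppath (real N * \<theta> / pi) - mid)"
  using assms Arg2pi_polar[of r \<theta>] by (cases "r = 0") (auto simp: kap_def norm_mult)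

lemma param_bounds: "0 \<le> \<theta> \<Longrightarrow> \<theta> \<le> pi \<Longrightarrow> 0 \<le> real N * \<theta> / pi \<and> real N * \<theta> / pi \<le> real N"
  by (auto simp: divide_le_eq intro!: mult_left_mono)

lemma continuous_on_kap: "continuous_on upper_disk kap"
proof -
  have "compact (ppath ` {0..real N})" by (intro compact_continuous_image continuous_on_ppath) simp
  then have "bounded (ppath ` {0..real N})" by (rule compact_imp_bounded)
  then obtain C where C: "\<And>t. t \<in> {0..real N} \<Longrightarrow> norm (ppath t) \<le> C"
    unfolding bounded_iff by blast
  have b: "real N * Arg2pi z / pi \<in> {0..real N}" if "z \<in> upper_disk" for z
    using param_bounds[of "Arg2pi z"] that Arg2pi_ge_0[of z] Arg2pi_le_pi[of z] by auto
  have "continuous_on (upper_disk - {0}) (\<lambda>z. real N * Arg2pi z / pi)"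
    by (intro continuous_intros continuous_on_subset[OF continuous_on_upperhalf_Arg2pi]) auto
  then have "continuous_on (upper_disk - {0}) (\<lambda>z. ppath (real N * Arg2pi z / pi))"
    by (rule continuous_on_compose2[OF continuous_on_ppath[of N]]) (use b in blast)
  then have "continuous_on (upper_disk - {0}) (\<lambda>z. ppath (real N * Arg2pi z / pi) - mid)"
    by (intro continuous_on_diff continuous_on_const)
  moreover have "norm (ppath (real N * Arg2pi z / pi) - mid) \<le> C + norm mid" if "z \<in> upper_disk" for z
    using C[OF b[OF that]] norm_triangle_ineq4[of "ppath (real N * Arg2pi z / pi)" mid] by linarith
  moreover have nz: "{z \<in> upper_disk. norm z \<noteq> 0} = upper_disk - {0}" by auto
  ultimately have "continuous_on upper_disk (\<lambda>z. norm z *\<^sub>R (ppath (real N * Arg2pi z / pi) - mid))"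
    using continuous_on_scaleR_bounded[of upper_disk norm "\<lambda>z. ppath (real N * Arg2pi z / pi) - mid" "C + norm mid"]
    unfolding nz by (auto intro: continuous_intros)
  then show ?thesis unfolding kap_def by (intro continuous_on_add continuous_on_const)
qed

text \<open>By \<open>orient_ppath\<close> the image determines the direction from
  \<open>mid\<close>, and then the radius. The exceptional pair \<open>t = 0\<close>,
  \<open>t' = N\<close> gives opposite directions.\<close>

lemma inj_on_kap: "inj_on kap upper_disk"
proof (rule inj_onI)
  fix z z' assume z: "z \<in> upper_disk" and z': "z' \<in> upper_disk" and eq: "kap z = kap z'"
  obtain r \<theta> where r: "0 \<le> r" "r \<le> 1" "0 \<le> \<theta>" "\<theta> \<le> pi" "z = of_real r * cis \<theta>" using upper_disk_polar[OF z] by metis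
  obtain r' \<theta>' where r': "0 \<le> r'" "r' \<le> 1" "0 \<le> \<theta>'" "\<theta>' \<le> pi" "z' = of_real r' * cis \<theta>'" using upper_disk_polar[OF z'] by metis
  define t t' where "t = real N * \<theta> / pi" and "t' = real N * \<theta>' / pi"
  have t: "0 \<le> t" "t \<le> real N" "0 \<le> t'" "t' \<le> real N" using r r' param_bounds by (auto simp: t_def t'_def)
  have e: "r *\<^sub>R (ppath t - mid) = r' *\<^sub>R (ppath t' - mid)"
    using eq r r' kap_polar[of r \<theta>] kap_polar[of r' \<theta>'] by (simp add: t_def t'_def)
  show "z = z'"
  proof (cases "r = 0 \<or> r' = 0")
    case True
    then show ?thesis using e ppath_neq_mid[OF t(1,2)] ppath_neq_mid[OF t(3,4)] r r' by auto
  next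
    case False
    have no: False if "r *\<^sub>R (ppath t - mid) = r' *\<^sub>R (ppath t' - mid)" "0 < r" "0 < r'" "0 \<le> t" "t < t'" "t' \<le> real N" for r r' t t'
    proof (cases "t = 0 \<and> t' = real N")
      case True
      then have "r *\<^sub>R (W 0 - mid) = r' *\<^sub>R (W N - mid)"
        using that(1) ppath_nat[of 0] ppath_nat[of N] by simp
      also have "\<dots> = - (r' *\<^sub>R (W 0 - mid))" by (simp only: W_N scaleR_minus_right)
      finally have "(r + r') *\<^sub>R (W 0 - mid) = 0" by (simp only: scaleR_add_left) simp
      then show False using that W_neq_mid[of 0] by auto
    next
      case False
      then have "0 < r * r' * orient mid (ppath t) (ppath t')" using orient_ppath[of t t'] that by auto
      also have "\<dots> = wedge (r *\<^sub>R (ppath t - mid)) (r' *\<^sub>R (ppath t' - mid))" by (simp add: wedge.scaleR_left wedge.scaleR_right)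
      also have "\<dots> = 0" unfolding that(1) by simp
      finally show False by simp
    qed
    have "t = t'"
      using no[OF e] no[OF e[symmetric]] False r r' t by (metis less_le linorder_neqE_linordered_idom)
    then have "\<theta> = \<theta>'" using N_ge_2 by (simp add: t_def t'_def)
    moreover have "r = r'" using e \<open>t = t'\<close> ppath_neq_mid[OF t(1,2)] by auto
    ultimately show ?thesis using r r' by simp
  qed
qed

lemma kap_in_region: "z \<in> upper_disk \<Longrightarrow> kap z \<in> region w"
proof -
  assume z: "z \<in> upper_disk"
  obtain r \<theta> where r: "0 \<le> r" "r \<le> 1" "0 \<le> \<theta>" "\<theta> \<le> pi" "z = of_real r * cis \<theta>" using upper_disk_polar[OF z] by metis
  have "kap z = (1 - r) *\<^sub>R mid + r *\<^sub>R ppath (real N * \<theta> / pi)"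
    unfolding r(5) kap_polar[OF r(1,3,4)] by (simp add: algebra_simps)
  moreover have "ppath (real N * \<theta> / pi) \<in> region w"
    using param_bounds[OF r(3,4)] by (intro ppath_in_region) auto
  ultimately show ?thesis
    using convexD_alt[OF convex_region mid_in_region, of "ppath (real N * \<theta> / pi)" r] r(1,2) by simp
qed

lemma kap_image: "kap ` upper_disk = region w"
proof
  show "kap ` upper_disk \<subseteq> region w" using kap_in_region by blast
  show "region w \<subseteq> kap ` upper_disk"
  proof
    fix x assume "x \<in> region w"
    then obtain k where k: "k < N" "x \<in> convex hull {mid, W k, W (Suc k)}"
      unfolding region_fan_N by blast
    obtain a b c where abc: "0 \<le> a" "0 \<le> b" "0 \<le> c" "a + b + c = 1" "x = a *\<^sub>R mid + b *\<^sub>R W k + c *\<^sub>R W (Suc k)"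
      using k(2) unfolding convex_hull_3 by blast
    \<comment> \<open>Polar data from barycentric coordinates: \<open>r\<close> is the weight away
      from \<open>mid\<close>, and \<open>c / r\<close> the position along the side.\<close>
    define r where "r = b + c"
    have xr: "x = mid + (b *\<^sub>R (W k - mid) + c *\<^sub>R (W (Suc k) - mid))"
    proof -
      have "a = 1 - b - c" using abc by simp
      show ?thesis unfolding abc(5) \<open>a = 1 - b - c\<close> by (simp add: algebra_simps)
    qed
    show "x \<in> kap ` upper_disk"
    proof (cases "r = 0")
      case True
      then have "b = 0" "c = 0" using abc r_def by auto
      then have "x = kap 0" using xr by (simp add: kap_def)
      then show ?thesis by (intro image_eqI[of _ _ 0]) auto
    next
      case False
      then have r: "0 < r" "r \<le> 1" using abc r_def by auto
      define s where "s = c / r"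
      have s: "0 \<le> s" "s \<le> 1" using abc r by (auto simp: s_def r_def)
      define \<theta> where "\<theta> = pi * (real k + s) / real N"
      have N0: "0 < real N" using N_ge_2 by simp
      have "real k + s \<le> real N" using k(1) s by linarith
      then have \<theta>: "0 \<le> \<theta>" "\<theta> \<le> pi" "real N * \<theta> / pi = real k + s"
        using s N0 by (auto simp: \<theta>_def divide_le_eq)
      have cr: "c = r * s" "b = r * (1 - s)" using r by (simp_all add: s_def r_def field_simps)
      have "kap (of_real r * cis \<theta>) = mid + r *\<^sub>R (W k + s *\<^sub>R (W (Suc k) - W k) - mid)"
        using kap_polar[of r \<theta>] r \<theta> ppath_eq[OF s, of k] by simp
      also have "\<dots> = x" unfolding xr cr by (simp add: algebra_simps)
      finally have xk: "x = kap (of_real r * cis \<theta>)" by (rule sym)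
      have "of_real r * cis \<theta> \<in> upper_disk"
        using r \<theta> by (auto simp: norm_mult sin_ge_zero)
      then show ?thesis by (rule image_eqI[where f = kap, OF xk])
    qed
  qed
qed

lemma kap_real: "x \<in> {-1..1} \<Longrightarrow> kap (of_real x) = mid + x *\<^sub>R (W 0 - mid)"
proof (cases "0 \<le> x")
  case True
  then show ?thesis using kap_polar[of x 0] ppath_nat[of 0] by simp
next
  case False
  then have x: "of_real x = of_real (- x) * cis pi" by simp
  have "kap (of_real x) = mid + (- x) *\<^sub>R (W N - mid)"
    unfolding x using False kap_polar[of "- x" pi] ppath_nat[of N] by simp
  then show ?thesis unfolding W_N by (simp only: scaleR_minus_left scaleR_minus_right minus_minus)
qed

lemma last_side_eq: "side nxt w (lbl N) = kap ` (of_real ` {-1..1})"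
proof -
  have s: "side nxt w (lbl N) = closed_segment (W N) (W 0)"
    using side_N by (simp add: side_def)
  have seg: "(1 - u) *\<^sub>R W N + u *\<^sub>R W 0 = mid + (2 * u - 1) *\<^sub>R (W 0 - mid)" for u
    by (simp add: mid_N scaleR_conv_of_real field_simps)
  have "closed_segment (W N) (W 0) = (\<lambda>x. mid + x *\<^sub>R (W 0 - mid)) ` {-1..1}"
  proof (intro equalityI subsetI)
    fix y assume "y \<in> closed_segment (W N) (W 0)"
    then obtain u where "0 \<le> u" "u \<le> 1" "y = mid + (2 * u - 1) *\<^sub>R (W 0 - mid)" unfolding in_segment seg by blast
    then show "y \<in> (\<lambda>x. mid + x *\<^sub>R (W 0 - mid)) ` {-1..1}" by (intro image_eqI[of _ _ "2 * u - 1"]) auto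
  next
    fix y assume "y \<in> (\<lambda>x. mid + x *\<^sub>R (W 0 - mid)) ` {-1..1}"
    then obtain x where x: "x \<in> {-1..1}" "y = mid + x *\<^sub>R (W 0 - mid)" by blast
    moreover have "2 * ((x + 1) / 2) - 1 = x" by (simp add: field_simps)
    ultimately have "y = (1 - (x + 1) / 2) *\<^sub>R W N + ((x + 1) / 2) *\<^sub>R W 0" by (simp only: seg)
    then show "y \<in> closed_segment (W N) (W 0)" unfolding in_segment using x by (intro exI[of _ "(x + 1) / 2"]) auto
  qed
  then show ?thesis unfolding s image_image using kap_real by auto
qed

lemma kap_boundary_point:
  assumes "k < N" "0 \<le> s" "s \<le> 1"
  shows "kap (cis (pi * (real k + s) / real N)) = W k + s *\<^sub>R (W (Suc k) - W k)"
    "0 \<le> pi * (real k + s) / real N" "pi * (real k + s) / real N \<le> pi"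
proof -
  let ?\<theta> = "pi * (real k + s) / real N"
  have "real k + s \<le> real N" using assms by linarith
  moreover have "0 < real N" using N_ge_2 by simp
  ultimately show \<theta>: "0 \<le> ?\<theta>" "?\<theta> \<le> pi" using assms by (auto simp: divide_le_eq)
  have "real N * ?\<theta> / pi = real k + s" using \<open>0 < real N\<close> by simp
  then show "kap (cis ?\<theta>) = W k + s *\<^sub>R (W (Suc k) - W k)"
    using kap_polar[of 1 ?\<theta>] \<theta> ppath_eq[OF assms(2,3), of k] by simp
qed

lemma side_eq_kap: "k < N \<Longrightarrow> side nxt w (lbl k) = kap ` ((\<lambda>s. cis (pi * (real k + s) / real N)) ` {0..1})"
proof -
  assume k: "k < N"
  have "side nxt w (lbl k) = closed_segment (W k) (W (Suc k))" by (simp add: side_def W_def nxt_lbl)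
  also have "\<dots> = (\<lambda>s. W k + s *\<^sub>R (W (Suc k) - W k)) ` {0..1}"
    unfolding closed_segment_def by (auto simp: algebra_simps)
  also have "\<dots> = (\<lambda>s. kap (cis (pi * (real k + s) / real N))) ` {0..1}"
    using kap_boundary_point[OF k] by (intro image_cong) auto
  finally show ?thesis by (simp add: image_image)
qed

lemma kap_last_pos:
  assumes "0 < t" "t < real N"
  shows "0 < orient (w (lbl N)) (w i0) (ppath t)"
proof -
  obtain k s where k: "k < N" "0 \<le> s" "s < 1" "t = real k + s" using ppath_rep_floor[of t N] assms by auto
  let ?o = "\<lambda>x. orient (w (lbl N)) (w i0) x"
  have nn: "0 \<le> ?o (W j)" for j using left_ge[of "lbl N" "lbl j"] nxt_lbl_N by (simp add: W_def)
  have pos: "0 < ?o (W j)" if "0 < j" "j < N" for j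
  proof -
    have "lbl j \<noteq> lbl N" "lbl j \<noteq> lbl 0" by (subst lbl_eq_iff; use that Suc_N in simp)+
    then show ?thesis using left[of "lbl j" "lbl N"] nxt_lbl_N by (simp add: W_def)
  qed
  have "?o (ppath t) = (1 - s) * ?o (W k) + s * ?o (W (Suc k))"
  proof -
    have pe: "ppath (real k + s) = W k + s *\<^sub>R (W (Suc k) - W k)" by (rule ppath_eq) (use k in auto)
    show ?thesis unfolding k(4) pe by (simp add: wedge_eq algebra_simps)
  qed
  also have "\<dots> > 0"
  proof (cases "k = 0")
    case True
    then have "0 < s * ?o (W (Suc k))" using assms k pos[of "Suc 0"] N_ge_2 by simp
    moreover have "0 \<le> (1 - s) * ?o (W k)" using nn k by simp
    ultimately show ?thesis by linarith
  next
    case False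
    then have "0 < (1 - s) * ?o (W k)" using k pos[of k] by simp
    moreover have "0 \<le> s * ?o (W (Suc k))" using nn k by simp
    ultimately show ?thesis by linarith
  qed
  finally show ?thesis .
qed

text \<open>\<open>kap z\<close> is a convex combination of \<open>mid\<close> and a point of the
  path. The former is strictly inside every side but the closing one, the latter strictly inside the
  closing one, so positive weights give an interior point.\<close>

lemma kap_upper_open:
  assumes "z \<in> upper_disk" "0 < Im z"
  shows "0 < orient (w (lbl N)) (w i0) (kap z)"
    and "norm z < 1 \<Longrightarrow> kap z \<in> interior (region w)"
proof -
  obtain r \<theta> where r: "0 \<le> r" "r \<le> 1" "0 \<le> \<theta>" "\<theta> \<le> pi" "z = of_real r * cis \<theta>" "r = norm z"
    using upper_disk_polar[OF assms(1)] by metis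
  have "0 < r * sin \<theta>" using assms(2) unfolding r(5) by simp
  then have r0: "0 < r" "sin \<theta> > 0" using r(1) by (auto simp: zero_less_mult_iff)
  have "\<theta> \<noteq> 0" "\<theta> \<noteq> pi" using r0(2) by auto
  then have \<theta>: "0 < \<theta>" "\<theta> < pi" using r(3,4) by auto
  define t where "t = real N * \<theta> / pi"
  have t: "0 < t" "t < real N" using \<theta> N_ge_2 by (auto simp: t_def divide_less_eq)
  have kz: "kap z = (1 - r) *\<^sub>R mid + r *\<^sub>R ppath t"
    unfolding r(5) using kap_polar[OF r(1,3,4)] by (simp add: t_def algebra_simps)
  have comb: "orient a b ((1 - r) *\<^sub>R x + r *\<^sub>R y) = (1 - r) * orient a b x + r * orient a b y" for a b x y
    by (simp add: wedge_eq algebra_simps)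
  have "orient (w (lbl N)) (w i0) mid = 0"
    using side_N W_N by (simp add: wedge_eq algebra_simps mid_N field_simps)
  then show last: "0 < orient (w (lbl N)) (w i0) (kap z)"
    unfolding kz comb using kap_last_pos[OF t] r0 by simp
  assume "norm z < 1"
  then have r1: "r < 1" using r(6) by simp
  have "0 < orient (w i) (w (nxt i)) (kap z)" for i
  proof -
    obtain k where k: "k < CARD('n)" "i = lbl k" by (rule lbl_exhaust)
    show ?thesis
    proof (cases "k = N")
      case True
      then show ?thesis using last k nxt_lbl_N by simp
    next
      case False
      then have "0 < orient mid (W k) (W (Suc k))" using k False Suc_N by (intro orient_mid_Suc) auto
      then have "0 < orient (w i) (w (nxt i)) mid" unfolding orient_rotate[of _ mid] k(2) nxt_lbl W_def[symmetric]
        by (metis orient_rotate)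
      moreover have "0 \<le> orient (w i) (w (nxt i)) (ppath t)" using ppath_in_region[of t] t by (simp add: region_eq)
      ultimately show ?thesis unfolding kz comb using r0 r1 by (intro add_pos_nonneg) auto
    qed
  qed
  then show "kap z \<in> interior (region w)" by (simp add: interior_region)
qed

lemma kap_frontier_iff:
  assumes "z \<in> upper_disk"
  shows "kap z \<in> frontier (region w) \<longleftrightarrow> norm z = 1 \<or> Im z = 0"
proof
  assume "kap z \<in> frontier (region w)"
  then have "kap z \<notin> interior (region w)" by (simp add: frontier_def)
  then show "norm z = 1 \<or> Im z = 0" using kap_upper_open(2)[of z] assms by force
next
  assume *: "norm z = 1 \<or> Im z = 0"
  show "kap z \<in> frontier (region w)"
  proof (cases "Im z = 0")
    case True
    then have z: "z = of_real (Re z)" by (simp add: complex_eq_iff)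
    moreover have "Re z \<in> {-1..1}" using assms abs_Re_le_cmod[of z] by auto
    ultimately have "kap z \<in> side nxt w (lbl N)" unfolding last_side_eq by (metis imageI)
    then show ?thesis unfolding frontier_region by blast
  next
    case False
    then have "norm z = 1" using * by simp
    then obtain \<theta> where \<theta>: "0 \<le> \<theta>" "\<theta> \<le> pi" "z = of_real 1 * cis \<theta>" using upper_disk_polar[OF assms] by metis
    then have "kap z = ppath (real N * \<theta> / pi)" using kap_polar[of 1 \<theta>] by simp
    then show ?thesis using ppath_side[of "real N * \<theta> / pi"] param_bounds[OF \<theta>(1,2)] by (auto simp: frontier_region)
  qed
qed

end

section \<open>Local degree of injective maps of the plane\<close>

lemma path_comp_circlepath:
  assumes "continuous_on U F" "cball z R \<subseteq> U" "0 \<le> R"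
  shows "path (F \<circ> circlepath z R)" "pathfinish (F \<circ> circlepath z R) = pathstart (F \<circ> circlepath z R)"
    "path_image (F \<circ> circlepath z R) = F ` sphere z R"
proof -
  have *: "path_image (circlepath z R) = sphere z R" using assms(3) by simp
  have "sphere z R \<subseteq> U" using assms(2) sphere_cball by blast
  then show "path (F \<circ> circlepath z R)"
    using assms(1) * by (intro path_continuous_image) (auto intro: continuous_on_subset)
  show "pathfinish (F \<circ> circlepath z R) = pathstart (F \<circ> circlepath z R)"
    by (simp add: pathfinish_compose pathstart_compose)
  show "path_image (F \<circ> circlepath z R) = F ` sphere z R"
    using * by (simp add: path_image_compose)
qed

text \<open>The small circle expands linearly to the large one without meeting \<open>z'\<close>,
  and injectivity lets \<open>F\<close> carry this homotopy. Then the base point moves from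
  \<open>F z'\<close> to \<open>F z\<close> inside the connected image of the open disk, which
  misses the image of the large circle.\<close>

lemma winding_number_inner_circle:
  assumes F: "continuous_on U F" "inj_on F U" and U: "cball z R \<subseteq> U"
    and r: "0 < r" "dist z z' + r < R"
  shows "winding_number (F \<circ> circlepath z' r) (F z') = winding_number (F \<circ> circlepath z R) (F z)"
proof -
  have R: "0 < R" using r zero_le_dist[of z z'] by linarith
  have z': "z' \<in> ball z R" using r by simp
  have sub: "cball z' r \<subseteq> cball z R"
  proof
    fix y assume "y \<in> cball z' r"
    then show "y \<in> cball z R" using r dist_triangle[of z y z'] by auto
  qed
  have "homotopic_loops (cball z R - {z'}) (circlepath z' r) (circlepath z R)"
  proof (rule homotopic_loops_linear)
    fix t :: real assume "t \<in> {0..1}"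
    define e where "e = exp (2 * of_real pi * \<i> * of_real t)"
    have e: "norm e = 1" by (simp add: e_def norm_exp_eq_Re)
    have c: "circlepath z' r t = z' + of_real r * e" "circlepath z R t = z + of_real R * e"
      by (simp_all add: circlepath e_def)
    have "circlepath z' r t \<in> cball z R" "circlepath z R t \<in> cball z R"
      using sub R r e by (auto simp: c dist_norm norm_mult subset_iff)
    then have 1: "closed_segment (circlepath z' r t) (circlepath z R t) \<subseteq> cball z R"
      by (intro closed_segment_subset) auto
    moreover have "z' \<notin> closed_segment (circlepath z' r t) (circlepath z R t)"
    proof
      assume "z' \<in> closed_segment (circlepath z' r t) (circlepath z R t)"
      then obtain u where u: "0 \<le> u" "u \<le> 1" "z' = (1 - u) *\<^sub>R (z' + of_real r * e) + u *\<^sub>R (z + of_real R * e)"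
        unfolding in_segment c by blast
      then have "of_real ((1 - u) * r + u * R) * e = of_real u * (z' - z)"
        by (simp add: scaleR_conv_of_real algebra_simps)
      then have "norm (of_real ((1 - u) * r + u * R) * e) = norm (of_real u * (z' - z))" by (rule arg_cong)
      then have eq: "\<bar>(1 - u) * r + u * R\<bar> = u * dist z z'"
        using u e by (simp only: norm_mult norm_of_real) (simp add: dist_norm norm_minus_commute)
      have "0 \<le> (1 - u) * r" using u r by simp
      moreover have "u * dist z z' \<le> u * (R - r)" using u r by (intro mult_left_mono) auto
      ultimately have "(1 - u) * r + u * r \<le> 0" using eq by (simp add: algebra_simps)
      then show False using r by (simp add: algebra_simps)
    qed
    ultimately show "closed_segment (circlepath z' r t) (circlepath z R t) \<subseteq> cball z R - {z'}" by blast
  qed auto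
  then have "homotopic_loops (- {F z'}) (F \<circ> circlepath z' r) (F \<circ> circlepath z R)"
  proof (rule homotopic_loops_continuous_image)
    show "continuous_on (cball z R - {z'}) F" using F U by (blast intro: continuous_on_subset)
    show "F \<in> (cball z R - {z'}) \<rightarrow> - {F z'}"
    proof (rule Pi_I)
      fix x assume "x \<in> cball z R - {z'}"
      moreover have "z' \<in> U" using z' U ball_subset_cball by blast
      ultimately show "F x \<in> - {F z'}" using inj_onD[OF F(2), of x z'] U by blast
    qed
  qed
  then have "winding_number (F \<circ> circlepath z' r) (F z') = winding_number (F \<circ> circlepath z R) (F z')"
    by (rule winding_number_homotopic_loops)
  also have "\<dots> = winding_number (F \<circ> circlepath z R) (F z)"
  proof -
    note p = path_comp_circlepath[OF F(1) U less_imp_le[OF R]]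
    have "ball z R \<subseteq> U" using U ball_subset_cball by blast
    then have "connected (F ` ball z R)"
      by (intro connected_continuous_image continuous_on_subset[OF F(1)]) simp_all
    moreover have "F ` ball z R \<inter> path_image (F \<circ> circlepath z R) = {}"
    proof -
      have "ball z R \<subseteq> U" "sphere z R \<subseteq> U" using U by auto
      then have "F ` (ball z R \<inter> sphere z R) = F ` ball z R \<inter> F ` sphere z R"
        using F(2) by (intro inj_on_image_Int)
      moreover have "ball z R \<inter> sphere z R = {}" by auto
      ultimately show ?thesis unfolding p(3) by simp
    qed
    ultimately have "winding_number (F \<circ> circlepath z R) constant_on F ` ball z R"
      by (intro winding_number_constant p(1,2))
    then show ?thesis using z' R unfolding constant_on_def by (metis centre_in_ball imageI)
  qed
  finally show ?thesis .
qed

text \<open>All radii give the same winding number, so a single circle decides.\<close>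

lemma orientation_preserving_at_iff:
  assumes F: "continuous_on U F" "inj_on F U" and U: "cball z R \<subseteq> U" "0 < R"
  shows "orientation_preserving_at F z \<longleftrightarrow> winding_number (F \<circ> circlepath z R) (F z) = 1"
proof -
  have eq: "winding_number (F \<circ> circlepath z r) (F z) = winding_number (F \<circ> circlepath z R) (F z)"
    if "0 < r" "r < R" for r
    by (rule winding_number_inner_circle[OF F U(1)]) (use that in auto)
  have nin: "F z \<notin> path_image (F \<circ> circlepath z r)" if "0 < r" "r < R" for r
  proof -
    have sub: "cball z r \<subseteq> U" using that U by auto
    then have "z \<in> U" "sphere z r \<subseteq> U" using that by auto
    moreover have "z \<notin> sphere z r" using that by simp
    ultimately have "F z \<notin> F ` sphere z r" using F(2) by (meson inj_on_image_mem_iff)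
    then show ?thesis using path_comp_circlepath(3)[OF F(1) sub] that by simp
  qed
  show ?thesis
  proof
    assume "orientation_preserving_at F z"
    then obtain \<epsilon> where e: "\<epsilon> > 0" "\<And>r. 0 < r \<Longrightarrow> r < \<epsilon> \<Longrightarrow> winding_number (F \<circ> circlepath z r) (F z) = 1"
      unfolding orientation_preserving_at_def by blast
    define r where "r = min \<epsilon> R / 2"
    have "0 < r" "r < \<epsilon>" "r < R" using e U by (auto simp: r_def min_def)
    then show "winding_number (F \<circ> circlepath z R) (F z) = 1" using eq[of r] e(2)[of r] by simp
  next
    assume "winding_number (F \<circ> circlepath z R) (F z) = 1"
    then show "orientation_preserving_at F z"
      unfolding orientation_preserving_at_def using eq nin U by (intro exI[of _ R]) auto
  qed
qed

text \<open>By \<open>winding_number_inner_circle\<close> the degree at all points of a small ball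
  is read off from one surrounding circle, so it is locally constant.\<close>

lemma orientation_preserving_on_connected:
  assumes F: "continuous_on U F" "inj_on F U" and U: "open U" "connected U"
    and z0: "z0 \<in> U" "orientation_preserving_at F z0" and z: "z \<in> U"
  shows "orientation_preserving_at F z"
proof (rule connected_induction_simple[where P = "orientation_preserving_at F", OF U(2) z0(1) z z0(2)])
  fix a assume "a \<in> U"
  then obtain R where R: "0 < R" "cball a R \<subseteq> U" using U(1) open_contains_cball by blast
  have "orientation_preserving_at F x \<longleftrightarrow> winding_number (F \<circ> circlepath a R) (F a) = 1" if "x \<in> ball a R" for x
  proof -
    define r where "r = (R - dist a x) / 2"
    have r: "0 < r" "dist a x + r < R" using that by (auto simp: r_def field_simps)
    have "cball x r \<subseteq> cball a R"
    proof
      fix y assume "y \<in> cball x r"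
      then show "y \<in> cball a R" using r dist_triangle[of a y x] by auto
    qed
    then have "cball x r \<subseteq> U" using R by blast
    then show ?thesis
      using orientation_preserving_at_iff[OF F _ r(1)] winding_number_inner_circle[OF F R(2) r] by simp
  qed
  moreover have "openin (top_of_set U) (ball a R)"
    using R ball_subset_cball by (intro open_subset) auto
  ultimately show "\<exists>T. openin (top_of_set U) T \<and> a \<in> T \<and>
      (\<forall>x\<in>T. \<forall>y\<in>T. orientation_preserving_at F x \<longrightarrow> orientation_preserving_at F y)"
    using R by (intro exI[of _ "ball a R"]) auto
qed

text \<open>Equality of winding numbers yields a homotopy in the whole punctured plane, whereas
  \<open>F\<close> is controlled only on \<open>U\<close>; so a retraction onto a small punctured
  disk in \<open>U\<close> is inserted before \<open>F\<close>.\<close>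

lemma orientation_preserving_at_compose:
  assumes G: "continuous_on A G" "inj_on G A" "open A" "z \<in> A" "orientation_preserving_at G z"
    and F: "continuous_on U F" "inj_on F U" "open U" "G z \<in> U" "orientation_preserving_at F (G z)"
  shows "orientation_preserving_at (F \<circ> G) z"
proof -
  obtain \<rho> where \<rho>: "0 < \<rho>" "cball (G z) \<rho> \<subseteq> U" using F open_contains_cball by blast
  have "open (A \<inter> G -` ball (G z) \<rho>)" using G by (intro continuous_open_preimage) auto
  moreover have "z \<in> A \<inter> G -` ball (G z) \<rho>" using G \<rho> by simp
  ultimately obtain r where r: "0 < r" "cball z r \<subseteq> A \<inter> G -` ball (G z) \<rho>" using open_contains_cball by blast
  let ?y = "G z" and ?\<gamma> = "G \<circ> circlepath z r"
  have rA: "cball z r \<subseteq> A" using r by blast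
  note p = path_comp_circlepath[OF G(1) rA less_imp_le[OF r(1)]]
  have w1: "winding_number ?\<gamma> ?y = 1" using orientation_preserving_at_iff[OF G(1,2) rA r(1)] G(5) by blast
  have im: "path_image ?\<gamma> \<subseteq> ball ?y \<rho> - {?y}"
  proof -
    have "sphere z r \<subseteq> cball z r" "z \<in> cball z r" "z \<notin> sphere z r" using r by auto
    then have "z \<in> A" "sphere z r \<subseteq> A" "G ` sphere z r \<subseteq> ball (G z) \<rho>" using r(2) by blast+
    moreover have "G z \<notin> G ` sphere z r"
      using G(2) calculation \<open>z \<notin> sphere z r\<close> by (meson inj_on_image_mem_iff)
    ultimately show ?thesis unfolding p(3) by blast
  qed
  have "winding_number (circlepath ?y \<rho>) ?y = 1" using \<rho> by (simp add: winding_number_circlepath_centre)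
  then have h: "homotopic_loops (- {?y}) ?\<gamma> (circlepath ?y \<rho>)"
    using winding_number_homotopic_loops_eq[of ?\<gamma> ?y "circlepath ?y \<rho>"] w1 p im \<rho> by auto
  \<comment> \<open>Radial retraction of the punctured plane onto the punctured closed disk of
    radius \<rho>; it is the identity on both loops.\<close>
  define ret where "ret = (\<lambda>y. ?y + min 1 (\<rho> / norm (y - ?y)) *\<^sub>R (y - ?y))"
  have ret_id: "ret y = y" if "y \<in> cball ?y \<rho>" "y \<noteq> ?y" for y
  proof -
    have "1 \<le> \<rho> / norm (y - ?y)" using that by (simp add: dist_norm norm_minus_commute)
    then show ?thesis by (simp add: ret_def)
  qed
  have ret_in: "ret y \<in> cball ?y \<rho> - {?y}" if "y \<noteq> ?y" for y
  proof -
    have n: "0 < norm (y - ?y)" using that by simp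
    then have m: "0 < min 1 (\<rho> / norm (y - ?y))" using \<rho> by simp
    have "min 1 (\<rho> / norm (y - ?y)) * norm (y - ?y) \<le> \<rho>"
    proof -
      have "min 1 (\<rho> / norm (y - ?y)) * norm (y - ?y) \<le> (\<rho> / norm (y - ?y)) * norm (y - ?y)"
        using n by (intro mult_right_mono) auto
      then show ?thesis using n by simp
    qed
    then have "norm (min 1 (\<rho> / norm (y - ?y)) *\<^sub>R (y - ?y)) \<le> \<rho>" by (simp only: norm_scaleR abs_of_pos[OF m])
    moreover have "min 1 (\<rho> / norm (y - ?y)) *\<^sub>R (y - ?y) \<noteq> 0"
      unfolding scaleR_eq_0_iff using m n by (metis less_irrefl norm_zero)
    ultimately show ?thesis by (simp add: ret_def dist_norm)
  qed
  have cont: "continuous_on (- {?y}) (F \<circ> ret)"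
  proof (rule continuous_on_compose)
    show "continuous_on (- {?y}) ret" unfolding ret_def by (intro continuous_intros) auto
    have "ret ` (- {?y}) \<subseteq> U" using ret_in \<rho> by blast
    then show "continuous_on (ret ` (- {?y})) F" using F(1) continuous_on_subset by blast
  qed
  have maps: "F \<circ> ret \<in> - {?y} \<rightarrow> - {F ?y}"
  proof (rule Pi_I)
    fix y assume "y \<in> - {?y}"
    then have "ret y \<in> cball ?y \<rho>" "ret y \<noteq> ?y" using ret_in by auto
    then show "(F \<circ> ret) y \<in> - {F ?y}" using F(2,4) \<rho> by (auto simp: inj_on_def)
  qed
  have "winding_number ((F \<circ> ret) \<circ> ?\<gamma>) (F ?y) = winding_number ((F \<circ> ret) \<circ> circlepath ?y \<rho>) (F ?y)"
    by (rule winding_number_homotopic_loops[OF homotopic_loops_continuous_image[OF h cont maps]])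
  moreover have "winding_number ((F \<circ> ret) \<circ> ?\<gamma>) (F ?y) = winding_number ((F \<circ> G) \<circ> circlepath z r) (F ?y)"
  proof (rule winding_number_cong)
    fix t :: real assume "0 \<le> t" "t \<le> 1"
    then have "t \<in> {0..1}" by simp
    then have "?\<gamma> t \<in> ball ?y \<rho> - {?y}" using im unfolding path_image_def by blast
    then have "ret (?\<gamma> t) = ?\<gamma> t" using ball_subset_cball by (intro ret_id) auto
    then show "((F \<circ> ret) \<circ> ?\<gamma>) t = ((F \<circ> G) \<circ> circlepath z r) t" by simp
  qed
  moreover have "winding_number ((F \<circ> ret) \<circ> circlepath ?y \<rho>) (F ?y) = winding_number (F \<circ> circlepath ?y \<rho>) (F ?y)"
  proof (rule winding_number_cong)
    fix t :: real assume "0 \<le> t" "t \<le> 1"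
    then have "t \<in> {0..1}" by simp
    then have "circlepath ?y \<rho> t \<in> path_image (circlepath ?y \<rho>)" unfolding path_image_def by blast
    then have "circlepath ?y \<rho> t \<in> sphere ?y \<rho>" using \<rho> by simp
    then have "ret (circlepath ?y \<rho> t) = circlepath ?y \<rho> t" using \<rho> by (intro ret_id) auto
    then show "((F \<circ> ret) \<circ> circlepath ?y \<rho>) t = (F \<circ> circlepath ?y \<rho>) t" by simp
  qed
  moreover have "winding_number (F \<circ> circlepath ?y \<rho>) (F ?y) = 1"
    using orientation_preserving_at_iff[OF F(1,2) \<rho>(2,1)] F(5) by blast
  ultimately have w: "winding_number ((F \<circ> G) \<circ> circlepath z r) ((F \<circ> G) z) = 1" by simp
  have sub: "G ` cball z r \<subseteq> U" using r \<rho> ball_subset_cball by blast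
  show ?thesis
  proof (rule orientation_preserving_at_iff[THEN iffD2, OF _ _ order_refl r(1) w])
    show "continuous_on (cball z r) (F \<circ> G)"
      using G(1) F(1) rA sub by (intro continuous_on_compose) (auto intro: continuous_on_subset)
    show "inj_on (F \<circ> G) (cball z r)"
      using G(2) F(2) rA sub by (intro comp_inj_on) (auto intro: inj_on_subset)
  qed
qed

text \<open>The segment from 1 to \<open>a\<close> may meet 0. The principal square root
  \<open>u\<close> has nonnegative real part, so the segment from 1 to \<open>u\<close> does not,
  and two linear homotopies, each multiplying by \<open>u\<close>, lead to \<open>a\<close>.\<close>

lemma winding_number_rotated_circle:
  assumes "a \<noteq> 0" "0 < r"
  shows "winding_number (\<lambda>x. c + a * circlepath 0 r x) c = 1"
proof -
  define u where "u = csqrt a"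
  have u: "u * u = a" "u \<noteq> 0" using assms by (auto simp: u_def simp flip: power2_eq_square)
  have nz: "(1 - s) *\<^sub>R 1 + s *\<^sub>R u \<noteq> 0" if "0 \<le> s" "s \<le> 1" for s
  proof
    assume 0: "(1 - s) *\<^sub>R 1 + s *\<^sub>R u = 0"
    then have re: "1 - s + s * Re u = 0" and im: "s * Im u = 0" by (auto simp: complex_eq_iff)
    have "0 \<le> Re u" using csqrt_principal[of a] by (auto simp: u_def)
    then have "s * Re u = 0" "s = 1" using re that mult_nonneg_nonneg[of s "Re u"] by linarith+
    then have "Re u = 0" "Im u = 0" using im by simp_all
    then have "u = 0" by (simp add: complex_eq_iff)
    then show False using u by simp
  qed
  have step: "homotopic_loops (- {c}) (\<lambda>x. c + b * circlepath 0 r x) (\<lambda>x. c + (b * u) * circlepath 0 r x)"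
    if b: "b \<noteq> 0" for b
  proof (rule homotopic_loops_linear)
    have p: "path (\<lambda>x. c + b * circlepath 0 r x)" for b
      unfolding path_def circlepath by (intro continuous_intros)
    show "path (\<lambda>x. c + b * circlepath 0 r x)" "path (\<lambda>x. c + (b * u) * circlepath 0 r x)" by (rule p)+
    show "pathfinish (\<lambda>x. c + b * circlepath 0 r x) = pathstart (\<lambda>x. c + b * circlepath 0 r x)"
      "pathfinish (\<lambda>x. c + (b * u) * circlepath 0 r x) = pathstart (\<lambda>x. c + (b * u) * circlepath 0 r x)"
      by (simp_all add: pathfinish_def pathstart_def circlepath)
    fix t :: real
    have n: "circlepath 0 r t \<noteq> 0" using assms by (simp add: circlepath)
    show "closed_segment (c + b * circlepath 0 r t) (c + (b * u) * circlepath 0 r t) \<subseteq> - {c}"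
    proof
      fix y assume "y \<in> closed_segment (c + b * circlepath 0 r t) (c + (b * u) * circlepath 0 r t)"
      then obtain s where s: "0 \<le> s" "s \<le> 1"
        "y = (1 - s) *\<^sub>R (c + b * circlepath 0 r t) + s *\<^sub>R (c + (b * u) * circlepath 0 r t)"
        unfolding in_segment by blast
      have "y = c + b * circlepath 0 r t * ((1 - s) *\<^sub>R 1 + s *\<^sub>R u)"
        unfolding s(3) by (simp add: scaleR_conv_of_real algebra_simps)
      then show "y \<in> - {c}" using nz[OF s(1,2)] n b by simp
    qed
  qed
  have "homotopic_loops (- {c}) (\<lambda>x. c + 1 * circlepath 0 r x) (\<lambda>x. c + (1 * u * u) * circlepath 0 r x)"
    using homotopic_loops_trans[OF step[of 1] step[of "1 * u"]] u by simp
  then have "winding_number (\<lambda>x. c + a * circlepath 0 r x) c = winding_number (\<lambda>x. c + 1 * circlepath 0 r x) c"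
    using winding_number_homotopic_loops u by (metis mult_1)
  also have "(\<lambda>x. c + 1 * circlepath 0 r x) = circlepath c r" by (auto simp: circlepath)
  finally show ?thesis using assms by (simp add: winding_number_circlepath_centre)
qed

text \<open>An injective map which never points opposite to a real linear similarity is homotopic to it
  around the centre.\<close>

lemma orientation_preserving_at_of_not_opposite:
  assumes F: "continuous_on (ball 0 1) F" "inj_on F (ball 0 1)" and a: "a \<noteq> 0"
    and opp: "\<And>z s. z \<in> ball 0 1 \<Longrightarrow> z \<noteq> 0 \<Longrightarrow> 0 \<le> s \<Longrightarrow> s \<le> 1 \<Longrightarrow> (1 - s) *\<^sub>R (F z - F 0) + s *\<^sub>R (a * z) \<noteq> 0"
  shows "orientation_preserving_at F 0"
proof -
  have sub: "cball 0 (1/2) \<subseteq> (ball 0 1 :: complex set)" by auto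
  note p = path_comp_circlepath[OF F(1) sub]
  have "homotopic_loops (- {F 0}) (F \<circ> circlepath 0 (1/2)) (\<lambda>x. F 0 + a * circlepath 0 (1/2) x)"
  proof (rule homotopic_loops_linear)
    show "path (F \<circ> circlepath 0 (1/2))" "pathfinish (F \<circ> circlepath 0 (1/2)) = pathstart (F \<circ> circlepath 0 (1/2))"
      using p by auto
    show "path (\<lambda>x. F 0 + a * circlepath 0 (1/2) x)" unfolding path_def circlepath by (intro continuous_intros)
    show "pathfinish (\<lambda>x. F 0 + a * circlepath 0 (1/2) x) = pathstart (\<lambda>x. F 0 + a * circlepath 0 (1/2) x)"
      by (simp add: pathfinish_def pathstart_def circlepath)
    fix t :: real
    have z: "circlepath 0 (1/2) t \<in> ball 0 1" "circlepath 0 (1/2) t \<noteq> (0::complex)"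
      by (simp_all add: circlepath norm_mult norm_exp_eq_Re)
    show "closed_segment ((F \<circ> circlepath 0 (1/2)) t) (F 0 + a * circlepath 0 (1/2) t) \<subseteq> - {F 0}"
    proof
      fix y assume "y \<in> closed_segment ((F \<circ> circlepath 0 (1/2)) t) (F 0 + a * circlepath 0 (1/2) t)"
      then obtain s where s: "0 \<le> s" "s \<le> 1"
        "y = (1 - s) *\<^sub>R F (circlepath 0 (1/2) t) + s *\<^sub>R (F 0 + a * circlepath 0 (1/2) t)"
        unfolding in_segment by auto
      have "y - F 0 = (1 - s) *\<^sub>R (F (circlepath 0 (1/2) t) - F 0) + s *\<^sub>R (a * circlepath 0 (1/2) t)"
        unfolding s(3) by (simp add: algebra_simps)
      then show "y \<in> - {F 0}" using opp[OF z s(1,2)] by auto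
    qed
  qed
  from winding_number_homotopic_loops[OF this]
  have "winding_number (F \<circ> circlepath 0 (1/2)) (F 0) = 1"
    using winding_number_rotated_circle[OF a, of "1/2" "F 0"] by simp
  then show ?thesis using orientation_preserving_at_iff[OF F sub] by simp
qed

section \<open>Stereographic projection\<close>

lemma norm_S2: "(z, t) \<in> S2 \<longleftrightarrow> (norm z)\<^sup>2 + t\<^sup>2 = 1"
proof -
  have "(z, t) \<in> S2 \<longleftrightarrow> sqrt ((norm z)\<^sup>2 + (norm t)\<^sup>2) = 1" by (simp add: norm_prod_def)
  then show ?thesis by (simp add: real_sqrt_eq_1_iff)
qed

lemma S2_south: "(z, t) \<in> S2 - {(0, -1)} \<Longrightarrow> 0 < 1 + t"
proof -
  assume *: "(z, t) \<in> S2 - {(0, -1)}"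
  then have n: "(norm z)\<^sup>2 + t\<^sup>2 = 1" using norm_S2 by blast
  then have "t\<^sup>2 \<le> 1" using zero_le_power2[of "norm z"] by linarith
  then have "- 1 \<le> t" using abs_square_le_1[of t] by (simp add: abs_le_iff)
  moreover have "t \<noteq> - 1" using n * by auto
  ultimately show ?thesis by simp
qed

lemma continuous_on_stereographic: "continuous_on (S2 - {(0, -1)}) stereographic"
proof -
  have eq: "stereographic = (\<lambda>u. fst u / of_real (1 + snd u))" by (auto simp: stereographic_def)
  have nz: "complex_of_real (1 + snd u) \<noteq> 0" if "u \<in> S2 - {(0, -1)}" for u
    using S2_south[of "fst u" "snd u"] that by (metis less_irrefl of_real_eq_0_iff prod.collapse)
  show ?thesis unfolding eq by (intro continuous_intros ballI nz)
qed

text \<open>The squared modulus of the image is \<open>2 / (1 + t) - 1\<close>, which determines the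
  height \<open>t\<close> and then \<open>z\<close>.\<close>

lemma inj_on_stereographic: "inj_on stereographic (S2 - {(0, -1)})"
proof (rule inj_onI)
  fix a b assume ab: "a \<in> S2 - {(0, -1)}" "b \<in> S2 - {(0, -1)}" "stereographic a = stereographic b"
  obtain z t where a: "a = (z, t)" by (cases a)
  obtain z' t' where b: "b = (z', t')" by (cases b)
  have u: "(z, t) \<in> S2" "(z, t) \<noteq> (0, -1)" and u': "(z', t') \<in> S2" "(z', t') \<noteq> (0, -1)"
    and eq: "stereographic (z, t) = stereographic (z', t')" using ab unfolding a b by blast+
  have pos: "0 < 1 + t" "0 < 1 + t'" using S2_south u u' by blast+
  have sq: "(norm (stereographic (z, t)))\<^sup>2 = 2 / (1 + t) - 1" if "(z, t) \<in> S2" "0 < 1 + t" for z t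
  proof -
    have "(norm z)\<^sup>2 = (1 - t) * (1 + t)" using norm_S2[of z t] that(1) by (simp add: algebra_simps power2_eq_square)
    moreover have "norm (complex_of_real (1 + t)) = 1 + t" using that(2) by (simp only: norm_of_real abs_of_pos)
    ultimately have "(norm (stereographic (z, t)))\<^sup>2 = (1 - t) * (1 + t) / (1 + t)\<^sup>2"
      by (simp only: stereographic_def split_conv norm_divide power_divide)
    moreover have "(2 - q) * q / q\<^sup>2 = 2 / q - 1" if "0 < q" for q :: real
      using that by (simp add: power2_eq_square diff_divide_distrib)
    from this[OF that(2)] have "(1 - t) * (1 + t) / (1 + t)\<^sup>2 = 2 / (1 + t) - 1" by simp
    ultimately show ?thesis by simp
  qed
  have "2 / (1 + t) = 2 / (1 + t')" using sq[OF u(1) pos(1)] sq[OF u'(1) pos(2)] eq by simp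
  then have t: "t = t'" using pos by (simp add: field_simps)
  moreover have "complex_of_real (1 + t) \<noteq> 0" using pos by (simp only: of_real_eq_0_iff)
  then have "z = z'" using eq t by (simp add: stereographic_def)
  ultimately show "a = b" by (simp add: a b)
qed

section \<open>Isotopies of the double\<close>

text \<open>Two phases. Until time \<open>1/2\<close> the boundary motion \<beta> is extended
  radially; it ends at the radial extension of \<eta> on the circle. Afterwards a copy of \<eta>
  grows from the centre, with that extension outside it. On the circle only \<beta> is visible, so
  two sheets with the same boundary motion stay glued.\<close>

lemma alexander_isotopy:
  fixes \<eta> :: "complex \<Rightarrow> complex" and \<beta> :: "real \<times> complex \<Rightarrow> complex"
  assumes \<eta>: "continuous_on (cball 0 1) \<eta>" "bij_betw \<eta> (cball 0 1) (cball 0 1)"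
    and \<beta>: "continuous_on ({0..1} \<times> sphere 0 1) \<beta>"
      "\<And>t. t \<in> {0..1} \<Longrightarrow> bij_betw (\<lambda>z. \<beta> (t, z)) (sphere 0 1) (sphere 0 1)"
      "\<And>z. z \<in> sphere 0 1 \<Longrightarrow> \<beta> (0, z) = z" "\<And>z. z \<in> sphere 0 1 \<Longrightarrow> \<beta> (1, z) = \<eta> z"
  shows "\<exists>H. continuous_on ({0..1} \<times> cball 0 1) H \<and>
     (\<forall>t\<in>{0..1}. bij_betw (\<lambda>z. H (t, z)) (cball 0 1) (cball 0 1)) \<and>
     (\<forall>z\<in>cball 0 1. H (0, z) = z \<and> H (1, z) = \<eta> z) \<and>
     (\<forall>t\<in>{0..1}. \<forall>z\<in>sphere 0 1. H (t, z) = \<beta> (min 1 (2 * t), z))"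
proof -
  have sgn1: "norm (sgn z) = 1" if "z \<noteq> 0" for z :: complex using that by (simp add: norm_sgn)
  have polar: "z = norm z *\<^sub>R sgn z" for z :: complex by (cases "z = 0") (auto simp: sgn_div_norm)
  have \<beta>n: "norm (\<beta> (t, z)) = 1" if "t \<in> {0..1}" "norm z = 1" for t z
    using bij_betwE[OF \<beta>(2)[OF that(1)]] that by simp
  have \<eta>sphere: "norm (\<eta> z) = 1" if "norm z = 1" for z using \<beta>n[of 1 z] \<beta>(4)[of z] that by simp
  have \<eta>cball: "norm (\<eta> z) \<le> 1" if "norm z \<le> 1" for z
    using bij_betwE[OF \<eta>(2)] that by simp
  have inj\<eta>: "z = z'" if "\<eta> z = \<eta> z'" "norm z \<le> 1" "norm z' \<le> 1" for z z'
    using bij_betw_imp_inj_on[OF \<eta>(2)] that by (auto simp: inj_on_def)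
  define m where "m = (\<lambda>(t, z::complex). max (2 * t - 1) (norm z))"
  define H1 where "H1 = (\<lambda>(t, z). norm z *\<^sub>R \<beta> (2 * t, sgn z))"
  define H2 where "H2 = (\<lambda>(t, z). m (t, z) *\<^sub>R \<eta> ((1 / m (t, z)) *\<^sub>R z))"
  define H where "H = (\<lambda>u. if u \<in> {0..1/2} \<times> cball 0 1 then H1 u else H2 u)"
  have m_ge: "norm z \<le> m (t, z)" for t z by (simp add: m_def)
  have m_nn: "0 \<le> m (t, z)" for t z using m_ge[of z t] norm_ge_zero[of z] by linarith
  have m_le: "m (t, z) \<le> 1" if "t \<le> 1" "norm z \<le> 1" for t z using that by (simp add: m_def)
  have arg_le: "norm ((1 / m (t, z)) *\<^sub>R z) \<le> 1" for t z
    using m_ge[of z t] m_nn[of t z] by (auto simp: divide_le_eq)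
  have c1: "continuous_on ({0..1/2} \<times> cball 0 1) H1"
  proof -
    have "continuous_on ({0..1/2} \<times> cball 0 1) (\<lambda>u::real \<times> complex. norm (snd u) *\<^sub>R \<beta> (2 * fst u, sgn (snd u)))"
    proof (rule continuous_on_scaleR_bounded)
      show "continuous_on {u \<in> {0..1/2} \<times> cball 0 1. norm (snd u) \<noteq> 0} (\<lambda>u::real \<times> complex. \<beta> (2 * fst u, sgn (snd u)))"
      proof (rule continuous_on_compose2[OF \<beta>(1)])
        show "continuous_on {u \<in> {0..1/2} \<times> cball 0 1. norm (snd u) \<noteq> 0} (\<lambda>u::real \<times> complex. (2 * fst u, sgn (snd u)))"
          by (intro continuous_intros) auto
        show "(\<lambda>u::real \<times> complex. (2 * fst u, sgn (snd u))) ` {u \<in> {0..1/2} \<times> cball 0 1. norm (snd u) \<noteq> 0} \<subseteq> {0..1} \<times> sphere 0 1"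
          by (auto simp: norm_sgn)
      qed
      show "norm (\<beta> (2 * fst u, sgn (snd u))) \<le> 1" if "u \<in> {0..1/2} \<times> cball 0 1" "norm (snd u) \<noteq> 0" for u :: "real \<times> complex"
        using that \<beta>n[of "2 * fst u" "sgn (snd u)"] by (auto simp: norm_sgn)
    qed (intro continuous_intros)
    then show ?thesis by (simp add: H1_def case_prod_unfold)
  qed
  have c2: "continuous_on ({1/2..1} \<times> cball 0 1) H2"
  proof -
    have cm: "continuous_on A m" for A unfolding m_def case_prod_unfold by (intro continuous_intros)
    have "continuous_on ({1/2..1} \<times> cball 0 1) (\<lambda>u::real \<times> complex. m u *\<^sub>R \<eta> ((1 / m u) *\<^sub>R snd u))"
    proof (rule continuous_on_scaleR_bounded[OF cm])
      show "continuous_on {u \<in> {1/2..1} \<times> cball 0 1. m u \<noteq> 0} (\<lambda>u. \<eta> ((1 / m u) *\<^sub>R snd u))"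
      proof (rule continuous_on_compose2[OF \<eta>(1)])
        show "continuous_on {u \<in> {1/2..1} \<times> cball 0 1. m u \<noteq> 0} (\<lambda>u. (1 / m u) *\<^sub>R snd u)"
          by (intro continuous_intros cm) auto
        show "(\<lambda>u. (1 / m u) *\<^sub>R snd u) ` {u \<in> {1/2..1} \<times> cball 0 1. m u \<noteq> 0} \<subseteq> cball 0 1"
          using arg_le by fastforce
      qed
      show "norm (\<eta> ((1 / m u) *\<^sub>R snd u)) \<le> 1" for u
        using \<eta>cball[OF arg_le[of "fst u" "snd u"]] by simp
    qed
    then show ?thesis by (simp add: H2_def case_prod_unfold)
  qed
  have agree: "H1 (1/2, z) = H2 (1/2, z)" if "norm z \<le> 1" for z
  proof (cases "z = 0")
    case False
    have "(1 / norm z) *\<^sub>R z = sgn z" by (simp add: sgn_div_norm divide_inverse)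
    then show ?thesis using \<beta>(4)[of "sgn z"] sgn1[OF False] by (simp add: H1_def H2_def m_def)
  qed (simp add: H1_def H2_def m_def)
  have "continuous_on (({0..1/2} \<times> cball 0 1) \<union> ({1/2..1} \<times> cball 0 1)) H"
    unfolding H_def
  proof (rule continuous_on_cases[OF _ _ c1 c2])
    show "closed ({0..1/2::real} \<times> (cball 0 1 :: complex set))" "closed ({1/2..1::real} \<times> (cball 0 1 :: complex set))"
      by (intro closed_Times closed_cball closed_atLeastAtMost)+
    show "\<forall>u. u \<in> {0..1/2} \<times> cball 0 1 \<and> u \<notin> {0..1/2} \<times> cball 0 1 \<or>
        u \<in> {1/2..1} \<times> cball 0 1 \<and> u \<in> {0..1/2} \<times> cball 0 1 \<longrightarrow> H1 u = H2 u"
    proof (intro allI impI)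
      fix u :: "real \<times> complex"
      assume "u \<in> {0..1/2} \<times> cball 0 1 \<and> u \<notin> {0..1/2} \<times> cball 0 1 \<or>
        u \<in> {1/2..1} \<times> cball 0 1 \<and> u \<in> {0..1/2} \<times> cball 0 1"
      then have "fst u = 1/2" "norm (snd u) \<le> 1" by auto
      then show "H1 u = H2 u" using agree[of "snd u"] by (metis prod.collapse)
    qed
  qed
  moreover have "({0..1/2} \<times> cball 0 1) \<union> ({1/2..1} \<times> cball 0 1) = {0..1::real} \<times> (cball 0 1 :: complex set)"
    by auto
  ultimately have cH: "continuous_on ({0..1} \<times> cball 0 1) H" by simp
  have H1_eq: "H (t, z) = norm z *\<^sub>R \<beta> (2 * t, sgn z)" if "t \<in> {0..1/2}" "norm z \<le> 1" for t z
    using that by (simp add: H_def H1_def)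
  have H2_eq: "H (t, z) = m (t, z) *\<^sub>R \<eta> ((1 / m (t, z)) *\<^sub>R z)" if "t \<in> {1/2..1}" "norm z \<le> 1" for t z
  proof (cases "t = 1/2")
    case True
    show ?thesis unfolding True using H1_eq[of "1/2" z] that agree[OF that(2)] by (simp add: H1_def H2_def)
  next
    case False
    then show ?thesis using that by (auto simp: H_def H2_def)
  qed
  have bij1: "bij_betw (\<lambda>z. H (t, z)) (cball 0 1) (cball 0 1)" if t: "t \<in> {0..1/2}" for t
  proof -
    have t2: "2 * t \<in> {0..1}" using t by auto
    have nH: "norm (H (t, z)) = norm z" if "norm z \<le> 1" for z
      using H1_eq[OF t that] \<beta>n[OF t2, of "sgn z"] sgn1[of z] by (cases "z = 0") auto
    show ?thesis
    proof (rule bij_betwI')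
      fix z z' :: complex assume z: "z \<in> cball 0 1" "z' \<in> cball 0 1"
      show "H (t, z) = H (t, z') \<longleftrightarrow> z = z'"
      proof
        assume eq: "H (t, z) = H (t, z')"
        then have n: "norm z = norm z'" using nH[of z] nH[of z'] z by simp
        show "z = z'"
        proof (cases "z = 0")
          case False
          then have "z' \<noteq> 0" using n by auto
          have "\<beta> (2 * t, sgn z) = \<beta> (2 * t, sgn z')"
            using eq H1_eq[OF t, of z] H1_eq[OF t, of z'] z n False by auto
          then have "sgn z = sgn z'"
            using bij_betw_imp_inj_on[OF \<beta>(2)[OF t2]] sgn1[OF False] sgn1[OF \<open>z' \<noteq> 0\<close>] by (auto simp: inj_on_def)
          then show ?thesis using polar[of z] polar[of z'] n by simp
        qed (use n in auto)
      qed simp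
    next
      show "H (t, z) \<in> cball 0 1" if "z \<in> cball 0 1" for z using that nH[of z] by simp
      show "\<exists>z\<in>cball 0 1. y = H (t, z)" if y: "y \<in> cball 0 1" for y
      proof (cases "y = 0")
        case True
        then show ?thesis using H1_eq[OF t, of 0] by (intro bexI[of _ 0]) auto
      next
        case False
        obtain e where e: "norm e = 1" "\<beta> (2 * t, e) = sgn y"
          using bij_betw_imp_surj_on[OF \<beta>(2)[OF t2]] sgn1[OF False] by (metis (no_types, lifting) imageE mem_sphere_0)
        have "sgn (norm y *\<^sub>R e) = e" using e(1) False by (simp add: sgn_div_norm)
        then have "H (t, norm y *\<^sub>R e) = y" using H1_eq[OF t, of "norm y *\<^sub>R e"] e y polar[of y] by simp
        then show ?thesis using e y by (intro bexI[of _ "norm y *\<^sub>R e"]) auto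
      qed
    qed
  qed
  \<comment> \<open>The disk of radius \<tau> is mapped to itself by a scaled \<eta>, and outside it
    the norm is preserved, so the two zones can be inverted separately.\<close>
  have bij2: "bij_betw (\<lambda>z. H (t, z)) (cball 0 1) (cball 0 1)" if t: "t \<in> {1/2..1}" for t
  proof -
    define \<tau> where "\<tau> = 2 * t - 1"
    have \<tau>: "0 \<le> \<tau>" "\<tau> \<le> 1" using t by (auto simp: \<tau>_def)
    have small: "H (t, z) = \<tau> *\<^sub>R \<eta> ((1 / \<tau>) *\<^sub>R z)" "norm ((1 / \<tau>) *\<^sub>R z) \<le> 1" "norm (H (t, z)) \<le> \<tau>" if "norm z \<le> \<tau>" for z
    proof -
      have "m (t, z) = \<tau>" using that by (simp add: m_def \<tau>_def)
      then show 1: "H (t, z) = \<tau> *\<^sub>R \<eta> ((1 / \<tau>) *\<^sub>R z)" using H2_eq[OF t, of z] that \<tau> by simp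
      show 2: "norm ((1 / \<tau>) *\<^sub>R z) \<le> 1" using that \<tau> by (auto simp: divide_le_eq)
      show "norm (H (t, z)) \<le> \<tau>" unfolding 1 using \<eta>cball[OF 2] \<tau> by (simp add: mult_left_le)
    qed
    have large: "H (t, z) = norm z *\<^sub>R \<eta> (sgn z)" "norm (H (t, z)) = norm z" "z \<noteq> 0" if "\<tau> < norm z" "norm z \<le> 1" for z
    proof -
      have "m (t, z) = norm z" using that by (simp add: m_def \<tau>_def)
      moreover have "(1 / norm z) *\<^sub>R z = sgn z" by (simp add: sgn_div_norm divide_inverse)
      ultimately show 1: "H (t, z) = norm z *\<^sub>R \<eta> (sgn z)" using H2_eq[OF t, of z] that by simp
      show z: "z \<noteq> 0" using that \<tau> by auto
      show "norm (H (t, z)) = norm z" unfolding 1 using \<eta>sphere[of "sgn z"] sgn1[OF z] by simp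
    qed
    show ?thesis
    proof (rule bij_betwI')
      fix z z' :: complex assume z: "z \<in> cball 0 1" "z' \<in> cball 0 1"
      show "H (t, z) = H (t, z') \<longleftrightarrow> z = z'"
      proof
        assume eq: "H (t, z) = H (t, z')"
        consider "norm z \<le> \<tau>" "norm z' \<le> \<tau>" | "\<tau> < norm z" "\<tau> < norm z'"
          using small(3)[of z] small(3)[of z'] large(2)[of z] large(2)[of z'] z eq by fastforce
        then show "z = z'"
        proof cases
          case 1
          show ?thesis
          proof (cases "\<tau> = 0")
            case False
            then have "\<eta> ((1 / \<tau>) *\<^sub>R z) = \<eta> ((1 / \<tau>) *\<^sub>R z')" using eq small(1) 1 by auto
            then have "(1 / \<tau>) *\<^sub>R z = (1 / \<tau>) *\<^sub>R z'" using inj\<eta> small(2) 1 by blast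
            then show ?thesis using False by simp
          qed (use 1 in auto)
        next
          case 2
          have n: "norm z = norm z'" using large(2)[OF 2(1)] large(2)[OF 2(2)] eq z by simp
          have nz: "z \<noteq> 0" "z' \<noteq> 0" using large(3) 2 z by auto
          then have "\<eta> (sgn z) = \<eta> (sgn z')" using eq large(1)[OF 2(1)] large(1)[OF 2(2)] z n by simp
          then have "sgn z = sgn z'" using inj\<eta>[of "sgn z" "sgn z'"] sgn1 nz by simp
          then show ?thesis using polar[of z] polar[of z'] n by simp
        qed
      qed simp
    next
      fix z :: complex assume "z \<in> cball 0 1"
      then show "H (t, z) \<in> cball 0 1" using small(3)[of z] large(2)[of z] \<tau> by (cases "norm z \<le> \<tau>") auto
    next
      fix y :: complex assume y: "y \<in> cball 0 1"
      show "\<exists>z\<in>cball 0 1. y = H (t, z)"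
      proof (cases "norm y \<le> \<tau>")
        case True
        show ?thesis
        proof (cases "\<tau> = 0")
          case True
          then show ?thesis using \<open>norm y \<le> \<tau>\<close> small(1)[of 0] by (intro bexI[of _ 0]) auto
        next
          case False
          then have \<tau>0: "0 < \<tau>" using \<tau> by simp
          have "(1 / \<tau>) *\<^sub>R y \<in> cball 0 1" using True \<tau>0 by (simp add: divide_le_eq)
          then obtain x where x: "norm x \<le> 1" "\<eta> x = (1 / \<tau>) *\<^sub>R y"
            using bij_betw_imp_surj_on[OF \<eta>(2)] by (metis (no_types, lifting) imageE mem_cball_0)
          have n: "norm (\<tau> *\<^sub>R x) \<le> \<tau>" using x \<tau> by (simp add: mult_left_le)
          have "H (t, \<tau> *\<^sub>R x) = y" using small(1)[OF n] x \<tau>0 by simp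
          then show ?thesis using n \<tau> by (intro bexI[of _ "\<tau> *\<^sub>R x"]) auto
        qed
      next
        case False
        then have "y \<noteq> 0" using \<tau> by auto
        obtain e where e: "norm e = 1" "\<beta> (1, e) = sgn y"
          using bij_betw_imp_surj_on[OF \<beta>(2)[of 1]] sgn1[OF \<open>y \<noteq> 0\<close>] by (metis (no_types, lifting) imageE mem_sphere_0 atLeastAtMost_iff order_refl zero_le_one)
        have s: "sgn (norm y *\<^sub>R e) = e" using e(1) \<open>y \<noteq> 0\<close> by (simp add: sgn_div_norm)
        have "H (t, norm y *\<^sub>R e) = norm y *\<^sub>R \<eta> e" using large(1)[of "norm y *\<^sub>R e"] s e False y by simp
        then have "H (t, norm y *\<^sub>R e) = y" using \<beta>(4)[of e] e polar[of y] by simp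
        then show ?thesis using e y by (intro bexI[of _ "norm y *\<^sub>R e"]) auto
      qed
    qed
  qed
  have "bij_betw (\<lambda>z. H (t, z)) (cball 0 1) (cball 0 1)" if "t \<in> {0..1}" for t
    using bij1[of t] bij2[of t] that by (cases "t \<le> 1/2") auto
  moreover have "H (0, z) = z \<and> H (1, z) = \<eta> z" if "z \<in> cball 0 1" for z
  proof
    show "H (0, z) = z"
      using H1_eq[of 0 z] that \<beta>(3)[of "sgn z"] sgn1[of z] polar[of z] by (cases "z = 0") auto
    have "m (1, z) = 1" using that by (simp add: m_def)
    then show "H (1, z) = \<eta> z" using H2_eq[of 1 z] that by simp
  qed
  moreover have "H (t, z) = \<beta> (min 1 (2 * t), z)" if "t \<in> {0..1}" "z \<in> sphere 0 1" for t z
  proof (cases "t \<le> 1/2")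
    case True
    then show ?thesis using H1_eq[of t z] that by (simp add: sgn_div_norm)
  next
    case False
    then have "m (t, z) = 1" using that by (simp add: m_def)
    then show ?thesis using H2_eq[of t z] that False \<beta>(4)[of z] by (simp add: min_def)
  qed
  ultimately show ?thesis using cH by (intro exI[of _ H]) auto
qed

text \<open>The isotopies of the two sheets agree on the seam and preserve it, so they descend to
  the sphere; each stage is a continuous bijection of a compact Hausdorff space.\<close>

lemma isotopic_to_id_of_sheets:
  fixes p :: "'n::finite \<Rightarrow> point" and H :: "bool \<Rightarrow> real \<times> complex \<Rightarrow> complex"
  assumes \<Psi>: "double_homeo (cball 0 1) \<Psi>"
    and cont: "\<And>s. continuous_on ({0..1} \<times> cball 0 1) (H s)"
    and bij: "\<And>s t. t \<in> {0..1} \<Longrightarrow> bij_betw (\<lambda>z. H s (t, z)) (cball 0 1) (cball 0 1)"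
    and bij_sphere: "\<And>s t. t \<in> {0..1} \<Longrightarrow> bij_betw (\<lambda>z. H s (t, z)) (sphere 0 1) (sphere 0 1)"
    and same: "\<And>t z. t \<in> {0..1} \<Longrightarrow> z \<in> sphere 0 1 \<Longrightarrow> H True (t, z) = H False (t, z)"
    and start: "\<And>s z. z \<in> cball 0 1 \<Longrightarrow> H s (0, z) = z"
    and finish: "\<And>s z. z \<in> cball 0 1 \<Longrightarrow> f (\<Psi> s z) = \<Psi> s (H s (1, z))"
    and p: "\<And>i. q i \<in> sphere 0 1" "\<And>i. p i = \<Psi> True (q i)" "\<And>t i. t \<in> {0..1} \<Longrightarrow> H True (t, q i) = q i"
  shows "isotopic_to_id p f"
proof -
  have contP: "continuous_on (cball 0 1) (\<Psi> s)" and injP: "inj_on (\<Psi> s) (cball 0 1)" for s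
    using \<Psi> by (auto simp: double_homeo_def)
  have glue: "\<Psi> True x = \<Psi> False y \<longleftrightarrow> x = y \<and> x \<in> sphere 0 1" if "x \<in> cball 0 1" "y \<in> cball 0 1" for x y
    using \<Psi> that by (auto simp: double_homeo_def)
  have cover: "(\<Union>s. \<Psi> s ` cball 0 1) = S2" using \<Psi> by (simp add: double_homeo_def)
  define G where "G = (\<lambda>s. inv_into (cball 0 1) (\<Psi> s))"
  have G: "G s (\<Psi> s z) = z" if "z \<in> cball 0 1" for s z using that injP by (simp add: G_def)
  have contG: "continuous_on (\<Psi> s ` cball 0 1) (G s)" for s
    by (rule continuous_on_inv[OF contP compact_cball]) (use G in auto)
  define h where "h = (\<lambda>(t, a). if a \<in> \<Psi> True ` cball 0 1 then \<Psi> True (H True (t, G True a)) else \<Psi> False (H False (t, G False a)))"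
  have hs: "h (t, \<Psi> s z) = \<Psi> s (H s (t, z))" if t: "t \<in> {0..1}" and z: "z \<in> cball 0 1" for t s z
  proof (cases s)
    case True
    then show ?thesis using z G by (auto simp: h_def)
  next
    case False
    show ?thesis
    proof (cases "\<Psi> s z \<in> \<Psi> True ` cball 0 1")
      case True
      then obtain y where y: "y \<in> cball 0 1" "\<Psi> True y = \<Psi> False z" using False by auto
      then have yz: "y = z" "z \<in> sphere 0 1" using glue z by auto
      have "H True (t, z) = H False (t, z)" using same[OF t yz(2)] .
      moreover have "H True (t, z) \<in> sphere 0 1" using bij_betwE[OF bij_sphere[OF t]] yz(2) by blast
      ultimately have "\<Psi> True (H True (t, z)) = \<Psi> False (H False (t, z))" using glue by auto
      moreover have "h (t, \<Psi> s z) = \<Psi> True (H True (t, G True (\<Psi> s z)))" using True by (simp add: h_def)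
      moreover have "\<Psi> s z = \<Psi> True z" using y yz False by simp
      ultimately show ?thesis using G[OF z, of True] False by simp
    next
      case F: False
      then show ?thesis using False G[OF z, of False] by (simp add: h_def)
    qed
  qed
  have S2_cases: thesis if "a \<in> S2" "\<And>s z. z \<in> cball 0 1 \<Longrightarrow> a = \<Psi> s z \<Longrightarrow> thesis" for a thesis
    using that cover by blast
  have conth: "continuous_on ({0..1} \<times> S2) h"
  proof -
    have piece: "continuous_on ({0..1} \<times> \<Psi> s ` cball 0 1) (\<lambda>u. \<Psi> s (H s (fst u, G s (snd u))))" for s
    proof (rule continuous_on_compose2[OF contP])
      show "continuous_on ({0..1} \<times> \<Psi> s ` cball 0 1) (\<lambda>u. H s (fst u, G s (snd u)))"
      proof (rule continuous_on_compose2[OF cont[of s]])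
        show "continuous_on ({0..1} \<times> \<Psi> s ` cball 0 1) (\<lambda>u. (fst u, G s (snd u)))"
          by (intro continuous_intros continuous_on_compose2[OF contG]) auto
        show "(\<lambda>u. (fst u, G s (snd u))) ` ({0..1} \<times> \<Psi> s ` cball 0 1) \<subseteq> {0..1} \<times> cball 0 1"
          using G by auto
      qed
      show "(\<lambda>u. H s (fst u, G s (snd u))) ` ({0..1} \<times> \<Psi> s ` cball 0 1) \<subseteq> cball 0 1"
        using G bij_betwE[OF bij] by fastforce
    qed
    have "continuous_on ({0..1} \<times> \<Psi> s ` cball 0 1) h" for s
      by (rule continuous_on_cong[THEN iffD1, OF refl _ piece[of s]]) (use hs G in auto)
    moreover have "closed ({0..1::real} \<times> \<Psi> s ` cball 0 1)" for s
      by (intro closed_Times closed_atLeastAtMost compact_imp_closed compact_continuous_image contP compact_cball)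
    ultimately have "continuous_on ({0..1} \<times> \<Psi> True ` cball 0 1 \<union> {0..1} \<times> \<Psi> False ` cball 0 1) h"
      by (intro continuous_on_closed_Un) auto
    moreover have "{0..1} \<times> \<Psi> True ` cball 0 1 \<union> {0..1} \<times> \<Psi> False ` cball 0 1 = {0..1::real} \<times> S2"
      using cover by (auto simp: UNIV_bool)
    ultimately show ?thesis by simp
  qed
  have h_in: "h (t, a) \<in> S2" if t: "t \<in> {0..1}" and a: "a \<in> S2" for t a
  proof -
    obtain s z where z: "z \<in> cball 0 1" "a = \<Psi> s z" using S2_cases[OF a] .
    then have "H s (t, z) \<in> cball 0 1" using bij_betwE[OF bij[OF t]] by blast
    then show ?thesis unfolding z(2) hs[OF t z(1)] cover[symmetric] by blast
  qed
  have homeo: "homeomorphic_map (top_of_set S2) (top_of_set S2) (\<lambda>a. h (t, a))" if t: "t \<in> {0..1}" for t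
  proof (rule continuous_imp_homeomorphic_map)
    have "continuous_on S2 (\<lambda>a. h (t, a))"
      by (rule continuous_on_compose2[OF conth]) (use t in \<open>auto intro!: continuous_intros\<close>)
    then show "continuous_map (top_of_set S2) (top_of_set S2) (\<lambda>a. h (t, a))"
      using h_in[OF t] by (auto simp del: mem_sphere_0)
    show "compact_space (top_of_set S2)" by (simp add: compact_space_subtopology)
    show "Hausdorff_space (top_of_set S2)" by (simp add: Hausdorff_space_subtopology)
    have "S2 \<subseteq> (\<lambda>a. h (t, a)) ` S2"
    proof
      fix b assume "b \<in> S2"
      then obtain s y where y: "y \<in> cball 0 1" "b = \<Psi> s y" using S2_cases by blast
      then obtain z where z: "z \<in> cball 0 1" "H s (t, z) = y"
        using bij_betw_imp_surj_on[OF bij[OF t]] by (metis (no_types, lifting) imageE)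
      then have "b = h (t, \<Psi> s z)" using hs[OF t z(1)] y by simp
      moreover have "\<Psi> s z \<in> S2" using cover z by blast
      ultimately show "b \<in> (\<lambda>a. h (t, a)) ` S2" by blast
    qed
    then show "(\<lambda>a. h (t, a)) ` topspace (top_of_set S2) = topspace (top_of_set S2)"
      using h_in[OF t] by auto
    have tf: "\<Psi> True z = \<Psi> False z'" if "z \<in> cball 0 1" "z' \<in> cball 0 1" "\<Psi> True (H True (t, z)) = \<Psi> False (H False (t, z'))" for z z'
    proof -
      have i: "H True (t, z) \<in> cball 0 1" "H False (t, z') \<in> cball 0 1"
        using bij_betwE[OF bij[OF t]] that by blast+
      then have e: "H True (t, z) = H False (t, z')" "H True (t, z) \<in> sphere 0 1" using glue that(3) by auto
      \<comment> \<open>Only seam points move into the seam: the stage is injective on the disk and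
        already maps the circle onto itself.\<close>
      have inv: "x \<in> sphere 0 1" if xx: "x \<in> cball 0 1" "H s (t, x) \<in> sphere 0 1" for s x
      proof -
        obtain x' where x': "x' \<in> sphere 0 1" "H s (t, x') = H s (t, x)"
          using bij_betw_imp_surj_on[OF bij_sphere[OF t, of s]] xx(2) by (metis (no_types, lifting) imageE)
        moreover have "x' \<in> cball 0 1" using x'(1) sphere_cball by blast
        ultimately have "x' = x" using bij_betw_imp_inj_on[OF bij[OF t, of s]] xx(1)
          by (auto simp: inj_on_def)
        then show ?thesis using x' by simp
      qed
      have zs: "z \<in> sphere 0 1" "z' \<in> sphere 0 1" using inv[of z True] inv[of z' False] e that by simp_all
      then have "H False (t, z) = H False (t, z')" using same[OF t zs(1)] e by simp
      then have "z = z'" using bij_betw_imp_inj_on[OF bij[OF t, of False]] that by (auto simp: inj_on_def)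
      then show ?thesis using glue zs that by blast
    qed
    show "inj_on (\<lambda>a. h (t, a)) (topspace (top_of_set S2))"
    proof (rule inj_onI)
      fix a b assume "a \<in> topspace (top_of_set S2)" "b \<in> topspace (top_of_set S2)" and eq: "h (t, a) = h (t, b)"
      then have ab: "a \<in> S2" "b \<in> S2" by auto
      obtain s z where z: "z \<in> cball 0 1" "a = \<Psi> s z" using S2_cases[OF ab(1)] .
      obtain s' z' where z': "z' \<in> cball 0 1" "b = \<Psi> s' z'" using S2_cases[OF ab(2)] .
      have e: "\<Psi> s (H s (t, z)) = \<Psi> s' (H s' (t, z'))" using eq z z' hs[OF t] by simp
      show "a = b"
      proof (cases "s = s'")
        case True
        have "H s (t, z) \<in> cball 0 1" "H s (t, z') \<in> cball 0 1" using bij_betwE[OF bij[OF t]] z z' by blast+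
        then have "H s (t, z) = H s (t, z')" using e True injP[of s] by (auto simp: inj_on_def)
        then have "z = z'" using bij_betw_imp_inj_on[OF bij[OF t, of s]] z z' by (auto simp: inj_on_def)
        then show ?thesis using z z' True by simp
      next
        case False
        then show ?thesis using tf[OF z(1) z'(1)] tf[OF z'(1) z(1)] e z z' by (cases s; cases s') auto
      qed
    qed
  qed
  have marks: "h (t, p i) = p i" if "t \<in> {0..1}" for t i
    using hs[OF that, of "q i" True] p sphere_cball that by (auto simp: subset_iff)
  let ?P = "\<lambda>g. homeomorphic_map (top_of_set S2) (top_of_set S2) g \<and> (\<forall>i. g (p i) = p i)"
  have pS: "p i \<in> S2" for i using p cover sphere_cball by (metis UN_I UNIV_I imageI subsetD)
  have "homotopic_with ?P (top_of_set S2) (top_of_set S2) id f"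
  proof (subst homotopic_with)
    show "?P g \<longleftrightarrow> ?P g'" if "\<And>x. x \<in> topspace (top_of_set S2) \<Longrightarrow> g x = g' x" for g g'
    proof -
      have "homeomorphic_map (top_of_set S2) (top_of_set S2) g \<longleftrightarrow> homeomorphic_map (top_of_set S2) (top_of_set S2) g'"
        using homeomorphic_map_eq[of "top_of_set S2" "top_of_set S2" g g'] homeomorphic_map_eq[of "top_of_set S2" "top_of_set S2" g' g] that by metis
      moreover have "g (p i) = g' (p i)" for i using that pS by simp
      ultimately show ?thesis by simp
    qed
    have "continuous_map (prod_topology (top_of_set {0..1}) (top_of_set S2)) (top_of_set S2) h"
    proof -
      have "prod_topology (top_of_set {0..1::real}) (top_of_set S2) = top_of_set ({0..1} \<times> S2)"
        by (simp add: subtopology_Times euclidean_product_topology)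
      then show ?thesis using conth h_in by (auto simp del: mem_sphere_0)
    qed
    moreover have "h (0, x) = id x" "h (1, x) = f x" if x: "x \<in> S2" for x
    proof -
      obtain s z where z: "z \<in> cball 0 1" "x = \<Psi> s z" using S2_cases[OF x] .
      then show "h (0, x) = id x" "h (1, x) = f x" using hs[of 0 z s] hs[of 1 z s] start finish by auto
    qed
    ultimately show "\<exists>h. continuous_map (prod_topology (subtopology euclideanreal {0..1}) (top_of_set S2)) (top_of_set S2) h \<and>
       (\<forall>x\<in>topspace (top_of_set S2). h (0, x) = id x) \<and> (\<forall>x\<in>topspace (top_of_set S2). h (1, x) = f x) \<and> (\<forall>t\<in>{0..1}. ?P (\<lambda>x. h (t, x)))"
      using homeo marks by (intro exI[of _ h]) auto
  qed
  then show ?thesis by (simp add: isotopic_to_id_def)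
qed

lemma strict_mono_unit_interval:
  fixes g :: "real \<Rightarrow> real"
  assumes "continuous_on {0..1} g" "inj_on g {0..1}" "g ` {0..1} \<subseteq> {0..1}" "g 0 = 0" "g 1 = 1"
    and ab: "0 \<le> a" "a < b" "b \<le> 1"
  shows "g a < g b"
proof -
  have r: "0 \<le> g x" "g x \<le> 1" if "0 \<le> x" "x \<le> 1" for x using assms(3) that by (auto simp: image_subset_iff)
  have i: "g x \<noteq> g y" if "0 \<le> x" "x \<le> 1" "0 \<le> y" "y \<le> 1" "x \<noteq> y" for x y
    using assms(2) that by (auto simp: inj_on_def)
  show ?thesis
  proof (cases "a = 0")
    case True
    then show ?thesis using r[of b] i[of 0 b] ab assms(4) by auto
  next
    case False
    have "{0..b} \<subseteq> {0..1}" using ab by auto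
    then have "continuous_on {0..b} g" "inj_on g {0..b}"
      using assms(1,2) continuous_on_subset inj_on_subset by blast+
    then have "g 0 < g a \<and> g a < g b \<or> g b < g a \<and> g a < g 0"
      using continuous_inj_imp_mono[of 0 a b g] False ab by auto
    then show ?thesis using r[of a] ab assms(4) by auto
  qed
qed

context ngon
begin

lemma side_param: "side nxt w i = (\<lambda>a. w i + a *\<^sub>R (w (nxt i) - w i)) ` {0..1}"
  unfolding side_def closed_segment_def by (auto simp: algebra_simps image_iff)

text \<open>In the coordinate along the side, \<eta> is continuous, injective and fixes both ends,
  hence increasing; then so is every convex combination with the identity.\<close>

lemma bij_side_interpolation:
  assumes \<eta>: "continuous_on (side nxt w i) \<eta>" "inj_on \<eta> (side nxt w i)" "\<eta> ` side nxt w i = side nxt w i"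
    and ends: "\<eta> (w i) = w i" "\<eta> (w (nxt i)) = w (nxt i)" and t: "t \<in> {0..1}"
  shows "bij_betw (\<lambda>x. (1 - t) *\<^sub>R x + t *\<^sub>R \<eta> x) (side nxt w i) (side nxt w i)"
proof -
  define d where "d = w (nxt i) - w i"
  have d: "d \<noteq> 0" using w_nxt_neq by (simp add: d_def)
  define l where "l = (\<lambda>a. w i + a *\<^sub>R d)"
  define co where "co = (\<lambda>x. ((x - w i) \<bullet> d) / (d \<bullet> d))"
  have side: "side nxt w i = l ` {0..1}" unfolding side_param l_def d_def by simp
  have co_l: "co (l a) = a" for a using d by (simp add: co_def l_def)
  have inj_l: "l a = l b \<longleftrightarrow> a = b" for a b using co_l by metis
  define g where "g = (\<lambda>a. co (\<eta> (l a)))"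
  have lg: "\<eta> (l a) = l (g a)" "g a \<in> {0..1}" if "a \<in> {0..1}" for a
  proof -
    have "\<eta> (l a) \<in> l ` {0..1}" using \<eta>(3) that side by blast
    then show "\<eta> (l a) = l (g a)" "g a \<in> {0..1}" using co_l unfolding g_def by auto
  qed
  have cont_g: "continuous_on {0..1} g"
  proof -
    have "continuous_on {0..1} (\<lambda>a. \<eta> (l a))"
    proof (rule continuous_on_compose2[OF \<eta>(1)])
      show "continuous_on {0..1} l" unfolding l_def by (intro continuous_intros)
    qed (simp add: side)
    then show ?thesis unfolding g_def co_def using d by (intro continuous_intros) auto
  qed
  have inj_g: "inj_on g {0..1}"
  proof (rule inj_onI)
    fix a b assume ab: "a \<in> {0..1}" "b \<in> {0..1}" "g a = g b"
    then have "\<eta> (l a) = \<eta> (l b)" using lg by simp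
    then have "l a = l b" using \<eta>(2) ab side by (auto simp: inj_on_def)
    then show "a = b" using inj_l by simp
  qed
  have g01: "g 0 = 0" "g 1 = 1" using ends co_l[of 0] co_l[of 1] by (simp_all add: g_def l_def d_def)
  define u where "u = (\<lambda>a. (1 - t) * a + t * g a)"
  have u_mono: "u a < u b" if "0 \<le> a" "a < b" "b \<le> 1" for a b
  proof -
    have g: "g a < g b" by (rule strict_mono_unit_interval[OF cont_g inj_g _ g01 that]) (use lg in auto)
    show ?thesis
    proof (cases "t = 0")
      case False
      then have "t * g a < t * g b" using g t by simp
      moreover have "(1 - t) * a \<le> (1 - t) * b" using that t by (intro mult_left_mono) auto
      ultimately show ?thesis by (simp add: u_def)
    qed (use that in \<open>simp add: u_def\<close>)
  qed
  have u01: "u 0 = 0" "u 1 = 1" using g01 by (simp_all add: u_def)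
  have u_in: "u a \<in> {0..1}" if "a \<in> {0..1}" for a
    using u_mono[of 0 a] u_mono[of a 1] u01 that by (cases "a = 0"; cases "a = 1") auto
  have b_l: "(1 - t) *\<^sub>R l a + t *\<^sub>R \<eta> (l a) = l (u a)" if "a \<in> {0..1}" for a
    unfolding lg(1)[OF that] by (simp add: l_def u_def algebra_simps)
  show ?thesis
  proof (rule bij_betwI')
    fix x y assume "x \<in> side nxt w i" "y \<in> side nxt w i"
    then obtain a b where ab: "a \<in> {0..1}" "b \<in> {0..1}" "x = l a" "y = l b" unfolding side by blast
    have "u a = u b \<longleftrightarrow> a = b" using u_mono[of a b] u_mono[of b a] ab by (cases a b rule: linorder_cases) auto
    then show "(1 - t) *\<^sub>R x + t *\<^sub>R \<eta> x = (1 - t) *\<^sub>R y + t *\<^sub>R \<eta> y \<longleftrightarrow> x = y"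
      unfolding ab(3,4) b_l[OF ab(1)] b_l[OF ab(2)] inj_l .
  next
    fix x assume "x \<in> side nxt w i"
    then obtain a where a: "a \<in> {0..1}" "x = l a" unfolding side by blast
    show "(1 - t) *\<^sub>R x + t *\<^sub>R \<eta> x \<in> side nxt w i"
      unfolding a(2) b_l[OF a(1)] side using u_in[OF a(1)] by blast
  next
    fix y assume "y \<in> side nxt w i"
    then obtain b where b: "b \<in> {0..1}" "y = l b" unfolding side by blast
    have "continuous_on {0..1} u" unfolding u_def by (intro continuous_intros cont_g)
    then obtain a where a: "0 \<le> a" "a \<le> 1" "u a = b" using IVT'[of u 0 b 1] u01 b by auto
    then have "y = (1 - t) *\<^sub>R l a + t *\<^sub>R \<eta> (l a)" using b b_l[of a] by simp
    moreover have "l a \<in> side nxt w i" using a side by auto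
    ultimately show "\<exists>x\<in>side nxt w i. y = (1 - t) *\<^sub>R x + t *\<^sub>R \<eta> x" by blast
  qed
qed

text \<open>Different sides meet only in vertices, which stay fixed, so the bijections of the single
  sides fit together.\<close>

lemma bij_frontier_interpolation:
  assumes \<eta>: "continuous_on (region w) \<eta>" "inj_on \<eta> (region w)" "\<And>i. \<eta> ` side nxt w i = side nxt w i"
    and verts: "\<And>i. \<eta> (w i) = w i" and t: "t \<in> {0..1}"
  shows "bij_betw (\<lambda>x. (1 - t) *\<^sub>R x + t *\<^sub>R \<eta> x) (frontier (region w)) (frontier (region w))"
proof -
  define b where "b = (\<lambda>x. (1 - t) *\<^sub>R x + t *\<^sub>R \<eta> x)"
  have bs: "bij_betw b (side nxt w i) (side nxt w i)" for i
    unfolding b_def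
    by (rule bij_side_interpolation[OF continuous_on_subset[OF \<eta>(1) side_subset_region]
          inj_on_subset[OF \<eta>(2) side_subset_region] \<eta>(3) verts verts t])
  have bv: "b (w k) = w k" for k by (simp add: b_def verts algebra_simps)
  have inj: "x = y" if "x \<in> side nxt w i" "y \<in> side nxt w j" "b x = b y" for x y i j
  proof (cases "i = j")
    case True
    then show ?thesis using bij_betw_imp_inj_on[OF bs[of i]] that by (auto simp: inj_on_def)
  next
    case False
    have m: "b x \<in> side nxt w i" "b x \<in> side nxt w j" using bij_betwE[OF bs] that by metis+
    then obtain k where k: "b x = w k" using side_Int[OF False] by blast
    have "x = w k" using bij_betw_imp_inj_on[OF bs[of i]] that(1) m(1) k bv[of k] by (auto simp: inj_on_def)
    moreover have "y = w k" using bij_betw_imp_inj_on[OF bs[of j]] that(2,3) m(2) k bv[of k] by (auto simp: inj_on_def)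
    ultimately show ?thesis by simp
  qed
  have "bij_betw b (frontier (region w)) (frontier (region w))"
    unfolding frontier_region
  proof (rule bij_betwI')
    fix x y assume "x \<in> (\<Union>i. side nxt w i)" "y \<in> (\<Union>i. side nxt w i)"
    then show "b x = b y \<longleftrightarrow> x = y" using inj by blast
  next
    fix x assume "x \<in> (\<Union>i. side nxt w i)"
    then show "b x \<in> (\<Union>i. side nxt w i)" using bij_betwE[OF bs] by blast
  next
    fix y assume "y \<in> (\<Union>i. side nxt w i)"
    then obtain i where "y \<in> side nxt w i" by blast
    then obtain x where "x \<in> side nxt w i" "y = b x"
      using bij_betw_imp_surj_on[OF bs[of i]] by (metis (no_types, lifting) imageE)
    then show "\<exists>x\<in>\<Union>i. side nxt w i. y = b x" by blast
  qed
  then show ?thesis by (simp add: b_def)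
qed

text \<open>The straight-line motion along the sides is transported to the unit circle and extended
  over each sheet by \<open>alexander_isotopy\<close>. Both sheets use the same boundary motion
  because the two maps \<eta> agree on the frontier.\<close>

lemma polygon_isotopy:
  assumes \<Phi>: "double_homeo (region w) \<Phi>"
    and cont: "\<And>s. continuous_on (region w) (\<eta> s)" and bij: "\<And>s. bij_betw (\<eta> s) (region w) (region w)"
    and sides: "\<And>s i. \<eta> s ` side nxt w i = side nxt w i" and verts: "\<And>s i. \<eta> s (w i) = w i"
    and same: "\<And>x. x \<in> frontier (region w) \<Longrightarrow> \<eta> True x = \<eta> False x"
    and f: "\<And>s x. x \<in> region w \<Longrightarrow> f (\<Phi> s x) = \<Phi> s (\<eta> s x)"
  shows "isotopic_to_id (\<lambda>i. \<Phi> True (w i)) f"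
proof -
  let ?Q = "region w"
  have "?Q homeomorphic cball (0::complex) 1"
    by (rule homeomorphic_convex_compact_cball[OF convex_region compact_region interior_nonempty zero_less_one])
  then have "cball (0::complex) 1 homeomorphic ?Q" by (rule homeomorphic_sym[THEN iffD1])
  then obtain K K' where K: "homeomorphism (cball (0::complex) 1) ?Q K K'" unfolding homeomorphic_def by blast
  note KK = homeomorphism_cont1[OF K] homeomorphism_cont2[OF K] homeomorphism_image1[OF K] homeomorphism_image2[OF K]
    homeomorphism_apply1[OF K] homeomorphism_apply2[OF K]
  have injK: "inj_on K (cball 0 1)" by (rule inj_on_inverseI[where g = K']) (rule KK(5))
  have injK': "inj_on K' ?Q" by (rule inj_on_inverseI[where g = K]) (rule KK(6))
  have inQ: "K z \<in> ?Q" if "z \<in> cball 0 1" for z using KK(3) that by blast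
  have inD: "K' x \<in> cball 0 1" if "x \<in> ?Q" for x using KK(4) that by blast
  \<comment> \<open>Invariance of domain, here for \<open>K\<close> and then for its inverse, shows
    that interior goes to interior and hence boundary to boundary.\<close>
  have ball: "K z \<in> interior ?Q" if "z \<in> ball 0 1" for z
  proof -
    have "open (K ` ball 0 1)"
      by (intro invariance_of_domain continuous_on_subset[OF KK(1)] inj_on_subset[OF injK]) auto
    moreover have "K ` ball 0 1 \<subseteq> ?Q" using KK(3) ball_subset_cball by blast
    ultimately have "K ` ball 0 1 \<subseteq> interior ?Q" by (rule interior_maximal[rotated])
    then show ?thesis using that by blast
  qed
  have int: "K' x \<in> ball 0 1" if "x \<in> interior ?Q" for x
  proof -
    have "open (K' ` interior ?Q)"
      by (intro invariance_of_domain continuous_on_subset[OF KK(2)] inj_on_subset[OF injK'] interior_subset) simp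
    moreover have "K' ` interior ?Q \<subseteq> cball 0 1" using KK(4) interior_subset by blast
    ultimately have "K' ` interior ?Q \<subseteq> interior (cball 0 1)" by (rule interior_maximal[rotated])
    then show ?thesis using that by auto
  qed
  have fr: "frontier ?Q = ?Q - interior ?Q" using compact_region by (simp add: frontier_def compact_imp_closed)
  have sph: "K z \<in> frontier ?Q \<longleftrightarrow> z \<in> sphere 0 1" if "z \<in> cball 0 1" for z
  proof -
    have "K z \<in> interior ?Q \<longleftrightarrow> z \<in> ball 0 1" using ball[of z] int[of "K z"] KK(5)[OF that] by auto
    then show ?thesis using fr inQ[OF that] that by auto
  qed
  have frD: "K' x \<in> sphere 0 1" if "x \<in> frontier ?Q" for x
    using sph[of "K' x"] inD[of x] KK(6)[of x] that fr by auto
  define \<Psi> where "\<Psi> = (\<lambda>s. \<Phi> s \<circ> K)"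
  have \<Psi>: "double_homeo (cball 0 1) \<Psi>"
    unfolding double_homeo_def
  proof (intro conjI allI ballI)
    fix s
    have "continuous_on ?Q (\<Phi> s)" "inj_on (\<Phi> s) ?Q" using \<Phi> by (auto simp: double_homeo_def)
    then show "continuous_on (cball 0 1) (\<Psi> s)" "inj_on (\<Psi> s) (cball 0 1)"
      unfolding \<Psi>_def by (intro continuous_on_compose comp_inj_on KK(1) injK; simp add: KK(3))+
  next
    fix x y :: complex assume xy: "x \<in> cball 0 1" "y \<in> cball 0 1"
    have "\<Phi> True (K x) = \<Phi> False (K y) \<longleftrightarrow> K x = K y \<and> K x \<in> frontier ?Q"
      using \<Phi> inQ xy by (simp add: double_homeo_def)
    moreover have "K x = K y \<longleftrightarrow> x = y" using KK(5) xy by metis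
    ultimately show "\<Psi> True x = \<Psi> False y \<longleftrightarrow> x = y \<and> x \<in> frontier (cball 0 1)"
      using sph[OF xy(1)] by (simp add: \<Psi>_def)
  next
    show "(\<Union>s. \<Psi> s ` cball 0 1) = S2"
    proof -
      have "\<Psi> s ` cball 0 1 = \<Phi> s ` ?Q" for s by (simp only: \<Psi>_def image_comp[symmetric] KK(3))
      then show ?thesis using \<Phi> by (simp add: double_homeo_def)
    qed
  qed
  define bh where "bh = (\<lambda>(t, x). (1 - t) *\<^sub>R x + t *\<^sub>R \<eta> True x)"
  have bh: "bij_betw (\<lambda>x. bh (t, x)) (frontier ?Q) (frontier ?Q)" if "t \<in> {0..1}" for t
    unfolding bh_def split_conv
    by (rule bij_frontier_interpolation[OF cont bij_betw_imp_inj_on[OF bij] sides verts that])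
  define \<beta> where "\<beta> = (\<lambda>(t, z). K' (bh (t, K z)))"
  have c\<beta>: "continuous_on ({0..1} \<times> sphere 0 1) \<beta>"
  proof -
    have cK: "continuous_on ({0..1} \<times> sphere 0 1) (\<lambda>u::real \<times> complex. K (snd u))"
      by (rule continuous_on_compose2[OF KK(1)]) (auto intro: continuous_intros)
    have "continuous_on ({0..1} \<times> sphere 0 1) (\<lambda>u::real \<times> complex. \<eta> True (K (snd u)))"
      by (rule continuous_on_compose2[OF cont cK]) (auto intro!: inQ)
    then have c1: "continuous_on ({0..1} \<times> sphere 0 1) (\<lambda>u::real \<times> complex. bh (fst u, K (snd u)))"
      unfolding bh_def split_conv by (intro continuous_intros cK)
    have "(\<lambda>u::real \<times> complex. bh (fst u, K (snd u))) ` ({0..1} \<times> sphere 0 1) \<subseteq> ?Q"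
      using sph bij_betwE[OF bh] fr by (fastforce simp del: mem_sphere_0)
    then have "continuous_on ({0..1} \<times> sphere 0 1) (\<lambda>u. K' (bh (fst u, K (snd u))))"
      by (intro continuous_on_compose2[OF KK(2) c1])
    then show ?thesis by (simp add: \<beta>_def case_prod_unfold)
  qed
  have b\<beta>: "bij_betw (\<lambda>z. \<beta> (t, z)) (sphere 0 1) (sphere 0 1)" if t: "t \<in> {0..1}" for t
  proof -
    have b1: "bij_betw K (sphere 0 1) (frontier ?Q)"
    proof (rule bij_betw_byWitness[where f' = K'])
      show "\<forall>z\<in>sphere 0 1. K' (K z) = z" "\<forall>x\<in>frontier ?Q. K (K' x) = x" using KK(5,6) fr by auto
      show "K ` sphere 0 1 \<subseteq> frontier ?Q" using sph sphere_cball by blast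
      show "K' ` frontier ?Q \<subseteq> sphere 0 1" using frD by blast
    qed
    have b2: "bij_betw K' (frontier ?Q) (sphere 0 1)"
    proof (rule bij_betw_byWitness[where f' = K])
      show "\<forall>z\<in>sphere 0 1. K' (K z) = z" "\<forall>x\<in>frontier ?Q. K (K' x) = x" using KK(5,6) fr by auto
      show "K ` sphere 0 1 \<subseteq> frontier ?Q" using sph sphere_cball by blast
      show "K' ` frontier ?Q \<subseteq> sphere 0 1" using frD by blast
    qed
    have "bij_betw (K' \<circ> ((\<lambda>x. bh (t, x)) \<circ> K)) (sphere 0 1) (sphere 0 1)"
      by (rule bij_betw_trans[OF bij_betw_trans[OF b1 bh[OF t]] b2])
    then show ?thesis by (simp add: \<beta>_def comp_def)
  qed
  define \<eta>' where "\<eta>' = (\<lambda>s z. K' (\<eta> s (K z)))"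
  have c\<eta>': "continuous_on (cball 0 1) (\<eta>' s)" for s
  proof -
    have c: "continuous_on (cball 0 1) (\<lambda>z. \<eta> s (K z))"
      by (rule continuous_on_compose2[OF cont KK(1)]) (auto simp: KK(3))
    show ?thesis unfolding \<eta>'_def
      by (rule continuous_on_compose2[OF KK(2) c]) (use inQ bij_betwE[OF bij[of s]] in auto)
  qed
  have b\<eta>': "bij_betw (\<eta>' s) (cball 0 1) (cball 0 1)" for s
  proof -
    have b1: "bij_betw K (cball 0 1) ?Q" by (simp add: bij_betw_def injK KK(3))
    have b2: "bij_betw K' ?Q (cball 0 1)" by (simp add: bij_betw_def injK' KK(4))
    have "bij_betw (K' \<circ> (\<eta> s \<circ> K)) (cball 0 1) (cball 0 1)"
      by (rule bij_betw_trans[OF bij_betw_trans[OF b1 bij[of s]] b2])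
    then show ?thesis by (simp add: \<eta>'_def comp_def)
  qed
  have \<beta>0: "\<beta> (0, z) = z" if "z \<in> sphere 0 1" for z
    using that KK(5)[of z] by (simp add: \<beta>_def bh_def)
  have \<beta>1: "\<beta> (1, z) = \<eta>' s z" if "z \<in> sphere 0 1" for z s
  proof -
    have "z \<in> cball 0 1" using that sphere_cball by blast
    then have "K z \<in> frontier ?Q" using sph that by blast
    then have "\<eta> True (K z) = \<eta> s (K z)" using same by (cases s) auto
    then show ?thesis by (simp add: \<beta>_def bh_def \<eta>'_def)
  qed
  have "\<exists>H. continuous_on ({0..1} \<times> cball 0 1) H \<and>
     (\<forall>t\<in>{0..1}. bij_betw (\<lambda>z. H (t, z)) (cball 0 1) (cball 0 1)) \<and>
     (\<forall>z\<in>cball 0 1. H (0, z) = z \<and> H (1, z) = \<eta>' s z) \<and>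
     (\<forall>t\<in>{0..1}. \<forall>z\<in>sphere 0 1. H (t, z) = \<beta> (min 1 (2 * t), z))" for s
    by (rule alexander_isotopy[OF c\<eta>' b\<eta>' c\<beta> b\<beta> \<beta>0 \<beta>1])
  then obtain H where H: "\<And>s. continuous_on ({0..1} \<times> cball 0 1) (H s)"
     "\<And>s t. t \<in> {0..1} \<Longrightarrow> bij_betw (\<lambda>z. H s (t, z)) (cball 0 1) (cball 0 1)"
     "\<And>s z. z \<in> cball 0 1 \<Longrightarrow> H s (0, z) = z" "\<And>s z. z \<in> cball 0 1 \<Longrightarrow> H s (1, z) = \<eta>' s z"
     "\<And>s t z. t \<in> {0..1} \<Longrightarrow> z \<in> sphere 0 1 \<Longrightarrow> H s (t, z) = \<beta> (min 1 (2 * t), z)"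
    by metis
  have w_fr: "w i \<in> frontier ?Q" for i unfolding frontier_region side_def by auto
  show ?thesis
  proof (rule isotopic_to_id_of_sheets[OF \<Psi> H(1,2) _ _ H(3)])
    show "bij_betw (\<lambda>z. H s (t, z)) (sphere 0 1) (sphere 0 1)" if t: "t \<in> {0..1}" for s t
    proof -
      have "min 1 (2 * t) \<in> {0..1}" using t by auto
      then have "bij_betw (\<lambda>z. \<beta> (min 1 (2 * t), z)) (sphere 0 1) (sphere 0 1)" by (rule b\<beta>)
      then show ?thesis using H(5)[OF t] by (subst bij_betw_cong[of _ _ "\<lambda>z. \<beta> (min 1 (2 * t), z)"]) auto
    qed
    show "H True (t, z) = H False (t, z)" if "t \<in> {0..1}" "z \<in> sphere 0 1" for t z
      using H(5)[OF that] by simp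
    show "f (\<Psi> s z) = \<Psi> s (H s (1, z))" if z: "z \<in> cball 0 1" for s z
    proof -
      have "\<eta> s (K z) \<in> ?Q" using inQ[OF z] bij_betwE[OF bij] by blast
      then show ?thesis using f[OF inQ[OF z]] KK(6) H(4)[OF z] by (simp add: \<Psi>_def \<eta>'_def)
    qed
    show "K' (w i) \<in> sphere 0 1" for i using frD[OF w_fr] .
    show "\<Phi> True (w i) = \<Psi> True (K' (w i))" for i using KK(6)[OF w_in_region] by (simp add: \<Psi>_def)
    show "H True (t, K' (w i)) = K' (w i)" if "t \<in> {0..1}" for t i
      using H(5)[OF that frD[OF w_fr]] KK(6)[OF w_in_region, of i] verts
      by (simp add: \<beta>_def bh_def algebra_simps)
  qed
qed

end

section \<open>The class of the double in the moduli space\<close>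

lemma isotopic_to_id_homeo:
  assumes "isotopic_to_id p f"
  shows "homeomorphic_map (top_of_set S2) (top_of_set S2) f" "f (p i) = p i"
  using homotopic_with_imp_property[OF assms[unfolded isotopic_to_id_def]] by auto

lemma isotopic_to_id_refl: "isotopic_to_id p id"
  unfolding isotopic_to_id_def
  by (subst homotopic_with_refl) (auto simp del: mem_sphere_0)

lemma isotopic_to_id_right:
  assumes f: "isotopic_to_id p f"
    and g: "homeomorphic_map (top_of_set S2) (top_of_set S2) g" "\<And>i. g (p i) = p i"
  shows "homotopic_with (\<lambda>g. homeomorphic_map (top_of_set S2) (top_of_set S2) g \<and> (\<forall>i. g (p i) = p i))
    (top_of_set S2) (top_of_set S2) (id \<circ> g) (f \<circ> g)"
proof (rule homotopic_with_compose_continuous_map_right[OF f[unfolded isotopic_to_id_def]])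
  show "continuous_map (top_of_set S2) (top_of_set S2) g" by (rule homeomorphic_imp_continuous_map[OF g(1)])
qed (use g in \<open>auto intro: homeomorphic_map_compose\<close>)

lemma isotopic_to_id_compose:
  assumes "isotopic_to_id p f" "isotopic_to_id p g"
  shows "isotopic_to_id p (f \<circ> g)"
proof -
  note h = isotopic_to_id_right[OF assms(1) isotopic_to_id_homeo(1)[OF assms(2)] isotopic_to_id_homeo(2)[OF assms(2)]]
  show ?thesis
    unfolding isotopic_to_id_def
    using homotopic_with_trans[OF assms(2)[unfolded isotopic_to_id_def]] h by simp
qed

text \<open>Composing the isotopy from \<open>id\<close> to \<open>f\<close> with the inverse
  \<open>g\<close> on the right joins \<open>g\<close> to \<open>f \<circ> g\<close>, the identity
  on the sphere.\<close>

lemma isotopic_to_id_inverse: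
  assumes f: "isotopic_to_id p f" and p: "\<And>i. p i \<in> S2"
  obtains g where "isotopic_to_id p g" "\<And>x. x \<in> S2 \<Longrightarrow> g (f x) = x" "\<And>x. x \<in> S2 \<Longrightarrow> f (g x) = x"
    "\<And>x. x \<in> S2 \<Longrightarrow> g x \<in> S2" "\<And>x. x \<in> S2 \<Longrightarrow> f x \<in> S2"
proof -
  obtain g where g: "homeomorphic_maps (top_of_set S2) (top_of_set S2) f g"
    using isotopic_to_id_homeo(1)[OF f] unfolding homeomorphic_map_maps by blast
  have fg: "f (g x) = x" "g (f x) = x" if "x \<in> S2" for x using g that unfolding homeomorphic_maps_def by auto
  have gh: "homeomorphic_map (top_of_set S2) (top_of_set S2) g"
    using g homeomorphic_maps_sym homeomorphic_map_maps by blast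
  have gp: "g (p i) = p i" for i using fg(2)[OF p[of i]] isotopic_to_id_homeo(2)[OF f, of i] by simp
  let ?P = "\<lambda>g. homeomorphic_map (top_of_set S2) (top_of_set S2) g \<and> (\<forall>i. g (p i) = p i)"
  have "homotopic_with ?P (top_of_set S2) (top_of_set S2) g (f \<circ> g)"
    using isotopic_to_id_right[OF f gh gp] by simp
  then have "homotopic_with ?P (top_of_set S2) (top_of_set S2) g id"
  proof (rule homotopic_with_eq)
    show "id x = (f \<circ> g) x" if "x \<in> topspace (top_of_set S2)" for x using fg that by simp
    show "?P h \<longleftrightarrow> ?P k" if "\<And>x. x \<in> topspace (top_of_set S2) \<Longrightarrow> h x = k x" for h k
    proof -
      have "homeomorphic_map (top_of_set S2) (top_of_set S2) h \<longleftrightarrow> homeomorphic_map (top_of_set S2) (top_of_set S2) k"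
        using homeomorphic_map_eq[of "top_of_set S2" "top_of_set S2" h k] homeomorphic_map_eq[of "top_of_set S2" "top_of_set S2" k h] that by metis
      moreover have "h (p i) = k (p i)" for i using that p by simp
      ultimately show ?thesis by simp
    qed
  qed simp
  then have "isotopic_to_id p g" unfolding isotopic_to_id_def by (rule homotopic_with_symD)
  moreover have "g x \<in> S2" "f x \<in> S2" if "x \<in> S2" for x
    using homeomorphic_imp_surjective_map[OF gh] homeomorphic_imp_surjective_map[OF isotopic_to_id_homeo(1)[OF f]] that by auto
  ultimately show ?thesis using that[of g] fg by blast
qed

lemma similarity_rel_refl: "d \<in> cone_metrics p \<alpha> \<Longrightarrow> (d, d) \<in> similarity_rel p \<alpha>"
  unfolding similarity_rel_def using isotopic_to_id_refl[of p] by (auto intro!: exI[of _ id] exI[of _ 1])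

lemma similarity_rel_trans:
  assumes "(d, d') \<in> similarity_rel p \<alpha>" "(d', d'') \<in> similarity_rel p \<alpha>"
  shows "(d, d'') \<in> similarity_rel p \<alpha>"
proof -
  obtain f c where f: "isotopic_to_id p f" "0 < c" "\<And>x y. x \<in> S2 \<Longrightarrow> y \<in> S2 \<Longrightarrow> d' (f x) (f y) = c * d x y"
    using assms(1) unfolding similarity_rel_def by blast
  obtain g c' where g: "isotopic_to_id p g" "0 < c'" "\<And>x y. x \<in> S2 \<Longrightarrow> y \<in> S2 \<Longrightarrow> d'' (g x) (g y) = c' * d' x y"
    using assms(2) unfolding similarity_rel_def by blast
  have fS: "f x \<in> S2" if "x \<in> S2" for x
    using homeomorphic_imp_surjective_map[OF isotopic_to_id_homeo(1)[OF f(1)]] that by auto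
  have "d'' ((g \<circ> f) x) ((g \<circ> f) y) = (c' * c) * d x y" if "x \<in> S2" "y \<in> S2" for x y
    using f(3)[OF that] g(3)[OF fS[OF that(1)] fS[OF that(2)]] by simp
  moreover have "0 < c' * c" using f g by simp
  ultimately show ?thesis
    using isotopic_to_id_compose[OF g(1) f(1)] assms unfolding similarity_rel_def by blast
qed

lemma similarity_rel_sym:
  assumes "(d, d') \<in> similarity_rel p \<alpha>" "\<And>i. p i \<in> S2"
  shows "(d', d) \<in> similarity_rel p \<alpha>"
proof -
  obtain f c where f: "isotopic_to_id p f" "0 < c" "\<And>x y. x \<in> S2 \<Longrightarrow> y \<in> S2 \<Longrightarrow> d' (f x) (f y) = c * d x y"
    using assms(1) unfolding similarity_rel_def by blast
  obtain g where g: "isotopic_to_id p g" "\<And>x. x \<in> S2 \<Longrightarrow> f (g x) = x" "\<And>x. x \<in> S2 \<Longrightarrow> g x \<in> S2"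
    using isotopic_to_id_inverse[OF f(1) assms(2)] by metis
  have "d (g x) (g y) = (1 / c) * d' x y" if "x \<in> S2" "y \<in> S2" for x y
    using f(3)[OF g(3)[OF that(1)] g(3)[OF that(2)]] g(2) that f(2) by simp
  moreover have "0 < 1 / c" using f by simp
  ultimately show ?thesis using g(1) assms unfolding similarity_rel_def by blast
qed

lemma frontier_homothety:
  fixes Q :: "complex set"
  assumes "0 < c"
  shows "frontier ((\<lambda>x. c *\<^sub>R x + t) ` Q) = (\<lambda>x. c *\<^sub>R x + t) ` frontier Q"
proof -
  have "inj (\<lambda>x::complex. c *\<^sub>R x)" "linear (\<lambda>x::complex. c *\<^sub>R x)"
    using assms by (auto simp: inj_on_def linear_scale_self)
  then have "frontier ((\<lambda>x. c *\<^sub>R x) ` Q) = (\<lambda>x. c *\<^sub>R x) ` frontier Q"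
    unfolding frontier_def
    by (simp only: image_set_diff closure_injective_linear_image interior_injective_linear_image)
  then have "frontier ((+) t ` (\<lambda>x. c *\<^sub>R x) ` Q) = (+) t ` (\<lambda>x. c *\<^sub>R x) ` frontier Q"
    by (simp only: frontier_translation)
  then show ?thesis by (simp add: image_image add.commute)
qed

lemma double_dist_homothety:
  assumes Q: "compact Q" "convex Q" "Q \<noteq> {}" and c: "0 < c"
  shows "double_dist ((\<lambda>x. c *\<^sub>R x + t) ` Q) s (c *\<^sub>R x + t) u (c *\<^sub>R y + t) = c * double_dist Q s x u y"
proof -
  let ?T = "\<lambda>x. c *\<^sub>R x + t"
  have dT: "dist (?T a) (?T b) = c * dist a b" for a b
    using c by (simp add: dist_norm flip: scaleR_diff_right)
  show ?thesis
  proof (cases "s = u")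
    case False
    have F: "frontier Q \<noteq> {}" using Q by (metis compact_imp_bounded frontier_eq_empty not_bounded_UNIV)
    have bdd: "bdd_below ((\<lambda>z. dist x z + dist z y) ` frontier Q)"
      by (auto intro!: bdd_belowI2[where m = 0])
    have "(INF z\<in>frontier (?T ` Q). dist (?T x) z + dist z (?T y)) = (INF z\<in>frontier Q. c * (dist x z + dist z y))"
      unfolding frontier_homothety[OF c] image_image by (simp only: dT distrib_left)
    also have "\<dots> = c * (INF z\<in>frontier Q. dist x z + dist z y)"
    proof (rule antisym)
      have "(INF z\<in>frontier Q. c * (dist x z + dist z y)) / c \<le> (INF z\<in>frontier Q. dist x z + dist z y)"
      proof (rule cINF_greatest[OF F])
        fix z assume "z \<in> frontier Q"
        then have "(INF z\<in>frontier Q. c * (dist x z + dist z y)) \<le> c * (dist x z + dist z y)"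
          using c by (intro cINF_lower bdd_belowI2[where m = 0]) auto
        then show "(INF z\<in>frontier Q. c * (dist x z + dist z y)) / c \<le> dist x z + dist z y"
          using c by (simp add: divide_le_eq mult.commute)
      qed
      then show "(INF z\<in>frontier Q. c * (dist x z + dist z y)) \<le> c * (INF z\<in>frontier Q. dist x z + dist z y)"
        using c by (simp add: divide_le_eq mult.commute)
      show "c * (INF z\<in>frontier Q. dist x z + dist z y) \<le> (INF z\<in>frontier Q. c * (dist x z + dist z y))"
        using c by (intro cINF_greatest[OF F] mult_left_mono cINF_lower bdd) auto
    qed
    finally show ?thesis using False by (simp add: double_dist_def)
  next
    case True
    then show ?thesis by (simp only: double_dist_def dT simp_thms if_True)
  qed
qed

context ngon
begin

lemma region_ne: "region w \<noteq> {}"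
  using w_in_region by blast

lemma frontier_subset_region: "frontier (region w) \<subseteq> region w"
  using side_subset_region by (auto simp: frontier_region)

end

locale marked_ngon = ngon nxt v i0 for nxt :: "'n::finite \<Rightarrow> 'n" and v i0 +
  fixes p :: "'n \<Rightarrow> point" and \<alpha> :: "'n \<Rightarrow> real" and \<Phi> :: "bool \<Rightarrow> complex \<Rightarrow> point"
  assumes angles: "\<And>i. interior_angle (v i) (v (nxt i)) (v (nxt (nxt i))) = \<alpha> (nxt i) / 2"
    and marking: "double_marking v p \<Phi>"
begin

lemma \<Phi>_homeo: "double_homeo (region v) \<Phi>" and \<Phi>_mark: "\<Phi> s (v i) = p i"
  using marking by (auto simp: double_marking_def)

lemma p_in_S2: "p i \<in> S2"
  using \<Phi>_homeo \<Phi>_mark[of True i] w_in_region[of i] unfolding double_homeo_def by (metis UN_I UNIV_I imageI)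

lemma parallel_angles:
  assumes "w \<in> parallel_ngons nxt v"
  shows "interior_angle (w i) (w (nxt i)) (w (nxt (nxt i))) = \<alpha> (nxt i) / 2"
proof -
  interpret parallel_pair nxt v i0 w by unfold_locales (rule assms)
  show ?thesis using angles[of i] by (simp only: w.interior_angle_eq interior_angle_eq same_D)
qed

definition doubled_by :: "('n \<Rightarrow> complex) \<Rightarrow> (point \<Rightarrow> point \<Rightarrow> real) \<Rightarrow> (bool \<Rightarrow> complex \<Rightarrow> point) \<Rightarrow> bool" where
  "doubled_by w d \<phi> \<longleftrightarrow> double_homeo (region w) \<phi> \<and>
     (\<forall>s. \<phi> s ` region w = \<Phi> s ` region v) \<and>
     (\<forall>s i. \<phi> s ` side nxt w i = \<Phi> s ` side nxt v i) \<and>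
     (\<forall>s i. \<phi> s (w i) = \<Phi> s (v i)) \<and>
     (\<forall>s t. \<forall>x\<in>region w. \<forall>y\<in>region w. d (\<phi> s x) (\<phi> t y) = double_dist (region w) s x t y)"

lemma double_metrics_eq: "double_metrics nxt v p \<alpha> \<Phi> w = {d \<in> cone_metrics p \<alpha>. \<exists>\<phi>. doubled_by w d \<phi>}"
  by (simp only: double_metrics_def doubled_by_def)

lemma doubled_byD:
  assumes "doubled_by w d \<phi>"
  shows "double_homeo (region w) \<phi>" "\<phi> s ` region w = \<Phi> s ` region v"
    "\<phi> s ` side nxt w i = \<Phi> s ` side nxt v i" "\<phi> s (w i) = \<Phi> s (v i)"
    "x \<in> region w \<Longrightarrow> y \<in> region w \<Longrightarrow> d (\<phi> s x) (\<phi> t y) = double_dist (region w) s x t y"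
  using assms unfolding doubled_by_def by (simp_all only: simp_thms)

text \<open>The homothety, conjugated by the identifications of the two doubles with the sphere, is
  a similarity \<open>f\<close> preserving sheets, sides and vertices, so
  \<open>polygon_isotopy\<close> applies to it. The case \<open>c = 1\<close>, \<open>t = 0\<close>
  says that the class does not depend on the identification.\<close>

lemma double_metrics_similar:
  assumes w: "w \<in> parallel_ngons nxt v" and w': "w' \<in> parallel_ngons nxt v"
    and ct: "0 < c" "\<And>i. w' i = c *\<^sub>R w i + t"
    and d: "d \<in> double_metrics nxt v p \<alpha> \<Phi> w" and d': "d' \<in> double_metrics nxt v p \<alpha> \<Phi> w'"
  shows "(d, d') \<in> similarity_rel p \<alpha>"
proof -
  interpret W: parallel_pair nxt v i0 w by unfold_locales (rule w)
  interpret W': parallel_pair nxt v i0 w' by unfold_locales (rule w')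
  let ?Q = "region v" and ?R = "region w" and ?R' = "region w'"
  obtain \<phi> \<phi>' where dby: "doubled_by w d \<phi>" "doubled_by w' d' \<phi>'"
    using d d' unfolding double_metrics_eq by blast
  note \<phi> = doubled_byD[OF dby(1)] and \<phi>' = doubled_byD[OF dby(2)]
  define T where "T = (\<lambda>x. c *\<^sub>R x + t)"
  have injT: "inj T" using ct by (auto simp: T_def inj_def)
  have T_aff: "T ` (convex hull X) = convex hull (T ` X)" for X
  proof -
    have "(\<lambda>x. t + c *\<^sub>R x) ` (convex hull X) = convex hull ((\<lambda>x. t + c *\<^sub>R x) ` X)"
      by (rule convex_hull_affinity[symmetric])
    then show ?thesis by (simp add: T_def add.commute)
  qed
  have TR: "T ` ?R = ?R'"
    unfolding region_def T_aff by (simp add: image_image T_def ct(2))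
  have T_side: "T ` side nxt w i = side nxt w' i" for i
    unfolding side_def segment_convex_hull T_aff by (simp add: T_def ct(2))
  have T_fr: "T x \<in> frontier ?R' \<longleftrightarrow> x \<in> frontier ?R" for x
    using frontier_homothety[OF ct(1), of t ?R] TR injT unfolding T_def[symmetric] by (auto simp: inj_def)
  have TRin: "T x \<in> ?R'" if "x \<in> ?R" for x using TR that by blast
  have ddT: "double_dist ?R' s (T x) u (T y) = c * double_dist ?R s x u y" for s x u y
    using double_dist_homothety[OF W.w.compact_region W.w.convex_region W.w.region_ne ct(1), of t s x u y] TR
    unfolding T_def by simp
  have i\<Phi>: "inj_on (\<Phi> s) ?Q" and c\<Phi>: "continuous_on ?Q (\<Phi> s)" for s using \<Phi>_homeo by (auto simp: double_homeo_def)
  have i\<phi>: "inj_on (\<phi> s) ?R" and c\<phi>: "continuous_on ?R (\<phi> s)" for s using \<phi>(1) by (auto simp: double_homeo_def)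
  have i\<phi>': "inj_on (\<phi>' s) ?R'" and c\<phi>': "continuous_on ?R' (\<phi>' s)" for s using \<phi>'(1) by (auto simp: double_homeo_def)
  have g\<Phi>: "\<Phi> True x = \<Phi> False y \<longleftrightarrow> x = y \<and> x \<in> frontier ?Q" if "x \<in> ?Q" "y \<in> ?Q" for x y
    using \<Phi>_homeo that by (auto simp: double_homeo_def)
  have g\<phi>: "\<phi> True x = \<phi> False y \<longleftrightarrow> x = y \<and> x \<in> frontier ?R" if "x \<in> ?R" "y \<in> ?R" for x y
    using \<phi>(1) that by (auto simp: double_homeo_def)
  have g\<phi>': "\<phi>' True x = \<phi>' False y \<longleftrightarrow> x = y \<and> x \<in> frontier ?R'" if "x \<in> ?R'" "y \<in> ?R'" for x y
    using \<phi>'(1) that by (auto simp: double_homeo_def)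
  define I where "I = (\<lambda>s. inv_into ?R (\<phi> s))"
  define J where "J = (\<lambda>s. inv_into ?Q (\<Phi> s))"
  have I: "I s (\<phi> s x) = x" if "x \<in> ?R" for s x using that i\<phi> by (simp add: I_def)
  have J: "J s (\<Phi> s x) = x" if "x \<in> ?Q" for s x using that i\<Phi> by (simp add: J_def)
  have cI: "continuous_on (\<phi> s ` ?R) (I s)" for s
    by (rule continuous_on_inv[OF c\<phi> W.w.compact_region]) (use I in auto)
  have cJ: "continuous_on (\<Phi> s ` ?Q) (J s)" for s
    by (rule continuous_on_inv[OF c\<Phi> compact_region]) (use J in auto)
  define f where "f = (\<lambda>a. if a \<in> \<phi> True ` ?R then \<phi>' True (T (I True a)) else \<phi>' False (T (I False a)))"
  have f: "f (\<phi> s x) = \<phi>' s (T x)" if x: "x \<in> ?R" for s x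
  proof (cases "s \<or> \<phi> s x \<notin> \<phi> True ` ?R")
    case True
    then show ?thesis using I[OF x, of s] x by (cases s) (auto simp: f_def)
  next
    case False
    then obtain y where y: "y \<in> ?R" "\<phi> True y = \<phi> False x" "\<not> s" by (cases s) auto
    then have yx: "y = x" "x \<in> frontier ?R" using g\<phi> x by auto
    then have "\<phi>' True (T x) = \<phi>' False (T x)" using g\<phi>' TRin[OF x] T_fr by blast
    then show ?thesis using False y yx I[OF x, of True] by (cases s) (auto simp: f_def)
  qed
  \<comment> \<open>The map \<open>f\<close> seen on sheet \<open>s\<close> of the double of
    \<open>P\<close>.\<close>
  define \<eta> where "\<eta> = (\<lambda>s y. J s (\<phi>' s (T (I s (\<Phi> s y)))))"
  have step: "\<exists>x\<in>?R. \<Phi> s y = \<phi> s x" if "y \<in> ?Q" for s y using \<phi>(2)[of s] that by (metis imageE imageI)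
  have \<eta>x: "\<eta> s y \<in> ?Q \<and> \<Phi> s (\<eta> s y) = \<phi>' s (T x)" if "y \<in> ?Q" "x \<in> ?R" "\<Phi> s y = \<phi> s x" for s y x
  proof -
    have e: "\<eta> s y = J s (\<phi>' s (T x))" using I[OF that(2)] that(3) by (simp add: \<eta>_def)
    have "\<phi>' s (T x) \<in> \<Phi> s ` ?Q" using \<phi>'(2)[of s] TRin[OF that(2)] by blast
    then obtain y' where "y' \<in> ?Q" "\<phi>' s (T x) = \<Phi> s y'" by blast
    then show ?thesis using J e by simp
  qed
  have f\<Phi>: "f (\<Phi> s y) = \<Phi> s (\<eta> s y)" if "y \<in> ?Q" for s y
    using step[OF that, of s] \<eta>x[OF that] f by (metis (no_types, lifting))
  have "isotopic_to_id (\<lambda>i. \<Phi> True (v i)) f"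
  proof (rule polygon_isotopy[where \<eta> = \<eta>, OF \<Phi>_homeo _ _ _ _ _ f\<Phi>])
    show "continuous_on ?Q (\<eta> s)" for s
    proof -
      have c1: "continuous_on ?Q (\<lambda>y. I s (\<Phi> s y))"
        by (rule continuous_on_compose2[OF cI[of s] c\<Phi>[of s]]) (simp only: \<phi>(2) order_refl)
      have r1: "I s (\<Phi> s y) \<in> ?R" if "y \<in> ?Q" for y using step[OF that, of s] I by auto
      have c2: "continuous_on ?Q (\<lambda>y. T (I s (\<Phi> s y)))" unfolding T_def by (intro continuous_intros c1)
      have c3: "continuous_on ?Q (\<lambda>y. \<phi>' s (T (I s (\<Phi> s y))))"
        by (rule continuous_on_compose2[OF c\<phi>'[of s] c2]) (use r1 TRin in blast)
      show ?thesis unfolding \<eta>_def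
        by (rule continuous_on_compose2[OF cJ[of s] c3]) (use r1 TRin \<phi>'(2)[of s] in blast)
    qed
    show "bij_betw (\<eta> s) ?Q ?Q" for s
    proof (rule bij_betwI')
      fix y y' assume y: "y \<in> ?Q" "y' \<in> ?Q"
      obtain x where x: "x \<in> ?R" "\<Phi> s y = \<phi> s x" using step[OF y(1)] by blast
      obtain x' where x': "x' \<in> ?R" "\<Phi> s y' = \<phi> s x'" using step[OF y(2)] by blast
      show "\<eta> s y = \<eta> s y' \<longleftrightarrow> y = y'"
      proof
        assume "\<eta> s y = \<eta> s y'"
        then have "\<phi>' s (T x) = \<phi>' s (T x')" using \<eta>x[OF y(1) x] \<eta>x[OF y(2) x'] by simp
        then have "T x = T x'" using i\<phi>'[of s] TRin x x' by (meson inj_onD)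
        then have "x = x'" using injT by (simp add: inj_eq)
        then show "y = y'" using i\<Phi>[of s] x x' y by (metis inj_onD)
      qed simp
    next
      show "\<eta> s y \<in> ?Q" if "y \<in> ?Q" for y using step[OF that, of s] \<eta>x[OF that] by blast
      fix y assume y: "y \<in> ?Q"
      then have "\<Phi> s y \<in> \<phi>' s ` ?R'" using \<phi>'(2)[of s] by blast
      then obtain x where x: "x \<in> ?R" "\<Phi> s y = \<phi>' s (T x)" unfolding TR[symmetric] by (elim imageE) simp
      have "\<phi> s x \<in> \<Phi> s ` ?Q" unfolding \<phi>(2)[of s, symmetric] using x(1) by (rule imageI)
      then obtain y' where y': "y' \<in> ?Q" "\<Phi> s y' = \<phi> s x" by (metis imageE)
      have "\<eta> s y' \<in> ?Q" "\<Phi> s (\<eta> s y') = \<Phi> s y" using \<eta>x[OF y'(1) x(1) y'(2)] x by auto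
      then have "\<eta> s y' = y" using i\<Phi>[of s] y by (meson inj_onD)
      then show "\<exists>y'\<in>?Q. y = \<eta> s y'" using y' by blast
    qed
    have sub: "\<eta> s ` side nxt v i \<subseteq> side nxt v i" for s i
    proof clarify
      fix y assume y: "y \<in> side nxt v i"
      then have yQ: "y \<in> ?Q" using side_subset_region by blast
      have "\<Phi> s y \<in> \<phi> s ` side nxt w i" unfolding \<phi>(3) using y by (rule imageI)
      then obtain x where x: "x \<in> side nxt w i" "\<Phi> s y = \<phi> s x" by (rule imageE) simp
      then have xR: "x \<in> ?R" using W.w.side_subset_region by blast
      have "\<phi>' s (T x) \<in> \<Phi> s ` side nxt v i"
        unfolding \<phi>'(3)[symmetric] T_side[symmetric] using x(1) by (intro imageI)
      then obtain y' where y': "y' \<in> side nxt v i" "\<phi>' s (T x) = \<Phi> s y'" by (rule imageE) simp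
      have "\<Phi> s (\<eta> s y) = \<Phi> s y'" "\<eta> s y \<in> ?Q" using \<eta>x[OF yQ xR x(2)] y' by auto
      moreover have "y' \<in> ?Q" using y' side_subset_region by blast
      ultimately have "\<eta> s y = y'" using i\<Phi>[of s] by (meson inj_onD)
      then show "\<eta> s y \<in> side nxt v i" using y' by simp
    qed
    show "\<eta> s ` side nxt v i = side nxt v i" for s i
    proof (rule antisym[OF sub])
      show "side nxt v i \<subseteq> \<eta> s ` side nxt v i"
      proof
        fix y assume y: "y \<in> side nxt v i"
        then have yQ: "y \<in> ?Q" using side_subset_region by blast
        have "\<Phi> s y \<in> \<phi>' s ` side nxt w' i" unfolding \<phi>'(3) using y by (rule imageI)
        then obtain x where x: "x \<in> side nxt w i" "\<Phi> s y = \<phi>' s (T x)"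
          unfolding T_side[symmetric] by (elim imageE) simp
        then have xR: "x \<in> ?R" using W.w.side_subset_region by blast
        have "\<phi> s x \<in> \<Phi> s ` side nxt v i" unfolding \<phi>(3)[symmetric] using x(1) by (rule imageI)
        then obtain y' where y': "y' \<in> side nxt v i" "\<Phi> s y' = \<phi> s x" by (metis imageE)
        have y'Q: "y' \<in> ?Q" using y' side_subset_region by blast
        have "\<eta> s y' \<in> ?Q" "\<Phi> s (\<eta> s y') = \<Phi> s y" using \<eta>x[OF y'Q xR y'(2)] x by auto
        then have "y = \<eta> s y'" using i\<Phi>[of s] yQ by (metis inj_onD)
        then show "y \<in> \<eta> s ` side nxt v i" using y' by blast
      qed
    qed
    show "\<eta> s (v i) = v i" for s i
    proof -
      have "\<Phi> s (\<eta> s (v i)) = \<phi>' s (T (w i))" "\<eta> s (v i) \<in> ?Q"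
        using \<eta>x[OF w_in_region W.w.w_in_region \<phi>(4)[symmetric], of s i] by auto
      moreover have "\<phi>' s (T (w i)) = \<Phi> s (v i)" using \<phi>'(4)[of s i] ct(2)[of i] by (simp add: T_def)
      ultimately show ?thesis using i\<Phi>[of s] w_in_region by (metis inj_onD)
    qed
    show "\<eta> True y = \<eta> False y" if "y \<in> frontier ?Q" for y
    proof -
      have yQ: "y \<in> ?Q" using that frontier_subset_region by blast
      obtain x where x: "x \<in> ?R" "\<Phi> True y = \<phi> True x" using step[OF yQ] by blast
      obtain x' where x': "x' \<in> ?R" "\<Phi> False y = \<phi> False x'" using step[OF yQ] by blast
      have "\<Phi> True y = \<Phi> False y" using g\<Phi>[OF yQ yQ] that by simp
      then have "x = x'" "x \<in> frontier ?R" using g\<phi>[OF x(1) x'(1)] x x' by auto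
      then have "\<phi>' True (T x) = \<phi>' False (T x')" using g\<phi>' TRin x T_fr by blast
      then have "\<Phi> True (\<eta> True y) = \<Phi> False (\<eta> False y)" using \<eta>x[OF yQ x] \<eta>x[OF yQ x'] by simp
      then show ?thesis using g\<Phi> \<eta>x[OF yQ x] \<eta>x[OF yQ x'] by blast
    qed
  qed
  then have "isotopic_to_id p f" by (simp add: \<Phi>_mark)
  moreover have "d' (f a) (f b) = c * d a b" if ab: "a \<in> S2" "b \<in> S2" for a b
  proof -
    have "(\<Union>s. \<phi> s ` ?R) = S2" using \<phi>(1) by (simp add: double_homeo_def)
    then have "\<exists>s. \<exists>x\<in>?R. a = \<phi> s x" if "a \<in> S2" for a
      using that by (simp only: set_eq_iff UN_iff image_iff UNIV_I bex_simps simp_thms)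
    then obtain s x u y where x: "x \<in> ?R" "a = \<phi> s x" and y: "y \<in> ?R" "b = \<phi> u y"
      using ab by meson
    show ?thesis unfolding x(2) y(2) f[OF x(1)] f[OF y(1)]
      using \<phi>(5)[OF x(1) y(1)] \<phi>'(5)[OF TRin[OF x(1)] TRin[OF y(1)]] ddT by simp
  qed
  ultimately show ?thesis
    using d d' ct(1) unfolding similarity_rel_def double_metrics_eq by blast
qed

text \<open>The homeomorphism between the regions of two parallel polygons which is radial from the
  midpoints of their last sides.\<close>

definition region_map :: "('n \<Rightarrow> complex) \<Rightarrow> complex \<Rightarrow> complex" where
  "region_map w = kap \<circ> inv_into upper_disk (ngon.kap nxt w i0)"

lemma region_map:
  assumes w: "w \<in> parallel_ngons nxt v"
  shows "\<And>z. z \<in> upper_disk \<Longrightarrow> region_map w (ngon.kap nxt w i0 z) = kap z"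
    and "continuous_on (region w) (region_map w)" "bij_betw (region_map w) (region w) (region v)"
    and "\<And>i. region_map w ` side nxt w i = side nxt v i" "\<And>i. region_map w (w i) = v i"
    and "\<And>x. x \<in> region w \<Longrightarrow> region_map w x \<in> frontier (region v) \<longleftrightarrow> x \<in> frontier (region w)"
proof -
  interpret W: parallel_pair nxt v i0 w by unfold_locales (rule w)
  let ?k = "W.w.kap"
  show rm: "region_map w (?k z) = kap z" if "z \<in> upper_disk" for z
    using that W.w.inj_on_kap by (simp add: region_map_def)
  have cU: "compact upper_disk"
  proof -
    have "upper_disk = cball 0 1 \<inter> {z. 0 \<le> Im z}" by auto
    then show ?thesis by (simp add: compact_Int_closed closed_halfspace_Im_ge)
  qed
  have "continuous_on (?k ` upper_disk) (inv_into upper_disk ?k)"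
    by (rule continuous_on_inv[OF W.w.continuous_on_kap cU]) (simp add: W.w.inj_on_kap)
  then have "continuous_on (region w) (inv_into upper_disk ?k)" by (simp only: W.w.kap_image)
  then show "continuous_on (region w) (region_map w)"
    unfolding region_map_def
  proof (rule continuous_on_compose)
    have "inv_into upper_disk ?k ` region w \<subseteq> upper_disk"
      unfolding W.w.kap_image[symmetric] by (auto simp: W.w.inj_on_kap)
    then show "continuous_on (inv_into upper_disk ?k ` region w) kap"
      by (rule continuous_on_subset[OF continuous_on_kap])
  qed
  have "bij_betw ?k upper_disk (region w)" "bij_betw kap upper_disk (region v)"
    using W.w.inj_on_kap W.w.kap_image inj_on_kap kap_image by (simp_all add: bij_betw_def)
  then show "bij_betw (region_map w) (region w) (region v)"
    unfolding region_map_def using bij_betw_inv_into bij_betw_trans by blast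
  have im: "region_map w ` (?k ` A) = kap ` A" if "A \<subseteq> upper_disk" for A
    using rm that unfolding image_image by (intro image_cong) auto
  show sides: "region_map w ` side nxt w i = side nxt v i" for i
  proof -
    obtain k where k: "k < CARD('n)" "i = lbl k" by (rule lbl_exhaust)
    show ?thesis
    proof (cases "k < N")
      case True
      have A: "(\<lambda>s. cis (pi * (real k + s) / real N)) ` {0..1} \<subseteq> upper_disk"
        using kap_boundary_point(2,3)[OF True] by (auto simp: sin_ge_zero)
      have "k < W.w.N" using True by simp
      note W.w.side_eq_kap[OF this]
      then show ?thesis by (simp only: k(2) im[OF A] side_eq_kap[OF True])
    next
      case False
      then have kN: "k = N" using k Suc_N by simp
      have A: "of_real ` {-1..1} \<subseteq> upper_disk" by (auto simp: abs_le_iff)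
      show ?thesis
        using W.w.last_side_eq by (simp only: k(2) kN im[OF A] last_side_eq)
    qed
  qed
  show "region_map w (w i) = v i" for i
  proof -
    obtain k where k: "k < CARD('n)" "i = lbl k" by (rule lbl_exhaust)
    have wk: "w i = W.w.W k" "v i = W k" using k by (simp_all add: W.w.W_def W_def)
    show ?thesis
    proof (cases "k < N")
      case True
      let ?z = "cis (pi * (real k + 0) / real N)"
      have "?z \<in> upper_disk" using kap_boundary_point(2,3)[OF True, of 0] by (simp add: sin_ge_zero)
      moreover have "?k ?z = w i" using W.w.kap_boundary_point(1)[of k 0] True wk by simp
      moreover have "kap ?z = v i" using kap_boundary_point(1)[OF True, of 0] wk by simp
      ultimately show ?thesis using rm[of ?z] by (simp only:)
    next
      case False
      then have kN: "k = N" using k Suc_N by simp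
      have "?k (of_real (-1)) = w i"
        using W.w.kap_real[of "-1"] W.w.W_N wk kN by (simp add: algebra_simps) (metis add_left_cancel)
      moreover have "kap (of_real (-1)) = v i"
        using kap_real[of "-1"] W_N wk kN by (simp add: algebra_simps) (metis add_left_cancel)
      ultimately show ?thesis using rm[of "of_real (-1)"] by simp
    qed
  qed
  show "region_map w x \<in> frontier (region v) \<longleftrightarrow> x \<in> frontier (region w)" if xw: "x \<in> region w" for x
  proof -
    obtain z where z: "z \<in> upper_disk" "x = ?k z" using xw unfolding W.w.kap_image[symmetric] by blast
    show ?thesis unfolding z(2) rm[OF z(1)] kap_frontier_iff[OF z(1)] W.w.kap_frontier_iff[OF z(1)] ..
  qed
qed

text \<open>The identification is \<Phi> after the radial \<open>region_map\<close>. Its explicit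
  distances are exported because the unfolding works with this metric and not with just any metric
  of the class.\<close>

lemma double_metric_exists:
  assumes w: "w \<in> parallel_ngons nxt v"
  obtains d where "d \<in> double_metrics nxt v p \<alpha> \<Phi> w"
    "\<forall>s t. \<forall>x\<in>region w. \<forall>y\<in>region w.
       d (\<Phi> s (region_map w x)) (\<Phi> t (region_map w y)) = double_dist (region w) s x t y"
proof -
  interpret W: parallel_pair nxt v i0 w by unfold_locales (rule w)
  let ?m = "region_map w"
  note m = region_map[OF w]
  define \<phi> where "\<phi> = (\<lambda>s. \<Phi> s \<circ> ?m)"
  have mR: "?m ` region w = region v" using m(3) by (simp add: bij_betw_def)
  have im: "inj_on ?m (region w)" using m(3) by (simp add: bij_betw_def)
  have h: "double_homeo (region w) \<phi>"
    unfolding double_homeo_def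
  proof (intro conjI allI ballI)
    fix s
    have "continuous_on (region v) (\<Phi> s)" "inj_on (\<Phi> s) (region v)" using \<Phi>_homeo by (auto simp: double_homeo_def)
    then show "continuous_on (region w) (\<phi> s)" "inj_on (\<phi> s) (region w)"
      unfolding \<phi>_def by (intro continuous_on_compose comp_inj_on m(2) im; simp add: mR)+
  next
    fix x y assume xy: "x \<in> region w" "y \<in> region w"
    have "\<Phi> True (?m x) = \<Phi> False (?m y) \<longleftrightarrow> ?m x = ?m y \<and> ?m x \<in> frontier (region v)"
    proof -
      have "?m x \<in> region v" "?m y \<in> region v" using mR xy by blast+
      then show ?thesis using \<Phi>_homeo unfolding double_homeo_def by blast
    qed
    then show "\<phi> True x = \<phi> False y \<longleftrightarrow> x = y \<and> x \<in> frontier (region w)"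
      using m(6)[OF xy(1)] im xy by (auto simp: \<phi>_def inj_on_def)
  next
    show "(\<Union>s. \<phi> s ` region w) = S2"
    proof -
      have "\<phi> s ` region w = \<Phi> s ` region v" for s by (simp only: \<phi>_def image_comp[symmetric] mR)
      then show ?thesis using \<Phi>_homeo by (simp add: double_homeo_def)
    qed
  qed
  interpret dbl: doubled "region w" \<phi>
    by unfold_locales (rule W.w.compact_region W.w.convex_region W.w.region_ne h)+
  obtain d where d: "\<And>a b. 0 \<le> d a b" "\<And>a b. d a b = d b a"
     "\<And>s t x y. x \<in> region w \<Longrightarrow> y \<in> region w \<Longrightarrow> d (\<phi> s x) (\<phi> t y) = double_dist (region w) s x t y"
    using dbl.ex_metric by blast
  have "double_metric (region w) \<phi> d"
    by unfold_locales (rule d; assumption?)+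
  then have "d \<in> cone_metrics p \<alpha>"
    by (rule W.w.double_in_cone_metrics) (use \<Phi>_mark m(5) parallel_angles[OF w] in \<open>auto simp: \<phi>_def\<close>)
  then have "d \<in> double_metrics nxt v p \<alpha> \<Phi> w"
    unfolding double_metrics_eq doubled_by_def
    by (intro CollectI conjI exI[of _ \<phi>] allI ballI)
      (use h d(3) in \<open>simp_all only: \<phi>_def image_comp[symmetric] mR m(4,5) comp_apply simp_thms\<close>)
  then show ?thesis by (rule that) (use d(3) in \<open>simp add: \<phi>_def\<close>)
qed

text \<open>\<open>double_class\<close> collects all that is similar to some metric of the double;
  as these metrics are all similar to \<open>d'\<close>, a single equivalence class results.\<close>

lemma double_class_eq:
  assumes w: "w \<in> parallel_ngons nxt v" and w': "w' \<in> parallel_ngons nxt v"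
    and ct: "0 < c" "\<And>i. w' i = c *\<^sub>R w i + t" and d': "d' \<in> double_metrics nxt v p \<alpha> \<Phi> w'"
  shows "double_class nxt v p \<alpha> \<Phi> w = similarity_rel p \<alpha> `` {d'}"
proof (intro equalityI subsetI)
  fix e assume "e \<in> double_class nxt v p \<alpha> \<Phi> w"
  then obtain d where d: "d \<in> double_metrics nxt v p \<alpha> \<Phi> w" "(d, e) \<in> similarity_rel p \<alpha>"
    unfolding double_class_def by blast
  have "(d', d) \<in> similarity_rel p \<alpha>"
    by (rule similarity_rel_sym[OF double_metrics_similar[OF w w' ct d(1) d'] p_in_S2])
  then show "e \<in> similarity_rel p \<alpha> `` {d'}" using similarity_rel_trans[OF _ d(2)] by blast
next
  fix e assume "e \<in> similarity_rel p \<alpha> `` {d'}"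
  then have e: "(d', e) \<in> similarity_rel p \<alpha>" by blast
  obtain d where d: "d \<in> double_metrics nxt v p \<alpha> \<Phi> w" using double_metric_exists[OF w] by metis
  have "(d, e) \<in> similarity_rel p \<alpha>"
    by (rule similarity_rel_trans[OF double_metrics_similar[OF w w' ct d d'] e])
  then show "e \<in> double_class nxt v p \<alpha> \<Phi> w" unfolding double_class_def using d by blast
qed

lemma double_class_in_moduli:
  assumes w: "w \<in> parallel_ngons nxt v"
  shows "double_class nxt v p \<alpha> \<Phi> w \<in> moduli_space p \<alpha>"
proof -
  obtain d where d: "d \<in> double_metrics nxt v p \<alpha> \<Phi> w" using double_metric_exists[OF w] by metis
  then have "double_class nxt v p \<alpha> \<Phi> w = similarity_rel p \<alpha> `` {d}"
    by (intro double_class_eq[OF w w, of 1 0]) auto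
  moreover have "d \<in> cone_metrics p \<alpha>" using d by (simp add: double_metrics_def)
  ultimately show ?thesis unfolding moduli_space_def quotient_def by blast
qed

lemma equiv_homothety: "equiv (parallel_ngons nxt v) (homothety_rel nxt v)"
proof (rule equivI)
  show "homothety_rel nxt v \<subseteq> parallel_ngons nxt v \<times> parallel_ngons nxt v" by (auto simp: homothety_rel_def)
  show "refl_on (parallel_ngons nxt v) (homothety_rel nxt v)"
  proof (rule refl_onI)
    fix w assume w: "w \<in> parallel_ngons nxt v"
    have "(0::real) < 1 \<and> (\<forall>i. w i = 1 *\<^sub>R w i + 0)" by simp
    then show "(w, w) \<in> homothety_rel nxt v" unfolding homothety_rel_def using w by blast
  qed
  show "sym (homothety_rel nxt v)"
  proof (rule symI)
    fix w w' assume "(w, w') \<in> homothety_rel nxt v"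
    then obtain c t where m: "w \<in> parallel_ngons nxt v" "w' \<in> parallel_ngons nxt v"
      and c: "0 < c" "\<And>i. w' i = c *\<^sub>R w i + t" unfolding homothety_rel_def by blast
    have "w i = (1 / c) *\<^sub>R w' i + (- (1 / c) *\<^sub>R t)" for i using c by (simp add: scaleR_add_right)
    moreover have "0 < 1 / c" using c by simp
    ultimately show "(w', w) \<in> homothety_rel nxt v" unfolding homothety_rel_def using m by blast
  qed
  show "trans (homothety_rel nxt v)"
  proof (rule transI)
    fix w w' w'' assume "(w, w') \<in> homothety_rel nxt v" "(w', w'') \<in> homothety_rel nxt v"
    then obtain c t c' t' where m: "w \<in> parallel_ngons nxt v" "w'' \<in> parallel_ngons nxt v"
      and c: "0 < c" "\<And>i. w' i = c *\<^sub>R w i + t" "0 < c'" "\<And>i. w'' i = c' *\<^sub>R w' i + t'"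
      unfolding homothety_rel_def by blast
    have "w'' i = (c' * c) *\<^sub>R w i + (c' *\<^sub>R t + t')" for i using c by (simp add: scaleR_add_right)
    moreover have "0 < c' * c" using c by simp
    ultimately show "(w, w'') \<in> homothety_rel nxt v" unfolding homothety_rel_def using m by blast
  qed
qed

lemma union_double_class:
  assumes X: "X \<in> H1 nxt v" and w: "w \<in> X"
  shows "(\<Union>w\<in>X. double_class nxt v p \<alpha> \<Phi> w) = double_class nxt v p \<alpha> \<Phi> w" "w \<in> parallel_ngons nxt v"
proof -
  show wp: "w \<in> parallel_ngons nxt v"
    using X w equiv_homothety in_quotient_imp_subset unfolding H1_def by blast
  have "double_class nxt v p \<alpha> \<Phi> w' = double_class nxt v p \<alpha> \<Phi> w" if "w' \<in> X" for w'
  proof -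
    have "(w', w) \<in> homothety_rel nxt v"
      using X w that equiv_homothety quotient_eq_iff unfolding H1_def by fastforce
    then obtain c t where m: "w' \<in> parallel_ngons nxt v" and c: "0 < c" "\<And>i. w i = c *\<^sub>R w' i + t"
      unfolding homothety_rel_def by blast
    obtain d where d: "d \<in> double_metrics nxt v p \<alpha> \<Phi> w" using double_metric_exists[OF wp] by metis
    show ?thesis
      using double_class_eq[OF m wp c d] double_class_eq[OF wp wp, of 1 0 d] d by simp
  qed
  then show "(\<Union>w\<in>X. double_class nxt v p \<alpha> \<Phi> w) = double_class nxt v p \<alpha> \<Phi> w" using w by blast
qed

lemma H1_rep: "X \<in> H1 nxt v \<Longrightarrow> \<exists>w. w \<in> X"
  using equiv_homothety in_quotient_imp_non_empty unfolding H1_def by blast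

text \<open>The distances of the marked points determine the side lengths, and with the side directions
  the polygon.\<close>

lemma homothetic_of_double_class_eq:
  assumes w: "w \<in> parallel_ngons nxt v" and w': "w' \<in> parallel_ngons nxt v"
    and eq: "double_class nxt v p \<alpha> \<Phi> w = double_class nxt v p \<alpha> \<Phi> w'"
  shows "(w, w') \<in> homothety_rel nxt v"
proof -
  interpret W: parallel_pair nxt v i0 w by unfold_locales (rule w)
  interpret W': parallel_pair nxt v i0 w' by unfold_locales (rule w')
  have marks: "d (p i) (p j) = dist (w i) (w j)" if dw: "d \<in> double_metrics nxt v p \<alpha> \<Phi> w" and ww: "w \<in> parallel_ngons nxt v" for d i j w
  proof -
    interpret w: parallel_pair nxt v i0 w by unfold_locales (rule ww)
    obtain \<phi> where \<phi>: "doubled_by w d \<phi>" using dw unfolding double_metrics_eq by blast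
    from doubled_byD(5)[OF \<phi> w.w.w_in_region w.w.w_in_region, of True i True j] doubled_byD(4)[OF \<phi>]
    show ?thesis by (simp add: \<Phi>_mark double_dist_def)
  qed
  obtain d' where d': "d' \<in> double_metrics nxt v p \<alpha> \<Phi> w'" using double_metric_exists[OF w'] by metis
  then have "d' \<in> double_class nxt v p \<alpha> \<Phi> w'"
    unfolding double_class_def using similarity_rel_refl[of d' p \<alpha>] by (auto simp: double_metrics_def)
  then obtain d where d: "d \<in> double_metrics nxt v p \<alpha> \<Phi> w" "(d, d') \<in> similarity_rel p \<alpha>"
    unfolding eq[symmetric] unfolding double_class_def by blast
  then obtain f c where f: "isotopic_to_id p f" "0 < c" "\<And>x y. x \<in> S2 \<Longrightarrow> y \<in> S2 \<Longrightarrow> d' (f x) (f y) = c * d x y"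
    unfolding similarity_rel_def by blast
  have dist: "dist (w' i) (w' j) = c * dist (w i) (w j)" for i j
    using f(3)[OF p_in_S2 p_in_S2, of i j] isotopic_to_id_homeo(2)[OF f(1)] marks[OF d' w'] marks[OF d(1) w] by simp
  have side: "w' (nxt i) - w' i = c *\<^sub>R (w (nxt i) - w i)" for i
  proof -
    have "norm (w' (nxt i) - w' i) = c * norm (w (nxt i) - w i)" using dist[of "nxt i" i] by (simp add: dist_norm)
    then show ?thesis using W.w.side_vec[of i] W'.w.side_vec[of i]
      by (metis W.same_D W'.same_D scaleR_scaleR)
  qed
  have "w' (lbl k) = c *\<^sub>R w (lbl k) + (w' i0 - c *\<^sub>R w i0)" for k
  proof (induction k)
    case (Suc k)
    have "w' (lbl (Suc k)) = w' (lbl k) + c *\<^sub>R (w (lbl (Suc k)) - w (lbl k))"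
      using side[of "lbl k"] by (simp add: lbl_Suc algebra_simps)
    then show ?case using Suc by (simp add: algebra_simps)
  qed simp
  then have "w' i = c *\<^sub>R w i + (w' i0 - c *\<^sub>R w i0)" for i by (metis lbl_exhaust)
  then show ?thesis unfolding homothety_rel_def using w w' f(2) by blast
qed

lemma H1_embeds_in_moduli:
  "(\<lambda>X. \<Union>w\<in>X. double_class nxt v p \<alpha> \<Phi> w) ` H1 nxt v \<subseteq> moduli_space p \<alpha>"
  "inj_on (\<lambda>X. \<Union>w\<in>X. double_class nxt v p \<alpha> \<Phi> w) (H1 nxt v)"
proof -
  show "(\<lambda>X. \<Union>w\<in>X. double_class nxt v p \<alpha> \<Phi> w) ` H1 nxt v \<subseteq> moduli_space p \<alpha>"
    using union_double_class H1_rep double_class_in_moduli by (metis (no_types, lifting) image_subsetI)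
  show "inj_on (\<lambda>X. \<Union>w\<in>X. double_class nxt v p \<alpha> \<Phi> w) (H1 nxt v)"
  proof (rule inj_onI)
    fix X Y assume X: "X \<in> H1 nxt v" and Y: "Y \<in> H1 nxt v"
      and eq: "(\<Union>w\<in>X. double_class nxt v p \<alpha> \<Phi> w) = (\<Union>w\<in>Y. double_class nxt v p \<alpha> \<Phi> w)"
    obtain w w' where w: "w \<in> X" "w' \<in> Y" using H1_rep X Y by blast
    then have "(w, w') \<in> homothety_rel nxt v"
      using eq union_double_class[OF X w(1)] union_double_class[OF Y w(2)] by (intro homothetic_of_double_class_eq) auto
    then show "X = Y" using X Y w equiv_homothety quotient_eq_iff unfolding H1_def by fastforce
  qed
qed

end

section \<open>Unfolding the double\<close>

definition fold_disk :: "complex \<Rightarrow> complex" where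
  "fold_disk z = (if 0 \<le> Im z then z else cnj z)"

lemma fold_disk_upper: "z \<in> cball 0 1 \<Longrightarrow> fold_disk z \<in> upper_disk"
  by (auto simp: fold_disk_def)

lemma continuous_on_halves:
  fixes f :: "complex \<Rightarrow> 'a::topological_space"
  assumes up: "continuous_on upper_disk f" and lo: "continuous_on upper_disk (\<lambda>z. f (cnj z))"
  shows "continuous_on (cball 0 1) f"
proof -
  let ?L = "{z. norm z \<le> 1 \<and> Im z \<le> 0}"
  have eq: "upper_disk = cball 0 1 \<inter> {z. 0 \<le> Im z}" "?L = cball 0 1 \<inter> {z. Im z \<le> 0}" by auto
  have cl: "closed upper_disk" "closed ?L"
    unfolding eq by (intro closed_Int closed_cball closed_halfspace_Im_ge closed_halfspace_Im_le)+
  have "continuous_on ?L (\<lambda>z. f (cnj (cnj z)))"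
    by (rule continuous_on_compose2[OF lo, where f = cnj]) (auto intro: continuous_intros)
  then have "continuous_on ?L f" by simp
  then have "continuous_on (upper_disk \<union> ?L) f" using up cl by (intro continuous_on_closed_Un)
  moreover have "upper_disk \<union> ?L = cball 0 1" by auto
  ultimately show ?thesis by simp
qed

lemma orientation_preserving_at_cong:
  assumes A: "open A" "z \<in> A" and eq: "\<And>x. x \<in> A \<Longrightarrow> f x = g x" and f: "orientation_preserving_at f z"
  shows "orientation_preserving_at g z"
proof -
  obtain \<epsilon> where \<epsilon>: "0 < \<epsilon>" "\<And>r. 0 < r \<Longrightarrow> r < \<epsilon> \<Longrightarrow>
      f z \<notin> path_image (f \<circ> circlepath z r) \<and> winding_number (f \<circ> circlepath z r) (f z) = 1"
    using f unfolding orientation_preserving_at_def by blast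
  obtain \<delta> where \<delta>: "0 < \<delta>" "cball z \<delta> \<subseteq> A" using A open_contains_cball by blast
  show ?thesis
    unfolding orientation_preserving_at_def
  proof (intro exI[of _ "min \<epsilon> \<delta>"] conjI allI impI)
    show "0 < min \<epsilon> \<delta>" using \<epsilon> \<delta> by simp
  next
    fix r assume r: "0 < r \<and> r < min \<epsilon> \<delta>"
    have "circlepath z r x \<in> A" for x
    proof -
      have "circlepath z r x \<in> sphere z r"
        using r by (simp add: circlepath dist_norm norm_mult norm_exp_eq_Re)
      then show ?thesis using \<delta>(2) r by (auto simp: subset_iff)
    qed
    then have e: "g \<circ> circlepath z r = f \<circ> circlepath z r" using eq by auto
    have "g z = f z" using eq A by simp
    then show "g z \<notin> path_image (g \<circ> circlepath z r)" "winding_number (g \<circ> circlepath z r) (g z) = 1"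
      using \<epsilon>(2)[of r] r by (simp_all add: e)
  qed
qed

lemma norm_circle_point [simp]: "norm (circle_point m x) = 1"
  by (simp add: circle_point_def)

lemma circle_point_in_cball [simp]: "circle_point m x \<in> cball 0 1"
  by simp

lemma cnj_circle_point: "cnj (circle_point m x) = circle_point m (- x)"
  by (simp add: circle_point_def cis_cnj)

lemma circle_point_eq_iff:
  assumes "0 < m"
  shows "circle_point m x = circle_point m y \<longleftrightarrow> (\<exists>q::int. x = y + of_int q * real m)"
proof -
  have 1: "circle_point m x = circle_point m y \<longleftrightarrow>
      (\<exists>q::int. 2 * pi * x / real m = 2 * pi * y / real m + 2 * pi * of_int q)"
    unfolding sin_cos_eq_iff[symmetric] by (auto simp: circle_point_def complex_eq_iff)
  have 2: "2 * pi * x / real m = 2 * pi * y / real m + 2 * pi * of_int q \<longleftrightarrow> x = y + of_int q * real m" for q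
  proof -
    have "2 * pi * x / real m = 2 * pi * y / real m + 2 * pi * of_int q \<longleftrightarrow>
       (2 * pi / real m) * x = (2 * pi / real m) * (y + of_int q * real m)"
      using assms by (simp add: field_simps)
    then show ?thesis using assms by simp
  qed
  show ?thesis unfolding 1 2 ..
qed

lemma circle_point_shift: "0 < m \<Longrightarrow> circle_point m (real m - x) = circle_point m (- x)"
  by (subst circle_point_eq_iff) (auto intro!: exI[of _ 1])

context ngon
begin

definition edge_dir :: complex where "edge_dir = D (lbl N)"

definition height :: "complex \<Rightarrow> real" where "height x = wedge edge_dir (x - mid)"

text \<open>Reflection in the line of the closing side: for a unit vector \<open>e\<close>,
  multiplying the conjugate by the square of \<open>e\<close> fixes \<open>e\<close> and negates
  \<open>\<i> * e\<close>.\<close>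

definition reflect :: "complex \<Rightarrow> complex" where "reflect x = mid + edge_dir\<^sup>2 * cnj (x - mid)"

lemma norm_axis: "norm edge_dir = 1"
  by (simp add: edge_dir_def)

lemma axis_cnj: "cnj edge_dir * edge_dir = 1" "edge_dir * cnj edge_dir = 1"
  using complex_norm_square[of edge_dir] by (simp_all add: norm_axis mult.commute)

lemma last_side_axis:
  obtains \<rho> where "0 < \<rho>" "W 0 - mid = \<rho> *\<^sub>R edge_dir" "mid - W N = \<rho> *\<^sub>R edge_dir"
proof -
  have s: "W 0 - W N = norm (W 0 - W N) *\<^sub>R edge_dir"
    using side_vec[of "lbl N"] by (simp add: nxt_lbl_N W_def edge_dir_def)
  have "0 < norm (W 0 - W N)" using side_len_pos[of "lbl N"] by (simp add: nxt_lbl_N W_def)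
  moreover have "W 0 - mid = (1 / 2) *\<^sub>R (W 0 - W N)" "mid - W N = (1 / 2) *\<^sub>R (W 0 - W N)"
    by (simp_all add: mid_N scaleR_conv_of_real field_simps)
  then have "W 0 - mid = (norm (W 0 - W N) / 2) *\<^sub>R edge_dir" "mid - W N = (norm (W 0 - W N) / 2) *\<^sub>R edge_dir"
    by (subst (asm) s, simp)+
  ultimately show ?thesis using that[of "norm (W 0 - W N) / 2"] by simp
qed

lemma reflect_diff: "reflect a - reflect b = edge_dir\<^sup>2 * cnj (a - b)"
  by (simp add: reflect_def algebra_simps)

lemma dist_reflect: "dist (reflect a) (reflect b) = dist a b"
  unfolding dist_norm reflect_diff by (simp add: norm_mult norm_power norm_axis flip: complex_cnj_diff)

lemma reflect_eq_iff [simp]: "reflect a = reflect b \<longleftrightarrow> a = b"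
  using dist_reflect[of a b] by (metis dist_eq_0_iff)

lemma continuous_on_reflect: "continuous_on A reflect"
  unfolding reflect_def by (intro continuous_intros)

lemma reflect_affine: "reflect (a + t *\<^sub>R (b - a)) = reflect a + t *\<^sub>R (reflect b - reflect a)"
  by (simp add: reflect_def scaleR_conv_of_real algebra_simps)

lemma height_reflect: "height (reflect x) = - height x"
proof -
  have "cnj edge_dir * (edge_dir\<^sup>2 * cnj (x - mid)) = cnj (cnj edge_dir * (x - mid))"
    using axis_cnj(1) by (simp add: power2_eq_square)
  then show ?thesis by (simp add: height_def reflect_def wedge_def del: complex_cnj_mult)
qed

lemma reflect_id: "height x = 0 \<Longrightarrow> reflect x = x"
proof -
  assume "height x = 0"
  then have "x - mid = (edge_dir \<bullet> (x - mid)) *\<^sub>R edge_dir" unfolding height_def by (rule unit_decomp[OF norm_axis])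
  then obtain r where r: "x - mid = of_real r * edge_dir" by (metis scaleR_conv_of_real)
  have "reflect x = mid + edge_dir\<^sup>2 * cnj (of_real r * edge_dir)" unfolding reflect_def r ..
  also have "\<dots> = mid + of_real r * edge_dir * (edge_dir * cnj edge_dir)" by (simp add: power2_eq_square)
  also have "\<dots> = x" using r axis_cnj by (simp add: algebra_simps)
  finally show ?thesis .
qed

lemma height_kap_pos:
  assumes "z \<in> upper_disk" "0 < Im z"
  shows "0 < height (kap z)"
proof -
  obtain \<rho> where \<rho>: "0 < \<rho>" "W 0 - mid = \<rho> *\<^sub>R edge_dir" "mid - W N = \<rho> *\<^sub>R edge_dir" by (rule last_side_axis)
  have 1: "W 0 - W N = (2 * \<rho>) *\<^sub>R edge_dir" using \<rho>(2,3) by (simp add: algebra_simps scaleR_2 flip: scaleR_scaleR)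
  have 2: "kap z - W N = (kap z - mid) + \<rho> *\<^sub>R edge_dir" unfolding \<rho>(3)[symmetric] by simp
  have "orient (w (lbl N)) (w i0) (kap z) = wedge (W 0 - W N) (kap z - W N)" by (simp add: W_def)
  also have "\<dots> = 2 * \<rho> * height (kap z)"
    unfolding 1 2 height_def by (simp only: wedge.scaleR_left wedge.scaleR_right wedge.add_right wedge_self) simp
  finally show ?thesis using kap_upper_open(1)[OF assms] \<rho>(1) by (simp add: zero_less_mult_iff)
qed

lemma height_kap_real:
  assumes "z \<in> upper_disk" "Im z = 0"
  shows "height (kap z) = 0"
proof -
  obtain \<rho> where \<rho>: "W 0 - mid = \<rho> *\<^sub>R edge_dir" by (rule last_side_axis)
  have z: "z = of_real (Re z)" using assms by (simp add: complex_eq_iff)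
  moreover have "Re z \<in> {-1..1}" using assms abs_Re_le_cmod[of z] by auto
  ultimately have "kap z = mid + Re z *\<^sub>R (\<rho> *\<^sub>R edge_dir)" using kap_real \<rho> by metis
  then show ?thesis by (simp add: height_def wedge.scaleR_right)
qed

lemma height_kap_nonneg: "z \<in> upper_disk \<Longrightarrow> 0 \<le> height (kap z)"
  using height_kap_pos[of z] height_kap_real[of z] by force

text \<open>The second sheet is folded out over the uncut side. The two formulas agree on the
  diameter, which \<open>kap\<close> sends to the mirror line.\<close>

definition dev :: "complex \<Rightarrow> complex" where
  "dev z = (if 0 \<le> Im z then kap z else reflect (kap (cnj z)))"

lemma dev_lower: "z \<in> cball 0 1 \<Longrightarrow> Im z \<le> 0 \<Longrightarrow> dev z = reflect (kap (cnj z))"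
proof (cases "Im z = 0")
  case True
  assume "z \<in> cball 0 1"
  moreover have "cnj z = z" using True by (simp add: complex_eq_iff)
  ultimately show ?thesis using True reflect_id[OF height_kap_real[of z]] by (simp add: dev_def)
qed (simp add: dev_def)

lemma height_dev:
  assumes "z \<in> cball 0 1"
  shows "0 \<le> Im z \<Longrightarrow> 0 \<le> height (dev z)" "Im z < 0 \<Longrightarrow> height (dev z) < 0" "0 < Im z \<Longrightarrow> 0 < height (dev z)"
  using assms height_kap_nonneg[of z] height_kap_pos[of z] height_kap_pos[of "cnj z"]
  by (auto simp: dev_def height_reflect)

lemma continuous_on_dev: "continuous_on (cball 0 1) dev"
proof (rule continuous_on_halves)
  show "continuous_on upper_disk dev"
    by (rule continuous_on_eq[OF continuous_on_kap]) (simp add: dev_def)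
  have "continuous_on upper_disk (\<lambda>z. reflect (kap z))"
    by (rule continuous_on_compose2[OF continuous_on_reflect[of UNIV] continuous_on_kap]) simp
  then show "continuous_on upper_disk (\<lambda>z. dev (cnj z))"
    by (rule continuous_on_eq) (simp add: dev_lower)
qed

lemma inj_on_dev: "inj_on dev (cball 0 1)"
proof (rule inj_onI)
  fix z z' assume z: "z \<in> cball 0 1" "z' \<in> cball 0 1" and eq: "dev z = dev z'"
  have "0 \<le> Im z \<longleftrightarrow> 0 \<le> Im z'"
    using height_dev(1,2)[OF z(1)] height_dev(1,2)[OF z(2)] eq by force
  then show "z = z'"
    using eq z inj_onD[OF inj_on_kap, of z z'] inj_onD[OF inj_on_kap, of "cnj z" "cnj z'"]
    by (auto simp: dev_def split: if_splits)
qed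

text \<open>Off the diameter, \<open>dev z - mid\<close> and
  \<open>\<rho> *\<^sub>R edge_dir * z\<close> have heights of the same sign, and on it they
  coincide, so they are never opposite. This settles the centre; connectedness does the
  rest.\<close>

lemma orientation_preserving_dev:
  assumes "z \<in> ball 0 1"
  shows "orientation_preserving_at dev z"
proof -
  have c: "continuous_on (ball 0 1) dev" "inj_on dev (ball 0 1)"
    using continuous_on_subset[OF continuous_on_dev] inj_on_subset[OF inj_on_dev] by auto
  obtain \<rho> where \<rho>: "0 < \<rho>" "W 0 - mid = \<rho> *\<^sub>R edge_dir" by (rule last_side_axis)
  have "orientation_preserving_at dev 0"
  proof (rule orientation_preserving_at_of_not_opposite[OF c, where a = "\<rho> *\<^sub>R edge_dir"])
    show "\<rho> *\<^sub>R edge_dir \<noteq> 0" using \<rho> norm_axis by auto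
    fix z :: complex and s :: real
    assume z: "z \<in> ball 0 1" "z \<noteq> 0" and s: "0 \<le> s" "s \<le> 1"
    have d0: "dev 0 = mid" by (simp add: dev_def kap_def)
    show "(1 - s) *\<^sub>R (dev z - dev 0) + s *\<^sub>R (\<rho> *\<^sub>R edge_dir * z) \<noteq> 0"
    proof (cases "Im z = 0")
      case True
      then have zr: "z = of_real (Re z)" by (simp add: complex_eq_iff)
      have "Re z \<in> {-1..1}" using z abs_Re_le_cmod[of z] by auto
      then have "kap z = mid + Re z *\<^sub>R (\<rho> *\<^sub>R edge_dir)" using kap_real zr \<rho> by metis
      then have 1: "dev z - dev 0 = Re z *\<^sub>R (\<rho> *\<^sub>R edge_dir)" using True d0 by (simp add: dev_def)
      have 2: "\<rho> *\<^sub>R edge_dir * z = Re z *\<^sub>R (\<rho> *\<^sub>R edge_dir)" by (subst zr) (simp add: scaleR_conv_of_real)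
      have "(1 - s) *\<^sub>R (dev z - dev 0) + s *\<^sub>R (\<rho> *\<^sub>R edge_dir * z) = Re z *\<^sub>R (\<rho> *\<^sub>R edge_dir)"
        unfolding 1 2 scaleR_left_distrib[symmetric] by simp
      moreover have "Re z \<noteq> 0" using z zr by auto
      ultimately show ?thesis using \<rho> norm_axis by auto
    next
      case False
      have "wedge edge_dir (edge_dir * z) = Im z" unfolding wedge_def using axis_cnj(1) by (metis mult.assoc mult_1)
      then have "wedge edge_dir ((1 - s) *\<^sub>R (dev z - dev 0) + s *\<^sub>R (\<rho> *\<^sub>R edge_dir * z)) =
         (1 - s) * height (dev z) + s * (\<rho> * Im z)"
        by (simp add: d0 height_def wedge.add_right wedge.scaleR_right)
      moreover have "\<dots> \<noteq> 0"
      proof (cases "0 < Im z")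
        case True
        then have "0 < height (dev z)" "0 < \<rho> * Im z" using height_dev(3) z \<rho> by auto
        then have "0 < (1 - s) * height (dev z) + s * (\<rho> * Im z)"
          using s by (cases "s = 0") (auto intro: add_nonneg_pos)
        then show ?thesis by simp
      next
        case neg: False
        then have "height (dev z) < 0" "\<rho> * Im z < 0" using height_dev(2) z \<rho> False by (auto simp: mult_pos_neg)
        then have "(1 - s) * height (dev z) + s * (\<rho> * Im z) < 0"
          using s by (cases "s = 0") (simp_all add: add_nonpos_neg mult_nonneg_nonpos mult_pos_neg)
        then show ?thesis by simp
      qed
      ultimately show ?thesis by auto
    qed
  qed
  then show ?thesis
    by (intro orientation_preserving_on_connected[OF c open_ball _ _ _ assms]) auto
qed

lemma corner_kap:
  assumes "k \<le> N"
  shows "kap (circle_point (2 * N) (real k)) = W k" "circle_point (2 * N) (real k) \<in> upper_disk"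
proof -
  have N: "0 < real N" using N_ge_2 by simp
  have cp: "circle_point (2 * N) (real k) = cis (pi * real k / real N)" by (simp add: circle_point_def)
  have b: "0 \<le> pi * real k / real N" "pi * real k / real N \<le> pi" using assms N by (auto simp: divide_le_eq)
  then show "circle_point (2 * N) (real k) \<in> upper_disk" by (simp add: cp sin_ge_zero)
  show "kap (circle_point (2 * N) (real k)) = W k"
    unfolding cp using kap_polar[of 1 "pi * real k / real N"] b N ppath_nat[of k] assms by simp
qed

text \<open>Off the diameter a small ball stays in one sheet. At a point of the diameter the polygon
  is a half disk bounded by the mirror line, and the shortest crossing found in
  \<open>dd_sector\<close> has the length of the straight segment to the mirror image.\<close>

lemma dev_local_isometry:
  assumes dbl: "doubled (region w) \<phi>" and z: "z \<in> ball 0 1"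
  shows "\<exists>\<epsilon>>0. ball z \<epsilon> \<subseteq> ball 0 1 \<and> (\<forall>x\<in>ball z \<epsilon>. \<forall>y\<in>ball z \<epsilon>. dist (dev x) (dev y) =
     double_dist (region w) (0 \<le> Im x) (kap (fold_disk x)) (0 \<le> Im y) (kap (fold_disk y)))"
proof -
  interpret doubled "region w" \<phi> by (rule dbl)
  obtain \<epsilon>0 where \<epsilon>0: "0 < \<epsilon>0" "ball z \<epsilon>0 \<subseteq> ball 0 1" using z open_ball open_contains_ball by metis
  have same: "dist (dev x) (dev y) = dd (0 \<le> Im x) (kap (fold_disk x)) (0 \<le> Im y) (kap (fold_disk y))"
    if "0 \<le> Im x \<longleftrightarrow> 0 \<le> Im y" for x y
    using that by (simp add: double_dist_def dev_def fold_disk_def dist_reflect)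
  show ?thesis
  proof (cases "Im z = 0")
    case False
    define \<epsilon> where "\<epsilon> = min \<epsilon>0 \<bar>Im z\<bar>"
    have im: "0 \<le> Im x \<longleftrightarrow> 0 < Im z" if "x \<in> ball z \<epsilon>" for x
    proof -
      have "\<bar>Im z - Im x\<bar> \<le> norm (z - x)" using abs_Im_le_cmod[of "z - x"] by simp
      also have "\<dots> < \<bar>Im z\<bar>" using that by (simp add: \<epsilon>_def dist_norm)
      finally show ?thesis by auto
    qed
    have "dist (dev x) (dev y) = dd (0 \<le> Im x) (kap (fold_disk x)) (0 \<le> Im y) (kap (fold_disk y))"
      if "x \<in> ball z \<epsilon>" "y \<in> ball z \<epsilon>" for x y
      by (rule same) (simp only: im[OF that(1)] im[OF that(2)])
    moreover have "0 < \<epsilon>" "ball z \<epsilon> \<subseteq> ball 0 1" using \<epsilon>0 False by (auto simp: \<epsilon>_def)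
    ultimately show ?thesis by blast
  next
    case True
    let ?X = "kap z"
    have zu: "z \<in> upper_disk" using z True by simp
    have zr: "z = of_real (Re z)" using True by (simp add: complex_eq_iff)
    have dz: "dev z = ?X" using True by (simp add: dev_def)
    have rX: "reflect ?X = ?X" by (rule reflect_id[OF height_kap_real[OF zu True]])
    have "Re z \<in> {-1..1}" using z abs_Re_le_cmod[of z] by auto
    then have side: "?X \<in> side nxt w (lbl N)" unfolding last_side_eq using zr by (metis imageI)
    \<comment> \<open>Vertices come from points of the unit circle, so an inner point of the
      diameter goes to an inner point of the closing side.\<close>
    have "?X \<notin> range w"
    proof
      assume "?X \<in> range w"
      then obtain k where k: "k < CARD('n)" "?X = W k" unfolding range_w by blast
      then have kN: "k \<le> N" using Suc_N by simp
      have "z = circle_point (2 * N) (real k)"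
        using inj_onD[OF inj_on_kap _ zu corner_kap(2)[OF kN]] corner_kap(1)[OF kN] k(2) by simp
      then have "norm z = 1" by simp
      then show False using z by simp
    qed
    then obtain \<epsilon>1 where sec: "sector_at (region w) ?X \<epsilon>1 edge_dir pi"
      using sector_edge[OF side] unfolding edge_dir_def by blast
    define \<eta> where "\<eta> = \<epsilon>1 / 2"
    have \<eta>: "0 < \<eta>" "2 * \<eta> = \<epsilon>1" using sec by (auto simp: \<eta>_def sector_at_def)
    have "continuous_on (ball 0 1) dev" using continuous_on_subset[OF continuous_on_dev] by auto
    then have "isCont dev z" using z by (simp add: continuous_on_eq_continuous_at)
    then obtain \<epsilon>2 where \<epsilon>2: "0 < \<epsilon>2" "\<And>x. dist x z < \<epsilon>2 \<Longrightarrow> dist (dev x) ?X < \<eta>"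
      using \<eta>(1) unfolding continuous_at_eps_delta dz by blast
    define \<epsilon> where "\<epsilon> = min \<epsilon>0 \<epsilon>2"
    have \<epsilon>: "0 < \<epsilon>" "ball z \<epsilon> \<subseteq> ball 0 1" "\<And>x. x \<in> ball z \<epsilon> \<Longrightarrow> dist (dev x) ?X < \<eta>"
      using \<epsilon>0 \<epsilon>2 by (auto simp: \<epsilon>_def dist_commute)
    have polar: "\<exists>r \<gamma>. 0 \<le> r \<and> r < \<eta> \<and> \<gamma> \<in> {0..pi} \<and> K = ?X + of_real r * (edge_dir * cis \<gamma>)"
      if K: "K \<in> region w" "dist K ?X < \<eta>" for K
    proof -
      have "K \<in> ball ?X \<epsilon>1" using K(2) \<eta> by (simp add: dist_commute)
      then obtain r \<gamma> where r: "0 \<le> r" "\<gamma> \<in> {0..pi}" "K = ?X + of_real r * (edge_dir * cis \<gamma>)"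
        using sec K(1) unfolding sector_at_def by blast
      have "dist K ?X = r" using r(1) unfolding r(3) by (simp add: dist_norm norm_mult norm_axis)
      then show ?thesis using r K(2) by blast
    qed
    have cross: "dist (dev x) (dev y) = dd True (kap x) False (kap (cnj y))"
      if x: "x \<in> ball z \<epsilon>" "0 \<le> Im x" and y: "y \<in> ball z \<epsilon>" "Im y < 0" for x y
    proof -
      have xy: "x \<in> upper_disk" "cnj y \<in> upper_disk"
        using subsetD[OF \<epsilon>(2) x(1)] subsetD[OF \<epsilon>(2) y(1)] x(2) y(2) by auto
      have dx: "dev x = kap x" and dy: "dev y = reflect (kap (cnj y))" using x y by (auto simp: dev_def)
      have "dist (kap (cnj y)) ?X < \<eta>" using \<epsilon>(3)[OF y(1)] dist_reflect[of "kap (cnj y)" ?X] by (simp add: dy rX)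
      then obtain r' \<gamma>' where r': "0 \<le> r'" "r' < \<eta>" "\<gamma>' \<in> {0..pi}" "kap (cnj y) = ?X + of_real r' * (edge_dir * cis \<gamma>')"
        using polar[OF kap_in_region[OF xy(2)]] by blast
      have "dist (kap x) ?X < \<eta>" using \<epsilon>(3)[OF x(1)] by (simp add: dx)
      then obtain r \<gamma> where r: "0 \<le> r" "r < \<eta>" "\<gamma> \<in> {0..pi}" "kap x = ?X + of_real r * (edge_dir * cis \<gamma>)"
        using polar[OF kap_in_region[OF xy(1)]] by blast
      have ry: "reflect (kap (cnj y)) = ?X + of_real r' * (edge_dir * cis (- \<gamma>'))"
      proof -
        have "reflect (kap (cnj y)) - reflect ?X = edge_dir\<^sup>2 * cnj (of_real r' * (edge_dir * cis \<gamma>'))"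
          unfolding reflect_diff r'(4) by simp
        also have "\<dots> = of_real r' * (edge_dir * cis (- \<gamma>')) * (edge_dir * cnj edge_dir)"
          by (simp add: power2_eq_square cis_cnj)
        finally show ?thesis using axis_cnj rX by (simp add: algebra_simps)
      qed
      have "dd True (kap x) False (kap (cnj y)) =
          sqrt (r\<^sup>2 + r'\<^sup>2 - 2 * r * r' * cos (min (\<gamma> + \<gamma>') (2 * pi - (\<gamma> + \<gamma>'))))"
        by (rule dd_sector[OF _ _ r(4) r'(4) r(1,2) r'(1,2) r(3) r'(3)]) (use sec \<eta> in simp_all)
      also have "cos (min (\<gamma> + \<gamma>') (2 * pi - (\<gamma> + \<gamma>'))) = cos (\<gamma> + \<gamma>')"
        by (auto simp: min_def cos_2pi_minus)
      also have "sqrt (r\<^sup>2 + r'\<^sup>2 - 2 * r * r' * cos (\<gamma> + \<gamma>')) = dist (dev x) (dev y)"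
        unfolding dx dy ry r(4) using dist_polar[OF norm_axis, of ?X r \<gamma> r' "- \<gamma>'"] by simp
      finally show ?thesis by (rule sym)
    qed
    have "dist (dev x) (dev y) = dd (0 \<le> Im x) (kap (fold_disk x)) (0 \<le> Im y) (kap (fold_disk y))"
      if xy: "x \<in> ball z \<epsilon>" "y \<in> ball z \<epsilon>" for x y
    proof -
      consider "0 \<le> Im x \<longleftrightarrow> 0 \<le> Im y" | "0 \<le> Im x" "Im y < 0" | "Im x < 0" "0 \<le> Im y" by linarith
      then show ?thesis
      proof cases
        case 1
        then show ?thesis by (rule same)
      next
        case 2
        then show ?thesis using cross[OF xy(1) _ xy(2)] by (simp add: fold_disk_def)
      next
        case 3
        then show ?thesis using cross[OF xy(2) _ xy(1)] dd_commute[of True "kap y" False "kap (cnj x)"]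
          by (simp add: fold_disk_def dist_commute)
      qed
    qed
    then show ?thesis using \<epsilon>(1,2) by blast
  qed
qed

text \<open>Vertices of the unfolded polygon in the order of the circle points: out along the path,
  then back along its mirror image. \<open>W 0\<close> and \<open>W N\<close> lie on the mirror
  line, so nothing jumps at the turning point.\<close>

definition corner :: "nat \<Rightarrow> complex" where
  "corner k = (if k \<le> N then W k else reflect (W (2 * N - k)))"

lemma height_W: "height (W 0) = 0" "height (W N) = 0"
proof -
  obtain \<rho> where \<rho>: "W 0 - mid = \<rho> *\<^sub>R edge_dir" "mid - W N = \<rho> *\<^sub>R edge_dir" by (rule last_side_axis)
  then have "W N - mid = - \<rho> *\<^sub>R edge_dir" by (simp add: algebra_simps)
  then show "height (W 0) = 0" "height (W N) = 0" unfolding height_def \<rho>(1) by (simp_all add: wedge.scaleR_right wedge.minus_right)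
qed

lemma corner_upper: "k \<le> N \<Longrightarrow> corner k = W k"
  by (simp add: corner_def)

lemma corner_lower: "N \<le> k \<Longrightarrow> corner k = reflect (W (2 * N - k))"
  using reflect_id[OF height_W(2)] by (cases "k = N") (auto simp: corner_def)

lemma dev_side:
  assumes k: "k < 2 * N" and x: "0 \<le> x" "x \<le> 1"
  shows "dev (circle_point (2 * N) (real k + x)) = corner k + x *\<^sub>R (corner (Suc k) - corner k)"
    and "corner (Suc k) \<noteq> corner k"
proof -
  have N: "0 < 2 * N" using N_ge_2 by simp
  have cp: "circle_point (2 * N) t = cis (pi * t / real N)" for t by (simp add: circle_point_def)
  have ne: "W (Suc j) \<noteq> W j" for j using w_nxt_neq[of "lbl j"] by (simp add: W_def nxt_lbl)
  have up: "circle_point (2 * N) (real j + y) \<in> upper_disk \<and>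
      kap (circle_point (2 * N) (real j + y)) = W j + y *\<^sub>R (W (Suc j) - W j)" if "j < N" "0 \<le> y" "y \<le> 1" for j y
    unfolding cp using kap_boundary_point[OF that] by (simp add: sin_ge_zero)
  show "dev (circle_point (2 * N) (real k + x)) = corner k + x *\<^sub>R (corner (Suc k) - corner k)"
  proof (cases "k < N")
    case True
    then show ?thesis using up[OF True x] by (simp add: dev_def corner_upper)
  next
    case False
    \<comment> \<open>Side \<open>k\<close> is the mirror image of side \<open>j\<close> traversed
      backwards, whence the parameter \<open>1 - x\<close>.\<close>
    define j where "j = 2 * N - Suc k"
    have j: "j < N" "2 * N - k = Suc j" "2 * N - Suc k = j" using False k by (auto simp: j_def)
    have rj: "real j + (1 - x) = real (2 * N) - (real k + x)" using k by (simp add: j_def of_nat_diff)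
    let ?z = "circle_point (2 * N) (real j + (1 - x))"
    have z: "?z \<in> upper_disk" "kap ?z = W j + (1 - x) *\<^sub>R (W (Suc j) - W j)" using up[OF j(1), of "1 - x"] x by auto
    have "circle_point (2 * N) (real k + x) = cnj ?z"
      unfolding rj circle_point_shift[OF N] cnj_circle_point by (simp only: minus_minus)
    then have "dev (circle_point (2 * N) (real k + x)) = reflect (W j + (1 - x) *\<^sub>R (W (Suc j) - W j))"
      using z dev_lower[of "cnj ?z"] by simp
    also have "\<dots> = corner (Suc k) + (1 - x) *\<^sub>R (corner k - corner (Suc k))"
      unfolding reflect_affine using False j by (simp add: corner_lower)
    also have "\<dots> = corner k + x *\<^sub>R (corner (Suc k) - corner k)" by (simp add: algebra_simps)
    finally show ?thesis .
  qed
  show "corner (Suc k) \<noteq> corner k"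
  proof (cases "k < N")
    case True
    then show ?thesis using ne by (simp add: corner_upper)
  next
    case False
    then have "2 * N - k = Suc (2 * N - Suc k)" using k by simp
    then show ?thesis using False ne[of "2 * N - Suc k"] by (simp add: corner_lower)
  qed
qed

lemma dev_developing_map:
  assumes dbl: "doubled (region w) \<phi>"
    and d: "\<And>x y. x \<in> ball 0 1 \<Longrightarrow> y \<in> ball 0 1 \<Longrightarrow> d (g x) (g y) =
       double_dist (region w) (0 \<le> Im x) (kap (fold_disk x)) (0 \<le> Im y) (kap (fold_disk y))"
  shows "developing_map (2 * N) d g dev"
  unfolding developing_map_def
proof (intro conjI ballI allI impI)
  show "continuous_on (cball 0 1) dev" by (rule continuous_on_dev)
next
  fix z :: complex assume z: "z \<in> ball 0 1"
  then show "orientation_preserving_at dev z" by (rule orientation_preserving_dev)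
  show "\<exists>\<epsilon>>0. ball z \<epsilon> \<subseteq> ball 0 1 \<and> (\<forall>x\<in>ball z \<epsilon>. \<forall>y\<in>ball z \<epsilon>. dist (dev x) (dev y) = d (g x) (g y))"
    using dev_local_isometry[OF dbl z] d by (metis subsetD)
next
  fix k assume k: "k < 2 * N"
  let ?c = "corner k" and ?c' = "corner (Suc k)"
  note s = dev_side[OF k]
  have ends: "dev (circle_point (2 * N) (real k)) = ?c" "dev (circle_point (2 * N) (real (k + 1))) = ?c'"
    using s(1)[of 0] s(1)[of 1] by (simp_all add: add.commute)
  show "inj_on (\<lambda>x. dev (circle_point (2 * N) (real k + x))) {0..1}"
  proof (rule inj_onI)
    fix x y :: real assume "x \<in> {0..1}" "y \<in> {0..1}"
      "dev (circle_point (2 * N) (real k + x)) = dev (circle_point (2 * N) (real k + y))"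
    then have "x *\<^sub>R (?c' - ?c) = y *\<^sub>R (?c' - ?c)" using s(1) by simp
    then show "x = y" using s(2)[of 0] by simp
  qed
  have "(\<lambda>x. dev (circle_point (2 * N) (real k + x))) ` {0..1} = (\<lambda>x. ?c + x *\<^sub>R (?c' - ?c)) ` {0..1}"
    using s(1) by (intro image_cong) auto
  also have "\<dots> = closed_segment ?c ?c'" unfolding closed_segment_def by (auto simp: algebra_simps)
  finally show "(\<lambda>x. dev (circle_point (2 * N) (real k + x))) ` {0..1} =
     closed_segment (dev (circle_point (2 * N) (real k))) (dev (circle_point (2 * N) (real (k + 1))))"
    by (simp only: ends)
qed

end

section \<open>The tree cut\<close>

context marked_ngon
begin

text \<open>On the circle, conjugate points have the same image, so the tree is the path of all
  sides but the closing one. Along the diameter the two sheets are glued, and that side stays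
  uncut.\<close>

definition cut_map :: "complex \<Rightarrow> point" where
  "cut_map z = \<Phi> (0 \<le> Im z) (kap (fold_disk z))"

definition cut_lbl :: "nat \<Rightarrow> 'n" where
  "cut_lbl k = lbl (if k \<le> N then k else 2 * N - k)"

text \<open>The circle follows the path out and back; the step out with number \<open>k\<close> is
  undone by the step \<open>2 * N - 1 - k\<close>.\<close>

definition cut_opp :: "nat \<Rightarrow> nat" where
  "cut_opp k = 2 * N - 1 - k"

lemma \<Phi>_eq_iff:
  assumes "x \<in> region v" "y \<in> region v"
  shows "\<Phi> s x = \<Phi> t y \<longleftrightarrow> x = y \<and> (s = t \<or> x \<in> frontier (region v))"
proof -
  interpret doubled "region v" \<Phi> by unfold_locales (rule compact_region convex_region region_ne \<Phi>_homeo)+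
  show ?thesis using inj_\<phi>[OF assms, of s] \<phi>_eq_iff[OF _ assms, of s t] by (cases "s = t") auto
qed

lemma \<Phi>_in_S2:
  assumes "x \<in> region v"
  shows "\<Phi> s x \<in> S2"
proof -
  interpret doubled "region v" \<Phi> by unfold_locales (rule compact_region convex_region region_ne \<Phi>_homeo)+
  show ?thesis by (rule \<phi>_in_S2[OF assms])
qed

lemma cut_map_eq_iff:
  assumes z: "z \<in> cball 0 1" and z': "z' \<in> cball 0 1"
  shows "cut_map z = cut_map z' \<longleftrightarrow> z = z' \<or> z' = cnj z \<and> norm z = 1"
proof -
  note u = fold_disk_upper[OF z] fold_disk_upper[OF z']
  have nf: "norm (fold_disk z) = norm z" by (simp add: fold_disk_def)
  have inj: "kap (fold_disk z) = kap (fold_disk z') \<longleftrightarrow> fold_disk z = fold_disk z'"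
    by (rule inj_on_eq_iff[OF inj_on_kap u])
  have "cut_map z = cut_map z' \<longleftrightarrow> fold_disk z = fold_disk z' \<and>
      ((0 \<le> Im z \<longleftrightarrow> 0 \<le> Im z') \<or> norm z = 1 \<or> Im (fold_disk z) = 0)"
    unfolding cut_map_def \<Phi>_eq_iff[OF kap_in_region[OF u(1)] kap_in_region[OF u(2)]] inj
      kap_frontier_iff[OF u(1)] nf by simp
  also have "\<dots> \<longleftrightarrow> z = z' \<or> z' = cnj z \<and> norm z = 1"
    by (auto simp: fold_disk_def complex_eq_iff split: if_splits)
  finally show ?thesis .
qed

lemma continuous_on_\<Phi>_kap: "continuous_on upper_disk (\<lambda>z. \<Phi> s (kap z))"
proof -
  have "continuous_on (region v) (\<Phi> s)" using \<Phi>_homeo by (simp add: double_homeo_def)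
  then show ?thesis by (rule continuous_on_compose2[OF _ continuous_on_kap]) (use kap_in_region in blast)
qed

lemma continuous_on_cut_map: "continuous_on (cball 0 1) cut_map"
proof (rule continuous_on_halves)
  show "continuous_on upper_disk cut_map"
    by (rule continuous_on_eq[OF continuous_on_\<Phi>_kap[of True]]) (simp add: cut_map_def fold_disk_def)
  show "continuous_on upper_disk (\<lambda>z. cut_map (cnj z))"
  proof (rule continuous_on_eq[OF continuous_on_\<Phi>_kap[of False]])
    fix z assume z: "z \<in> upper_disk"
    show "\<Phi> False (kap z) = cut_map (cnj z)"
    proof (cases "Im z = 0")
      case True
      then have "cnj z = z" by (simp add: complex_eq_iff)
      moreover have "\<Phi> False (kap z) = \<Phi> True (kap z)"
        using \<Phi>_eq_iff[OF kap_in_region[OF z] kap_in_region[OF z]] kap_frontier_iff[OF z] True by simp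
      ultimately show ?thesis using True by (simp add: cut_map_def fold_disk_def)
    qed (use z in \<open>simp add: cut_map_def fold_disk_def\<close>)
  qed
qed

lemma cut_map_image: "cut_map ` cball 0 1 = S2"
proof
  have S: "(\<Union>s. \<Phi> s ` region v) = S2" using \<Phi>_homeo by (simp add: double_homeo_def)
  show "cut_map ` cball 0 1 \<subseteq> S2"
    unfolding S[symmetric] cut_map_def using kap_in_region[OF fold_disk_upper] by blast
  show "S2 \<subseteq> cut_map ` cball 0 1"
  proof
    fix a assume "a \<in> S2"
    then obtain s x where x: "x \<in> region v" "a = \<Phi> s x" unfolding S[symmetric] by blast
    obtain z where z: "z \<in> upper_disk" "x = kap z" using x(1) unfolding kap_image[symmetric] by blast
    show "a \<in> cut_map ` cball 0 1"
    proof (cases "s \<or> Im z = 0")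
      case True
      have "\<Phi> s (kap z) = \<Phi> True (kap z)"
        using True \<Phi>_eq_iff[OF kap_in_region[OF z(1)] kap_in_region[OF z(1)], of s True] kap_frontier_iff[OF z(1)] by auto
      then have "a = cut_map z" using x z by (simp add: cut_map_def fold_disk_def)
      then show ?thesis using z by auto
    next
      case False
      then have "a = cut_map (cnj z)" using x z by (simp add: cut_map_def fold_disk_def)
      then show ?thesis using z by auto
    qed
  qed
qed

text \<open>Over the upper half disk \<open>cut_map\<close> is \<open>\<Phi> True\<close> after
  \<open>kap\<close>; the marking orients the former, and the latter equals \<open>dev\<close>
  there. This settles one point, and injectivity spreads it over the disk without the point above
  the south pole.\<close>

lemma sphere_oriented_cut_map: "sphere_oriented_on (ball 0 1) cut_map"
proof -
  let ?I = "interior (region v)" and ?p = "(0, -1) :: point"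
  define U where "U = {z \<in> ball 0 1. cut_map z \<noteq> ?p}"
  define A where "A = {x \<in> ?I. \<Phi> True x \<noteq> ?p}"
  have inj: "inj_on cut_map (ball 0 1)"
  proof (rule inj_onI)
    fix z z' assume z: "z \<in> ball 0 1" "z' \<in> ball 0 1" "cut_map z = cut_map z'"
    then have "z \<in> cball 0 1" "z' \<in> cball 0 1" "norm z \<noteq> 1" by auto
    then show "z = z'" using cut_map_eq_iff[of z z'] z(3) by blast
  qed
  have cont: "continuous_on (ball 0 1) cut_map" by (rule continuous_on_subset[OF continuous_on_cut_map]) auto
  have one: "\<exists>a. {z \<in> ball 0 1. cut_map z = ?p} \<subseteq> {a}"
  proof (cases "\<exists>a\<in>ball 0 1. cut_map a = ?p")
    case True
    then obtain a where "a \<in> ball 0 1" "cut_map a = ?p" by blast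
    then show ?thesis using inj_onD[OF inj] by (intro exI[of _ a] subsetI) auto
  qed blast
  \<comment> \<open>At most one point lies over the south pole, by injectivity; if there is none,
    the point 1 outside the open disk is removed instead.\<close>
  have UD: "\<exists>a. U = ball 0 1 - {a}"
  proof -
    obtain a where a: "{z \<in> ball 0 1. cut_map z = ?p} \<subseteq> {a}" using one by blast
    show ?thesis
    proof (cases "a \<in> ball 0 1 \<and> cut_map a = ?p")
      case True
      then show ?thesis using a unfolding U_def by (intro exI[of _ a]) auto
    next
      case False
      then have "U = ball 0 1" using a unfolding U_def by auto
      then show ?thesis by (intro exI[of _ 1]) auto
    qed
  qed
  have U: "open U" "connected U"
  proof -
    obtain a where a: "U = ball 0 1 - {a}" using UD by blast
    show "open U" unfolding a by (simp add: open_Diff)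
    show "connected U" unfolding a by (rule connected_open_delete) auto
  qed
  have south: "cut_map ` U \<subseteq> S2 - {?p}"
    using cut_map_image ball_subset_cball unfolding U_def by fastforce
  define F where "F = stereographic \<circ> cut_map"
  have F: "continuous_on U F" "inj_on F U"
  proof -
    have UB: "U \<subseteq> ball 0 1" by (auto simp: U_def)
    show "continuous_on U F" unfolding F_def
      by (rule continuous_on_compose[OF continuous_on_subset[OF cont UB] continuous_on_subset[OF continuous_on_stereographic south]])
    show "inj_on F U" unfolding F_def
      by (rule comp_inj_on[OF inj_on_subset[OF inj UB] inj_on_subset[OF inj_on_stereographic south]])
  qed
  obtain z0 where z0: "z0 \<in> U" "0 < Im z0"
  proof -
    obtain a where a: "{z \<in> ball 0 1. cut_map z = ?p} \<subseteq> {a}" using one by blast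
    \<comment> \<open>Two candidates in the upper half, of which at most one can lie over the south
      pole.\<close>
    have b: "\<i> / 2 \<in> ball 0 1" "\<i> / 3 \<in> ball 0 1" by (auto simp: norm_divide)
    have "\<i> / 2 \<in> U \<or> \<i> / 3 \<in> U"
    proof (rule ccontr)
      assume "\<not> (\<i> / 2 \<in> U \<or> \<i> / 3 \<in> U)"
      then have "\<i> / 2 = a" "\<i> / 3 = a" using a b unfolding U_def by blast+
      then have "\<i> / 2 = (\<i> / 3 :: complex)" by (rule trans[OF _ sym])
      then show False by simp
    qed
    then show ?thesis using that[of "\<i> / 2"] that[of "\<i> / 3"] by auto
  qed
  define V where "V = {z \<in> ball 0 1. 0 < Im z}"
  have V: "open V"
  proof -
    have "V = ball 0 1 \<inter> {z. 0 < Im z}" by (auto simp: V_def)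
    then show ?thesis by (simp add: open_Int open_halfspace_Im_gt)
  qed
  have Vu: "V \<subseteq> upper_disk" by (auto simp: V_def)
  have z0V: "z0 \<in> V" using z0 by (auto simp: V_def U_def)
  have opk: "orientation_preserving_at kap z0"
    by (rule orientation_preserving_at_cong[OF V z0V _ orientation_preserving_dev])
      (use z0V in \<open>auto simp: V_def dev_def\<close>)
  have kA: "kap z0 \<in> A"
    using kap_upper_open(2)[of z0] z0V Vu z0(1) by (auto simp: A_def U_def V_def cut_map_def fold_disk_def)
  have oA: "open A"
  proof -
    have "open (?I \<inter> \<Phi> True -` (- {?p}))"
      by (rule continuous_open_preimage)
        (use \<Phi>_homeo interior_subset in \<open>auto simp: double_homeo_def open_Compl intro: continuous_on_subset\<close>)
    moreover have "A = ?I \<inter> \<Phi> True -` (- {?p})" by (auto simp: A_def)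
    ultimately show ?thesis by simp
  qed
  have sc: "continuous_on A (stereographic \<circ> \<Phi> True)" and si: "inj_on (stereographic \<circ> \<Phi> True) A"
  proof -
    have AQ: "A \<subseteq> region v" using interior_subset by (auto simp: A_def)
    have c: "continuous_on A (\<Phi> True)" and i: "inj_on (\<Phi> True) A"
      using \<Phi>_homeo continuous_on_subset[OF _ AQ] inj_on_subset[OF _ AQ] by (auto simp: double_homeo_def)
    have s: "\<Phi> True ` A \<subseteq> S2 - {?p}"
    proof -
      have "\<Phi> True x \<in> S2 - {?p}" if "x \<in> A" for x
        using \<Phi>_in_S2[OF subsetD[OF AQ that]] that by (simp add: A_def)
      then show ?thesis by (rule image_subsetI)
    qed
    show "continuous_on A (stereographic \<circ> \<Phi> True)"
      by (rule continuous_on_compose[OF c continuous_on_subset[OF continuous_on_stereographic s]])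
    show "inj_on (stereographic \<circ> \<Phi> True) A"
      by (rule comp_inj_on[OF i inj_on_subset[OF inj_on_stereographic s]])
  qed
  have "sphere_oriented_on ?I (\<Phi> True)" using marking by (simp only: double_marking_def)
  then have sop: "orientation_preserving_at (stereographic \<circ> \<Phi> True) (kap z0)"
    using kA by (simp add: sphere_oriented_on_def A_def)
  have "orientation_preserving_at ((stereographic \<circ> \<Phi> True) \<circ> kap) z0"
    by (rule orientation_preserving_at_compose[OF continuous_on_subset[OF continuous_on_kap Vu]
          inj_on_subset[OF inj_on_kap Vu] V z0V opk sc si oA kA sop])
  then have "orientation_preserving_at F z0"
    by (rule orientation_preserving_at_cong[OF V z0V, rotated])
      (simp add: F_def V_def cut_map_def fold_disk_def)
  then have "orientation_preserving_at F z" if "z \<in> U" for z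
    using orientation_preserving_on_connected[OF F U z0(1) _ that] by blast
  then show ?thesis by (simp add: sphere_oriented_on_def F_def U_def)
qed

lemma cut_map_circle_point:
  "cut_map (circle_point (2 * N) x) = cut_map (circle_point (2 * N) y) \<longleftrightarrow>
     (\<exists>q::int. x = y + of_int q * real (2 * N) \<or> x = - y + of_int q * real (2 * N))"
proof -
  have N: "0 < 2 * N" using N_ge_2 by simp
  have "circle_point (2 * N) y = cnj (circle_point (2 * N) x) \<longleftrightarrow>
      circle_point (2 * N) x = circle_point (2 * N) (- y)"
    unfolding cnj_circle_point[symmetric] by (metis complex_cnj_cnj)
  then show ?thesis
    unfolding cut_map_eq_iff[OF circle_point_in_cball circle_point_in_cball] circle_point_eq_iff[OF N]
    by auto
qed

lemma cut_map_corner: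
  assumes "k < 2 * N"
  shows "cut_map (circle_point (2 * N) (real k)) = p (cut_lbl k)"
proof -
  have up: "cut_map (circle_point (2 * N) (real j)) = p (lbl j)" if "j \<le> N" for j
    using corner_kap[OF that] \<Phi>_mark by (simp add: cut_map_def fold_disk_def W_def)
  show ?thesis
  proof (cases "k \<le> N")
    case False
    then have "real k = - real (2 * N - k) + of_int 1 * real (2 * N)" using assms by (simp add: of_nat_diff)
    then have "cut_map (circle_point (2 * N) (real k)) = cut_map (circle_point (2 * N) (real (2 * N - k)))"
      unfolding cut_map_circle_point by blast
    then show ?thesis using False up[of "2 * N - k"] by (simp add: cut_lbl_def)
  qed (simp add: up cut_lbl_def)
qed

lemma int_plus_fraction_cancel:
  assumes "0 < x" "x < (1::real)"
  shows "real_of_int a + x \<noteq> real_of_int b"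
proof
  assume "real_of_int a + x = real_of_int b"
  then have "real_of_int a < real_of_int b" "real_of_int b < real_of_int (a + 1)" using assms by simp_all
  then show False unfolding of_int_less_iff by simp
qed

lemma tree_cut: "tree_cut p cut_lbl cut_opp cut_map"
proof -
  have m: "2 * (CARD('n) - 1) = 2 * N" by (simp only: N_eq)
  have N2: "2 \<le> N" by (rule N_ge_2)
  show ?thesis
    unfolding tree_cut_def Let_def m
  proof (intro conjI allI impI ballI)
    show "continuous_on (cball 0 1) cut_map" "cut_map ` cball 0 1 = S2" "sphere_oriented_on (ball 0 1) cut_map"
      by (fact continuous_on_cut_map cut_map_image sphere_oriented_cut_map)+
    show "inj_on cut_map (ball 0 1)"
    proof (rule inj_onI)
      fix z z' assume z: "z \<in> ball 0 1" "z' \<in> ball 0 1" "cut_map z = cut_map z'"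
      then have "z \<in> cball 0 1" "z' \<in> cball 0 1" "norm z \<noteq> 1" by auto
      then show "z = z'" using cut_map_eq_iff[of z z'] z(3) by blast
    qed
    show "cut_map ` ball 0 1 \<inter> cut_map ` sphere 0 1 = {}"
    proof -
      have "cut_map z \<noteq> cut_map z'" if "z \<in> ball 0 1" "z' \<in> sphere 0 1" for z z'
        using cut_map_eq_iff[of z z'] that by auto
      then show ?thesis by blast
    qed
    show "cut_lbl ` {..<2 * N} = UNIV"
    proof -
      have "i \<in> cut_lbl ` {..<2 * N}" for i
      proof -
        obtain k where "k < CARD('n)" "i = lbl k" by (rule lbl_exhaust)
        then have "k \<le> N" "i = cut_lbl k" "k < 2 * N" using Suc_N N2 by (auto simp: cut_lbl_def)
        then show ?thesis by blast
      qed
      then show ?thesis by blast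
    qed
  next
    fix k assume k: "k < 2 * N"
    show "cut_map (circle_point (2 * N) (real k)) = p (cut_lbl k)" by (rule cut_map_corner[OF k])
    show "cut_opp k < 2 * N" "cut_opp (cut_opp k) = k" using k by (auto simp: cut_opp_def)
    show "cut_opp k \<noteq> k" using k unfolding cut_opp_def by presburger
  next
    fix k and x :: real assume k: "k < 2 * N" and x: "x \<in> {0<..<1}"
    show "cut_map (circle_point (2 * N) (real k + x)) \<notin> range p"
    proof
      assume "cut_map (circle_point (2 * N) (real k + x)) \<in> range p"
      then obtain i where i: "cut_map (circle_point (2 * N) (real k + x)) = p i" by blast
      obtain j where j: "j < CARD('n)" "i = lbl j" by (rule lbl_exhaust)
      then have "j < 2 * N" "i = cut_lbl j" using Suc_N N2 by (auto simp: cut_lbl_def)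
      then have "cut_map (circle_point (2 * N) (real k + x)) = cut_map (circle_point (2 * N) (real j))"
        using i cut_map_corner by simp
      then obtain q :: int where "real k + x = real j + of_int q * real (2 * N) \<or>
          real k + x = - real j + of_int q * real (2 * N)"
        unfolding cut_map_circle_point by blast
      then have "real_of_int (int k) + x = real_of_int (int j + q * int (2 * N)) \<or>
          real_of_int (int k) + x = real_of_int (- int j + q * int (2 * N))"
        by simp
      moreover have "real_of_int (int k) + x \<noteq> real_of_int b" for b
        by (rule int_plus_fraction_cancel) (use x in auto)
      ultimately show False by blast
    qed
  next
    fix k l and x y :: real assume kl: "k < 2 * N" "l < 2 * N" and x: "x \<in> {0<..<1}" and y: "y \<in> {0<..<1}"
    show "cut_map (circle_point (2 * N) (real k + x)) = cut_map (circle_point (2 * N) (real l + y)) \<longleftrightarrow>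
        l = k \<and> y = x \<or> l = cut_opp k \<and> y = 1 - x"
    proof
      assume "cut_map (circle_point (2 * N) (real k + x)) = cut_map (circle_point (2 * N) (real l + y))"
      then obtain q :: int where "real k + x = (real l + y) + of_int q * real (2 * N) \<or>
          real k + x = - (real l + y) + of_int q * real (2 * N)"
        unfolding cut_map_circle_point by blast
      then show "l = k \<and> y = x \<or> l = cut_opp k \<and> y = 1 - x"
      proof
        \<comment> \<open>Both parameters lie strictly between 0 and \<open>2 * N\<close>, which
          leaves only \<open>q = 0\<close>; then integer and fractional parts agree.\<close>
        assume e: "real k + x = (real l + y) + of_int q * real (2 * N)"
        have b: "real k + 1 \<le> real (2 * N)" "real l + 1 \<le> real (2 * N)" using kl by linarith+
        have "\<bar>of_int q * real (2 * N)\<bar> < real (2 * N)" using e b x y by auto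
        then have "\<bar>of_int q\<bar> * real (2 * N) < 1 * real (2 * N)" by (simp add: abs_mult)
        then have "\<bar>of_int q :: real\<bar> < 1" by (rule mult_right_less_imp_less) simp
        then have "q = 0" by linarith
        then have "real k + x = real l + y" using e by simp
        then have "\<lfloor>real k + x\<rfloor> = \<lfloor>real l + y\<rfloor>" by simp
        moreover have "\<lfloor>real k + x\<rfloor> = int k" "\<lfloor>real l + y\<rfloor> = int l" using x y by (auto simp: floor_eq_iff)
        ultimately show ?thesis using \<open>real k + x = real l + y\<close> by simp
      next
        \<comment> \<open>The parameters add up to a positive multiple of \<open>2 * N\<close> below
          \<open>4 * N\<close>, so \<open>q = 1\<close>; then \<open>x + y\<close> is an integer
          strictly between 0 and 2.\<close>
        assume e: "real k + x = - (real l + y) + of_int q * real (2 * N)"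
        have b: "real k + 1 \<le> real (2 * N)" "real l + 1 \<le> real (2 * N)" using kl by linarith+
        have s: "real k + x + (real l + y) = of_int q * real (2 * N)" using e by simp
        have "0 < of_int q * real (2 * N)" "of_int q * real (2 * N) < 2 * real (2 * N)"
          unfolding s[symmetric] using b x y by auto
        then have "0 < (of_int q :: real)" "(of_int q :: real) < 2" using N2 by (auto simp: zero_less_mult_iff)
        then have "q = 1" by simp
        then have s: "x + y = real (2 * N) - real k - real l" using s by simp
        then have "real_of_int (int (2 * N) - int k - int l) = x + y" by simp
        then have "0 < real_of_int (int (2 * N) - int k - int l)" "real_of_int (int (2 * N) - int k - int l) < 2"
          using x y by auto
        then have "int (2 * N) - int k - int l = 1" by simp
        then have "l = 2 * N - 1 - k" "real (2 * N) - real k - real l = 1" using kl by linarith+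
        then show ?thesis using s by (simp add: cut_opp_def)
      qed
    next
      assume "l = k \<and> y = x \<or> l = cut_opp k \<and> y = 1 - x"
      then show "cut_map (circle_point (2 * N) (real k + x)) = cut_map (circle_point (2 * N) (real l + y))"
      proof
        assume l: "l = cut_opp k \<and> y = 1 - x"
        have "real l = real (2 * N) - 1 - real k" using l kl by (simp add: cut_opp_def of_nat_diff)
        then have "real k + x = - (real l + y) + of_int 1 * real (2 * N)" using l by simp
        then show ?thesis unfolding cut_map_circle_point by blast
      qed simp
    qed
  qed
qed

text \<open>\<open>region_map\<close> turns the map \<open>kap\<close> of \<open>w\<close> into that
  of \<open>v\<close>. For the transported metric \<open>cut_map\<close> is therefore itself the cut
  along the sides of \<open>w\<close>, with the identity as isotopy and the map \<open>dev\<close>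
  of \<open>w\<close> as developing map.\<close>

lemma unfolds_to_corners:
  assumes w: "w \<in> parallel_ngons nxt v"
  obtains d where "d \<in> double_metrics nxt v p \<alpha> \<Phi> w"
    "unfolds_to p cut_map d (\<lambda>k. if k < 2 * N then ngon.corner nxt w i0 (Suc k) - ngon.corner nxt w i0 k else 0)"
proof -
  interpret W: parallel_pair nxt v i0 w by unfold_locales (rule w)
  obtain d where d: "d \<in> double_metrics nxt v p \<alpha> \<Phi> w"
    "\<forall>s t. \<forall>x\<in>region w. \<forall>y\<in>region w.
       d (\<Phi> s (region_map w x)) (\<Phi> t (region_map w y)) = double_dist (region w) s x t y"
    by (rule double_metric_exists[OF w])
  have m: "2 * (CARD('n) - 1) = 2 * N" by (simp only: N_eq)
  obtain \<phi> where "doubled_by w d \<phi>" using d(1) unfolding double_metrics_eq by blast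
  then have dbl: "doubled (region w) \<phi>"
    by unfold_locales (rule W.w.compact_region W.w.convex_region W.w.region_ne doubled_byD(1))+
  have "d ((id \<circ> cut_map) x) ((id \<circ> cut_map) y) = double_dist (region w) (0 \<le> Im x) (W.w.kap (fold_disk x))
      (0 \<le> Im y) (W.w.kap (fold_disk y))" if xy: "x \<in> ball 0 1" "y \<in> ball 0 1" for x y
  proof -
    have u: "fold_disk x \<in> upper_disk" "fold_disk y \<in> upper_disk"
      using fold_disk_upper[of x] fold_disk_upper[of y] xy by auto
    show ?thesis
      using d(2)[rule_format, OF W.w.kap_in_region[OF u(1)] W.w.kap_in_region[OF u(2)], of "0 \<le> Im x" "0 \<le> Im y"]
      by (simp only: region_map(1)[OF w u(1)] region_map(1)[OF w u(2)] cut_map_def comp_apply id_apply)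
  qed
  then have dev: "developing_map (2 * N) d (id \<circ> cut_map) W.w.dev" by (rule W.w.dev_developing_map[OF dbl])
  have "(if k < 2 * N then W.w.corner (Suc k) - W.w.corner k else 0) =
     (if k < 2 * N then W.w.dev (circle_point (2 * N) (real (k + 1))) - W.w.dev (circle_point (2 * N) (real k)) else 0)" for k
    using W.w.dev_side(1)[of k 0] W.w.dev_side(1)[of k 1] by (simp add: add.commute)
  then have "unfolds_to p cut_map d (\<lambda>k. if k < 2 * N then W.w.corner (Suc k) - W.w.corner k else 0)"
    unfolding unfolds_to_def Let_def m using isotopic_to_id_refl dev by blast
  then show ?thesis using that d(1) by blast
qed

end

section \<open>The side vectors of the unfolding\<close>

lemma sum_lessThan_double:
  fixes f :: "nat \<Rightarrow> 'a::comm_monoid_add"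
  shows "(\<Sum>k<2 * n. f k) = (\<Sum>k<n. f k + f (2 * n - Suc k))"
proof -
  have "(\<Sum>k<2 * n. f k) = (\<Sum>k<n. f k) + (\<Sum>k = n..<2 * n. f k)"
    using sum.atLeastLessThan_concat[of 0 n "2 * n" f] by (simp add: lessThan_atLeast0)
  also have "(\<Sum>k = n..<2 * n. f k) = (\<Sum>k<n. f (2 * n - Suc k))"
    by (rule sum.reindex_bij_witness[of _ "\<lambda>k. 2 * n - Suc k" "\<lambda>k. 2 * n - Suc k"]) auto
  finally show ?thesis by (simp add: sum.distrib)
qed

text \<open>The partial sums of the side vectors are the corners, so the inner sum over
  \<open>j\<close> collapses and a polarised shoelace formula remains.\<close>

lemma area_form_corners:
  assumes s: "\<And>k. k < m \<Longrightarrow> s k = X (Suc k) - X k" "X 0 = 0" and t: "\<And>k. k < m \<Longrightarrow> t k = Y (Suc k) - Y k" "Y 0 = 0"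
  shows "area_form m s t = (\<Sum>k<m. cnj (X k) * Y (Suc k) - cnj (X (Suc k)) * Y k) / (4 * \<i>)"
proof -
  have "(\<Sum>j<k. cnj (s j) * t k - cnj (s k) * t j) = cnj (X k) * Y (Suc k) - cnj (X (Suc k)) * Y k" if k: "k < m" for k
  proof -
    have S: "(\<Sum>j<k. s j) = X k" and T: "(\<Sum>j<k. t j) = Y k"
      using k s t by (simp_all add: sum_lessThan_telescope)
    have "(\<Sum>j<k. cnj (s j) * t k - cnj (s k) * t j) = cnj (\<Sum>j<k. s j) * t k - cnj (s k) * (\<Sum>j<k. t j)"
      by (simp only: sum_subtractf sum_distrib_left sum_distrib_right cnj_sum)
    also have "\<dots> = cnj (X k) * Y (Suc k) - cnj (X (Suc k)) * Y k"
      unfolding S T s(1)[OF k] t(1)[OF k] by (simp add: algebra_simps)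
    finally show ?thesis .
  qed
  then show ?thesis unfolding area_form_def by simp
qed

context ngon
begin

text \<open>The linear map \<open>L\<close> of the embedding: the sides along the path, then their
  mirror images in reverse order, with a sign because they are traversed backwards.\<close>

definition unfold_vec :: "real^'n \<Rightarrow> nat \<Rightarrow> complex" where
  "unfold_vec h k =
     (if k < N then slen h (lbl k) *\<^sub>R D (lbl k)
      else if k < 2 * N then - (slen h (lbl (2 * N - Suc k)) *\<^sub>R (edge_dir\<^sup>2 * cnj (D (lbl (2 * N - Suc k)))))
      else 0)"

lemma linear_unfold_vec: "linear (\<lambda>h. unfold_vec h k)"
  by (rule linearI)
    (simp_all add: unfold_vec_def linear_add[OF linear_slen] linear_scale[OF linear_slen] scaleR_add_left)

definition path_vert :: "real^'n \<Rightarrow> nat \<Rightarrow> complex" where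
  "path_vert h k = vert h (lbl k) - vert h i0"

definition unfold_vert :: "real^'n \<Rightarrow> nat \<Rightarrow> complex" where
  "unfold_vert h k = (if k \<le> N then path_vert h k else edge_dir\<^sup>2 * cnj (path_vert h (2 * N - k)))"

lemma path_vert_0 [simp]: "path_vert h 0 = 0" and path_vert_card [simp]: "path_vert h CARD('n) = 0"
  by (simp_all add: path_vert_def)

lemma path_vert_Suc: "path_vert h (Suc k) - path_vert h k = slen h (lbl k) *\<^sub>R D (lbl k)"
  using vert_side[of h "lbl k"] by (simp add: path_vert_def nxt_lbl)

lemma path_vert_N: "path_vert h N = - (slen h (lbl N) *\<^sub>R edge_dir)"
  using vert_side[of h "lbl N"] by (simp add: path_vert_def nxt_lbl_N edge_dir_def algebra_simps)

lemma unfold_vert_lower: "N \<le> k \<Longrightarrow> unfold_vert h k = edge_dir\<^sup>2 * cnj (path_vert h (2 * N - k))"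
proof (cases "k = N")
  case True
  have "edge_dir\<^sup>2 * cnj (path_vert h N) = - (slen h (lbl N) *\<^sub>R (edge_dir * (edge_dir * cnj edge_dir)))"
    by (simp add: path_vert_N power2_eq_square)
  also have "\<dots> = path_vert h N" by (simp add: axis_cnj path_vert_N)
  finally show ?thesis using True by (simp add: unfold_vert_def)
qed (simp add: unfold_vert_def)

lemma unfold_vert_0 [simp]: "unfold_vert h 0 = 0" and unfold_vert_last [simp]: "unfold_vert h (2 * N) = 0"
  using N_ge_2 by (simp_all add: unfold_vert_def)

lemma unfold_vec_eq: "k < 2 * N \<Longrightarrow> unfold_vec h k = unfold_vert h (Suc k) - unfold_vert h k"
proof (cases "k < N")
  case True
  then show ?thesis using path_vert_Suc[of h k] by (simp add: unfold_vec_def unfold_vert_def)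
next
  case False
  assume k: "k < 2 * N"
  define j where "j = 2 * N - Suc k"
  then have j: "2 * N - k = Suc j" "2 * N - Suc k = j" using k by auto
  have "unfold_vert h (Suc k) - unfold_vert h k = - (edge_dir\<^sup>2 * cnj (path_vert h (Suc j) - path_vert h j))"
    using False unfold_vert_lower[of k h] unfold_vert_lower[of "Suc k" h] j by (simp add: algebra_simps)
  then show ?thesis using False k j by (simp add: path_vert_Suc unfold_vec_def)
qed

text \<open>Only \<open>N\<close> of the side lengths appear in the vector; the remaining one
  vanishes because the polygon closes up, by \<open>path_vert_N\<close>.\<close>

lemma unfold_vec_eq_0_iff: "unfold_vec h = (\<lambda>_. 0) \<longleftrightarrow> h \<in> translation_vectors nxt w"
proof
  assume "h \<in> translation_vectors nxt w"
  then have "slen h i = 0" for i using slen_eq_0_iff by blast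
  then show "unfold_vec h = (\<lambda>_. 0)" by (auto simp: unfold_vec_def)
next
  assume z: "unfold_vec h = (\<lambda>_. 0)"
  have s: "slen h (lbl k) = 0" if "k < N" for k using fun_cong[OF z, of k] that by (simp add: unfold_vec_def)
  have "path_vert h k = 0" if "k \<le> N" for k
    using that
  proof (induction k)
    case (Suc k)
    then show ?case using path_vert_Suc[of h k] s[of k] by simp
  qed simp
  then have "slen h (lbl N) = 0" using path_vert_N[of h] norm_axis by force
  then have "slen h i = 0" for i
    using s lbl_exhaust[of i] Suc_N by (metis less_Suc_eq)
  then show "h \<in> translation_vectors nxt w" using slen_eq_0_iff by blast
qed

text \<open>The mirror image of a side contributes minus the conjugate of the term of that side.
  Each pair thus leaves twice an imaginary part, which makes the value real and counts the shoelace
  terms of the polygon once for each sheet.\<close>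

lemma area_form_unfold_vec: "area_form (2 * N) (unfold_vec h) (unfold_vec h') = of_real (2 * area_bil h h')"
proof -
  let ?X = "unfold_vert h" and ?Y = "unfold_vert h'" and ?x = "path_vert h" and ?y = "path_vert h'"
  define f where "f = (\<lambda>k. cnj (?X k) * ?Y (Suc k) - cnj (?X (Suc k)) * ?Y k)"
  define g where "g = (\<lambda>k. wedge (?x k) (?y (Suc k)) + wedge (?y k) (?x (Suc k)))"
  have mirror: "cnj (edge_dir\<^sup>2 * cnj a) * (edge_dir\<^sup>2 * cnj b) = a * cnj b" for a b
  proof -
    have "cnj (edge_dir\<^sup>2 * cnj a) * (edge_dir\<^sup>2 * cnj b) = (cnj edge_dir * edge_dir) * (cnj edge_dir * edge_dir) * (a * cnj b)"
      by (simp add: power2_eq_square)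
    then show ?thesis by (simp add: axis_cnj)
  qed
  have pair: "f k + f (2 * N - Suc k) = of_real (2 * g k) * \<i>" if k: "k < N" for k
  proof -
    have up: "?X k = ?x k" "?X (Suc k) = ?x (Suc k)" "?Y k = ?y k" "?Y (Suc k) = ?y (Suc k)"
      using k by (simp_all add: unfold_vert_def)
    have n: "Suc (2 * N - Suc k) = 2 * N - k" "2 * N - (2 * N - Suc k) = Suc k" "2 * N - (2 * N - k) = k"
      "N \<le> 2 * N - Suc k" "N \<le> 2 * N - k" using k by auto
    have lo: "?X (2 * N - Suc k) = edge_dir\<^sup>2 * cnj (?x (Suc k))" "?X (2 * N - k) = edge_dir\<^sup>2 * cnj (?x k)"
      "?Y (2 * N - Suc k) = edge_dir\<^sup>2 * cnj (?y (Suc k))" "?Y (2 * N - k) = edge_dir\<^sup>2 * cnj (?y k)"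
      using n by (simp_all only: unfold_vert_lower)
    have "f (2 * N - Suc k) = - cnj (f k)"
      unfolding f_def n lo up mirror by simp
    then have "f k + f (2 * N - Suc k) = f k - cnj (f k)" by simp
    also have "\<dots> = of_real (2 * Im (f k)) * \<i>" by (rule complex_diff_cnj)
    also have "Im (f k) = g k"
      unfolding f_def g_def up by (simp add: wedge_eq)
    finally show ?thesis .
  qed
  have "area_form (2 * N) (unfold_vec h) (unfold_vec h') = (\<Sum>k<2 * N. f k) / (4 * \<i>)"
    unfolding f_def by (rule area_form_corners) (simp_all add: unfold_vec_eq)
  also have "(\<Sum>k<2 * N. f k) = (\<Sum>k<N. of_real (2 * g k) * \<i>)"
    unfolding sum_lessThan_double using pair by (intro sum.cong) auto
  also have "\<dots> / (4 * \<i>) = of_real ((\<Sum>k<N. g k) / 2)"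
    by (simp add: sum_distrib_left[symmetric] sum_distrib_right[symmetric])
  also have "(\<Sum>k<N. g k) = (\<Sum>k<CARD('n). g k)"
  proof -
    \<comment> \<open>The closing side ends at the base vertex, from which \<open>path_vert\<close>
      is measured.\<close>
    have "g N = 0" unfolding g_def Suc_N by simp
    then show ?thesis unfolding Suc_N[symmetric] by simp
  qed
  also have "(\<Sum>k<CARD('n). g k) / 2 = 2 * area_bil h h'"
  proof -
    let ?a = "vert h i0" and ?b = "vert h' i0"
    \<comment> \<open>Moving the origin to the base vertices adds differences that telescope around
      the closed polygon.\<close>
    have "wedge (vert h (lbl k)) (vert h' (nxt (lbl k))) + wedge (vert h' (lbl k)) (vert h (nxt (lbl k))) =
        g k + ((wedge ?a (?y (Suc k)) - wedge ?a (?y k)) + (wedge ?b (?x (Suc k)) - wedge ?b (?x k)))" for k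
      by (simp add: g_def path_vert_def nxt_lbl wedge_eq algebra_simps)
    then have "(\<Sum>k<CARD('n). wedge (vert h (lbl k)) (vert h' (nxt (lbl k))) + wedge (vert h' (lbl k)) (vert h (nxt (lbl k)))) =
        (\<Sum>k<CARD('n). g k) + ((wedge ?a (?y CARD('n)) - wedge ?a (?y 0)) + (wedge ?b (?x CARD('n)) - wedge ?b (?x 0)))"
      by (simp only: sum.distrib sum_lessThan_telescope[where f = "\<lambda>k. wedge ?a (?y k)"]
          sum_lessThan_telescope[where f = "\<lambda>k. wedge ?b (?x k)"])
    then show ?thesis unfolding area_bil_def sum_lbl by simp
  qed
  finally show ?thesis .
qed

end

context parallel_pair
begin

lemma same_edge_dir: "w.edge_dir = edge_dir"
  by (simp add: w.edge_dir_def edge_dir_def)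

lemma unfold_vec_support_vector:
  "unfold_vec (support_vector nxt v w) k = (if k < 2 * N then w.corner (Suc k) - w.corner k else 0)"
proof -
  have W: "w.W (Suc j) - w.W j = slen (support_vector nxt v w) (lbl j) *\<^sub>R D (lbl j)" for j
    using w.side_vec[of "lbl j"] unfolding slen_support_vector same_D nxt_lbl w.W_def .
  consider "k < N" | "N \<le> k" "k < 2 * N" | "2 * N \<le> k" by linarith
  then show ?thesis
  proof cases
    case 1
    then show ?thesis using W[of k] by (simp add: unfold_vec_def w.corner_upper)
  next
    case 2
    then have "2 * N - k = Suc (2 * N - Suc k)" by simp
    then have "w.corner (Suc k) - w.corner k = edge_dir\<^sup>2 * cnj (w.W (2 * N - Suc k) - w.W (Suc (2 * N - Suc k)))"
      using 2 by (simp only: w.corner_lower le_SucI w.reflect_diff same_edge_dir)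
    also have "\<dots> = - (edge_dir\<^sup>2 * cnj (w.W (Suc (2 * N - Suc k)) - w.W (2 * N - Suc k)))"
      by (simp add: algebra_simps)
    finally show ?thesis using 2 by (simp add: W unfold_vec_def)
  qed (simp add: unfold_vec_def)
qed

end

context marked_ngon
begin

text \<open>At each vertex the next direction, turned by half the cone angle, is the negative of the
  previous one. Squaring removes the sign and doubles the angle, and the turns accumulate up to the
  closing side.\<close>

lemma edge_dir_turn: "k \<le> N \<Longrightarrow> edge_dir\<^sup>2 = (D (lbl k))\<^sup>2 * cis (- (\<Sum>j\<in>{Suc k..N}. \<alpha> (lbl j)))"
proof (induction k rule: inc_induct)
  case base
  then show ?case by (simp add: edge_dir_def)
next
  case (step k)
  have "D (lbl (Suc k)) * cis (\<alpha> (lbl (Suc k)) / 2) = - D (lbl k)"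
    using cis_interior_angle[of "lbl k"] unfolding angles unfolding nxt_lbl .
  then have "(D (lbl k))\<^sup>2 = (D (lbl (Suc k)) * cis (\<alpha> (lbl (Suc k)) / 2))\<^sup>2" by simp
  also have "\<dots> = (D (lbl (Suc k)))\<^sup>2 * cis (\<alpha> (lbl (Suc k)))" by (simp add: power_mult_distrib Complex.DeMoivre)
  finally have "(D (lbl (Suc k)))\<^sup>2 = (D (lbl k))\<^sup>2 * cis (- \<alpha> (lbl (Suc k)))"
    by (simp add: mult.assoc cis_mult)
  moreover have "(\<Sum>j\<in>{Suc k..N}. \<alpha> (lbl j)) = \<alpha> (lbl (Suc k)) + (\<Sum>j\<in>{Suc (Suc k)..N}. \<alpha> (lbl j))"
    using step.hyps by (simp add: sum.atLeast_Suc_atMost)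
  ultimately show ?case using step.IH by (simp add: mult.assoc cis_mult)
qed

text \<open>The mirror image \<open>edge_dir\<^sup>2 * cnj D\<close> of a unit direction
  \<open>D\<close> is \<open>D\<close> times the quotient of the squares of \<open>edge_dir\<close>
  and \<open>D\<close>; by \<open>edge_dir_turn\<close> this is the rotation by the cone angles
  beyond the edge.\<close>

lemma unfold_vec_in_side_space: "unfold_vec h \<in> side_space \<alpha> cut_lbl cut_opp"
proof -
  have m: "2 * (CARD('n) - 1) = 2 * N" by (simp only: N_eq)
  show ?thesis
    unfolding side_space_def Let_def m
  proof (intro CollectI conjI allI impI)
    show "unfold_vec h k = 0" if "2 * N \<le> k" for k using that by (simp add: unfold_vec_def)
    have "(\<Sum>k<2 * N. unfold_vec h k) = (\<Sum>k<2 * N. unfold_vert h (Suc k) - unfold_vert h k)"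
      by (intro sum.cong) (simp_all add: unfold_vec_eq)
    then show "(\<Sum>k<2 * N. unfold_vec h k) = 0" by (simp only: sum_lessThan_telescope) simp
  next
    fix k assume k: "k < 2 * N" "k < cut_opp k"
    then have kN: "k < N" by (simp add: cut_opp_def)
    \<comment> \<open>The corners between a side and its opposite run out to \<open>N\<close> and
      back to \<open>k + 1\<close>; as a set their labels are the vertices of the far part of the
      path.\<close>
    have "cut_lbl ` {k + 1..cut_opp k} = lbl ` {Suc k..N}"
    proof
      show "cut_lbl ` {k + 1..cut_opp k} \<subseteq> lbl ` {Suc k..N}"
        using kN by (auto simp: cut_lbl_def cut_opp_def intro!: imageI)
      show "lbl ` {Suc k..N} \<subseteq> cut_lbl ` {k + 1..cut_opp k}"
      proof
        fix i assume "i \<in> lbl ` {Suc k..N}"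
        then obtain j where "j \<in> {Suc k..N}" "i = cut_lbl j" by (auto simp: cut_lbl_def)
        then show "i \<in> cut_lbl ` {k + 1..cut_opp k}" using kN by (auto simp: cut_opp_def)
      qed
    qed
    moreover have "inj_on lbl {Suc k..N}"
      by (rule inj_onI) (use Suc_N lbl_eq_iff in auto)
    ultimately have sum: "(\<Sum>i\<in>cut_lbl ` {k + 1..cut_opp k}. \<alpha> i) = (\<Sum>j\<in>{Suc k..N}. \<alpha> (lbl j))"
      by (simp add: sum.reindex)
    have "2 * N - Suc (cut_opp k) = k" "\<not> cut_opp k < N" "cut_opp k < 2 * N" using kN by (auto simp: cut_opp_def)
    then have "unfold_vec h (cut_opp k) = - (slen h (lbl k) *\<^sub>R (edge_dir\<^sup>2 * cnj (D (lbl k))))"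
      by (simp add: unfold_vec_def)
    also have "edge_dir\<^sup>2 * cnj (D (lbl k)) =
        (D (lbl k) * cnj (D (lbl k))) * D (lbl k) * cis (- (\<Sum>j\<in>{Suc k..N}. \<alpha> (lbl j)))"
      using edge_dir_turn[of k] kN by (simp add: power2_eq_square)
    also have "D (lbl k) * cnj (D (lbl k)) = 1" using complex_norm_square[of "D (lbl k)"] by simp
    finally show "unfold_vec h (cut_opp k) = - cis (- (\<Sum>i\<in>cut_lbl ` {k + 1..cut_opp k}. \<alpha> i)) * unfold_vec h k"
      unfolding sum using kN by (simp add: unfold_vec_def scaleR_conv_of_real mult_ac)
  qed
qed

lemma unfolds_to_unfold_vec:
  assumes w: "w \<in> parallel_ngons nxt v"
  obtains d where "d \<in> double_metrics nxt v p \<alpha> \<Phi> w"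
    "unfolds_to p cut_map d (unfold_vec (support_vector nxt v w))"
proof -
  interpret W: parallel_pair nxt v i0 w by unfold_locales (rule w)
  have "unfold_vec (support_vector nxt v w) = (\<lambda>k. if k < 2 * N then W.w.corner (Suc k) - W.w.corner k else 0)"
    by (rule ext) (rule W.unfold_vec_support_vector)
  then show ?thesis using unfolds_to_corners[OF w] that by metis
qed

lemma isometric_embedding: "H1_isometrically_embeds nxt v p \<alpha> \<Phi>"
proof -
  have m: "2 * (CARD('n) - 1) = 2 * N" by (simp only: N_eq)
  have chart: "unfold_vec ` support_cone nxt v \<subseteq> unfolding_chart p \<alpha> cut_lbl cut_opp cut_map"
  proof
    fix s assume "s \<in> unfold_vec ` support_cone nxt v"
    then obtain w where w: "w \<in> parallel_ngons nxt v" "s = unfold_vec (support_vector nxt v w)"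
      unfolding support_cone_def by blast
    obtain d where "d \<in> double_metrics nxt v p \<alpha> \<Phi> w" "unfolds_to p cut_map d s"
      unfolding w(2) by (rule unfolds_to_unfold_vec[OF w(1)])
    moreover from this have "d \<in> cone_metrics p \<alpha>" by (simp add: double_metrics_def)
    ultimately show "s \<in> unfolding_chart p \<alpha> cut_lbl cut_opp cut_map"
      unfolding unfolding_chart_def using unfold_vec_in_side_space w(2) by blast
  qed
  have unf: "\<exists>d\<in>double_metrics nxt v p \<alpha> \<Phi> w. unfolds_to p cut_map d (unfold_vec (support_vector nxt v w))"
    if w: "w \<in> parallel_ngons nxt v" for w
    using unfolds_to_unfold_vec[OF w] by metis
  have area: "area_form (2 * N) (unfold_vec h) (unfold_vec h') = of_real (2 * polar_form (area_P nxt v) h h')" for h h'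
    unfolding area_form_unfold_vec area_P_eq polar_form_bilinear[OF bilinear_area_bil area_bil_commute] ..
  show ?thesis
    unfolding H1_isometrically_embeds_def m
  proof (intro conjI ballI exI[of _ cut_lbl] exI[of _ cut_opp] exI[of _ cut_map] exI[of _ unfold_vec] allI)
    show "range unfold_vec \<subseteq> side_space \<alpha> cut_lbl cut_opp" using unfold_vec_in_side_space by blast
    show "{h. unfold_vec h = (\<lambda>_. 0)} = translation_vectors nxt v" using unfold_vec_eq_0_iff by blast
  qed (fact double_class_in_moduli H1_embeds_in_moduli tree_cut linear_unfold_vec chart unf area)+
qed

end

theorem corollary2p5:
  fixes nxt :: "'n::finite \<Rightarrow> 'n"
    and v :: "'n \<Rightarrow> complex"
    and \<alpha> :: "'n \<Rightarrow> real"
    and p :: "'n \<Rightarrow> point"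
    and \<Phi> :: "bool \<Rightarrow> complex \<Rightarrow> point"
  assumes "convex_ngon nxt v"
    and "\<And>i. interior_angle (v i) (v (nxt i)) (v (nxt (nxt i))) = \<alpha> (nxt i) / 2"
    and "double_marking v p \<Phi>"
  shows "hyperbolic_polyhedron_mod (area_P nxt v) (translation_vectors nxt v) (CARD('n) - 3)
           {h \<in> support_cone nxt v. area_P nxt v h = 1}
       \<and> H1_isometrically_embeds nxt v p \<alpha> \<Phi>"
proof -
  \<comment> \<open>Any label may start the numbering, since the conclusions do not mention
    it.\<close>
  interpret marked_ngon nxt v undefined p \<alpha> \<Phi>
    by unfold_locales (fact assms)+
  show ?thesis using hyperbolic_polyhedron isometric_embedding by blast
qed

end
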